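(* Let $k\ge 3$ and $r\ge 2$ be integers with $k\ge M_r$. Let $T$ be a $k$-vertex tree that satisfies the Erdős–Sós conjecture. Let $F$ be the $(r-2)$-fold enlargement of $T$. Then there exists a positive integer $n_4$ such that for all $n\ge n_4$ we have $\mathrm{ex}(n,H^F_{r+k-2})=|T_r(n,r+k-3)|$.
   Context: An $r$-graph is a finite $r$-uniform hypergraph; $|G|$ denotes the number of edges and $n(G)$ the number of vertices of $G$. An $r$-graph is $F$-free if it contains no (not necessarily induced) copy of $F$ as a subgraph. $\mathrm{ex}(n,F)$ is the maximum number of edges in an $F$-free $r$-graph on $n$ vertices. A $k$-vertex tree $T$ satisfies the Erdős–Sós conjecture if $\mathrm{ex}(n,T)\le n(k-2)/2$ for all $n$. The $(r-2)$-fold enlargement of a graph $T$ is the $r$-graph $\{e\cup D: e\in E(T)\}$, where $D$ is an $(r-2)$-set of vertices disjoint from $V(T)$ (its vertex set is $V(T)\cup D$). For $r\ge2$ let $f_r(x)=\frac{\prod_{i=1}^{r-1}(x+i-2)}{(x+r-3)^r}$. $M_r$ denotes the last (i.e. rightmost) point of $[2,\infty)$ at which $f_r$ attains its maximum on $[2,\infty)$ (for instance $M_2=M_3=2$, $M_4=2+\sqrt3$). A pair of vertices is covered in a hypergraph if some edge contains both vertices. For an $r$-graph $F$ and an integer $p\ge n(F)$, $H^F_p$ is the $r$-graph obtained as follows: label the vertices of $F$ as $v_1,\dots,v_{n(F)}$, add new vertices $v_{n(F)+1},\dots,v_p$, and for each pair $v_i,v_j$ ($1\le i<j\le p$) not covered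 in $F$ add a set $B_{i,j}$ of $r-2$ new vertices and the edge $\{v_i,v_j\}\cup B_{i,j}$, where the sets $B_{i,j}$ are pairwise disjoint. $T_r(n,m)$ is the complete $m$-partite $r$-graph on $n$ vertices in which no two parts differ in size by more than one (its edges are all $r$-sets meeting each part in at most one vertex). *)

theory Defs
  imports Complex_Main
begin

record 'a hypergraph =
  verts :: "'a set"
  edges :: "'a set set"

definition rgraph :: "nat \<Rightarrow> 'a hypergraph \<Rightarrow> bool" where
  "rgraph r G \<longleftrightarrow> finite (verts G) \<and> (\<forall>e\<in>edges G. e \<subseteq> verts G \<and> card e = r)"

text \<open>Copies need not be induced. A copy includes the isolated vertices of \<open>F\<close>, if there are any.\<close>

definition contains_copy :: "'a hypergraph \<Rightarrow> 'b hypergraph \<Rightarrow> bool" where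
  "contains_copy G F \<longleftrightarrow>
     (\<exists>\<phi>. inj_on \<phi> (verts F) \<and> \<phi> ` verts F \<subseteq> verts G \<and> (\<forall>e\<in>edges F. \<phi> ` e \<in> edges G))"

text \<open>
  Up to isomorphism, an \<open>n\<close>-vertex hypergraph has vertex set \<open>{..<n}\<close>. The set below is finite,
  and it is nonempty as soon as \<open>F\<close> has an edge, since an edgeless hypergraph is then \<open>F\<close>-free.
\<close>

definition ex_number :: "nat \<Rightarrow> nat \<Rightarrow> 'b hypergraph \<Rightarrow> nat" where
  "ex_number r n F = Max {card (edges G) | G :: nat hypergraph.
     rgraph r G \<and> verts G = {..<n} \<and> \<not> contains_copy G F}"

definition connected_graph :: "'a hypergraph \<Rightarrow> bool" where
  "connected_graph G \<longleftrightarrow> verts G \<noteq> {} \<and>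
     (\<forall>u\<in>verts G. \<forall>v\<in>verts G. (u, v) \<in> {(x, y). {x, y} \<in> edges G}\<^sup>*)"

definition graph_cycle :: "'a hypergraph \<Rightarrow> 'a list \<Rightarrow> bool" where
  "graph_cycle G xs \<longleftrightarrow> length xs \<ge> 3 \<and> distinct xs \<and>
     (\<forall>i<length xs. {xs ! i, xs ! (Suc i mod length xs)} \<in> edges G)"

definition is_tree :: "'a hypergraph \<Rightarrow> bool" where
  "is_tree T \<longleftrightarrow> rgraph 2 T \<and> connected_graph T \<and> (\<nexists>xs. graph_cycle T xs)"

definition satisfies_erdos_sos :: "'a hypergraph \<Rightarrow> bool" where
  "satisfies_erdos_sos T \<longleftrightarrow>
     (\<forall>n. real (ex_number 2 n T) \<le> real n * (real (card (verts T)) - 2) / 2)"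

text \<open>The \<open>d\<close> vertices added to every edge are the elements of \<open>Inr ` {..<d}\<close>.\<close>

definition enlargement :: "nat \<Rightarrow> 'a hypergraph \<Rightarrow> ('a + nat) hypergraph" where
  "enlargement d T =
     \<lparr>verts = Inl ` verts T \<union> Inr ` {..<d},
      edges = {Inl ` e \<union> Inr ` {..<d} | e. e \<in> edges T}\<rparr>"

definition covered :: "'a hypergraph \<Rightarrow> 'a \<Rightarrow> 'a \<Rightarrow> bool" where
  "covered F u v \<longleftrightarrow> (\<exists>e\<in>edges F. u \<in> e \<and> v \<in> e)"

definition f_fun :: "nat \<Rightarrow> real \<Rightarrow> real" where
  "f_fun r x = (\<Prod>i=1..r-1. x + real i - 2) / (x + real r - 3) ^ r"

text \<open>
  For \<open>r \<ge> 2\<close> the function \<open>f_fun r\<close> is continuous and positive on \<open>[2, \<infinity>)\<close> and tends to \<open>0\<close> at infinity.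
  Hence the set of its maximum points is nonempty and compact and has a greatest element.
\<close>

definition M_last :: "nat \<Rightarrow> real" where
  "M_last r = (GREATEST x. x \<ge> 2 \<and> (\<forall>y\<ge>2. f_fun r y \<le> f_fun r x))"

text \<open>
  The core of \<open>H_graph F r p\<close> consists of the vertices \<open>Old v\<close> of \<open>F\<close> and of \<open>p - card (verts F)\<close> new
  vertices \<open>New i\<close>. The set \<open>B\<close> belonging to an uncovered core pair \<open>P = {u, v}\<close> is
  \<open>Aux P ` {..<r-2}\<close>. Indexing by the unordered pair makes these sets pairwise disjoint and
  creates only one of them for each pair.
\<close>

datatype 'a core_vertex = Old 'a | New nat

datatype 'a ext_vertex = Core "'a core_vertex" | Aux "'a core_vertex set" nat

definition core :: "nat \<Rightarrow> 'a hypergraph \<Rightarrow> 'a core_vertex hypergraph" where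
  "core p F =
     \<lparr>verts = Old ` verts F \<union> New ` {..<p - card (verts F)},
      edges = (\<lambda>e. Old ` e) ` edges F\<rparr>"

definition uncovered_pairs :: "'a hypergraph \<Rightarrow> 'a set set" where
  "uncovered_pairs F =
     {{u, v} | u v. u \<in> verts F \<and> v \<in> verts F \<and> u \<noteq> v \<and> \<not> covered F u v}"

definition H_graph :: "'a hypergraph \<Rightarrow> nat \<Rightarrow> nat \<Rightarrow> 'a ext_vertex hypergraph" where
  "H_graph F r p =
     \<lparr>verts = Core ` verts (core p F) \<union> (\<Union>P\<in>uncovered_pairs (core p F). Aux P ` {..<r-2}),
      edges = (\<lambda>e. Core ` e) ` edges (core p F) \<union>
              {Core ` P \<union> Aux P ` {..<r-2} | P. P \<in> uncovered_pairs (core p F)}\<rparr>"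

text \<open>
  The parts are the residue classes modulo \<open>m\<close> in \<open>{..<n}\<close>. By \<open>turan_parts_balanced\<close> no two of
  them differ in size by more than one. An \<open>r\<close>-set is an edge iff it meets each part in at most
  one vertex.
\<close>

definition turan :: "nat \<Rightarrow> nat \<Rightarrow> nat \<Rightarrow> nat hypergraph" where
  "turan r n m =
     \<lparr>verts = {..<n},
      edges = {e. e \<subseteq> {..<n} \<and> card e = r \<and> (\<forall>i<m. card {x\<in>e. x mod m = i} \<le> 1)}\<rparr>"

lemma turan_parts_balanced:
  fixes n m i j :: nat
  assumes "i < m" and "j < m"
  shows "card {x\<in>{..<n}. x mod m = i} \<le> card {x\<in>{..<n}. x mod m = j} + 1"
proof -
  let ?A = "{x\<in>{..<n}. x mod m = i}" and ?B = "{x\<in>{..<n}. x mod m = j}"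
  let ?C = "{x\<in>?A. m \<le> x}" and ?g = "\<lambda>x. m * (x div m - 1) + j"
  have g: "?g x \<in> ?B" if "x \<in> ?C" for x
  proof -
    from that assms have "x div m \<ge> 1"
      by (simp add: div_greater_zero_iff Suc_le_eq)
    then obtain q where q: "x div m = Suc q"
      by (cases "x div m") auto
    have "m * q + j < m * (x div m)"
      using assms q by simp
    also have "\<dots> \<le> x"
      by simp
    finally show ?thesis
      using that assms q by simp
  qed
  have inj: "inj_on ?g ?C"
  proof (rule inj_onI)
    fix x y assume xy: "x \<in> ?C" "y \<in> ?C" "?g x = ?g y"
    then have "x div m \<ge> 1" "y div m \<ge> 1"
      using assms by (simp_all add: div_greater_zero_iff Suc_le_eq)
    moreover from xy have "x div m - 1 = y div m - 1"
      using assms by simp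
    ultimately have "x div m = y div m"
      by linarith
    moreover have "x mod m = y mod m"
      using xy by simp
    ultimately show "x = y"
      by (metis mult_div_mod_eq)
  qed
  have "?A \<subseteq> insert i ?C"
    by (auto simp: not_less[symmetric])
  then have "card ?A \<le> card (insert i ?C)"
    by (intro card_mono) auto
  also have "\<dots> \<le> card ?C + 1"
    by (simp add: card_insert_if)
  also have "card ?C \<le> card ?B"
    using inj g by (intro card_inj_on_le[of ?g]) auto
  finally show ?thesis
    by simp
qed

lemma rgraph_enlargement:
  assumes "rgraph 2 T"
  shows "rgraph (d + 2) (enlargement d T)"
proof -
  have "card (Inl ` e \<union> Inr ` {..<d}) = d + 2" if "e \<in> edges T" for e
  proof -
    have "finite e" "card e = 2"
      using assms that by (auto simp: rgraph_def intro: finite_subset)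
    then show ?thesis
      by (subst card_Un_disjoint) (auto simp: card_image)
  qed
  then show ?thesis
    using assms by (fastforce simp: rgraph_def enlargement_def)
qed

lemma rgraph_H_graph:
  assumes "rgraph r F" and "r \<ge> 2"
  shows "rgraph r (H_graph F r p)"
proof -
  have fin: "finite (verts (core p F))"
    using assms by (simp add: rgraph_def core_def)
  have sub: "P \<subseteq> verts (core p F)" "finite P" "card P = 2" if "P \<in> uncovered_pairs (core p F)" for P
    using that by (auto simp: uncovered_pairs_def)
  then have "uncovered_pairs (core p F) \<subseteq> Pow (verts (core p F))"
    by auto
  then have finu: "finite (uncovered_pairs (core p F))"
    using fin by (meson finite_Pow_iff finite_subset)
  have c1: "e \<subseteq> verts (core p F) \<and> card (Core ` e) = r" if "e \<in> edges (core p F)" for e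
    using that assms by (auto simp: core_def rgraph_def card_image inj_on_def)
  have c2: "card (Core ` P \<union> Aux P ` {..<r-2}) = r" if "P \<in> uncovered_pairs (core p F)" for P
    using sub[OF that] assms(2)
    by (subst card_Un_disjoint) (auto simp: card_image inj_on_def)
  show ?thesis
    unfolding rgraph_def
  proof (intro conjI ballI)
    show "finite (verts (H_graph F r p))"
      using fin finu by (simp add: H_graph_def)
  next
    fix e assume e: "e \<in> edges (H_graph F r p)"
    show "e \<subseteq> verts (H_graph F r p)"
      using e c1 sub(1) by (fastforce simp: H_graph_def)
    show "card e = r"
      using e c1 c2 by (auto simp: H_graph_def)
  qed
qed

end

theory Submission
  imports Defs "HOL-Analysis.Analysis"
begin

text \<open>
  Fix \<open>m = r + k - 3\<close>. If every \<open>(r - 2)\<close>-set of an \<open>r\<close>-graph has a link graph as sparse as the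
  Erdos--Sos bound guarantees, then its Lagrange polynomial is at most that of the complete \<open>r\<close>-graph
  on \<open>m\<close> vertices under uniform weights. The induction over links caps the weights: at a maximiser a
  heaviest vertex has the largest partial derivative, and \<open>k \<ge> M_r\<close> makes the resulting bound monotone
  in the cap. Near-optimal weights concentrate on \<open>m\<close> vertices.

  An \<open>r\<close>-graph without a homomorphic image of \<open>H\<close> whose support has all pairs covered is sparse in this
  sense. Motzkin--Straus symmetrisation reaches such a support in small steps. A leaf of \<open>T\<close> can play the
  role of a vertex of large degree added to a nearly complete \<open>m\<close>-partite \<open>r\<close>-graph, and the rest of \<open>H\<close>
  embeds there, so the structure survives when the steps are reversed: a dense \<open>r\<close>-graph without
  homomorphic image of \<open>H\<close> is \<open>m\<close>-partite up to vertices of small degree. An \<open>H\<close>-free \<open>r\<close>-graph loses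
  every homomorphic image of \<open>H\<close> after the deletion of few edges, and removing vertices of small degree
  one by one reduces the exact result to large minimum degree.
\<close>

section \<open>Lagrange polynomials\<close>

text \<open>Why a cap: passing \<open>r - 2\<close> times to the link of a heaviest vertex ends in a
  graph, whose Lagrange polynomial under cap y and total weight s is at most (k - 2) y s / 2 by the
  Erdos--Sos bound. Undoing the passages gives a multiple of \<open>gfun r y s\<close>, which must
  grow up to y = s/m for uniform weights to be best. At s = 1 the substitution y = 1/(x + r - 3)
  turns \<open>gfun\<close> into \<open>f_fun r x\<close>, so the sign of the derivative of
  \<open>f_fun r\<close> at k decides; here M_r enters. The obstacle to exactness: symmetrisation
  bounds the density of a homomorphism-free hypergraph but destroys its structure, while stability
  is needed for the hypergraph at hand. Moves are linear in the weight moved and can be cut into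
  pieces of weight at most \<zeta>. Between neighbours in this chain the vertices of large degree
  agree up to small weight, and a colouring of the common part is extended again to all of them.
  Every extension starts from a complete colouring, so errors do not add up along a chain of
  unbounded length.\<close>

definition unif :: "nat \<Rightarrow> 'v set \<Rightarrow> 'v set set \<Rightarrow> bool" where
  "unif r V E \<longleftrightarrow> finite V \<and> (\<forall>e\<in>E. e \<subseteq> V \<and> card e = r)"

definition lag :: "'v set set \<Rightarrow> ('v \<Rightarrow> real) \<Rightarrow> real" where
  "lag E x = (\<Sum>e\<in>E. \<Prod>v\<in>e. x v)"

definition link :: "'v set set \<Rightarrow> 'v \<Rightarrow> 'v set set" where
  "link E v = (\<lambda>e. e - {v}) ` {e\<in>E. v \<in> e}"

lemma unif_finite: "unif r V E \<Longrightarrow> finite E"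
  unfolding unif_def by (meson finite_Pow_iff finite_subset PowI subsetI)

lemma unif_finite_verts: "unif r V E \<Longrightarrow> finite V"
  by (simp add: unif_def)

lemma unif_edge: "unif r V E \<Longrightarrow> e \<in> E \<Longrightarrow> finite e \<and> e \<subseteq> V \<and> card e = r"
  unfolding unif_def by (meson finite_subset)

lemma unif_subset: "unif r V E \<Longrightarrow> E' \<subseteq> E \<Longrightarrow> unif r V E'"
  unfolding unif_def by blast

lemma unif_link: "unif r V E \<Longrightarrow> unif (r - 1) (V - {v}) (link E v)"
  unfolding unif_def link_def by auto

lemma link_iff: "f \<in> link E v \<longleftrightarrow> v \<notin> f \<and> insert v f \<in> E"
proof
  assume "f \<in> link E v"
  then show "v \<notin> f \<and> insert v f \<in> E"
    unfolding link_def by (auto simp: insert_absorb)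
next
  assume "v \<notin> f \<and> insert v f \<in> E"
  then show "f \<in> link E v"
    unfolding link_def by (auto intro!: image_eqI[where x="insert v f"])
qed

lemma link_mono: "E' \<subseteq> E \<Longrightarrow> link E' v \<subseteq> link E v"
  unfolding link_def by auto

lemma link_finite: "finite E \<Longrightarrow> finite (link E v)"
  unfolding link_def by auto

lemma lag_link: "lag (link E v) x = (\<Sum>e\<in>{e\<in>E. v \<in> e}. \<Prod>w\<in>e - {v}. x w)"
  unfolding lag_def link_def
  by (subst sum.reindex) (auto simp: inj_on_def)

lemma lag_split:
  assumes "unif r V E"
  shows "lag E x = x v * lag (link E v) x + lag {e\<in>E. v \<notin> e} x"
proof -
  have fin: "finite E" using assms by (rule unif_finite)
  have "lag E x = (\<Sum>e\<in>{e\<in>E. v \<in> e}. \<Prod>w\<in>e. x w) + (\<Sum>e\<in>{e\<in>E. v \<notin> e}. \<Prod>w\<in>e. x w)"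
    unfolding lag_def using fin
    by (subst sum.union_disjoint[symmetric]) (auto intro!: sum.cong)
  moreover have "(\<Sum>e\<in>{e\<in>E. v \<in> e}. \<Prod>w\<in>e. x w) = x v * lag (link E v) x"
    unfolding lag_link sum_distrib_left
    using unif_edge[OF assms] by (intro sum.cong) (auto simp: prod.remove)
  ultimately show ?thesis by (simp add: lag_def)
qed

lemma lag_cong: "(\<And>e v. e \<in> E \<Longrightarrow> v \<in> e \<Longrightarrow> x v = y v) \<Longrightarrow> lag E x = lag E y"
  unfolding lag_def by (auto intro!: sum.cong prod.cong)

lemma lag_cong': "unif r V E \<Longrightarrow> (\<And>v. v \<in> V \<Longrightarrow> x v = y v) \<Longrightarrow> lag E x = lag E y"
  by (rule lag_cong) (use unif_edge in blast)

lemma lag_nonneg: "unif r V E \<Longrightarrow> (\<And>v. v \<in> V \<Longrightarrow> 0 \<le> x v) \<Longrightarrow> 0 \<le> lag E x"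
  unfolding lag_def by (intro sum_nonneg prod_nonneg) (use unif_edge in blast)

lemma lag_mono:
  "unif r V E \<Longrightarrow> (\<And>v. v \<in> V \<Longrightarrow> 0 \<le> x v \<and> x v \<le> y v) \<Longrightarrow> lag E x \<le> lag E y"
  unfolding lag_def by (intro sum_mono prod_mono) (use unif_edge in blast)

lemma lag_mono_edges:
  assumes "unif r V E" "E' \<subseteq> E" "\<And>v. v \<in> V \<Longrightarrow> 0 \<le> x v"
  shows "lag E' x \<le> lag E x"
  unfolding lag_def
  by (intro sum_mono2 unif_finite[OF assms(1)] assms(2) prod_nonneg)
    (use assms unif_edge in blast)

lemma lag_scale: "unif r V E \<Longrightarrow> lag E (\<lambda>v. c * x v) = c ^ r * lag E x"
  unfolding lag_def sum_distrib_left
  by (intro sum.cong) (auto simp: prod.distrib dest: unif_edge)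

lemma lag_euler:
  assumes "unif r V E"
  shows "(\<Sum>v\<in>V. x v * lag (link E v) x) = real r * lag E x"
proof -
  have fin: "finite E" "finite V" using unif_finite[OF assms] unif_finite_verts[OF assms] by auto
  have "(\<Sum>v\<in>V. x v * lag (link E v) x) = (\<Sum>v\<in>V. \<Sum>e\<in>{e\<in>E. v \<in> e}. \<Prod>w\<in>e. x w)"
    unfolding lag_link sum_distrib_left
    using unif_edge[OF assms] by (intro sum.cong) (auto simp: prod.remove)
  also have "\<dots> = (\<Sum>e\<in>E. \<Sum>v\<in>{v\<in>V. v \<in> e}. \<Prod>w\<in>e. x w)"
    by (rule sum.swap_restrict) (use fin in auto)
  also have "\<dots> = (\<Sum>e\<in>E. real r * (\<Prod>w\<in>e. x w))"
  proof (rule sum.cong)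
    fix e assume "e \<in> E"
    then have "{v\<in>V. v \<in> e} = e" "card e = r" using unif_edge[OF assms] by auto
    then show "(\<Sum>v\<in>{v\<in>V. v \<in> e}. \<Prod>w\<in>e. x w) = real r * (\<Prod>w\<in>e. x w)" by simp
  qed simp
  finally show ?thesis by (simp add: lag_def sum_distrib_left)
qed

lemma unif_0: "unif 0 V E \<Longrightarrow> E \<subseteq> {{}}"
  using unif_edge by fastforce

lemma lag_crude:
  assumes "unif r V E" "\<And>v. v \<in> V \<Longrightarrow> 0 \<le> x v"
  shows "lag E x \<le> (\<Sum>v\<in>V. x v) ^ r"
  using assms
proof (induction r arbitrary: V E)
  case 0
  then have "E = {} \<or> E = {{}}" using unif_0 by blast
  then show ?case by (auto simp: lag_def)
next
  case (Suc r)
  let ?s = "\<Sum>v\<in>V. x v"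
  have finV: "finite V" using Suc.prems by (simp add: unif_def)
  have s0: "0 \<le> ?s" using Suc.prems by (simp add: sum_nonneg)
  have "real (Suc r) * lag E x = (\<Sum>v\<in>V. x v * lag (link E v) x)"
    using lag_euler[OF Suc.prems(1)] by simp
  also have "\<dots> \<le> (\<Sum>v\<in>V. x v * ?s ^ r)"
  proof (intro sum_mono mult_left_mono)
    fix v assume v: "v \<in> V"
    have u: "unif r (V - {v}) (link E v)" using unif_link[OF Suc.prems(1), of v] by simp
    have "lag (link E v) x \<le> (\<Sum>v\<in>V - {v}. x v) ^ r"
      by (rule Suc.IH[OF u]) (use Suc.prems in auto)
    also have "\<dots> \<le> ?s ^ r"
      by (intro power_mono sum_mono2 sum_nonneg) (use Suc.prems finV in auto)
    finally show "lag (link E v) x \<le> ?s ^ r" .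
    show "0 \<le> x v" using Suc.prems v by auto
  qed
  also have "\<dots> = ?s ^ Suc r" by (simp add: sum_distrib_right)
  finally have "real (Suc r) * lag E x \<le> ?s ^ Suc r" .
  moreover have "lag E x \<le> real (Suc r) * lag E x"
    using mult_right_mono[of 1 "real (Suc r)" "lag E x"] lag_nonneg[OF Suc.prems] by simp
  ultimately show ?case by linarith
qed

lemma lag_crude1:
  assumes "unif r V E" "\<And>v. v \<in> V \<Longrightarrow> 0 \<le> x v" "(\<Sum>v\<in>V. x v) \<le> 1"
  shows "lag E x \<le> 1"
proof -
  have "(\<Sum>v\<in>V. x v) ^ r \<le> 1"
    by (intro power_le_one sum_nonneg) (use assms in auto)
  then show ?thesis using lag_crude[OF assms(1,2)] by fastforce
qed

lemma lag_link_crude1: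
  assumes "unif r V E" "\<And>v. v \<in> V \<Longrightarrow> 0 \<le> x v" "(\<Sum>v\<in>V. x v) \<le> 1"
  shows "lag (link E v) x \<le> 1"
proof (rule lag_crude1[OF unif_link[OF assms(1)]])
  have "finite V" using assms by (simp add: unif_def)
  then have "(\<Sum>v\<in>V - {v}. x v) \<le> (\<Sum>v\<in>V. x v)"
    by (intro sum_mono2) (use assms in auto)
  then show "(\<Sum>v\<in>V - {v}. x v) \<le> 1" using assms by simp
qed (use assms in auto)

lemma link_commute: "link (link E u) v = link (link E v) u"
  by (auto simp: link_iff insert_commute)

lemma lag_upd_notin: "(\<And>e. e \<in> E \<Longrightarrow> v \<notin> e) \<Longrightarrow> lag E (x(v := a)) = lag E x"
  by (rule lag_cong) auto

lemma lag_link_upd: "lag (link E v) (x(v := a)) = lag (link E v) x"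
  by (rule lag_upd_notin) (auto simp: link_iff)

text \<open>Multilinearity: as a function of the weights of \<open>u\<close> and \<open>v\<close>
  alone the polynomial has four coefficients. The constant one is quantified before
  \<open>y\<close>, so that comparing two weightings cancels it.\<close>

lemma lag_split2:
  assumes "unif r V E" "u \<noteq> v"
  shows "\<exists>c. \<forall>y. (\<forall>w. w \<noteq> u \<longrightarrow> w \<noteq> v \<longrightarrow> y w = x w) \<longrightarrow>
    lag E y = y u * y v * lag (link (link E u) v) x + y u * lag {e\<in>link E u. v \<notin> e} x
       + y v * lag {e\<in>link E v. u \<notin> e} x + c \<and>
    lag (link E u) y = y v * lag (link (link E u) v) x + lag {e\<in>link E u. v \<notin> e} x \<and>
    lag (link E v) y = y u * lag (link (link E u) v) x + lag {e\<in>link E v. u \<notin> e} x"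
proof -
  have u: "unif (r - 1) (V - {w}) (link E w)" for w by (rule unif_link[OF assms(1)])
  let ?c = "lag {e\<in>{e\<in>E. u \<notin> e}. v \<notin> e} x"
  have linkeq: "link {e\<in>E. u \<notin> e} v = {e\<in>link E v. u \<notin> e}"
    using assms(2) by (auto simp: link_iff)
  show ?thesis
  proof (rule exI[of _ ?c], intro allI impI)
    fix y assume "\<forall>w. w \<noteq> u \<longrightarrow> w \<noteq> v \<longrightarrow> y w = x w"
    then have y: "\<And>w. w \<noteq> u \<Longrightarrow> w \<noteq> v \<Longrightarrow> y w = x w" by blast
    have a: "lag (link (link E u) v) y = lag (link (link E u) v) x"
      by (rule lag_cong) (metis insert_iff link_iff y)
    have b: "lag {e\<in>link E u. v \<notin> e} y = lag {e\<in>link E u. v \<notin> e} x"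
      by (rule lag_cong) (metis (no_types, lifting) link_iff mem_Collect_eq y)
    have c: "lag {e\<in>link E v. u \<notin> e} y = lag {e\<in>link E v. u \<notin> e} x"
      by (rule lag_cong) (metis (no_types, lifting) link_iff mem_Collect_eq y)
    have d: "lag {e\<in>{e\<in>E. u \<notin> e}. v \<notin> e} y = ?c"
      by (rule lag_cong) (metis (no_types, lifting) mem_Collect_eq y)
    have 1: "lag (link E u) y = y v * lag (link (link E u) v) x + lag {e\<in>link E u. v \<notin> e} x"
      using lag_split[OF u, of u y v] a b by simp
    have 2: "lag (link E v) y = y u * lag (link (link E u) v) x + lag {e\<in>link E v. u \<notin> e} x"
      using lag_split[OF u, of v y u] a c link_commute[of E u v] by simp
    have "lag E y = y u * lag (link E u) y + lag {e\<in>E. u \<notin> e} y"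
      by (rule lag_split[OF assms(1)])
    also have "lag {e\<in>E. u \<notin> e} y = y v * lag {e\<in>link E v. u \<notin> e} x + ?c"
      using lag_split[OF unif_subset[OF assms(1)], of "{e\<in>E. u \<notin> e}" y v] linkeq c d by auto
    finally have "lag E y = y u * y v * lag (link (link E u) v) x + y u * lag {e\<in>link E u. v \<notin> e} x
       + y v * lag {e\<in>link E v. u \<notin> e} x + ?c"
      unfolding 1 by (simp add: algebra_simps)
    with 1 2 show "lag E y = y u * y v * lag (link (link E u) v) x + y u * lag {e\<in>link E u. v \<notin> e} x
       + y v * lag {e\<in>link E v. u \<notin> e} x + ?c \<and>
      lag (link E u) y = y v * lag (link (link E u) v) x + lag {e\<in>link E u. v \<notin> e} x \<and>
      lag (link E v) y = y u * lag (link (link E u) v) x + lag {e\<in>link E v. u \<notin> e} x"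
      by blast
  qed
qed

text \<open>The expansion is exact, and its quadratic coefficient is the codegree of the pair. If
  that codegree vanishes at \<open>x\<close>, the polynomial is linear along the shift, which is
  what symmetrisation exploits.\<close>

lemma lag_shift:
  fixes x :: "'v \<Rightarrow> real"
  assumes "unif r V E" "u \<noteq> v"
  defines "y t \<equiv> x(u := x u + t, v := x v - t)"
  shows "lag E (y t) = lag E x + t * (lag (link E u) x - lag (link E v) x) - t ^ 2 * lag (link (link E u) v) x"
    and "lag (link E v) (y t) = lag (link E v) x + t * lag (link (link E u) v) x"
    and "lag (link E u) (y t) = lag (link E u) x - t * lag (link (link E u) v) x"
proof -
  have yt: "\<forall>w. w \<noteq> u \<longrightarrow> w \<noteq> v \<longrightarrow> y t w = x w" "y t u = x u + t" "y t v = x v - t"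
    using assms(2) by (simp_all add: y_def)
  from lag_split2[OF assms(1,2), of x] obtain a b c d where c: "\<And>z. \<forall>w. w \<noteq> u \<longrightarrow> w \<noteq> v \<longrightarrow> z w = x w \<Longrightarrow>
    lag E z = z u * z v * a + z u * b + z v * c + d \<and> lag (link E u) z = z v * a + b \<and> lag (link E v) z = z u * a + c"
    and a: "a = lag (link (link E u) v) x"
    by blast
  show "lag E (y t) = lag E x + t * (lag (link E u) x - lag (link E v) x) - t ^ 2 * lag (link (link E u) v) x"
    using c[OF yt(1)] c[of x] unfolding yt a[symmetric] by (simp add: algebra_simps power2_eq_square)
  show "lag (link E v) (y t) = lag (link E v) x + t * lag (link (link E u) v) x"
    using c[OF yt(1)] c[of x] unfolding yt a[symmetric] by (simp add: algebra_simps)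
  show "lag (link E u) (y t) = lag (link E u) x - t * lag (link (link E u) v) x"
    using c[OF yt(1)] c[of x] unfolding yt a[symmetric] by (simp add: algebra_simps)
qed

lemma lag_restrict:
  assumes "unif r V E" "\<And>v. v \<in> V \<Longrightarrow> v \<notin> S \<Longrightarrow> x v = 0"
  shows "lag {e\<in>E. e \<subseteq> S} x = lag E x"
  unfolding lag_def
proof (rule sum.mono_neutral_left)
  show "finite E" using assms unif_finite by auto
  show "\<forall>i\<in>E - {e\<in>E. e \<subseteq> S}. prod x i = 0"
  proof
    fix e assume e: "e \<in> E - {e\<in>E. e \<subseteq> S}"
    then obtain v where "v \<in> e" "v \<notin> S" by auto
    then have "x v = 0" "finite e" using assms unif_edge[OF assms(1)] e by auto
    then show "prod x e = 0" using \<open>v \<in> e\<close> by auto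
  qed
qed auto

text \<open>Factors are changed one at a time, the others being raised to their values at the larger
  point \<open>x\<close>.\<close>

lemma prod_diff_le:
  fixes x y :: "'v \<Rightarrow> real"
  assumes "finite A" "\<And>v. v \<in> A \<Longrightarrow> 0 \<le> y v \<and> y v \<le> x v"
  shows "prod x A - prod y A \<le> (\<Sum>v\<in>A. (x v - y v) * prod x (A - {v}))"
  using assms
proof (induction A rule: finite_induct)
  case empty
  then show ?case by simp
next
  case (insert a A)
  have IH: "prod x A - prod y A \<le> (\<Sum>v\<in>A. (x v - y v) * prod x (A - {v}))"
    using insert by auto
  have le: "prod y A \<le> prod x A" by (intro prod_mono) (use insert in auto)
  have "(\<Sum>v\<in>insert a A. (x v - y v) * prod x (insert a A - {v}))
      = (x a - y a) * prod x A + (\<Sum>v\<in>A. (x v - y v) * prod x (insert a A - {v}))"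
    using insert by simp
  also have "(\<Sum>v\<in>A. (x v - y v) * prod x (insert a A - {v})) = x a * (\<Sum>v\<in>A. (x v - y v) * prod x (A - {v}))"
    unfolding sum_distrib_left
  proof (rule sum.cong)
    fix v assume v: "v \<in> A"
    then have "insert a A - {v} = insert a (A - {v})" using insert by auto
    then show "(x v - y v) * prod x (insert a A - {v}) = x a * ((x v - y v) * prod x (A - {v}))"
      using insert by simp
  qed simp
  finally have eq: "(\<Sum>v\<in>insert a A. (x v - y v) * prod x (insert a A - {v}))
     = (x a - y a) * prod x A + x a * (\<Sum>v\<in>A. (x v - y v) * prod x (A - {v}))" .
  have "prod x (insert a A) - prod y (insert a A) = (x a - y a) * prod y A + x a * (prod x A - prod y A)"
    using insert by (simp add: algebra_simps)
  also have "\<dots> \<le> (x a - y a) * prod x A + x a * (\<Sum>v\<in>A. (x v - y v) * prod x (A - {v}))"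
  proof (intro add_mono mult_left_mono)
    show "0 \<le> x a" "0 \<le> x a - y a" using insert(4)[of a] by auto
  qed (use le IH in auto)
  finally show ?case unfolding eq .
qed

lemma lag_diff_le:
  assumes "unif r V E" "\<And>v. v \<in> V \<Longrightarrow> 0 \<le> y v \<and> y v \<le> x v"
  shows "lag E x - lag E y \<le> (\<Sum>v\<in>V. (x v - y v) * lag (link E v) x)"
proof -
  have fin: "finite E" "finite V" using unif_finite[OF assms(1)] unif_finite_verts[OF assms(1)] by auto
  have "lag E x - lag E y = (\<Sum>e\<in>E. prod x e - prod y e)"
    by (simp add: lag_def sum_subtractf)
  also have "\<dots> \<le> (\<Sum>e\<in>E. \<Sum>v\<in>e. (x v - y v) * prod x (e - {v}))"
    by (intro sum_mono prod_diff_le) (use assms unif_edge[OF assms(1)] in blast)+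
  also have "\<dots> = (\<Sum>e\<in>E. \<Sum>v\<in>{v\<in>V. v \<in> e}. (x v - y v) * prod x (e - {v}))"
    by (intro sum.cong) (use unif_edge[OF assms(1)] in auto)
  also have "\<dots> = (\<Sum>v\<in>V. \<Sum>e\<in>{e\<in>E. v \<in> e}. (x v - y v) * prod x (e - {v}))"
    by (rule sum.swap_restrict[symmetric]) (use fin in auto)
  finally show ?thesis by (simp add: lag_link sum_distrib_left)
qed

text \<open>Partial derivatives are at most 1 when the total weight is, so removing weight costs no
  more density than the weight removed.\<close>

lemma lag_loss:
  assumes "unif r V E" "\<And>v. v \<in> V \<Longrightarrow> 0 \<le> x v" "(\<Sum>v\<in>V. x v) \<le> 1"
  shows "lag E x - (\<Sum>v\<in>V - S. x v) \<le> lag {e\<in>E. e \<subseteq> S} x"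
proof -
  let ?y = "\<lambda>v. if v \<in> S then x v else 0"
  have fin: "finite V" using assms by (auto simp: unif_def)
  have "lag E x - lag E ?y \<le> (\<Sum>v\<in>V. (x v - ?y v) * lag (link E v) x)"
    by (rule lag_diff_le[OF assms(1)]) (use assms in auto)
  also have "\<dots> \<le> (\<Sum>v\<in>V. (x v - ?y v) * 1)"
    by (intro sum_mono mult_left_mono lag_link_crude1[OF assms(1)]) (use assms in auto)
  also have "\<dots> = (\<Sum>v\<in>V - S. x v)"
    using fin by (intro sum.mono_neutral_cong_right) auto
  finally have "lag E x - (\<Sum>v\<in>V - S. x v) \<le> lag E ?y" by simp
  also have "lag E ?y = lag {e\<in>E. e \<subseteq> S} ?y"
    by (rule lag_restrict[OF assms(1), symmetric]) auto
  also have "\<dots> = lag {e\<in>E. e \<subseteq> S} x"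
    by (rule lag_cong) auto
  finally show ?thesis .
qed

text \<open>Scaling the light vertices down by a common factor would otherwise raise the density above \<open>l\<close>.\<close>

lemma low_degree_small:
  fixes \<zeta> \<epsilon> l :: real
  assumes "unif r V E" "\<And>v. v \<in> V \<Longrightarrow> 0 \<le> x v" "(\<Sum>v\<in>V. x v) \<le> 1"
    and bound: "\<And>z. (\<And>v. v \<in> V \<Longrightarrow> 0 \<le> z v) \<Longrightarrow> lag E z \<le> l * (\<Sum>v\<in>V. z v) ^ r"
    and l: "0 \<le> l" "l \<le> 1" and big: "lag E x \<ge> l - \<epsilon>" and r: "r \<ge> 1"
    and \<zeta>: "0 < \<zeta>" "\<zeta> \<le> 1" "\<epsilon> < \<zeta>\<^sup>2 / (4 * real r ^ 2)"
  shows "(\<Sum>v\<in>{v\<in>V. lag (link E v) x < real r * l - \<zeta>}. x v) \<le> \<zeta>"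
proof (rule ccontr)
  let ?Z = "{v\<in>V. lag (link E v) x < real r * l - \<zeta>}"
  assume "\<not> ?thesis"
  then have Z: "\<zeta> < sum x ?Z" by simp
  have fin: "finite V" using assms by (auto simp: unif_def)
  \<comment> \<open>Removing total weight \<tau> from the light vertices gains
    \<open>\<zeta> * \<tau>\<close> to first order against a second-order error
    \<open>r^2 * \<tau>^2\<close>. This \<tau> maximises the difference, which becomes the bound
    imposed on \<epsilon>.\<close>
  define \<tau> where "\<tau> = \<zeta> / (2 * real r ^ 2)"
  have r1: "real r ^ 2 \<ge> 1" using r by simp
  have "\<zeta> * 1 \<le> \<zeta> * (2 * real r ^ 2)" using \<zeta> r1 by (intro mult_left_mono) auto
  then have \<tau>: "0 < \<tau>" "\<tau> \<le> \<zeta>" unfolding \<tau>_def using \<zeta> r1 r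
    by (simp_all add: divide_le_eq) (use r1 in linarith)
  define \<theta> where "\<theta> = \<tau> / sum x ?Z"
  have \<theta>: "0 \<le> \<theta>" "\<theta> \<le> 1" using Z \<tau> \<zeta> unfolding \<theta>_def by (auto simp: field_simps)
  define y where "y = (\<lambda>v. if v \<in> ?Z then x v - \<theta> * x v else x v)"
  have y: "0 \<le> y v \<and> y v \<le> x v" if "v \<in> V" for v
    using assms(2)[OF that] \<theta> unfolding y_def by (auto simp: mult_left_le_one_le)
  have sumd: "(\<Sum>v\<in>V. x v - y v) = \<tau>"
  proof -
    have "(\<Sum>v\<in>V. x v - y v) = (\<Sum>v\<in>?Z. \<theta> * x v)"
      unfolding y_def using fin by (intro sum.mono_neutral_cong_right) auto
    also have "\<dots> = \<theta> * sum x ?Z" by (simp add: sum_distrib_left)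
    finally show ?thesis using Z \<zeta> unfolding \<theta>_def by simp
  qed
  have "lag E x - lag E y \<le> (\<Sum>v\<in>V. (x v - y v) * lag (link E v) x)"
    by (rule lag_diff_le[OF assms(1)]) (use y in auto)
  also have "\<dots> \<le> (\<Sum>v\<in>V. (x v - y v) * (real r * l - \<zeta>))"
  proof (rule sum_mono)
    fix v assume v: "v \<in> V"
    show "(x v - y v) * lag (link E v) x \<le> (x v - y v) * (real r * l - \<zeta>)"
    proof (cases "v \<in> ?Z")
      case True
      then show ?thesis using y[OF v] by (intro mult_left_mono) auto
    next
      case False
      then show ?thesis unfolding y_def by auto
    qed
  qed
  also have "\<dots> = \<tau> * (real r * l - \<zeta>)" using sumd by (simp add: sum_distrib_right[symmetric])
  finally have 1: "l - \<epsilon> - \<tau> * (real r * l - \<zeta>) \<le> lag E y" using big by simp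
  have sy: "(\<Sum>v\<in>V. y v) \<le> 1 - \<tau>" using sumd assms(3) by (simp add: sum_subtractf)
  have "lag E y \<le> l * (\<Sum>v\<in>V. y v) ^ r" by (rule bound) (use y in auto)
  also have "\<dots> \<le> l * (1 - \<tau>) ^ r"
    by (intro mult_left_mono power_mono sy sum_nonneg) (use y l in auto)
  also have "(1 - \<tau>) ^ r \<le> 1 - real r * \<tau> + real r ^ 2 * \<tau>\<^sup>2"
  proof -
    have t: "0 \<le> 1 - \<tau>" "\<tau> \<le> 1" using \<tau> \<zeta> by auto
    have "(1 - \<tau>) ^ n \<le> 1 - real n * \<tau> + real n ^ 2 * \<tau>\<^sup>2" for n
    proof (induction n)
      case (Suc n)
      have "(1 - \<tau>) ^ Suc n \<le> (1 - \<tau>) * (1 - real n * \<tau> + real n ^ 2 * \<tau>\<^sup>2)"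
        using Suc t by (simp add: mult_left_mono)
      also have "\<dots> = 1 - real (Suc n) * \<tau> + (real n ^ 2 + real n) * \<tau>\<^sup>2 - real n ^ 2 * \<tau>^3"
        by (simp add: algebra_simps power2_eq_square power3_eq_cube)
      also have "\<dots> \<le> 1 - real (Suc n) * \<tau> + (real n ^ 2 + real n) * \<tau>\<^sup>2"
        using \<tau> by simp
      also have "\<dots> \<le> 1 - real (Suc n) * \<tau> + real (Suc n) ^ 2 * \<tau>\<^sup>2"
        by (intro add_left_mono mult_right_mono) (auto simp: power2_eq_square algebra_simps)
      finally show ?case .
    qed simp
    then show ?thesis .
  qed
  finally have 2: "lag E y \<le> l * (1 - real r * \<tau> + real r ^ 2 * \<tau>\<^sup>2)" using l by (simp add: mult_left_mono)
  have "l * (real r ^ 2 * \<tau>\<^sup>2) \<le> 1 * (real r ^ 2 * \<tau>\<^sup>2)"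
    by (rule mult_right_mono) (use l in auto)
  then have "\<zeta> * \<tau> \<le> \<epsilon> + real r ^ 2 * \<tau>\<^sup>2" using 1 2 by (simp add: algebra_simps)
  moreover have "\<zeta> * \<tau> = \<zeta>\<^sup>2 / (2 * real r ^ 2)" unfolding \<tau>_def by (simp add: power2_eq_square)
  moreover have "real r ^ 2 * \<tau>\<^sup>2 = \<zeta>\<^sup>2 / (4 * real r ^ 2)"
    unfolding \<tau>_def using r by (simp add: power2_eq_square field_simps)
  ultimately show False using \<zeta>(3) by simp
qed

section \<open>Hypergraphs with sparse link graphs\<close>

lemma finite_argmax:
  fixes f :: "'v \<Rightarrow> real"
  assumes "finite P" "P \<noteq> {}"
  obtains u where "u \<in> P" "\<And>w. w \<in> P \<Longrightarrow> f w \<le> f u"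
proof -
  have "Max (f ` P) \<in> f ` P" using assms by (intro Max_in) auto
  then obtain u where "u \<in> P" "f u = Max (f ` P)" by auto
  then show thesis using that assms by (metis Max_ge finite_imageI imageI)
qed

text \<open>The Erdos--Sos bound for the link graphs of \<open>(r - 2)\<close>-sets. Asking it of
  every finite \<open>S\<close>, not just of the whole vertex set, makes the condition pass to links
  and to the level sets of a weighting.\<close>

definition es_sparse :: "nat \<Rightarrow> nat \<Rightarrow> 'v set set \<Rightarrow> bool" where
  "es_sparse k r E \<longleftrightarrow> (\<forall>D S. finite D \<and> card D + 2 = r \<and> finite S \<and> D \<inter> S = {} \<longrightarrow>
     2 * card {e\<in>E. D \<subseteq> e \<and> e \<subseteq> D \<union> S} \<le> (k - 2) * card S)"

text \<open>Up to the factor (k - 2)/r!, this bounds the Lagrange polynomial under cap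
  \<open>y\<close> and total weight \<open>s\<close>. It is \<open>y * s\<close> in rank two, and
  each further rank peels off one heaviest vertex through
  \<open>gfun (Suc q) y s = s * gfun q y (s - y)\<close>.\<close>

definition gfun :: "nat \<Rightarrow> real \<Rightarrow> real \<Rightarrow> real" where
  "gfun r y s = y * (\<Prod>j<r-1. s - real j * y)"

text \<open>Up to reindexing, this says that the logarithmic derivative of \<open>f_fun r\<close> is at most \<open>0\<close> at \<open>k\<close>.\<close>

definition tame :: "nat \<Rightarrow> nat \<Rightarrow> bool" where
  "tame k r \<longleftrightarrow> (\<Sum>j<r-1. real j / (real k + real r - 3 - real j)) \<le> 1"

text \<open>Raising both the rank and \<open>j\<close> by one keeps every denominator while the
  numerators grow; this lets \<open>tame\<close> descend along links.\<close>

lemma tame_pred: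
  assumes "tame k (Suc r)" "k \<ge> 3" "r \<ge> 2"
  shows "tame k r"
proof -
  have r: "Suc r - 1 = Suc (r - 1)" using assms by simp
  have "(\<Sum>j<r-1. real j / (real k + real r - 3 - real j)) \<le>
      (\<Sum>j<r-1. real (Suc j) / (real k + real (Suc r) - 3 - real (Suc j)))"
    by (intro sum_mono frac_le) (use assms in auto)
  also have "\<dots> = (\<Sum>j<Suc r-1. real j / (real k + real (Suc r) - 3 - real j))"
    unfolding r sum.lessThan_Suc_shift by simp
  also have "\<dots> \<le> 1" using assms by (simp add: tame_def)
  finally show ?thesis by (simp add: tame_def)
qed

lemma gfun_scale: "r \<ge> 1 \<Longrightarrow> gfun r (c * y) (c * s) = c ^ r * gfun r y s"
proof -
  assume r: "r \<ge> 1"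
  have "(\<Prod>j<r-1. c * s - real j * (c * y)) = (\<Prod>j<r-1. c * (s - real j * y))"
    by (intro prod.cong) (auto simp: algebra_simps)
  then have "(\<Prod>j<r-1. c * s - real j * (c * y)) = c ^ (r - 1) * (\<Prod>j<r-1. s - real j * y)"
    by (simp add: prod.distrib)
  moreover have "c ^ r = c * c ^ (r - 1)" using r by (cases r) auto
  ultimately show ?thesis unfolding gfun_def by (simp add: algebra_simps)
qed

lemma gfun_Suc: "q \<ge> 1 \<Longrightarrow> gfun (Suc q) y s = s * gfun q y (s - y)"
proof -
  assume "q \<ge> 1"
  then have q: "Suc q - 1 = Suc (q - 1)" by simp
  show ?thesis
    unfolding gfun_def q prod.lessThan_Suc_shift by (simp add: algebra_simps)
qed

lemma gfun_nonneg:
  assumes "0 \<le> y" "y * (real r - 1) \<le> s"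
  shows "0 \<le> gfun r y s"
  unfolding gfun_def
proof (intro mult_nonneg_nonneg prod_nonneg)
  fix j assume j: "j \<in> {..<r-1}"
  then have "real j * y \<le> (real r - 1) * y" by (intro mult_right_mono) (use assms in auto)
  then show "0 \<le> s - real j * y" using assms by (simp add: mult.commute)
qed (use assms in auto)

text \<open>Strictness comes from applying the tangent bound to half of the exponent and
  squaring.\<close>

lemma less_exp_diff_one: "u \<noteq> 1 \<Longrightarrow> 0 \<le> u \<Longrightarrow> (u::real) < exp (u - 1)"
proof -
  assume u: "u \<noteq> 1" "0 \<le> u"
  have "u < u + ((u - 1) / 2)\<^sup>2" using u by simp
  also have "\<dots> = (1 + (u - 1) / 2)\<^sup>2" by (simp add: power2_eq_square field_simps)
  also have "\<dots> \<le> (exp ((u - 1) / 2))\<^sup>2"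
    by (intro power_mono exp_ge_add_one_self) (use u in \<open>simp add: field_simps\<close>)
  also have "\<dots> = exp (u - 1)" by (simp add: exp_double[symmetric])
  finally show ?thesis .
qed

text \<open>Instead of differentiating, each factor at \<open>y\<close> is written as the factor at
  \<open>z\<close> times \<open>1 + a j\<close>, and the product of these is at most the exponential
  of the sum of the \<open>a j\<close>. The tameness sum turns this into
  \<open>exp (1 - y / z)\<close>, and \<open>y / z < exp (y / z - 1)\<close> finishes.\<close>

lemma gfun_strict_mono_real:
  fixes x :: real
  assumes k: "x \<ge> 2" "r \<ge> 2" "(\<Sum>j<r-1. real j / (x + real r - 3 - real j)) \<le> 1"
    and y: "0 \<le> y" "y < z" "z * (x + real r - 3) \<le> 1"
  shows "gfun r y 1 < gfun r z 1"
proof -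
  let ?m = "x + real r - 3"
  have z0: "0 < z" using y by simp
  have pos: "1 - real j * z > 0" "?m - real j > 0" if "j < r - 1" for j
  proof -
    show "?m - real j > 0" using that k by auto
    then have "real j * z < ?m * z" using z0 by (intro mult_strict_right_mono) auto
    then show "1 - real j * z > 0" using y(3) by (simp add: mult.commute)
  qed
  define a where "a j = real j * (z - y) / (1 - real j * z)" for j
  have "(\<Prod>j<r-1. 1 - real j * y) = (\<Prod>j<r-1. (1 - real j * z) * (1 + a j))"
  proof (intro prod.cong refl)
    fix j assume "j \<in> {..<r-1}"
    then have "1 - real j * z \<noteq> 0" using pos[of j] by auto
    then show "1 - real j * y = (1 - real j * z) * (1 + a j)"
      unfolding a_def by (simp add: field_simps)
  qed
  also have "\<dots> = (\<Prod>j<r-1. 1 - real j * z) * (\<Prod>j<r-1. 1 + a j)"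
    by (simp add: prod.distrib)
  finally have 1: "(\<Prod>j<r-1. 1 - real j * y) = (\<Prod>j<r-1. 1 - real j * z) * (\<Prod>j<r-1. 1 + a j)" .
  have a0: "0 \<le> a j" if "j < r - 1" for j
    unfolding a_def using pos[OF that] y by auto
  have "(\<Prod>j<r-1. 1 + a j) \<le> (\<Prod>j<r-1. exp (a j))"
    by (intro prod_mono) (use a0 in \<open>auto simp: add_nonneg_nonneg intro: exp_ge_add_one_self\<close>)
  also have "\<dots> = exp (\<Sum>j<r-1. a j)" by (simp add: exp_sum)
  also have "\<dots> \<le> exp (1 - y / z)"
  proof -
    have "a j \<le> (1 - y / z) * (real j / (?m - real j))" if j: "j < r - 1" for j
    proof -
      have "real j * z * (?m - real j) \<le> real j * (1 - real j * z)"
      proof -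
        have "real j * (z * ?m) \<le> real j * 1" by (intro mult_left_mono y) auto
        then show ?thesis by (simp add: algebra_simps)
      qed
      then have "real j * z / (1 - real j * z) \<le> real j / (?m - real j)"
        using pos[OF j] by (simp add: divide_simps)
      then have "(1 - y / z) * (real j * z / (1 - real j * z)) \<le> (1 - y / z) * (real j / (?m - real j))"
        by (rule mult_left_mono) (use y in auto)
      moreover have "(1 - y / z) * (real j * z / (1 - real j * z)) = a j"
      proof -
        have "(1 - y / z) * z = z - y" using z0 by (simp add: field_simps)
        then have "(1 - y / z) * (real j * z) = real j * (z - y)" by (metis mult.assoc mult.commute)
        then show ?thesis unfolding a_def by (metis times_divide_eq_right)
      qed
      ultimately show ?thesis by simp
    qed
    then have "(\<Sum>j<r-1. a j) \<le> (\<Sum>j<r-1. (1 - y / z) * (real j / (?m - real j)))"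
      by (intro sum_mono) auto
    also have "\<dots> = (1 - y / z) * (\<Sum>j<r-1. real j / (?m - real j))" by (simp add: sum_distrib_left)
    also have "\<dots> \<le> (1 - y / z) * 1"
      by (rule mult_left_mono) (use k y in auto)
    finally show ?thesis by simp
  qed
  finally have 2: "(\<Prod>j<r-1. 1 + a j) \<le> exp (1 - y / z)" .
  have "y / z < exp (y / z - 1)" by (rule less_exp_diff_one) (use y in auto)
  then have "y / z * exp (1 - y / z) < exp (y / z - 1) * exp (1 - y / z)"
    by (rule mult_strict_right_mono) simp
  also have "\<dots> = 1" by (simp add: exp_add[symmetric])
  finally have "y / z * exp (1 - y / z) < 1" .
  then have "y * exp (1 - y / z) < z" using z0 by (simp add: field_simps)
  moreover have "y * (\<Prod>j<r-1. 1 + a j) \<le> y * exp (1 - y / z)"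
    by (rule mult_left_mono[OF 2]) (use y in auto)
  ultimately have "y * (\<Prod>j<r-1. 1 + a j) < z" by simp
  moreover have "(\<Prod>j<r-1. 1 - real j * z) > 0" by (rule prod_pos) (use pos in auto)
  ultimately have "y * (\<Prod>j<r-1. 1 + a j) * (\<Prod>j<r-1. 1 - real j * z) < z * (\<Prod>j<r-1. 1 - real j * z)"
    by simp
  then show ?thesis unfolding gfun_def 1 by (simp add: ac_simps)
qed

lemma gfun_strict_mono:
  assumes k: "k \<ge> 3" "r \<ge> 2" "tame k r"
    and y: "0 \<le> y" "y < z" "z * (real k + real r - 3) \<le> 1"
  shows "gfun r y 1 < gfun r z 1"
  by (rule gfun_strict_mono_real[of "real k"]) (use assms in \<open>auto simp: tame_def\<close>)

lemma gfun_mono: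
  assumes k: "k \<ge> 3" "r \<ge> 2" "tame k r"
    and y: "0 \<le> y" "y \<le> z" "z * (real k + real r - 3) \<le> s" "0 < s"
  shows "gfun r y s \<le> gfun r z s"
proof (cases "y = z")
  case False
  have "gfun r (y / s) 1 < gfun r (z / s) 1"
    by (rule gfun_strict_mono[OF k]) (use y False in \<open>auto simp: field_simps\<close>)
  then have "s ^ r * gfun r (y / s) 1 \<le> s ^ r * gfun r (z / s) 1" using y by simp
  then show ?thesis using gfun_scale[of r s "y / s" 1] gfun_scale[of r s "z / s" 1] k y by simp
qed simp

text \<open>Adding \<open>v\<close> to \<open>D\<close> turns the link graph of \<open>D\<close> in
  the link of \<open>v\<close> into a link graph of \<open>E\<close>.\<close>

lemma sparse_link:
  assumes "es_sparse k (Suc r) E" "unif (Suc r) V E"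
  shows "es_sparse k r (link E v)"
  unfolding es_sparse_def
proof (intro allI impI, elim conjE)
  fix D S :: "'a set" assume D: "finite D" "card D + 2 = r" "finite S" "D \<inter> S = {}"
  let ?A = "{e\<in>link E v. D \<subseteq> e \<and> e \<subseteq> D \<union> S}"
  show "2 * card ?A \<le> (k - 2) * card S"
  proof (cases "v \<in> D")
    case True
    then have "\<not> D \<subseteq> e" if "e \<in> link E v" for e using that by (auto simp: link_iff)
    then have "?A = {}" by blast
    then have "card ?A = 0" by (metis card.empty)
    then show ?thesis by simp
  next
    case False
    let ?B = "{e\<in>E. insert v D \<subseteq> e \<and> e \<subseteq> insert v D \<union> (S - {v})}"
    have "finite ?B" using unif_finite[OF assms(2)] by simp
    then have "card ?A \<le> card ?B"
      by (intro card_inj_on_le[of "insert v"])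
        (auto simp: inj_on_def link_iff insert_ident)
    moreover have "2 * card ?B \<le> (k - 2) * card (S - {v})"
      using assms(1)[unfolded es_sparse_def, rule_format, of "insert v D" "S - {v}"] D False by auto
    moreover have "(k - 2) * card (S - {v}) \<le> (k - 2) * card S"
      by (intro mult_le_mono2 card_mono D) auto
    ultimately show ?thesis by linarith
  qed
qed

section \<open>Rank two: weighted sparse graphs\<close>

lemma pair_edge:
  assumes "unif 2 V E" "e \<in> E"
  obtains u w where "e = {u, w}" "u \<noteq> w" "u \<in> V" "w \<in> V"
proof -
  have "card e = 2" "e \<subseteq> V" using unif_edge[OF assms] by auto
  then show thesis using that by (auto simp: card_2_iff)
qed

text \<open>Layer-cake summation of the edge counts of the sets of vertices of large weight.\<close>

lemma sum_Min_edges_le: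
  fixes c :: real
  assumes "unif 2 V E" "\<And>S. S \<subseteq> V \<Longrightarrow> 2 * real (card {e\<in>E. e \<subseteq> S}) \<le> c * real (card S)"
    and "\<And>v. v \<in> V \<Longrightarrow> 0 \<le> x v"
  shows "2 * (\<Sum>e\<in>E. Min (x ` e)) \<le> c * (\<Sum>v\<in>V. x v)"
  using assms(3)
proof (induction "card {v\<in>V. x v > 0}" arbitrary: x rule: less_induct)
  case less
  have finV: "finite V" and finE: "finite E"
    using unif_finite_verts[OF assms(1)] unif_finite[OF assms(1)] by auto
  let ?S = "{v\<in>V. x v > 0}"
  have Minpair: "Min (y ` e) = min (y u) (y w)" if "e = {u, w}" for e u w and y :: "'a \<Rightarrow> real"
    using that by simp
  show ?case
  proof (cases "?S = {}")
    case True
    then have 0: "x v = 0" if "v \<in> V" for v using that less.prems[OF that] by force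
    have "Min (x ` e) = 0" if "e \<in> E" for e
      by (rule pair_edge[OF assms(1) that]) (use 0 in auto)
    then show ?thesis using 0 by simp
  next
    case False
    \<comment> \<open>One layer: lowering all positive weights by their minimum makes at least one
      of them vanish, and lowers the minimum over an edge by \<open>t\<close> exactly when both ends
      are positive.\<close>
    define t where "t = Min (x ` ?S)"
    have t: "t > 0" "\<And>v. v \<in> ?S \<Longrightarrow> t \<le> x v" unfolding t_def using False finV
      by (auto intro!: Min_le)
    obtain v0 where v0: "v0 \<in> ?S" "x v0 = t"
      unfolding t_def using False finV Min_in[of "x ` ?S"] by fastforce
    define y where "y v = (if v \<in> ?S then x v - t else x v)" for v
    have y0: "0 \<le> y v" if "v \<in> V" for v unfolding y_def using t less.prems that by auto
    have xz: "x v = 0" if "v \<in> V" "v \<notin> ?S" for v using that less.prems[of v] by auto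
    have "{v\<in>V. y v > 0} \<subset> ?S"
      using v0 xz unfolding y_def by (force split: if_splits)
    then have "card {v\<in>V. y v > 0} < card ?S" using finV by (intro psubset_card_mono) auto
    then have IH: "2 * (\<Sum>e\<in>E. Min (y ` e)) \<le> c * (\<Sum>v\<in>V. y v)" using less.hyps[of y] y0 by auto
    have Me: "Min (x ` e) = Min (y ` e) + (if e \<subseteq> ?S then t else 0)" if e: "e \<in> E" for e
    proof (rule pair_edge[OF assms(1) e])
      fix u w assume uw: "e = {u, w}" "u \<noteq> w" "u \<in> V" "w \<in> V"
      show ?thesis
        unfolding Minpair[OF uw(1)] using uw xz[of u] xz[of w] less.prems[of u] less.prems[of w] t(2)[of u] t(2)[of w]
        by (auto simp: y_def min_def)
    qed
    have "2 * (\<Sum>e\<in>E. Min (x ` e)) = 2 * (\<Sum>e\<in>E. Min (y ` e)) + 2 * (\<Sum>e\<in>E. if e \<subseteq> ?S then t else 0)"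
      using Me by (simp add: sum.distrib)
    also have "(\<Sum>e\<in>E. if e \<subseteq> ?S then t else 0) = real (card {e\<in>E. e \<subseteq> ?S}) * t"
      using finE by (simp add: sum.If_cases Int_def)
    finally have "2 * (\<Sum>e\<in>E. Min (x ` e)) \<le> c * (\<Sum>v\<in>V. y v) + (2 * real (card {e\<in>E. e \<subseteq> ?S})) * t"
      using IH by simp
    also have "(2 * real (card {e\<in>E. e \<subseteq> ?S})) * t \<le> (c * real (card ?S)) * t"
      by (intro mult_right_mono assms(2)) (use t in auto)
    also have "c * (\<Sum>v\<in>V. y v) + (c * real (card ?S)) * t = c * (\<Sum>v\<in>V. y v + (if v \<in> ?S then t else 0))"
    proof -
      have "(\<Sum>v\<in>V. if v \<in> ?S then t else 0) = real (card ?S) * t"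
        using finV by (simp add: sum.If_cases Int_def)
      then show ?thesis by (simp add: sum.distrib algebra_simps)
    qed
    also have "(\<Sum>v\<in>V. y v + (if v \<in> ?S then t else 0)) = (\<Sum>v\<in>V. x v)"
      by (intro sum.cong) (auto simp: y_def)
    finally show ?thesis by simp
  qed
qed

lemma sparse_2:
  assumes "es_sparse k 2 E" "finite S" "k \<ge> 2"
  shows "2 * real (card {e\<in>E. e \<subseteq> S}) \<le> (real k - 2) * real (card S)"
proof -
  have "2 * card {e\<in>E. e \<subseteq> S} \<le> (k - 2) * card S"
    using assms(1,2) unfolding es_sparse_def by (metis (mono_tags, lifting) Collect_cong Int_empty_left Un_empty_left add_0 card.empty empty_subsetI finite.emptyI)
  then have "real (2 * card {e\<in>E. e \<subseteq> S}) \<le> real ((k - 2) * card S)" by linarith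
  then show ?thesis using assms(3) by (simp add: of_nat_diff)
qed

text \<open>The larger weight of an edge is replaced by the cap and the smaller one is kept, ready
  for the layer-cake sum.\<close>

lemma lag_2_le_Min:
  assumes "unif 2 V E" "\<And>v. v \<in> V \<Longrightarrow> 0 \<le> x v \<and> x v \<le> y"
  shows "lag E x \<le> y * (\<Sum>e\<in>E. Min (x ` e))"
  unfolding lag_def sum_distrib_left
proof (rule sum_mono)
  fix e assume e: "e \<in> E"
  show "prod x e \<le> y * Min (x ` e)"
  proof (rule pair_edge[OF assms(1) e])
    fix u w assume uw: "e = {u, w}" "u \<noteq> w" "u \<in> V" "w \<in> V"
    have "x u * x w \<le> y * min (x u) (x w)"
      using assms(2)[OF uw(3)] assms(2)[OF uw(4)]
      by (auto simp: min_def intro: mult_right_mono) (metis mult.commute mult_right_mono)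
    then show ?thesis using uw by simp
  qed
qed

section \<open>Maximisers under a cap on the weights\<close>

lemma lag_continuous: "continuous_on A (lag E :: ('v \<Rightarrow> real) \<Rightarrow> real)"
proof -
  have "continuous_on A (\<lambda>x :: 'v \<Rightarrow> real. \<Sum>e\<in>E. \<Prod>v\<in>e. x v)"
    by (intro continuous_on_sum continuous_on_prod continuous_on_subset[OF continuous_on_product_coordinates]) auto
  then show ?thesis by (simp add: lag_def[abs_def])
qed

text \<open>Weights off \<open>V\<close> are pinned to 0, so that the set is a product of compact
  intervals cut by a closed hyperplane.\<close>

lemma capped_simplex_compact:
  assumes "finite V"
  shows "compact {x :: 'v \<Rightarrow> real. (\<forall>v. x v \<in> (if v \<in> V then {0..y} else {0})) \<and> (\<Sum>v\<in>V. x v) = s}"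
proof -
  let ?B = "PiE UNIV (\<lambda>v. if v \<in> V then {0..y} else {0::real})"
  have "compactin (product_topology (\<lambda>v. euclidean) UNIV) ?B"
    by (subst compactin_PiE) auto
  then have 1: "compact ?B" by (simp add: euclidean_product_topology)
  have "continuous_on UNIV (\<lambda>x :: 'v \<Rightarrow> real. \<Sum>v\<in>V. x v)"
    by (intro continuous_on_sum continuous_on_product_coordinates)
  then have "closed ((\<lambda>x :: 'v \<Rightarrow> real. \<Sum>v\<in>V. x v) -` {s})"
    by (intro closed_vimage) auto
  then have "compact (?B \<inter> ((\<lambda>x :: 'v \<Rightarrow> real. \<Sum>v\<in>V. x v) -` {s}))"
    using 1 by (rule compact_Int_closed[rotated])
  moreover have "?B \<inter> ((\<lambda>x :: 'v \<Rightarrow> real. \<Sum>v\<in>V. x v) -` {s}) =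
    {x. (\<forall>v. x v \<in> (if v \<in> V then {0..y} else {0})) \<and> (\<Sum>v\<in>V. x v) = s}"
    by (auto simp only: PiE_UNIV_domain Pi_iff)
  ultimately show ?thesis by simp
qed

text \<open>Let \<open>u\<close> have the largest degree in the support of a maximiser. If
  \<open>u\<close> is at the cap, it is also heaviest. If not, weight could still be moved to
  \<open>u\<close>, so optimality makes all degrees in the support equal and any heaviest vertex
  will do. Euler's identity then compares the polynomial with that one degree.\<close>

lemma capped_maximiser:
  assumes E: "unif r V E" and x: "\<And>v. v \<in> V \<Longrightarrow> 0 \<le> x v \<and> x v \<le> y" "(\<Sum>v\<in>V. x v) = s" "0 < s"
  obtains z v where "\<And>v. v \<in> V \<Longrightarrow> 0 \<le> z v \<and> z v \<le> y" "(\<Sum>v\<in>V. z v) = s" "lag E x \<le> lag E z"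
    "v \<in> V" "\<And>w. w \<in> V \<Longrightarrow> z w \<le> z v" "real r * lag E z \<le> s * lag (link E v) z"
proof -
  have finV: "finite V" using unif_finite_verts[OF E] .
  define K where "K = {x :: 'a \<Rightarrow> real. (\<forall>v. x v \<in> (if v \<in> V then {0..y} else {0})) \<and> (\<Sum>v\<in>V. x v) = s}"
  define x' where "x' v = (if v \<in> V then x v else 0)" for v
  have x'K: "x' \<in> K" unfolding K_def x'_def using x by (auto intro!: sum.cong)
  have "\<exists>z\<in>K. \<forall>w\<in>K. lag E w \<le> lag E z"
    by (rule continuous_attains_sup) (use x'K capped_simplex_compact[OF finV] lag_continuous in \<open>auto simp only: K_def\<close>)
  then obtain z where z: "z \<in> K" "\<And>w. w \<in> K \<Longrightarrow> lag E w \<le> lag E z" by blast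
  have zV: "0 \<le> z v \<and> z v \<le> y" if "v \<in> V" for v
    using z(1) that unfolding K_def by (auto dest: spec[of _ v])
  have z0: "z v = 0" if "v \<notin> V" for v
    using z(1) that unfolding K_def by (auto dest: spec[of _ v])
  have zs: "(\<Sum>v\<in>V. z v) = s" using z(1) by (simp add: K_def)
  have "lag E x = lag E x'" by (rule lag_cong'[OF E]) (simp add: x'_def)
  then have xz: "lag E x \<le> lag E z" using z(2)[OF x'K] by simp
  let ?d = "\<lambda>v. lag (link E v) z"
  let ?P = "{v\<in>V. z v > 0}"
  have P: "?P \<noteq> {}"
  proof
    assume "?P = {}"
    then have "z v = 0" if "v \<in> V" for v using zV[OF that] that by force
    then show False using zs x(3) by simp
  qed
  obtain u where u: "u \<in> ?P" "\<And>w. w \<in> ?P \<Longrightarrow> ?d w \<le> ?d u"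
    using finite_argmax[of ?P ?d] P finV by (metis (no_types, lifting) finite_subset mem_Collect_eq subsetI)
  have key: "\<exists>v\<in>V. (\<forall>w\<in>V. z w \<le> z v) \<and> (\<forall>w\<in>?P. ?d w \<le> ?d v)"
  proof (cases "z u = y")
    case True
    then show ?thesis using u zV by blast
  next
    case False
    then have uy: "z u < y" using zV[of u] u by auto
    have eq: "?d u \<le> ?d w" if w: "w \<in> ?P" for w
    proof (cases "w = u")
      case wu: False
      let ?c = "lag (link (link E u) w) z"
      have step: "?d u - ?d w \<le> t * ?c" if t: "0 < t" "t \<le> min (y - z u) (z w)" for t
      proof -
        let ?z' = "z(u := z u + t, w := z w - t)"
        have "(\<Sum>v\<in>V. ?z' v) = (\<Sum>v\<in>V. z v)"
        proof -
          have V: "V = insert u (insert w (V - {u, w}))" using u w by auto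
          have f: "finite (V - {u, w})" using finV by simp
          have "sum y V = y u + (y w + sum y (V - {u,w}))" for y :: "'a \<Rightarrow> real"
            using wu f by (subst V) simp
          moreover have "sum ?z' (V - {u,w}) = sum z (V - {u,w})" by (intro sum.cong) auto
          ultimately show ?thesis using wu by simp
        qed
        then have "?z' \<in> K" unfolding K_def using t u w zV z0 zs
          by (auto simp: less_imp_le add_increasing)
            (use zV in fastforce)+
        then have "lag E ?z' \<le> lag E z" by (rule z(2))
        then have "t * (?d u - ?d w) - t ^ 2 * ?c \<le> 0"
          using lag_shift(1)[OF E, of u w z t] wu by simp
        then have "t * (?d u - ?d w) \<le> t * (t * ?c)" by (simp add: power2_eq_square algebra_simps)
        then show ?thesis using t by simp
      qed
      have c0: "0 \<le> ?c" using lag_nonneg[OF unif_link[OF unif_link[OF E]]] zV by blast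
      show ?thesis
      proof (rule ccontr)
        assume "\<not> ?thesis"
        then have D: "?d u - ?d w > 0" by simp
        \<comment> \<open>Small enough to be feasible and to keep the quadratic term below half of
          the linear gain; the \<open>+ 1\<close> guards against a zero codegree.\<close>
        define t where "t = min (min (y - z u) (z w)) ((?d u - ?d w) / (2 * (?c + 1)))"
        have t: "0 < t" "t \<le> min (y - z u) (z w)" unfolding t_def using uy w D c0 by auto
        have "t * ?c \<le> (?d u - ?d w) / (2 * (?c + 1)) * ?c"
          by (intro mult_right_mono c0) (simp add: t_def)
        also have "\<dots> \<le> (?d u - ?d w) / 2"
        proof -
          have "?c / (?c + 1) \<le> 1" using c0 by simp
          then have "(?d u - ?d w) / 2 * (?c / (?c + 1)) \<le> (?d u - ?d w) / 2 * 1"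
            by (intro mult_left_mono) (use D in auto)
          then show ?thesis by (simp add: field_simps)
        qed
        also have "\<dots> < ?d u - ?d w" using D by simp
        finally show False using step[OF t] by simp
      qed
    qed simp
    obtain v where v: "v \<in> V" "\<And>w. w \<in> V \<Longrightarrow> z w \<le> z v"
      using finite_argmax[of V z] u(1) finV by (metis (no_types, lifting) empty_iff mem_Collect_eq)
    have "v \<in> ?P" using v u by fastforce
    then have "?d w \<le> ?d v" if "w \<in> ?P" for w using u(2)[OF that] eq[of v] by simp
    then show ?thesis using v by blast
  qed
  then obtain v where v: "v \<in> V" "\<And>w. w \<in> V \<Longrightarrow> z w \<le> z v" "\<And>w. w \<in> ?P \<Longrightarrow> ?d w \<le> ?d v" by blast
  have "real r * lag E z = (\<Sum>w\<in>V. z w * ?d w)" using lag_euler[OF E] by simp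
  also have "\<dots> \<le> (\<Sum>w\<in>V. z w * ?d v)"
  proof (rule sum_mono)
    fix w assume w: "w \<in> V"
    show "z w * ?d w \<le> z w * ?d v"
    proof (cases "z w > 0")
      case True
      then show ?thesis using v(3)[of w] w by (intro mult_left_mono) auto
    next
      case False
      then have "z w = 0" using zV[OF w] by simp
      then show ?thesis by simp
    qed
  qed
  also have "\<dots> = s * ?d v" by (simp add: sum_distrib_right[symmetric] zs)
  finally show thesis using that[of z v] zV zs xz v by blast
qed

text \<open>The cap is part of the statement because the induction applies it to the link of a
  heaviest vertex, whose weights are capped by that vertex. The \<open>min\<close> appears since
  \<open>gfun\<close> is only known to increase up to the uniform weight
  \<open>s / (k + r - 3)\<close>; a heavier vertex leaves too little total weight to its link, so
  the bound saturates there.\<close>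

lemma sparse_cap:
  assumes "k \<ge> 3" "r \<ge> 2" "tame k r" "unif r V E" "es_sparse k r E"
    and "\<And>v. v \<in> V \<Longrightarrow> 0 \<le> x v \<and> x v \<le> y" "(\<Sum>v\<in>V. x v) = s" "0 \<le> y"
  shows "fact r * lag E x \<le> (real k - 2) * gfun r (min y (s / (real k + real r - 3))) s"
  using assms(2-)
proof (induction r arbitrary: V E x y s rule: nat_induct_at_least)
  case base
  let ?m = "real k + real 2 - 3"
  have s0: "0 \<le> s" using base(4,5) by (metis sum_nonneg)
  show ?case
  proof (cases "s = 0")
    case True
    have "lag E x \<le> 0" using lag_crude[OF base(2), of x] base(4,5) True by simp
    then show ?thesis using True base by (simp add: gfun_def)
  next
    case False
    then have s: "0 < s" using s0 by simp
    obtain z v where z: "\<And>v. v \<in> V \<Longrightarrow> 0 \<le> z v \<and> z v \<le> y" "(\<Sum>v\<in>V. z v) = s" "lag E x \<le> lag E z"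
      "v \<in> V" "\<And>w. w \<in> V \<Longrightarrow> z w \<le> z v" "real 2 * lag E z \<le> s * lag (link E v) z"
      using capped_maximiser[OF base(2) base(4) base(5) s] by metis
    have finV: "finite V" using base(2) unif_finite_verts by auto
    have k: "2 * lag E z \<le> (real k - 2) * gfun 2 (min y (s / ?m)) s"
    proof (cases "z v \<le> s / ?m")
      case True
      have "lag E z \<le> z v * (\<Sum>e\<in>E. Min (z ` e))"
        by (rule lag_2_le_Min[OF base(2)]) (use z in auto)
      moreover have "2 * (\<Sum>e\<in>E. Min (z ` e)) \<le> (real k - 2) * (\<Sum>v\<in>V. z v)"
      proof (rule sum_Min_edges_le[OF base(2)])
        fix S assume "S \<subseteq> V"
        then have "finite S" using finV finite_subset by auto
        then show "2 * real (card {e \<in> E. e \<subseteq> S}) \<le> (real k - 2) * real (card S)"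
          using sparse_2[OF base(3)] assms(1) by simp
      qed (use z(1) in auto)
      then have "z v * (2 * (\<Sum>e\<in>E. Min (z ` e))) \<le> z v * ((real k - 2) * s)"
        by (intro mult_left_mono) (use z in auto)
      ultimately have 1: "2 * lag E z \<le> z v * ((real k - 2) * s)" by linarith
      have "z v * ((real k - 2) * s) \<le> min y (s / ?m) * ((real k - 2) * s)"
        by (intro mult_right_mono) (use z True assms(1) s in auto)
      then show ?thesis using 1 by (simp add: gfun_def lessThan_Suc ac_simps numeral_2_eq_2)
    next
      case False
      \<comment> \<open>Above the uniform weight, bounding the degree by the weight left over
        already gives the value at cap \<open>s / m\<close>, because \<open>m - 1 = k - 2\<close> in
        rank two.\<close>
      have "lag (link E v) z \<le> (\<Sum>w\<in>V - {v}. z w) ^ 1"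
        using lag_crude[OF unif_link[OF base(2)], of v z] z(1) by simp
      also have "\<dots> = s - z v" using z finV by (simp add: sum_diff1)
      finally have 1: "2 * lag E z \<le> s * (s - s / ?m)"
        using z(6) s False mult_left_mono[of "lag (link E v) z" "s - s / ?m" s] by linarith
      have "min y (s / ?m) = s / ?m" using False z(1)[OF z(4)] by auto
      then have "(real k - 2) * gfun 2 (min y (s / ?m)) s = (real k - 2) * (s / ?m * s)"
        by (simp add: gfun_def lessThan_Suc numeral_2_eq_2)
      also have "\<dots> = s * (s - s / ?m)" using assms(1) by (simp add: field_simps)
      finally show ?thesis using 1 by simp
    qed
    then show ?thesis using z(3) by simp
  qed
next
  case (Suc q)
  let ?m = "real k + real (Suc q) - 3"
  have s0: "0 \<le> s" using Suc.prems(4,5) by (metis sum_nonneg)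
  have q2: "q \<ge> 2" by fact
  then have q1: "q \<ge> 1" by simp
  show ?case
  proof (cases "s = 0")
    case True
    have "lag E x \<le> 0" using lag_crude[OF Suc.prems(2), of x] Suc.prems(4,5) True by simp
    then have "fact (Suc q) * lag E x \<le> 0" by (intro mult_nonneg_nonpos) auto
    then show ?thesis using True Suc.prems by (simp add: gfun_def)
  next
    case False
    then have s: "0 < s" using s0 by simp
    obtain z v where z: "\<And>v. v \<in> V \<Longrightarrow> 0 \<le> z v \<and> z v \<le> y" "(\<Sum>v\<in>V. z v) = s" "lag E x \<le> lag E z"
      "v \<in> V" "\<And>w. w \<in> V \<Longrightarrow> z w \<le> z v" "real (Suc q) * lag E z \<le> s * lag (link E v) z"
      using capped_maximiser[OF Suc.prems(2) Suc.prems(4) Suc.prems(5) s] by metis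
    have finV: "finite V" using Suc.prems(2) unif_finite_verts by auto
    have t: "tame k q" using tame_pred Suc.prems(1) assms(1) q2 by blast
    have m: "?m - 1 = real k + real q - 3" "?m - 1 \<ge> 2" "?m > 0" using assms(1) q2 by auto
    define s' where "s' = s - z v"
    have "fact q * lag (link E v) z \<le> (real k - 2) * gfun q (min (z v) (s' / (real k + real q - 3))) s'"
    proof (rule Suc.IH[OF t])
      show "unif q (V - {v}) (link E v)" using unif_link[OF Suc.prems(2)] by simp
      show "es_sparse k q (link E v)" by (rule sparse_link[OF Suc.prems(3,2)])
      show "sum z (V - {v}) = s'" using z finV by (simp add: sum_diff1 s'_def)
    qed (use z in auto)
    then have L: "fact q * lag (link E v) z \<le> (real k - 2) * gfun q (min (z v) (s' / (?m - 1))) s'"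
      using m(1) by simp
    have s'0: "0 \<le> s'"
      unfolding s'_def using z(2) member_le_sum[of v V z] z(1,4) finV by fastforce
    have "fact (Suc q) * lag E z = fact q * (real (Suc q) * lag E z)" by simp
    also have "\<dots> \<le> fact q * (s * lag (link E v) z)" by (intro mult_left_mono z(6)) auto
    also have "\<dots> = s * (fact q * lag (link E v) z)" by simp
    also have "\<dots> \<le> s * ((real k - 2) * gfun q (min (z v) (s' / (?m - 1))) s')"
      by (intro mult_left_mono L) (use s in auto)
    also have "\<dots> = (real k - 2) * (s * gfun q (min (z v) (s' / (?m - 1))) s')" by simp
    also have "\<dots> \<le> (real k - 2) * gfun (Suc q) (min y (s / ?m)) s"
    proof (rule mult_left_mono)
      show "s * gfun q (min (z v) (s' / (?m - 1))) s' \<le> gfun (Suc q) (min y (s / ?m)) s"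
      proof (cases "z v \<le> s / ?m")
        case True
        then have "z v * ?m \<le> s" using m by (simp add: field_simps)
        \<comment> \<open>A weight at most uniform for total \<open>s\<close> and \<open>m\<close>
          vertices is at most uniform for the link with total \<open>s'\<close> and
          \<open>m - 1\<close> vertices, so the \<open>min\<close> is \<open>z v\<close> and the
          recursion for \<open>gfun\<close> applies.\<close>
        then have "z v \<le> s' / (?m - 1)" unfolding s'_def using m by (simp add: field_simps)
        then have "s * gfun q (min (z v) (s' / (?m - 1))) s' = gfun (Suc q) (z v) s"
          using gfun_Suc[of q "z v" s] q2 by (simp add: s'_def)
        also have "\<dots> \<le> gfun (Suc q) (min y (s / ?m)) s"
        proof (rule gfun_mono[OF assms(1) _ Suc.prems(1)])
          have "min y (s / ?m) * ?m \<le> s / ?m * ?m" by (intro mult_right_mono) (use m in auto)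
          then show "min y (s / ?m) * ?m \<le> s" using m by simp
        qed (use q2 z True s in auto)
        finally show ?thesis .
      next
        case False
        then have zm: "z v * ?m > s" using m by (simp add: field_simps)
        \<comment> \<open>Now the \<open>min\<close> is the uniform weight of the link, so by
          homogeneity the bound is a constant times a power of \<open>s'\<close>, and
          \<open>s'\<close> is less than \<open>s - s / m\<close>.\<close>
        then have "s' / (?m - 1) \<le> z v" unfolding s'_def using m by (simp add: field_simps)
        then have "gfun q (min (z v) (s' / (?m - 1))) s' = gfun q (s' * (1 / (?m - 1))) (s' * 1)" by simp
        also have "\<dots> = s' ^ q * gfun q (1 / (?m - 1)) 1" by (rule gfun_scale[OF q1])
        also have "\<dots> \<le> (s - s / ?m) ^ q * gfun q (1 / (?m - 1)) 1"
        proof (intro mult_right_mono power_mono s'0)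
          show "s' \<le> s - s / ?m" using False by (simp add: s'_def)
          show "0 \<le> gfun q (1 / (?m - 1)) 1" by (rule gfun_nonneg) (use m assms(1) in \<open>auto simp: field_simps\<close>)
        qed
        also have "\<dots> = gfun q ((s - s / ?m) * (1 / (?m - 1))) ((s - s / ?m) * 1)" by (rule gfun_scale[OF q1, symmetric])
        also have "(s - s / ?m) * (1 / (?m - 1)) = s / ?m"
        proof -
          have G: "(s - s / M) * (1 / (M - 1)) = s / M" if "M > 0" "M - 1 \<noteq> 0" for M :: real
          proof -
            have "s - s / M = s / M * (M - 1)" using that by (simp add: field_simps)
            then show ?thesis using that by simp
          qed
          show ?thesis by (rule G) (use m(2,3) in linarith)+
        qed
        finally have "s * gfun q (min (z v) (s' / (?m - 1))) s' \<le> s * gfun q (s / ?m) (s - s / ?m)"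
          using s by (simp only: mult_1_right mult_le_cancel_left_pos)
        also have "\<dots> = gfun (Suc q) (s / ?m) s" by (rule gfun_Suc[OF q1, symmetric])
        also have "s / ?m = min y (s / ?m)" using False z(1)[OF z(4)] by linarith
        finally show ?thesis .
      qed
    qed (use assms in auto)
    finally show ?thesis by (rule order_trans[rotated]) (intro mult_left_mono z(3), simp)
  qed
qed

section \<open>The clique density and the bound without a cap\<close>

text \<open>The Lagrange polynomial of the complete \<open>r\<close>-graph on \<open>m\<close>
  vertices at uniform weights \<open>1 / m\<close>.\<close>

definition dens :: "nat \<Rightarrow> nat \<Rightarrow> real" where
  "dens m r = real (m choose r) / real m ^ r"

text \<open>For \<open>m = k + r - 3\<close> the last factor \<open>m - r + 1\<close> of the falling
  factorial is exactly \<open>k - 2\<close>; the capped bound is attained by the clique.\<close>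

lemma dens_gfun:
  assumes "k \<ge> 3" "r \<ge> 2" "m = k + r - 3"
  shows "fact r * dens m r = (real k - 2) * gfun r (1 / real m) 1"
proof -
  have m: "real m > 0" "real m = real k + real r - 3" using assms by auto
  have r: "r = Suc (r - 1)" using assms by simp
  have "gfun r (1 / real m) 1 = 1 / real m * (\<Prod>j<r-1. (real m - real j) / real m)"
    unfolding gfun_def using m(1) by (simp add: diff_divide_distrib)
  also have "\<dots> = (\<Prod>j<r-1. real m - real j) / real m ^ r"
    by (subst r) (simp add: prod_dividef)
  finally have 1: "(real k - 2) * gfun r (1 / real m) 1 = (\<Prod>j<r-1. real m - real j) * (real k - 2) / real m ^ r"
    by simp
  have "fact r * real (m choose r) = (\<Prod>j<r. real m - real j)"
    by (simp add: binomial_gbinomial gbinomial_prod_rev lessThan_atLeast0)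
  also have "\<dots> = (\<Prod>j<r-1. real m - real j) * (real m - real (r - 1))"
    by (subst r) (simp only: prod.lessThan_Suc)
  also have "real m - real (r - 1) = real k - 2" using assms m by (simp add: of_nat_diff)
  finally show ?thesis unfolding 1 dens_def by simp
qed

text \<open>Euler's identity for the complete \<open>r\<close>-graph at uniform weights: every link
  is complete on \<open>m - 1\<close> vertices of total weight \<open>1 - 1 / m\<close>.\<close>

lemma dens_step:
  assumes "m \<ge> 1" "r \<ge> 1"
  shows "real r * dens m r = dens (m - 1) (r - 1) * (1 - 1 / real m) ^ (r - 1)"
proof (cases "m = 1")
  case True
  then show ?thesis using assms by (cases r) (auto simp: dens_def)
next
  case False
  obtain m' r' where mr: "m = Suc m'" "r = Suc r'" using assms by (metis One_nat_def Suc_le_D)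
  have m': "m' > 0" using False mr by simp
  have 1: "real (Suc r') * real (Suc m' choose Suc r') = real (Suc m') * real (m' choose r')"
    by (metis Suc_times_binomial_eq mult.commute of_nat_mult)
  have 2: "1 - 1 / real (Suc m') = real m' / real (Suc m')" by (simp add: field_simps)
  have "real r * dens m r = real (Suc m') * real (m' choose r') / real (Suc m') ^ Suc r'"
    unfolding dens_def mr 1[symmetric] by simp
  also have "\<dots> = real (m' choose r') / real (Suc m') ^ r'" by simp
  also have "\<dots> = dens (m - 1) (r - 1) * (1 - 1 / real m) ^ (r - 1)"
    unfolding dens_def mr 2 using m' by (simp add: power_divide)
  finally show ?thesis .
qed

text \<open>With the total weight as cap there is no constraint left, and the \<open>min\<close>
  picks the uniform weight.\<close>

lemma sparse_bound:
  assumes "k \<ge> 3" "r \<ge> 2" "tame k r" "unif r V E" "es_sparse k r E"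
    and "\<And>v. v \<in> V \<Longrightarrow> 0 \<le> x v"
  shows "lag E x \<le> dens (k + r - 3) r * (\<Sum>v\<in>V. x v) ^ r"
proof -
  let ?s = "\<Sum>v\<in>V. x v" and ?m = "real k + real r - 3"
  have finV: "finite V" using assms unif_finite_verts by auto
  have s0: "0 \<le> ?s" by (rule sum_nonneg) (use assms in auto)
  have m: "?m \<ge> 1" "?m = real (k + r - 3)" using assms by auto
  have "fact r * lag E x \<le> (real k - 2) * gfun r (min ?s (?s / ?m)) ?s"
    by (rule sparse_cap[OF assms(1-5)]) (use assms s0 finV in \<open>auto intro!: member_le_sum\<close>)
  also have "min ?s (?s / ?m) = ?s * (1 / ?m)"
  proof -
    have "?s / ?m \<le> ?s / 1" by (rule divide_left_mono) (use s0 m(1) in auto)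
    then show ?thesis by simp
  qed
  also have "gfun r (?s * (1 / ?m)) ?s = ?s ^ r * gfun r (1 / ?m) 1"
    using gfun_scale[of r ?s "1 / ?m" 1] assms(2) by simp
  also have "(real k - 2) * (?s ^ r * gfun r (1 / ?m) 1) = ?s ^ r * ((real k - 2) * gfun r (1 / ?m) 1)"
    by (rule mult.left_commute)
  also have "(real k - 2) * gfun r (1 / ?m) 1 = fact r * dens (k + r - 3) r"
    using dens_gfun[OF assms(1,2) refl] unfolding m(2)[symmetric] by (rule sym)
  finally have "fact r * lag E x \<le> fact r * (dens (k + r - 3) r * ?s ^ r)"
    by (simp only: mult_ac)
  then show ?thesis by simp
qed

section \<open>Stability of the sparse bound\<close>

lemma es_sparse_subset:
  assumes "es_sparse k r E" "E' \<subseteq> E" "finite E"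
  shows "es_sparse k r E'"
  unfolding es_sparse_def
proof (intro allI impI)
  fix D S :: "'a set" assume D: "finite D \<and> card D + 2 = r \<and> finite S \<and> D \<inter> S = {}"
  have "card {e\<in>E'. D \<subseteq> e \<and> e \<subseteq> D \<union> S} \<le> card {e\<in>E. D \<subseteq> e \<and> e \<subseteq> D \<union> S}"
    by (intro card_mono) (use assms in auto)
  moreover have "2 * card {e\<in>E. D \<subseteq> e \<and> e \<subseteq> D \<union> S} \<le> (k - 2) * card S"
    using assms(1) D unfolding es_sparse_def by blast
  ultimately show "2 * card {e\<in>E'. D \<subseteq> e \<and> e \<subseteq> D \<union> S} \<le> (k - 2) * card S" by linarith
qed

lemma dens_pos: "r \<le> m \<Longrightarrow> m \<ge> 1 \<Longrightarrow> 0 < dens m r"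
  unfolding dens_def by simp

lemma dens_le_1: "dens m r \<le> 1"
proof (cases "m = 0")
  case True
  then show ?thesis by (cases r) (auto simp: dens_def)
next
  case False
  have "real (m choose r) \<le> real (m ^ r)"
    using binomial_le_pow2 by (metis binomial_eq_0 binomial_le_pow le_less_linear of_nat_le_iff zero_le)
  then show ?thesis using False by (simp add: dens_def)
qed

lemma gfun_mono_total:
  assumes "0 \<le> y" "y * (real r - 1) \<le> s" "s \<le> t"
  shows "gfun r y s \<le> gfun r y t"
  unfolding gfun_def
proof (intro mult_left_mono prod_mono)
  fix j assume "j \<in> {..<r-1}"
  then have "real j * y \<le> (real r - 1) * y" by (intro mult_right_mono) (use assms in auto)
  then show "0 \<le> s - real j * y \<and> s - real j * y \<le> t - real j * y" using assms by (simp add: mult.commute)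
qed (use assms in auto)

lemma sparse_cap_simplex:
  assumes k: "k \<ge> 3" "r \<ge> 2" "tame k r" and E: "unif r V E" "es_sparse k r E"
    and x: "\<And>v. v \<in> V \<Longrightarrow> 0 \<le> x v \<and> x v \<le> y" "(\<Sum>v\<in>V. x v) \<le> 1" "0 \<le> y"
    and z: "y \<le> z" "z \<le> 1 / real (k + r - 3)"
  shows "fact r * lag E x \<le> (real k - 2) * gfun r z 1"
proof -
  let ?s = "\<Sum>v\<in>V. x v" and ?m = "real k + real r - 3"
  have s0: "0 \<le> ?s" by (rule sum_nonneg) (use x in auto)
  have m: "?m \<ge> 2" "?m = real (k + r - 3)" using k by auto
  let ?y = "min y (?s / ?m)"
  have y: "0 \<le> ?y" "?y \<le> z" using x s0 m(1) z by auto
  have "?y * ?m \<le> ?s / ?m * ?m" by (intro mult_right_mono) (use m(1) in auto)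
  then have ym: "?y * ?m \<le> ?s" using m(1) by simp
  have "?y * (real r - 1) \<le> ?y * ?m" by (intro mult_left_mono y) (use k in auto)
  then have yr: "?y * (real r - 1) \<le> ?s" using ym by linarith
  have "gfun r ?y ?s \<le> gfun r ?y 1" by (rule gfun_mono_total[OF y(1) yr x(2)])
  also have "\<dots> \<le> gfun r z 1"
  proof (rule gfun_mono[OF k y])
    have "z * ?m \<le> 1 / real (k + r - 3) * ?m" by (intro mult_right_mono z) (use m(1) in auto)
    also have "\<dots> = 1" unfolding m(2)[symmetric] using m(1) by simp
    finally show "z * ?m \<le> 1" .
  qed simp
  finally have "(real k - 2) * gfun r ?y ?s \<le> (real k - 2) * gfun r z 1"
    by (rule mult_left_mono) (use k in auto)
  moreover have "fact r * lag E x \<le> (real k - 2) * gfun r ?y ?s"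
    by (rule sparse_cap[OF k E x(1) refl x(3)])
  ultimately show ?thesis by linarith
qed

text \<open>Rank two is separate: links then have rank one, where \<open>es_sparse\<close> is
  vacuous and the crude bound is exact enough.\<close>

lemma link_bound:
  assumes k: "k \<ge> 3" "r \<ge> 2" "tame k r" and E: "unif r V E" "es_sparse k r E"
    and x: "\<And>v. v \<in> V \<Longrightarrow> 0 \<le> x v"
  shows "lag (link E v) x \<le> dens (k + r - 4) (r - 1) * (\<Sum>w\<in>V - {v}. x w) ^ (r - 1)"
proof (cases "r = 2")
  case True
  have "dens (k + r - 4) (r - 1) = 1" using True k by (simp add: dens_def)
  then show ?thesis using lag_crude[OF unif_link[OF E(1)], of v x] x by simp
next
  case False
  then obtain q where q: "r = Suc q" "q \<ge> 2" using k by (metis One_nat_def Suc_1 Suc_le_D le_SucE le_antisym not_less_eq_eq)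
  have "lag (link E v) x \<le> dens (k + q - 3) q * (\<Sum>w\<in>V - {v}. x w) ^ q"
  proof (rule sparse_bound[OF k(1) q(2)])
    show "tame k q" using tame_pred k q by blast
    show "unif q (V - {v}) (link E v)" using unif_link[OF E(1)] q by auto
    show "es_sparse k q (link E v)" using sparse_link[of k q E V v] E q by simp
  qed (use x in auto)
  moreover have "k + r - 4 = k + q - 3" using q by simp
  ultimately show ?thesis using q by simp
qed

text \<open>A near-maximal \<open>x\<close> need not be a maximiser, so vertices of low degree are
  discarded first; a heaviest remaining vertex then has degree close to \<open>r * dens m r\<close>.
  A larger weight than stated would leave too little for its link, and a smaller one would cap all
  of \<open>U\<close> strictly below the uniform weight. Either way a fixed amount is lost.\<close>

lemma heavy_vertex:
  fixes \<delta> :: real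
  assumes k: "k \<ge> 3" "r \<ge> 2" "tame k r" and m: "m = k + r - 3" and \<delta>: "\<delta> > 0"
  shows "\<exists>\<epsilon>>0. \<forall>(V :: 'v set) E x. unif r V E \<longrightarrow> es_sparse k r E \<longrightarrow> (\<forall>v\<in>V. 0 \<le> x v) \<longrightarrow>
     (\<Sum>v\<in>V. x v) \<le> 1 \<longrightarrow> dens m r - \<epsilon> \<le> lag E x \<longrightarrow>
     (\<exists>U v. U \<subseteq> V \<and> v \<in> U \<and> (\<forall>w\<in>U. x w \<le> x v) \<and> \<bar>x v - 1 / real m\<bar> \<le> \<delta> \<and>
        dens m r - \<delta> \<le> lag {e\<in>E. e \<subseteq> U} x \<and>
        real r * dens m r - \<delta> \<le> lag {f\<in>link E v. f \<subseteq> U - {v}} x)"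
proof -
  have m2: "m \<ge> 2" "r \<le> m" "real m = real k + real r - 3" "m - 1 = k + r - 4" using k m by auto
  define d where "d = dens m r"
  have d: "0 < d" "d \<le> 1" unfolding d_def using dens_pos dens_le_1 m2 by auto
  define \<delta>' where "\<delta>' = min \<delta> (1 / real m)"
  have "2 \<le> real m" using m2(1) by linarith
  then have "1 / real m \<le> 1 / 2" using m2 by (intro divide_left_mono) auto
  moreover have "0 < \<delta>'" "\<delta>' \<le> \<delta>" "\<delta>' \<le> 1 / real m"
    unfolding \<delta>'_def using \<delta> m2(1) by auto
  ultimately have \<delta>': "0 < \<delta>'" "\<delta>' \<le> \<delta>" "\<delta>' \<le> 1 / real m" "\<delta>' \<le> 1 - 1 / real m"
    by linarith+
  \<comment> \<open>The density lost when all weights stay below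
    \<open>1 / m - \<delta>'\<close>.\<close>
  define a where "a = (real k - 2) / fact r * (gfun r (1 / real m) 1 - gfun r (1 / real m - \<delta>') 1)"
  have "gfun r (1 / real m - \<delta>') 1 < gfun r (1 / real m) 1"
    by (rule gfun_strict_mono[OF k]) (use \<delta>' m2 in auto)
  then have a: "0 < a" unfolding a_def using k by simp
  define d' where "d' = dens (m - 1) (r - 1)"
  have d': "0 < d'" unfolding d'_def by (rule dens_pos) (use m2 k in auto)
  have rd: "real r * d = d' * (1 - 1 / real m) ^ (r - 1)"
    unfolding d_def d'_def by (rule dens_step) (use m2 k in auto)
  \<comment> \<open>The degree lost by a vertex heavier than
    \<open>1 / m + \<delta>'\<close>.\<close>
  define b where "b = d' * ((1 - 1 / real m) ^ (r - 1) - (1 - 1 / real m - \<delta>') ^ (r - 1))"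
  have "(1 - 1 / real m - \<delta>') ^ (r - 1) < (1 - 1 / real m) ^ (r - 1)"
    by (rule power_strict_mono) (use \<delta>' k in auto)
  then have b: "0 < b" unfolding b_def using d' by simp
  define \<zeta> where "\<zeta> = Min {\<delta> / 4, a / 4, b / 4, d / 4, 1}"
  have \<zeta>: "0 < \<zeta>" "\<zeta> \<le> \<delta> / 4" "\<zeta> \<le> a / 4" "\<zeta> \<le> b / 4" "\<zeta> \<le> d / 4" "\<zeta> \<le> 1"
    unfolding \<zeta>_def using \<delta> a b d by auto
  define \<epsilon> where "\<epsilon> = \<zeta>\<^sup>2 / (8 * real r ^ 2)"
  have r2: "real r ^ 2 \<ge> 1" using k by simp
  have \<epsilon>: "0 < \<epsilon>" "\<epsilon> < \<zeta>\<^sup>2 / (4 * real r ^ 2)" unfolding \<epsilon>_def using \<zeta> k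
    by (auto intro!: divide_strict_left_mono)
  have r8: "1 \<le> 8 * real r ^ 2" using r2 by linarith
  then have "0 < 8 * real r ^ 2 * 1" by linarith
  then have "\<zeta>\<^sup>2 / (8 * real r ^ 2) \<le> \<zeta>\<^sup>2 / 1"
    by (rule divide_left_mono[OF r8 zero_le_power2])
  also have "\<dots> \<le> \<zeta>" using \<zeta> by (simp add: power2_eq_square mult_left_le)
  finally have \<epsilon>\<zeta>: "\<epsilon> \<le> \<zeta>" by (simp add: \<epsilon>_def)
  show ?thesis
  proof (intro exI[of _ \<epsilon>] conjI allI impI \<epsilon>(1))
    fix V :: "'v set" and E x
    assume E: "unif r V E" "es_sparse k r E" and x0: "\<forall>v\<in>V. 0 \<le> x v" and x1: "(\<Sum>v\<in>V. x v) \<le> 1"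
      and big: "dens m r - \<epsilon> \<le> lag E x"
    have finV: "finite V" and finE: "finite E" using unif_finite_verts[OF E(1)] unif_finite[OF E(1)] by auto
    define Z where "Z = {v\<in>V. lag (link E v) x < real r * d - \<zeta>}"
    have xZ: "sum x Z \<le> \<zeta>"
      unfolding Z_def
    proof (rule low_degree_small[OF E(1) _ x1])
      show "lag E z \<le> d * (\<Sum>v\<in>V. z v) ^ r" if "\<And>v. v \<in> V \<Longrightarrow> 0 \<le> z v" for z
        using sparse_bound[OF k E that] by (simp add: d_def m)
      show "d - \<epsilon> \<le> lag E x" using big by (simp add: d_def)
    qed (use x0 d \<zeta> \<epsilon> k in auto)
    define U where "U = V - Z"
    have U: "U \<subseteq> V" "V - U = Z" unfolding U_def Z_def by auto
    have finU: "finite U" using U finV finite_subset by auto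
    let ?EU = "{e\<in>E. e \<subseteq> U}"
    have EU: "unif r U ?EU" using E(1) finU by (auto simp: unif_def)
    have sEU: "es_sparse k r ?EU" by (rule es_sparse_subset[OF E(2)]) (use finE in auto)
    have lagU: "d - 2 * \<zeta> \<le> lag ?EU x"
      using lag_loss[OF E(1), of x U] x0 x1 U xZ big \<epsilon>\<zeta> by (auto simp: d_def)
    have Une: "U \<noteq> {}"
    proof
      assume "U = {}"
      then have "lag ?EU x \<le> 0 ^ r" using lag_crude[OF EU, of x] by simp
      moreover have "(0::real) ^ r = 0" using k(2) by simp
      ultimately show False using lagU \<zeta> d by linarith
    qed
    obtain v where v: "v \<in> U" "\<And>w. w \<in> U \<Longrightarrow> x w \<le> x v" using finite_argmax[OF finU Une, of x] by metis
    have vV: "v \<in> V" "v \<notin> Z" using v U_def by auto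
    have xv0: "0 \<le> x v" using x0 vV by auto
    have xU: "sum x U \<le> 1" using x1 sum_mono2[OF finV U(1), of x] x0 by force
    let ?L = "{f\<in>link E v. f \<subseteq> U - {v}}"
    have Ls: "(\<Sum>w\<in>V - {v}. x w) \<le> 1" using x1 sum_mono2[OF finV, of "V - {v}" x] x0 by force
    have "(V - {v}) - (U - {v}) = Z" using U v vV by auto
    then have lagL: "real r * d - 2 * \<zeta> \<le> lag ?L x"
      using lag_loss[OF unif_link[OF E(1), of v], of x "U - {v}"] x0 xZ Ls vV unfolding Z_def by auto
    have up: "x v \<le> 1 / real m + \<delta>'"
    proof (rule ccontr)
      assume n: "\<not> ?thesis"
      have "?L \<subseteq> link ?EU v"
        using v by (auto simp: link_iff)
      then have "lag ?L x \<le> lag (link ?EU v) x"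
        using lag_mono_edges[OF unif_link[OF EU, of v], of ?L x] x0 U by auto
      also have "\<dots> \<le> d' * (\<Sum>w\<in>U - {v}. x w) ^ (r - 1)"
        unfolding d'_def m2(4) by (rule link_bound[OF k EU sEU]) (use x0 U in auto)
      also have "\<dots> \<le> d' * (1 - 1 / real m - \<delta>') ^ (r - 1)"
      proof (intro mult_left_mono power_mono)
        have "(\<Sum>w\<in>U - {v}. x w) = sum x U - x v" using v finU by (simp add: sum_diff1)
        then show "(\<Sum>w\<in>U - {v}. x w) \<le> 1 - 1 / real m - \<delta>'" using n xU by simp
        show "0 \<le> (\<Sum>w\<in>U - {v}. x w)" by (rule sum_nonneg) (use x0 U in auto)
      qed (use d' in auto)
      also have "\<dots> = real r * d - b" unfolding rd b_def by (simp add: algebra_simps)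
      finally show False using lagL \<zeta> b by linarith
    qed
    have lo: "1 / real m - \<delta>' \<le> x v"
    proof (rule ccontr)
      assume n: "\<not> ?thesis"
      have "fact r * lag ?EU x \<le> (real k - 2) * gfun r (1 / real m - \<delta>') 1"
        by (rule sparse_cap_simplex[OF k EU sEU _ xU xv0]) (use v x0 U n \<delta>' m in auto)
      also have "\<dots> = (real k - 2) * gfun r (1 / real m) 1 - fact r * a"
      proof -
        have fa: "fact r * a = (real k - 2) * (gfun r (1 / real m) 1 - gfun r (1 / real m - \<delta>') 1)"
          unfolding a_def by simp
        show ?thesis unfolding fa by (simp add: algebra_simps)
      qed
      also have "(real k - 2) * gfun r (1 / real m) 1 = fact r * d"
        using dens_gfun[OF k(1,2) m] by (simp add: d_def)
      also have "fact r * d - fact r * a = fact r * (d - a)" by (simp add: algebra_simps)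
      finally have "lag ?EU x \<le> d - a" by simp
      then show False using lagU \<zeta> a by linarith
    qed
    show "\<exists>U v. U \<subseteq> V \<and> v \<in> U \<and> (\<forall>w\<in>U. x w \<le> x v) \<and> \<bar>x v - 1 / real m\<bar> \<le> \<delta> \<and>
        dens m r - \<delta> \<le> lag {e\<in>E. e \<subseteq> U} x \<and>
        real r * dens m r - \<delta> \<le> lag {f\<in>link E v. f \<subseteq> U - {v}} x"
    proof (intro exI[of _ U] exI[of _ v] conjI)
      show "\<bar>x v - 1 / real m\<bar> \<le> \<delta>" using up lo \<delta>' by (simp add: abs_le_iff)
      show "dens m r - \<delta> \<le> lag ?EU x" using lagU \<zeta> by (simp add: d_def)
      show "real r * dens m r - \<delta> \<le> lag ?L x" using lagL \<zeta> by (simp add: d_def)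
    qed (use U v in auto)
  qed
qed

text \<open>The weights are cut at height \<open>t\<close>. What exceeds \<open>t\<close> sits on at
  most \<open>k - 2\<close> vertices, where even a complete graph has average degree at most
  \<open>k - 3\<close>, so the excess earns the coefficient \<open>k - 3\<close> in place of
  \<open>k - 2\<close>.\<close>

lemma sum_Min_few_heavy:
  assumes E: "unif 2 U E" "es_sparse k 2 E" and k: "k \<ge> 3" and t: "0 \<le> t"
    and x: "\<And>v. v \<in> U \<Longrightarrow> 0 \<le> x v" and c: "card {v\<in>U. x v > t} \<le> k - 2"
  shows "2 * (\<Sum>e\<in>E. Min (x ` e)) \<le> (real k - 2) * sum x U - (\<Sum>v\<in>U. x v - min (x v) t)"
proof -
  have finU: "finite U" and finE: "finite E" using unif_finite_verts[OF E(1)] unif_finite[OF E(1)] by auto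
  let ?S = "{v\<in>U. x v > t}" and ?y = "\<lambda>v. min (x v) t" and ?z = "\<lambda>v. x v - min (x v) t"
  let ?E = "{e\<in>E. e \<subseteq> ?S}"
  have Me: "Min (x ` e) = Min (?y ` e) + (if e \<subseteq> ?S then Min (?z ` e) else 0)" if e: "e \<in> E" for e
  proof (rule pair_edge[OF E(1) e])
    fix u w assume uw: "e = {u, w}" "u \<in> U" "w \<in> U"
    have Mp: "Min (g ` e) = min (g u) (g w)" for g :: "'a \<Rightarrow> real" using uw by simp
    show ?thesis unfolding Mp using uw by (auto simp: min_def)
  qed
  have 1: "2 * (\<Sum>e\<in>E. Min (?y ` e)) \<le> (real k - 2) * (\<Sum>v\<in>U. ?y v)"
  proof (rule sum_Min_edges_le[OF E(1)])
    fix S assume "S \<subseteq> U"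
    then have "finite S" using finU finite_subset by auto
    then show "2 * real (card {e \<in> E. e \<subseteq> S}) \<le> (real k - 2) * real (card S)"
      using sparse_2[OF E(2)] k by simp
  qed (use x t in auto)
  have 2: "2 * (\<Sum>e\<in>?E. Min (?z ` e)) \<le> (real k - 3) * (\<Sum>v\<in>?S. ?z v)"
  proof (rule sum_Min_edges_le)
    show "unif 2 ?S ?E" using E(1) finU by (auto simp: unif_def)
    fix S assume S: "S \<subseteq> ?S"
    have finS: "finite S" using S finU finite_subset by fastforce
    have cS: "card S \<le> k - 2" using card_mono[OF _ S] finU c by simp
    have "{e\<in>?E. e \<subseteq> S} \<subseteq> {e. e \<subseteq> S \<and> card e = 2}" using unif_edge[OF E(1)] by auto
    then have "card {e\<in>?E. e \<subseteq> S} \<le> card {e. e \<subseteq> S \<and> card e = 2}"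
      by (intro card_mono) (use finS in auto)
    also have "\<dots> = card S choose 2" by (rule n_subsets[OF finS])
    finally have "card {e\<in>?E. e \<subseteq> S} \<le> card S choose 2" .
    then have "real (card {e\<in>?E. e \<subseteq> S}) \<le> real (card S choose 2)" by simp
    also have "real (card S choose 2) = real (card S) * (real (card S) - 1) / 2"
      by (simp add: binomial_gbinomial gbinomial_prod_rev numeral_2_eq_2)
    finally have "2 * real (card {e\<in>?E. e \<subseteq> S}) \<le> real (card S) * (real (card S) - 1)" by simp
    also have "\<dots> \<le> real (card S) * (real k - 3)"
      by (intro mult_left_mono) (use cS k in auto)
    finally show "2 * real (card {e\<in>?E. e \<subseteq> S}) \<le> (real k - 3) * real (card S)" by (simp add: mult.commute)
  qed auto
  have 3: "(\<Sum>v\<in>?S. ?z v) = (\<Sum>v\<in>U. ?z v)"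
    by (rule sum.mono_neutral_left) (use finU in auto)
  have "(\<Sum>e\<in>E. Min (x ` e)) = (\<Sum>e\<in>E. Min (?y ` e)) + (\<Sum>e\<in>E. if e \<subseteq> ?S then Min (?z ` e) else 0)"
    using Me by (simp add: sum.distrib)
  also have "(\<Sum>e\<in>E. if e \<subseteq> ?S then Min (?z ` e) else 0) = (\<Sum>e\<in>?E. Min (?z ` e))"
    using finE by (simp add: sum.If_cases Int_def)
  finally have "2 * (\<Sum>e\<in>E. Min (x ` e)) \<le> (real k - 2) * (\<Sum>v\<in>U. ?y v) + (real k - 3) * (\<Sum>v\<in>U. ?z v)"
    using 1 2 3 by simp
  also have "\<dots> = (real k - 2) * ((\<Sum>v\<in>U. ?y v) + (\<Sum>v\<in>U. ?z v)) - (\<Sum>v\<in>U. ?z v)"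
    by (simp add: algebra_simps)
  also have "(\<Sum>v\<in>U. ?y v) + (\<Sum>v\<in>U. ?z v) = sum x U" by (simp add: sum.distrib[symmetric])
  finally show ?thesis .
qed

text \<open>In rank two \<open>m = k - 1\<close>. If fewer than \<open>m\<close> vertices exceed
  \<open>t = 1 / m - \<delta>0\<close>, then at least the excess of the heaviest vertex over
  \<open>t\<close> is lost, against near-maximality.\<close>

lemma sparse_stability_2:
  fixes \<delta> :: real
  assumes k: "k \<ge> 3" "tame k 2" and \<delta>: "\<delta> > 0"
  shows "\<exists>\<epsilon>>0. \<forall>(V :: 'v set) E x. unif 2 V E \<longrightarrow> es_sparse k 2 E \<longrightarrow> (\<forall>v\<in>V. 0 \<le> x v) \<longrightarrow>
     (\<Sum>v\<in>V. x v) \<le> 1 \<longrightarrow> dens (k + 2 - 3) 2 - \<epsilon> \<le> lag E x \<longrightarrow>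
     (\<exists>S\<subseteq>V. card S = k + 2 - 3 \<and> (\<forall>v\<in>S. 1 / real (k + 2 - 3) - \<delta> \<le> x v))"
proof -
  define m where "m = k + 2 - 3"
  have m: "m \<ge> 2" "real m = real k - 1" "k - 2 = m - 1" using k by (auto simp: m_def)
  define \<delta>0 where "\<delta>0 = min \<delta> (1 / real m)"
  have \<delta>0: "0 < \<delta>0" "\<delta>0 \<le> \<delta>" "\<delta>0 \<le> 1 / real m" using \<delta> m by (auto simp: \<delta>0_def)
  \<comment> \<open>Makes \<open>\<eta> * (m + 1)\<close> equal to
    \<open>\<delta>0 / (4 * m)\<close>, half of what the final comparison would require.\<close>
  define \<eta> where "\<eta> = \<delta>0 / (4 * real m * (real m + 1))"
  have mm: "4 * real m * (real m + 1) \<ge> 2"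
  proof -
    have "4 * real m * (real m + 1) \<ge> 4 * 1 * 1" using m by (intro mult_mono) auto
    then show ?thesis by simp
  qed
  have "0 < 4 * real m * (real m + 1)" using mm by linarith
  then have \<eta>: "0 < \<eta>" "\<eta> \<le> \<delta>0 / 2" unfolding \<eta>_def
    using \<delta>0(1) divide_left_mono[OF mm, of \<delta>0] by simp_all
  obtain \<epsilon> where \<epsilon>: "\<epsilon> > 0" and H: "\<forall>(V :: 'v set) E x. unif 2 V E \<longrightarrow> es_sparse k 2 E \<longrightarrow> (\<forall>v\<in>V. 0 \<le> x v) \<longrightarrow>
     (\<Sum>v\<in>V. x v) \<le> 1 \<longrightarrow> dens m 2 - \<epsilon> \<le> lag E x \<longrightarrow>
     (\<exists>U v. U \<subseteq> V \<and> v \<in> U \<and> (\<forall>w\<in>U. x w \<le> x v) \<and> \<bar>x v - 1 / real m\<bar> \<le> \<eta> \<and>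
        dens m 2 - \<eta> \<le> lag {e\<in>E. e \<subseteq> U} x \<and>
        real 2 * dens m 2 - \<eta> \<le> lag {f\<in>link E v. f \<subseteq> U - {v}} x)"
    using heavy_vertex[OF k(1) order_refl k(2) m_def \<eta>(1), where 'v='v] by (elim exE conjE) (rule that)
  show ?thesis
  proof (intro exI[of _ \<epsilon>] conjI allI impI \<epsilon>)
    fix V :: "'v set" and E x
    assume E: "unif 2 V E" "es_sparse k 2 E" and x0: "\<forall>v\<in>V. 0 \<le> x v" and x1: "(\<Sum>v\<in>V. x v) \<le> 1"
      and big: "dens (k + 2 - 3) 2 - \<epsilon> \<le> lag E x"
    obtain U v where U: "U \<subseteq> V" "v \<in> U" "\<forall>w\<in>U. x w \<le> x v" "\<bar>x v - 1 / real m\<bar> \<le> \<eta>"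
      "dens m 2 - \<eta> \<le> lag {e\<in>E. e \<subseteq> U} x"
      using H[rule_format, OF E _ x1] x0 big unfolding m_def by blast
    have finU: "finite U" using U(1) unif_finite_verts[OF E(1)] finite_subset by auto
    let ?E = "{e\<in>E. e \<subseteq> U}"
    have EU: "unif 2 U ?E" using E(1) finU by (auto simp: unif_def)
    have sEU: "es_sparse k 2 ?E" by (rule es_sparse_subset[OF E(2)]) (use unif_finite[OF E(1)] in auto)
    define t where "t = 1 / real m - \<delta>0"
    have t0: "0 \<le> t" using \<delta>0 by (simp add: t_def)
    have xU: "sum x U \<le> 1" using x1 sum_mono2[OF unif_finite_verts[OF E(1)] U(1), of x] x0 by force
    let ?S = "{v\<in>U. x v > t}"
    have "\<not> card ?S \<le> k - 2"
    proof
      assume c: "card ?S \<le> k - 2"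
      have "x v - t \<le> x v - min (x v) t" by simp
      also have "\<dots> \<le> (\<Sum>v\<in>U. x v - min (x v) t)"
        using member_le_sum[of v U "\<lambda>v. x v - min (x v) t"] U finU by simp
      finally have z: "x v - t \<le> (\<Sum>v\<in>U. x v - min (x v) t)" .
      have "(real k - 2) * sum x U \<le> (real k - 2) * 1" by (intro mult_left_mono xU) (use k in auto)
      moreover have "2 * (\<Sum>e\<in>?E. Min (x ` e)) \<le> (real k - 2) * sum x U - (\<Sum>v\<in>U. x v - min (x v) t)"
        by (rule sum_Min_few_heavy[OF EU sEU k(1) t0 _ c]) (use x0 U in auto)
      ultimately have M: "2 * (\<Sum>e\<in>?E. Min (x ` e)) \<le> (real m - 1) - (x v - t)"
        using z m(2) by argo
      have "lag ?E x \<le> x v * (\<Sum>e\<in>?E. Min (x ` e))"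
        by (rule lag_2_le_Min[OF EU]) (use U x0 in auto)
      moreover have "x v * (2 * (\<Sum>e\<in>?E. Min (x ` e))) \<le> x v * ((real m - 1) - (x v - t))"
        by (rule mult_left_mono[OF M]) (use x0 U in auto)
      moreover have "dens m 2 = (real m - 1) / (2 * real m)"
        using m by (simp add: dens_def binomial_gbinomial gbinomial_prod_rev numeral_2_eq_2 field_simps power2_eq_square)
      ultimately have A: "(real m - 1) / real m - 2 * \<eta> \<le> x v * ((real m - 1) - (x v - t))"
        using U(5) by simp
      have xv: "1 / real m - \<eta> \<le> x v" "x v \<le> 1 / real m + \<eta>" using U(4) by (auto simp: abs_le_iff)
      have "x v * ((real m - 1) - (x v - t)) \<le> x v * ((real m - 1) - \<delta>0 / 2)"
        by (intro mult_left_mono) (use xv \<eta> x0 U in \<open>auto simp: t_def\<close>)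
      also have "\<dots> \<le> (1 / real m + \<eta>) * ((real m - 1) - \<delta>0 / 2)"
      proof (rule mult_right_mono[OF xv(2)])
        have "2 \<le> real m" using m(1) by linarith
        moreover from this have "1 / real m \<le> 1" by simp
        ultimately show "0 \<le> (real m - 1) - \<delta>0 / 2" using \<delta>0(3) by linarith
      qed
      also have "\<dots> \<le> (real m - 1) / real m + \<eta> * (real m - 1) - \<delta>0 / (2 * real m)"
      proof -
        have "real m > 0" using m(1) by simp
        then have "(1 / real m + \<eta>) * ((real m - 1) - \<delta>0 / 2) =
          (real m - 1) / real m + \<eta> * (real m - 1) - \<delta>0 / (2 * real m) - \<eta> * \<delta>0 / 2"
          by (simp add: field_simps)
        then show ?thesis using mult_pos_pos[OF \<eta>(1) \<delta>0(1)] by linarith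
      qed
      finally have "\<delta>0 / (2 * real m) \<le> \<eta> * (real m + 1)" using A by (simp add: algebra_simps)
      also have "\<dots> = \<delta>0 / (4 * real m)" unfolding \<eta>_def using m by (simp add: field_simps)
      finally show False using \<delta>0 m by (simp add: field_simps)
    qed
    then have "m \<le> card ?S" using m by linarith
    then obtain S where S: "S \<subseteq> ?S" "card S = m" using obtain_subset_with_card_n by metis
    have "1 / real m - \<delta> \<le> x v" if "v \<in> S" for v
    proof -
      have "t < x v" using S that by auto
      then show ?thesis using \<delta>0(2) unfolding t_def by linarith
    qed
    then show "\<exists>S\<subseteq>V. card S = k + 2 - 3 \<and> (\<forall>v\<in>S. 1 / real (k + 2 - 3) - \<delta> \<le> x v)"
      using U(1) S unfolding m_def[symmetric] by blast
  qed
qed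

text \<open>The link of the vertex from \<open>heavy_vertex\<close>, rescaled to total weight at
  most 1, is near-maximal one rank lower. It yields \<open>m - 1\<close> vertices of scaled weight
  about \<open>1 / (m - 1)\<close>, which is about \<open>1 / m\<close> before scaling; the vertex
  itself is the last one.\<close>

lemma sparse_stability:
  fixes \<delta> :: real
  assumes k: "k \<ge> 3" "r \<ge> 2" "tame k r" and \<delta>: "\<delta> > 0"
  shows "\<exists>\<epsilon>>0. \<forall>(V :: 'v set) E x. unif r V E \<longrightarrow> es_sparse k r E \<longrightarrow> (\<forall>v\<in>V. 0 \<le> x v) \<longrightarrow>
     (\<Sum>v\<in>V. x v) \<le> 1 \<longrightarrow> dens (k + r - 3) r - \<epsilon> \<le> lag E x \<longrightarrow>
     (\<exists>S\<subseteq>V. card S = k + r - 3 \<and> (\<forall>v\<in>S. 1 / real (k + r - 3) - \<delta> \<le> x v))"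
  using k(2,3) \<delta>
proof (induction r arbitrary: \<delta> rule: nat_induct_at_least)
  case base
  show ?case by (rule sparse_stability_2[OF k(1) base])
next
  case (Suc q)
  note q = \<open>2 \<le> q\<close>
  define r where "r = Suc q"
  define m where "m = k + r - 3"
  have m: "m \<ge> 3" "k + q - 3 = m - 1" "r - 1 = q" "r \<ge> 2" using k(1) q by (auto simp: m_def r_def)
  have t: "tame k q" using tame_pred Suc.prems(1) k(1) q by blast
  have tr: "tame k r" using Suc.prems by (simp add: r_def)
  define d where "d = dens m r"
  define d' where "d' = dens (m - 1) q"
  have rd: "real r * d = d' * (1 - 1 / real m) ^ q"
    unfolding d_def d'_def using dens_step[of m r] m by simp
  have m1: "0 < 1 - 1 / real m" using m by simp
  have \<delta>2: "\<delta> / 2 > 0" using Suc.prems by simp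
  obtain \<epsilon>2 where \<epsilon>2: "\<epsilon>2 > 0" and S: "\<And>(V :: 'v set) E x. unif q V E \<Longrightarrow> es_sparse k q E \<Longrightarrow> (\<forall>v\<in>V. 0 \<le> x v) \<Longrightarrow>
     (\<Sum>v\<in>V. x v) \<le> 1 \<Longrightarrow> d' - \<epsilon>2 \<le> lag E x \<Longrightarrow>
     (\<exists>S\<subseteq>V. card S = m - 1 \<and> (\<forall>v\<in>S. 1 / real (m - 1) - \<delta> / 2 \<le> x v))"
    using Suc.IH[OF t \<delta>2] unfolding m d'_def by blast
  \<comment> \<open>As \<open>t\<close> tends to 0 the density of the rescaled link tends to
    \<open>d'\<close>, so some small \<eta> meets the tolerance \<open>\<epsilon>2\<close> of the
    induction hypothesis.\<close>
  have "((\<lambda>t. (real r * d - t) / (1 - 1 / real m + t) ^ q) \<longlongrightarrow> (real r * d - 0) / (1 - 1 / real m + 0) ^ q) (at_right 0)"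
    by (intro tendsto_intros) (use m1 in auto)
  moreover have "(1 - 1 / real m) ^ q \<noteq> 0" using m1 by (metis less_irrefl power_not_zero)
  then have "(real r * d - 0) / (1 - 1 / real m + 0) ^ q = d'"
    by (simp only: diff_zero add_0_right rd) (rule nonzero_mult_div_cancel_right)
  ultimately have e1: "\<forall>\<^sub>F t in at_right 0. d' - \<epsilon>2 < (real r * d - t) / (1 - 1 / real m + t) ^ q"
    using \<epsilon>2 by (intro order_tendstoD) auto
  have ev: "\<forall>\<^sub>F t in at_right (0::real). t < c" if "c > 0" for c
    by (rule order_tendstoD(2)[OF tendsto_ident_at that])
  have e2: "\<forall>\<^sub>F t in at_right (0::real). t < min (\<delta> / 2) (1 / 4)"
    by (rule ev) (use \<delta>2 in auto)
  have dp: "d > 0" unfolding d_def by (rule dens_pos) (use m m_def k in auto)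
  have e3: "\<forall>\<^sub>F t in at_right (0::real). t < real r * d"
    by (rule ev) (use dp m in simp)
  have "\<forall>\<^sub>F t in at_right (0::real). t > 0 \<and> d' - \<epsilon>2 < (real r * d - t) / (1 - 1 / real m + t) ^ q \<and>
      t < min (\<delta> / 2) (1 / 4) \<and> t < real r * d"
    using e1 e2 e3 eventually_at_right_less[of "0::real"] by eventually_elim auto
  from eventually_happens'[OF trivial_limit_at_right_real this] obtain \<eta> where \<eta>: "\<eta> > 0" "d' - \<epsilon>2 < (real r * d - \<eta>) / (1 - 1 / real m + \<eta>) ^ q"
      "\<eta> < \<delta> / 2" "\<eta> < 1 / 4" "\<eta> < real r * d"
    by auto
  obtain \<epsilon> where \<epsilon>: "\<epsilon> > 0" and H: "\<forall>(V :: 'v set) E x. unif r V E \<longrightarrow> es_sparse k r E \<longrightarrow> (\<forall>v\<in>V. 0 \<le> x v) \<longrightarrow>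
     (\<Sum>v\<in>V. x v) \<le> 1 \<longrightarrow> dens m r - \<epsilon> \<le> lag E x \<longrightarrow>
     (\<exists>U v. U \<subseteq> V \<and> v \<in> U \<and> (\<forall>w\<in>U. x w \<le> x v) \<and> \<bar>x v - 1 / real m\<bar> \<le> \<eta> \<and>
        dens m r - \<eta> \<le> lag {e\<in>E. e \<subseteq> U} x \<and>
        real r * dens m r - \<eta> \<le> lag {f\<in>link E v. f \<subseteq> U - {v}} x)"
    using heavy_vertex[OF k(1) m(4) tr m_def \<eta>(1), where 'v='v] by (elim exE conjE) (rule that)
  show ?case
    unfolding r_def[symmetric] m_def[symmetric]
  proof (intro exI[of _ \<epsilon>] conjI allI impI \<epsilon>)
    fix V :: "'v set" and E x
    assume E: "unif r V E" "es_sparse k r E" and x0: "\<forall>v\<in>V. 0 \<le> x v" and x1: "(\<Sum>v\<in>V. x v) \<le> 1"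
      and big: "dens m r - \<epsilon> \<le> lag E x"
    obtain U v where U: "U \<subseteq> V" "v \<in> U" "\<forall>w\<in>U. x w \<le> x v" "\<bar>x v - 1 / real m\<bar> \<le> \<eta>"
        "real r * d - \<eta> \<le> lag {f\<in>link E v. f \<subseteq> U - {v}} x"
      using H[rule_format, OF E _ x1 big] x0 unfolding d_def by blast
    let ?L = "{f\<in>link E v. f \<subseteq> U - {v}}"
    have finU: "finite U" using U(1) unif_finite_verts[OF E(1)] finite_subset by auto
    have L: "unif q (U - {v}) ?L" using unif_link[OF E(1), of v] finU m(3) by (auto simp: unif_def)
    have "es_sparse k q (link E v)" using sparse_link E by (simp add: r_def)
    then have sL: "es_sparse k q ?L"
      by (rule es_sparse_subset) (use unif_finite[OF E(1)] link_finite in auto)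
    have y: "1 / real m - \<eta> \<le> x v" "x v \<le> 1 / real m + \<eta>" using U(4) by (auto simp: abs_le_iff)
    have m3: "1 / real m \<le> 1 / 3" using m by (intro divide_left_mono) auto
    have y1: "0 < 1 - x v" "1 - x v \<le> 1" using y m3 \<eta>(4) x0 U by auto
    have xU: "sum x U \<le> 1" using x1 sum_mono2[OF unif_finite_verts[OF E(1)] U(1), of x] x0 by force
    define c where "c = 1 / (1 - x v)"
    have c0: "0 < c" using y1 by (simp add: c_def)
    have "(\<Sum>w\<in>U - {v}. c * x w) = c * (sum x U - x v)"
      using finU U by (simp add: sum_distrib_left[symmetric] sum_diff1)
    also have "\<dots> \<le> c * (1 - x v)" by (intro mult_left_mono) (use xU c0 in auto)
    also have "\<dots> = 1" using y1 by (simp add: c_def)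
    finally have s1: "(\<Sum>w\<in>U - {v}. c * x w) \<le> 1" .
    have "d' - \<epsilon>2 \<le> (real r * d - \<eta>) / (1 - 1 / real m + \<eta>) ^ q" using \<eta> by simp
    also have "\<dots> \<le> (real r * d - \<eta>) / (1 - x v) ^ q"
      by (intro divide_left_mono power_mono mult_pos_pos zero_less_power) (use y y1 \<eta> m1 in auto)
    also have "\<dots> \<le> lag ?L x / (1 - x v) ^ q"
      by (intro divide_right_mono U(5)) (use y1 in auto)
    also have "\<dots> = lag ?L (\<lambda>w. c * x w)" using lag_scale[OF L, of c x] by (simp add: c_def power_divide)
    finally obtain S' where S': "S' \<subseteq> U - {v}" "card S' = m - 1" "\<forall>w\<in>S'. 1 / real (m - 1) - \<delta> / 2 \<le> c * x w"
      using S[OF L sL _ s1] x0 c0 U(1) by (auto simp: subset_iff)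
    show "\<exists>S\<subseteq>V. card S = m \<and> (\<forall>v\<in>S. 1 / real m - \<delta> \<le> x v)"
    proof (intro exI[of _ "insert v S'"] conjI ballI)
      show "insert v S' \<subseteq> V" using S' U by auto
      have "finite S'" using S' finU finite_subset by blast
      moreover have "v \<notin> S'" using S' by auto
      ultimately show "card (insert v S') = m" using S' m by simp
      fix w assume w: "w \<in> insert v S'"
      show "1 / real m - \<delta> \<le> x w"
      proof (cases "w = v")
        case True
        then show ?thesis using y \<eta> by simp
      next
        case False
        then have "1 / real (m - 1) - \<delta> / 2 \<le> c * x w" using S' w by auto
        then have "(1 - x v) * (1 / real (m - 1) - \<delta> / 2) \<le> (1 - x v) * (c * x w)"
          by (rule mult_left_mono) (use y1 in auto)
        then have 1: "(1 - x v) * (1 / real (m - 1) - \<delta> / 2) \<le> x w" using y1 by (simp add: c_def)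
        have "(1 - x v) * (\<delta> / 2) \<le> 1 * (\<delta> / 2)"
          by (intro mult_right_mono y1) (use \<delta>2 in auto)
        moreover have "(1 - 1 / real m - \<eta>) * (1 / real (m - 1)) \<le> (1 - x v) * (1 / real (m - 1))"
          by (intro mult_right_mono) (use y in auto)
        moreover have "(1 - 1 / real m - \<eta>) * (1 / real (m - 1)) = 1 / real m - \<eta> * (1 / real (m - 1))"
          using m by (simp add: of_nat_diff field_simps)
        moreover have "\<eta> * (1 / real (m - 1)) \<le> \<eta> * 1"
          by (intro mult_left_mono) (use m \<eta> in auto)
        ultimately have "1 / real m - \<eta> - \<delta> / 2 \<le> (1 - x v) * (1 / real (m - 1) - \<delta> / 2)"
          by (simp add: right_diff_distrib)
        then show ?thesis using 1 \<eta> by linarith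
      qed
    qed
  qed
qed

section \<open>The rightmost maximiser of the density function\<close>

text \<open>The point \<open>x\<close> stands for a real value of \<open>k\<close>, and
  \<open>1 / (x + r - 3)\<close> for the uniform weight belonging to it. The two products run in
  opposite orders.\<close>

lemma f_fun_gfun:
  assumes "r \<ge> 2" "x \<ge> 2"
  shows "f_fun r x = gfun r (1 / (x + real r - 3)) 1"
proof -
  let ?M = "x + real r - 3"
  have M: "?M > 0" using assms by auto
  have "gfun r (1 / ?M) 1 = 1 / ?M * (\<Prod>j<r-1. (?M - real j) / ?M)"
    unfolding gfun_def using M by (simp add: diff_divide_distrib)
  also have "\<dots> = (\<Prod>j<r-1. ?M - real j) / ?M ^ Suc (r - 1)"
    by (simp only: prod_dividef prod_constant card_lessThan power_Suc times_divide_times_eq mult_1)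
  also have "Suc (r - 1) = r" using assms by simp
  also have "(\<Prod>j<r-1. ?M - real j) = (\<Prod>i=1..r-1. x + real i - 2)"
    by (rule prod.reindex_bij_witness[of _ "\<lambda>i. r - 1 - i" "\<lambda>j. r - 1 - j"])
      (use assms in \<open>auto simp: of_nat_diff\<close>)
  finally show ?thesis unfolding f_fun_def by simp
qed

text \<open>The mirror image of \<open>gfun_strict_mono_real\<close>. The smaller weight is now
  \<open>y = 1 / m\<close> itself, where \<open>1 - j * y = (m - j) * y\<close> makes the exponents
  exact multiples of the tameness summands.\<close>

lemma gfun_strict_antimono_real:
  fixes x :: real
  assumes k: "x \<ge> 2" "r \<ge> 2" "(\<Sum>j<r-1. real j / (x + real r - 3 - real j)) \<ge> 1"
    and z: "1 / (x + real r - 3) < z" "z * (real r - 1) \<le> 1"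
  shows "gfun r z 1 < gfun r (1 / (x + real r - 3)) 1"
proof -
  let ?m = "x + real r - 3"
  define y where "y = 1 / ?m"
  have m: "?m \<ge> real r - 1" "?m > 0" using k by auto
  have y0: "0 < y" unfolding y_def using m by simp
  have yz: "y < z" using z by (simp add: y_def)
  have pos: "1 - real j * z > 0" "?m - real j > 0" "1 - real j * y > 0" if "j < r - 1" for j
  proof -
    show 1: "?m - real j > 0" using that k by auto
    have "real j < real r - 1" using that by linarith
    then have "real j * z < (real r - 1) * z" by (rule mult_strict_right_mono) (use y0 yz in auto)
    then show "1 - real j * z > 0" using z(2) by (simp add: mult.commute)
    have "real j * y < ?m * y" by (rule mult_strict_right_mono) (use 1 y0 in auto)
    then show "1 - real j * y > 0" using m by (simp add: y_def)
  qed
  define a where "a j = real j * (z - y) / (1 - real j * y)" for j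
  have "(\<Prod>j<r-1. 1 - real j * z) = (\<Prod>j<r-1. (1 - real j * y) * (1 - a j))"
  proof (intro prod.cong refl)
    fix j assume "j \<in> {..<r-1}"
    then have "1 - real j * y \<noteq> 0" using pos(3)[of j] by auto
    then show "1 - real j * z = (1 - real j * y) * (1 - a j)"
      unfolding a_def by (simp add: field_simps)
  qed
  also have "\<dots> = (\<Prod>j<r-1. 1 - real j * y) * (\<Prod>j<r-1. 1 - a j)"
    by (simp add: prod.distrib)
  finally have 1: "(\<Prod>j<r-1. 1 - real j * z) = (\<Prod>j<r-1. 1 - real j * y) * (\<Prod>j<r-1. 1 - a j)" .
  have "(\<Prod>j<r-1. 1 - a j) \<le> (\<Prod>j<r-1. exp (- a j))"
  proof (intro prod_mono conjI)
    fix j assume j: "j \<in> {..<r-1}"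
    have "0 < 1 - real j * z" using pos(1)[of j] j by auto
    then have "real j * (z - y) \<le> 1 - real j * y" by (simp add: algebra_simps)
    then show "0 \<le> 1 - a j" unfolding a_def using pos(3)[of j] j by simp
    show "1 - a j \<le> exp (- a j)" using exp_ge_add_one_self[of "- a j"] by simp
  qed
  also have "\<dots> = exp (- (\<Sum>j<r-1. a j))" by (simp add: exp_sum[symmetric] sum_negf)
  also have "\<dots> \<le> exp (1 - z / y)"
  proof -
    have "a j = (z / y - 1) * (real j / (?m - real j))" if j: "j < r - 1" for j
    proof -
      have e: "1 - real j * y = (?m - real j) * y" using m(2) by (simp add: y_def field_simps)
      have "z / y - 1 = (z - y) / y" using y0 by (simp add: field_simps)
      then show ?thesis unfolding a_def e using y0 pos(2)[OF j] by (simp add: mult.commute)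
    qed
    then have "(\<Sum>j<r-1. a j) = (\<Sum>j<r-1. (z / y - 1) * (real j / (?m - real j)))"
      by (intro sum.cong) auto
    also have "\<dots> = (z / y - 1) * (\<Sum>j<r-1. real j / (?m - real j))" by (simp only: sum_distrib_left)
    finally have "(\<Sum>j<r-1. a j) = (z / y - 1) * (\<Sum>j<r-1. real j / (?m - real j))" .
    moreover have "(z / y - 1) * 1 \<le> (z / y - 1) * (\<Sum>j<r-1. real j / (?m - real j))"
      by (rule mult_left_mono) (use k(3) y0 yz in auto)
    ultimately show ?thesis by simp
  qed
  finally have 2: "(\<Prod>j<r-1. 1 - a j) \<le> exp (1 - z / y)" .
  have "z / y < exp (z / y - 1)" by (rule less_exp_diff_one) (use y0 yz in auto)
  then have "z / y * exp (1 - z / y) < exp (z / y - 1) * exp (1 - z / y)"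
    by (rule mult_strict_right_mono) simp
  also have "\<dots> = 1" by (simp add: exp_add[symmetric])
  finally have "z * exp (1 - z / y) < y" using y0 by (simp add: field_simps)
  moreover have "z * (\<Prod>j<r-1. 1 - a j) \<le> z * exp (1 - z / y)"
    by (rule mult_left_mono[OF 2]) (use y0 yz in auto)
  ultimately have "z * (\<Prod>j<r-1. 1 - a j) < y" by simp
  moreover have "(\<Prod>j<r-1. 1 - real j * y) > 0" by (rule prod_pos) (use pos in auto)
  ultimately have "z * (\<Prod>j<r-1. 1 - a j) * (\<Prod>j<r-1. 1 - real j * y) < y * (\<Prod>j<r-1. 1 - real j * y)"
    by simp
  then show ?thesis unfolding gfun_def 1 y_def[symmetric] by (simp add: ac_simps)
qed

text \<open>If \<open>tame\<close> fails at \<open>k\<close>, then \<open>f_fun r\<close> has its unique maximum to the right of \<open>k\<close>,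
  at the point where its logarithmic derivative vanishes.\<close>

lemma tame_of_M_last:
  assumes "k \<ge> 3" "r \<ge> 2" "M_last r \<le> real k"
  shows "tame k r"
proof (rule ccontr)
  define \<Phi> where "\<Phi> x = (\<Sum>j<r-1. real j / (x + real r - 3 - real j))" for x
  assume "\<not> tame k r"
  then have k: "1 < \<Phi> (real k)" by (simp add: tame_def \<Phi>_def)
  \<comment> \<open>Far enough to the right that each of the \<open>r - 1\<close> summands is at
    most \<open>1 / r\<close>.\<close>
  define X where "X = real k + real r ^ 2"
  have "\<Phi> X \<le> (\<Sum>j<r-1. 1 / real r)"
    unfolding \<Phi>_def
  proof (rule sum_mono)
    fix j assume j: "j \<in> {..<r-1}"
    have "real r * real j \<le> real r * real r" by (intro mult_left_mono) (use j in auto)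
    also have "\<dots> \<le> X + real r - 3 - real j"
      using j assms unfolding X_def power2_eq_square by auto
    finally have "real j * real r \<le> X + real r - 3 - real j" by (simp add: mult.commute)
    moreover have "0 < X + real r - 3 - real j"
    proof -
      have "0 \<le> real r ^ 2" by simp
      moreover have "real j + 1 \<le> real r" "3 \<le> real k" using j assms by auto
      ultimately show ?thesis unfolding X_def by linarith
    qed
    ultimately show "real j / (X + real r - 3 - real j) \<le> 1 / real r"
      using assms by (simp add: divide_simps)
  qed
  also have "\<dots> \<le> 1" using assms by (simp add: of_nat_diff)
  finally have X: "\<Phi> X \<le> 1" .
  have "\<exists>x. real k \<le> x \<and> x \<le> X \<and> \<Phi> x = 1"
  proof (rule IVT2')
    have "x + real r - 3 - real j \<noteq> 0" if "x \<in> {real k..X}" "j \<in> {..<r-1}" for x j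
      using that assms by auto
    then show "continuous_on {real k..X} \<Phi>"
      unfolding \<Phi>_def by (intro continuous_intros) auto
  qed (use k X in \<open>auto simp: X_def\<close>)
  then obtain x where x: "real k \<le> x" "\<Phi> x = 1" by blast
  have xk: "real k < x" using x k by (cases "x = real k") auto
  have x2: "x \<ge> 2" using x assms by simp
  \<comment> \<open>Left of \<open>x\<close> the weight \<open>1 / (y + r - 3)\<close> is the larger
    one and \<open>gfun\<close> decreases towards it; right of \<open>x\<close> it is the smaller
    one and \<open>gfun\<close> increases. Both lemmas apply because the tameness sum at
    \<open>x\<close> is exactly 1.\<close>
  have less: "f_fun r y < f_fun r x" if "y \<ge> 2" "y \<noteq> x" for y
  proof (cases "y < x")
    case True
    have "gfun r (1 / (y + real r - 3)) 1 < gfun r (1 / (x + real r - 3)) 1"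
      by (rule gfun_strict_antimono_real)
        (use x that True assms x2 in \<open>auto simp: \<Phi>_def intro!: divide_strict_left_mono mult_pos_pos\<close>)
    then show ?thesis using f_fun_gfun assms that x2 by simp
  next
    case False
    have "gfun r (1 / (y + real r - 3)) 1 < gfun r (1 / (x + real r - 3)) 1"
      by (rule gfun_strict_mono_real[of x])
        (use x that False assms x2 in \<open>auto simp: \<Phi>_def intro!: divide_strict_left_mono mult_pos_pos\<close>)
    then show ?thesis using f_fun_gfun assms that x2 by simp
  qed
  have "M_last r = x"
    unfolding M_last_def
  proof (rule Greatest_equality)
    show "2 \<le> x \<and> (\<forall>y\<ge>2. f_fun r y \<le> f_fun r x)"
      using x2 less by (metis less_le_not_le linear)
    fix y assume "2 \<le> y \<and> (\<forall>z\<ge>2. f_fun r z \<le> f_fun r y)"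
    then show "y \<le> x" using less[of y] x2 by (metis not_le order_refl)
  qed
  then show False using xk assms by simp
qed

section \<open>Covered cores and homomorphisms\<close>

lemma contains_copy_iso:
  assumes "bij_betw h (verts G) W" "contains_copy \<lparr>verts = W, edges = (`) h ` edges G\<rparr> F" "rgraph r G"
    and F: "\<And>e. e \<in> edges F \<Longrightarrow> e \<subseteq> verts F"
  shows "contains_copy G F"
proof -
  obtain \<phi> where \<phi>: "inj_on \<phi> (verts F)" "\<phi> ` verts F \<subseteq> W" "\<And>e. e \<in> edges F \<Longrightarrow> \<phi> ` e \<in> (`) h ` edges G"
    using assms(2) by (auto simp: contains_copy_def)
  define g where "g = inv_into (verts G) h"
  have g: "bij_betw g W (verts G)" unfolding g_def using assms(1) by (rule bij_betw_inv_into)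
  have "inj_on (g \<circ> \<phi>) (verts F)"
    using \<phi> g by (meson bij_betw_imp_inj_on comp_inj_on inj_on_subset)
  moreover have "(g \<circ> \<phi>) ` verts F \<subseteq> verts G"
    using \<phi>(2) g by (auto simp: bij_betw_def)
  moreover have "(g \<circ> \<phi>) ` e \<in> edges G" if e: "e \<in> edges F" for e
  proof -
    obtain e' where e': "e' \<in> edges G" "\<phi> ` e = h ` e'" using \<phi>(3)[OF e] by auto
    have "e' \<subseteq> verts G" using assms(3) e' by (auto simp: rgraph_def)
    then have "g ` h ` e' = e'" unfolding g_def
      using assms(1) by (metis bij_betw_def inv_into_image_cancel)
    then show ?thesis using e' by (metis image_comp)
  qed
  ultimately show ?thesis unfolding contains_copy_def by blast
qed

lemma finite_ex_set: "finite {card (edges G) | G :: nat hypergraph.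
     rgraph r G \<and> verts G = {..<n} \<and> \<not> contains_copy G F}"
proof (rule finite_subset)
  show "{card (edges G) | G :: nat hypergraph.
     rgraph r G \<and> verts G = {..<n} \<and> \<not> contains_copy G F} \<subseteq> card ` Pow (Pow {..<n})"
    by (auto simp: rgraph_def)
qed simp

text \<open>\<open>ex_number\<close> ranges over the vertex set \<open>{..<n}\<close> only; other
  finite vertex sets arise from link graphs and from deleting a vertex.\<close>

lemma card_le_ex_number:
  assumes G: "rgraph r G" "\<not> contains_copy G F" and F: "\<And>e. e \<in> edges F \<Longrightarrow> e \<subseteq> verts F"
  shows "card (edges G) \<le> ex_number r (card (verts G)) F"
proof -
  have fin: "finite (verts G)" using G by (simp add: rgraph_def)
  obtain h where h: "bij_betw h (verts G) {..<card (verts G)}"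
    using fin by (metis bij_betw_iff_card card_lessThan finite_lessThan)
  let ?G = "\<lparr>verts = {..<card (verts G)}, edges = (`) h ` edges G\<rparr>"
  have inj: "inj_on h (verts G)" using h by (rule bij_betw_imp_inj_on)
  have sub: "e \<subseteq> verts G" "card e = r" if "e \<in> edges G" for e using G that by (auto simp: rgraph_def)
  have "card (h ` e) = r" if "e \<in> edges G" for e
    using sub[OF that] inj by (metis card_image inj_on_subset)
  moreover have "h ` e \<subseteq> {..<card (verts G)}" if "e \<in> edges G" for e
    using sub[OF that] h by (metis bij_betw_def image_mono)
  ultimately have "rgraph r ?G" unfolding rgraph_def by auto
  moreover have "\<not> contains_copy ?G F" using contains_copy_iso[OF h _ G(1) F] G(2) by blast
  moreover have "card (edges ?G) = card (edges G)"
    using inj_on_subset[OF inj_on_image_Pow[OF inj], of "edges G"] sub(1) by (auto intro!: card_image)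
  ultimately show ?thesis unfolding ex_number_def
    by (intro Max_ge finite_ex_set) (auto intro!: exI[of _ ?G])
qed

lemma tree_vertex_in_edge:
  assumes "is_tree T" "card (verts T) \<ge> 3" "v \<in> verts T"
  shows "\<exists>e\<in>edges T. v \<in> e"
proof -
  have "\<not> verts T \<subseteq> {v}" using assms(2) card_mono[of "{v}" "verts T"] by auto
  then obtain u where u: "u \<in> verts T" "u \<noteq> v" by blast
  then have "(v, u) \<in> {(x, y). {x, y} \<in> edges T}\<^sup>*"
    using assms by (auto simp: is_tree_def connected_graph_def)
  then show ?thesis using u(2) by (cases rule: converse_rtranclE) auto
qed

text \<open>The end of a longest path: a second edge there would prolong the path or close a
  cycle.\<close>

lemma tree_leaf:
  assumes T: "is_tree T" "card (verts T) \<ge> 3"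
  obtains l t where "{l, t} \<in> edges T" "l \<noteq> t" "\<And>e. e \<in> edges T \<Longrightarrow> l \<in> e \<Longrightarrow> e = {l, t}"
proof -
  define P where "P xs \<longleftrightarrow> distinct xs \<and> set xs \<subseteq> verts T \<and>
    (\<forall>i. Suc i < length xs \<longrightarrow> {xs ! i, xs ! Suc i} \<in> edges T)" for xs
  have g: "rgraph 2 T" using T by (simp add: is_tree_def)
  then have fin: "finite (verts T)" by (simp add: rgraph_def)
  have pair: "\<exists>y. e = {v, y} \<and> y \<noteq> v \<and> y \<in> verts T \<and> v \<in> verts T" if "e \<in> edges T" "v \<in> e" for e v
  proof -
    have e: "card e = 2" "e \<subseteq> verts T" using g that by (auto simp: rgraph_def)
    then obtain a b where "e = {a, b}" "a \<noteq> b" by (auto simp: card_2_iff)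
    then show ?thesis using that e by auto
  qed
  have len: "length xs \<le> card (verts T)" if "P xs" for xs
    using that fin unfolding P_def by (metis card_mono distinct_card)
  have "\<not> verts T \<subseteq> {}" using T(2) by auto
  then obtain v0 where "v0 \<in> verts T" by blast
  then obtain e0 where e0: "e0 \<in> edges T" "v0 \<in> e0" using tree_vertex_in_edge[OF T] by blast
  then obtain y0 where y0: "e0 = {v0, y0}" "y0 \<noteq> v0" "y0 \<in> verts T" "v0 \<in> verts T" using pair by blast
  have P0: "P [v0, y0]" unfolding P_def using y0 e0 by auto
  obtain xs where xs: "P xs" "\<And>ys. P ys \<Longrightarrow> length ys \<le> length xs"
  proof -
    have "finite (length ` {xs. P xs})"
      by (rule finite_subset[of _ "{..card (verts T)}"]) (use len in auto)
    then have "Max (length ` {xs. P xs}) \<in> length ` {xs. P xs}" using P0 by (intro Max_in) auto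
    then obtain xs where "P xs" "length xs = Max (length ` {xs. P xs})" by auto
    then show thesis using that \<open>finite (length ` {xs. P xs})\<close> by (metis Max_ge image_eqI mem_Collect_eq)
  qed
  have l2: "length xs \<ge> 2" using xs(2)[OF P0] by simp
  let ?l = "xs ! 0" and ?t = "xs ! 1"
  have "{?l, ?t} \<in> edges T" using xs(1) l2 by (auto simp: P_def)
  moreover have "distinct xs" using xs(1) by (simp add: P_def)
  then have "?l \<noteq> ?t"  proof -
    have "0 < length xs" "1 < length xs" using l2 by linarith+
    then show ?thesis using nth_eq_iff_index_eq[OF \<open>distinct xs\<close>, of 0 1] by simp
  qed
  moreover have "e = {?l, ?t}" if e: "e \<in> edges T" "?l \<in> e" for e
  proof (rule ccontr)
    assume ne: "e \<noteq> {?l, ?t}"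
    obtain y where y: "e = {?l, y}" "y \<noteq> ?l" "y \<in> verts T" using pair[OF e] by blast
    show False
    proof (cases "y \<in> set xs")
      case False
      have "P (y # xs)"
        unfolding P_def
      proof (intro conjI allI impI)
        fix i assume "Suc i < length (y # xs)"
        then show "{(y # xs) ! i, (y # xs) ! Suc i} \<in> edges T"
          using xs(1) e y by (cases i) (auto simp: P_def insert_commute)
      qed (use False xs(1) y in \<open>auto simp: P_def\<close>)
      then show False using xs(2) by fastforce
    next
      case True
      then obtain i where i: "i < length xs" "y = xs ! i" by (auto simp: in_set_conv_nth)
      have "i \<noteq> 0" "i \<noteq> 1" using y ne i by auto
      then have i2: "i \<ge> 2" by simp
      \<comment> \<open>The initial segment of the path up to \<open>y\<close>, closed by
        \<open>e\<close>. It has at least three vertices because \<open>y\<close> is neither of the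
        first two.\<close>
      have "graph_cycle T (take (Suc i) xs)"
        unfolding graph_cycle_def
      proof (intro conjI allI impI)
        show "3 \<le> length (take (Suc i) xs)" using i i2 by simp
        show "distinct (take (Suc i) xs)" using xs(1) by (simp add: P_def)
        fix j assume "j < length (take (Suc i) xs)"
        then have j: "j \<le> i" "j < length xs" using i by auto
        have L: "length (take (Suc i) xs) = Suc i" using i by simp
        show "{take (Suc i) xs ! j, take (Suc i) xs ! (Suc j mod length (take (Suc i) xs))} \<in> edges T"
        proof (cases "j = i")
          case True
          then show ?thesis using e y i L by (simp add: insert_commute)
        next
          case False
          then have "Suc j mod Suc i = Suc j" using j by simp
          then show ?thesis unfolding L using j False xs(1) i by (simp add: P_def)
        qed
      qed
      then show False using T by (auto simp: is_tree_def)
    qed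
  qed
  ultimately show thesis using that by blast
qed

text \<open>The construction of \<open>H_graph\<close> over an arbitrary core, so that the extremal
  argument can forget trees and enlargements.\<close>

definition ext_graph :: "'a core_vertex hypergraph \<Rightarrow> nat \<Rightarrow> 'a ext_vertex hypergraph" where
  "ext_graph K r =
     \<lparr>verts = Core ` verts K \<union> (\<Union>P\<in>uncovered_pairs K. Aux P ` {..<r-2}),
      edges = (\<lambda>e. Core ` e) ` edges K \<union>
              {Core ` P \<union> Aux P ` {..<r-2} | P. P \<in> uncovered_pairs K}\<rparr>"

lemma H_graph_ext_graph: "H_graph F r p = ext_graph (core p F) r"
  by (simp add: H_graph_def ext_graph_def)

text \<open>No injectivity is asked of the map, so a single vertex with a large weight may stand for
  many vertices of an unweighted hypergraph.\<close>

definition hom_free :: "'a hypergraph \<Rightarrow> nat set set \<Rightarrow> bool" where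
  "hom_free H E \<longleftrightarrow> (\<nexists>\<psi>. \<forall>e\<in>edges H. \<psi> ` e \<in> E)"

lemma ex_bij_betw_subset:
  assumes "finite A" "finite B" "card A = card B" "A' \<subseteq> A" "B' \<subseteq> B" "card A' = card B'"
  shows "\<exists>f. bij_betw f A B \<and> f ` A' = B'"
proof -
  have fin: "finite A'" "finite B'" using assms finite_subset by auto
  obtain f where f: "bij_betw f A' B'" using fin assms(6) by (metis bij_betw_iff_card)
  have "card (A - A') = card (B - B')" using assms fin by (simp add: card_Diff_subset)
  then obtain g where g: "bij_betw g (A - A') (B - B')" using assms by (metis bij_betw_iff_card finite_Diff)
  let ?h = "\<lambda>x. if x \<in> A' then f x else g x"
  have "bij_betw ?h A' B'" using f by (subst bij_betw_cong[of _ _ f]) auto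
  moreover have "bij_betw ?h (A - A') (B - B')" using g by (subst bij_betw_cong[of _ _ g]) auto
  ultimately have "bij_betw ?h (A' \<union> (A - A')) (B' \<union> (B - B'))" by (rule bij_betw_combine) auto
  moreover have "A' \<union> (A - A') = A" "B' \<union> (B - B') = B" using assms by auto
  moreover have "?h ` A' = B'" using f by (auto simp: bij_betw_def)
  ultimately show ?thesis by auto
qed

text \<open>\<open>K\<close> plays the role of the core \<open>F\<close>; \<open>l\<close> is the vertex of \<open>F\<close> coming from a leaf of the tree.\<close>

locale pendant_core =
  fixes K :: "'a core_vertex hypergraph" and k r m :: nat and l :: "'a core_vertex" and el :: "'a core_vertex set"
  assumes k3: "k \<ge> 3" and r2: "r \<ge> 2" and m_def: "m = k + r - 3" and tame: "tame k r"
    and rgraph_K: "rgraph r K" and card_K: "card (verts K) = Suc m"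
    and Union_K: "\<Union> (edges K) = verts K"
    and el: "el \<in> edges K" "l \<in> el" and leaf: "\<And>e. e \<in> edges K \<Longrightarrow> l \<in> e \<Longrightarrow> e = el"
    and K_free: "\<And>V (E :: nat set set). unif r V E \<Longrightarrow>
        (\<nexists>\<phi>. inj_on \<phi> (verts K) \<and> (\<forall>e\<in>edges K. \<phi> ` e \<in> E)) \<Longrightarrow> es_sparse k r E"
begin

abbreviation H :: "'a ext_vertex hypergraph" where "H \<equiv> ext_graph K r"

lemma m_ge: "m \<ge> 2" "r \<le> m" "r \<ge> 1" "m \<ge> 1"
  using k3 r2 m_def by auto

lemma fin_K: "finite (verts K)"
  using rgraph_K by (simp add: rgraph_def)

lemma K_edge: "e \<in> edges K \<Longrightarrow> e \<subseteq> verts K \<and> card e = r \<and> finite e"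
  using rgraph_K by (auto simp: rgraph_def intro: finite_subset)

lemma l_in: "l \<in> verts K"
  using el Union_K by blast

lemma uncovered_pair:
  assumes "P \<in> uncovered_pairs K"
  obtains u v where "P = {u, v}" "u \<noteq> v" "u \<in> verts K" "v \<in> verts K" "\<not> covered K u v"
  using assms by (auto simp: uncovered_pairs_def)

text \<open>Any edge covering the images of an uncovered pair serves as the image of its auxiliary
  edge. The auxiliary vertices may then collide with each other or with the core, which is why only
  a homomorphism results.\<close>

lemma hom_from_core:
  assumes E: "unif r V E" and \<phi>: "inj_on \<phi> (verts K)" "\<And>e. e \<in> edges K \<Longrightarrow> \<phi> ` e \<in> E"
    and cov: "\<And>u v. u \<in> verts K \<Longrightarrow> v \<in> verts K \<Longrightarrow> u \<noteq> v \<Longrightarrow> \<exists>e\<in>E. \<phi> u \<in> e \<and> \<phi> v \<in> e"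
  shows "\<not> hom_free H E"
proof -
  have "\<exists>b. \<phi> ` P \<union> b ` {..<r-2} \<in> E" if P: "P \<in> uncovered_pairs K" for P
  proof (rule uncovered_pair[OF P])
    fix u v assume uv: "P = {u, v}" "u \<noteq> v" "u \<in> verts K" "v \<in> verts K"
    obtain e where e: "e \<in> E" "\<phi> u \<in> e" "\<phi> v \<in> e" using cov uv by blast
    have "\<phi> u \<noteq> \<phi> v" using \<phi>(1) uv by (auto simp: inj_on_def)
    then have "card (e - \<phi> ` P) = r - 2"
      using unif_edge[OF E e(1)] e uv by (simp add: card_Diff_subset)
    then obtain b where "bij_betw b {..<r-2} (e - \<phi> ` P)"
      using unif_edge[OF E e(1)] ex_bij_betw_nat_finite[of "e - \<phi> ` P"] by (auto simp: lessThan_atLeast0)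
    then have "\<phi> ` P \<union> b ` {..<r-2} = e" using e uv by (auto simp: bij_betw_def)
    then show ?thesis using e by metis
  qed
  then obtain b where b: "\<And>P. P \<in> uncovered_pairs K \<Longrightarrow> \<phi> ` P \<union> b P ` {..<r-2} \<in> E" by metis
  define \<psi> where "\<psi> w = (case w of Core c \<Rightarrow> \<phi> c | Aux P i \<Rightarrow> b P i)" for w
  have [simp]: "\<psi> (Core c) = \<phi> c" "\<psi> (Aux P i) = b P i" for c P i by (auto simp: \<psi>_def)
  have "\<psi> ` e \<in> E" if e: "e \<in> edges H" for e
  proof -
    from e consider e' where "e' \<in> edges K" "e = Core ` e'"
      | P where "P \<in> uncovered_pairs K" "e = Core ` P \<union> Aux P ` {..<r-2}"
      by (auto simp: ext_graph_def)
    then show ?thesis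
    proof cases
      case 1
      then show ?thesis using \<phi>(2) by (simp add: image_image)
    next
      case 2
      then show ?thesis using b by (simp add: image_image image_Un)
    qed
  qed
  then show ?thesis unfolding hom_free_def by blast
qed

text \<open>When all pairs are covered, a copy of the core extends to a homomorphism of
  \<open>H\<close>; so \<open>hom_free\<close> already excludes the core.\<close>

lemma covering_sparse:
  assumes E: "unif r V E" and free: "hom_free H E"
    and cov: "\<And>u v. u \<in> V \<Longrightarrow> v \<in> V \<Longrightarrow> u \<noteq> v \<Longrightarrow> \<exists>e\<in>E. u \<in> e \<and> v \<in> e"
  shows "es_sparse k r E"
proof (rule K_free[OF E])
  show "\<nexists>\<phi>. inj_on \<phi> (verts K) \<and> (\<forall>e\<in>edges K. \<phi> ` e \<in> E)"
  proof
    assume "\<exists>\<phi>. inj_on \<phi> (verts K) \<and> (\<forall>e\<in>edges K. \<phi> ` e \<in> E)"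
    then obtain \<phi> where \<phi>: "inj_on \<phi> (verts K)" "\<And>e. e \<in> edges K \<Longrightarrow> \<phi> ` e \<in> E" by blast
    have in_V: "\<phi> u \<in> V" if u: "u \<in> verts K" for u
    proof -
      obtain e where "e \<in> edges K" "u \<in> e" using u Union_K by blast
      then show ?thesis using \<phi>(2)[of e] unif_edge[OF E] by blast
    qed
    have "\<not> hom_free H E"
      by (rule hom_from_core[OF E \<phi>]) (use cov in_V \<phi>(1) in \<open>auto simp: inj_on_eq_iff\<close>)
    then show False using free by simp
  qed
qed

text \<open>The leaf \<open>l\<close> goes to \<open>w\<close> and the other \<open>m\<close> core
  vertices fill the clique, placed so that the only edge through \<open>l\<close> lands on
  \<open>insert w f\<close>.\<close>

lemma clique_pendant:
  assumes E: "unif r V E" and S: "finite S" "card S = m" "\<And>e. e \<subseteq> S \<Longrightarrow> card e = r \<Longrightarrow> e \<in> E"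
    and w: "w \<notin> S" "f \<subseteq> S" "card f = r - 1" "insert w f \<in> E"
    and cov: "\<And>u. u \<in> S \<Longrightarrow> \<exists>e\<in>E. u \<in> e \<and> w \<in> e"
  shows "\<not> hom_free H E"
proof -
  have ce: "card (el - {l}) = r - 1" using K_edge[OF el(1)] el(2) by simp
  have cK: "card (verts K - {l}) = m" using card_K l_in by simp
  obtain g where g: "bij_betw g (verts K - {l}) S" "g ` (el - {l}) = f"
    using ex_bij_betw_subset[of "verts K - {l}" S "el - {l}" f] fin_K S(1,2) w(2,3) ce cK K_edge[OF el(1)] by auto
  define \<phi> where "\<phi> = g(l := w)"
  have \<phi>l: "\<phi> l = w" "\<And>c. c \<noteq> l \<Longrightarrow> \<phi> c = g c" by (auto simp: \<phi>_def)
  have gS: "g c \<in> S" if "c \<in> verts K" "c \<noteq> l" for c using g(1) that by (auto simp: bij_betw_def)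
  have inj: "inj_on \<phi> (verts K)"
  proof (rule inj_onI)
    fix a b assume ab: "a \<in> verts K" "b \<in> verts K" "\<phi> a = \<phi> b"
    show "a = b"
      using ab gS w(1) g(1) unfolding \<phi>_def bij_betw_def inj_on_def by (auto split: if_splits)
  qed
  show ?thesis
  proof (rule hom_from_core[OF E inj])
    fix e assume e: "e \<in> edges K"
    show "\<phi> ` e \<in> E"
    proof (cases "l \<in> e")
      case True
      then have e': "e = insert l (el - {l})" using leaf[OF e] el by auto
      have "\<phi> ` (el - {l}) = f" unfolding g(2)[symmetric] by (rule image_cong) (auto simp: \<phi>_def)
      then have "\<phi> ` e = insert w f" by (subst e') (simp only: image_insert \<phi>l(1))
      then show ?thesis using w(4) by simp
    next
      case False
      have "\<phi> ` e \<subseteq> S" using False K_edge[OF e] gS \<phi>l(2) by fastforce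
      moreover have "card (\<phi> ` e) = r" using inj K_edge[OF e] by (metis card_image inj_on_subset)
      ultimately show ?thesis by (rule S(3))
    qed
  next
    fix u v assume uv: "u \<in> verts K" "v \<in> verts K" "u \<noteq> v"
    show "\<exists>e\<in>E. \<phi> u \<in> e \<and> \<phi> v \<in> e"
    proof (cases "u = l \<or> v = l")
      case True
      then show ?thesis using cov gS uv \<phi>l by metis
    next
      case False
      then have 1: "\<phi> u \<in> S" "\<phi> v \<in> S" using gS uv \<phi>l by auto
      have "\<phi> u \<noteq> \<phi> v" using inj uv by (auto simp: inj_on_def)
      then have "card {\<phi> u, \<phi> v} = 2" by simp
      then obtain e where "{\<phi> u, \<phi> v} \<subseteq> e" "e \<subseteq> S" "card e = r"
        using obtain_subset_with_card_n exists_subset_between[of "{\<phi> u, \<phi> v}" r S] S(1,2) 1 m_ge r2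
        by auto
      then show ?thesis using S(3) by blast
    qed
  qed
qed

end

section \<open>Random representatives\<close>

text \<open>The transversals of the colour classes with index in \<open>I\<close>. The set
  \<open>I\<close> is called the type of an edge below.\<close>

definition rsets :: "('v \<Rightarrow> nat) \<Rightarrow> 'v set \<Rightarrow> nat set \<Rightarrow> 'v set set" where
  "rsets c U I = {e. e \<subseteq> U \<and> inj_on c e \<and> c ` e = I}"

definition cls :: "('v \<Rightarrow> nat) \<Rightarrow> 'v set \<Rightarrow> nat \<Rightarrow> 'v set" where
  "cls c U i = {v\<in>U. c v = i}"

lemma finite_rsets: "finite U \<Longrightarrow> finite (rsets c U I)"
  unfolding rsets_def by (rule finite_subset[of _ "Pow U"]) auto

lemma finite_cls: "finite U \<Longrightarrow> finite (cls c U i)"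
  by (simp add: cls_def)

lemma card_rsets: "e \<in> rsets c U I \<Longrightarrow> card e = card I"
  by (auto simp: rsets_def card_image)

text \<open>Injectivity of \<rho> lets the colour of a chosen vertex reveal the coordinate for which
  it was chosen.\<close>

lemma PiE_cls_bij:
  assumes "inj_on \<rho> A"
  shows "bij_betw (\<lambda>t. t ` A) (PiE A (\<lambda>j. cls c U (\<rho> j))) (rsets c U (\<rho> ` A))"
proof (rule bij_betw_imageI)
  have ct: "c (t j) = \<rho> j" "t j \<in> U" if "t \<in> PiE A (\<lambda>j. cls c U (\<rho> j))" "j \<in> A" for t j
    using that by (auto simp: cls_def PiE_iff)
  show "inj_on (\<lambda>t. t ` A) (PiE A (\<lambda>j. cls c U (\<rho> j)))"
  proof (rule inj_onI)
    fix s t assume s: "s \<in> PiE A (\<lambda>j. cls c U (\<rho> j))" and t: "t \<in> PiE A (\<lambda>j. cls c U (\<rho> j))"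
      and eq: "s ` A = t ` A"
    show "s = t"
    proof (rule PiE_ext[OF s t])
      fix j assume j: "j \<in> A"
      then obtain j' where j': "j' \<in> A" "s j = t j'" using eq by (metis imageE imageI)
      then have "\<rho> j = \<rho> j'" using ct(1)[OF s j] ct(1)[OF t j'(1)] by simp
      then show "s j = t j" using assms j j' by (auto dest: inj_onD)
    qed
  qed
  show "(\<lambda>t. t ` A) ` (PiE A (\<lambda>j. cls c U (\<rho> j))) = rsets c U (\<rho> ` A)"
  proof (intro equalityI subsetI)
    fix e assume "e \<in> (\<lambda>t. t ` A) ` (PiE A (\<lambda>j. cls c U (\<rho> j)))"
    then obtain t where t: "t \<in> PiE A (\<lambda>j. cls c U (\<rho> j))" "e = t ` A" by auto
    have "inj_on c (t ` A)"
    proof (rule inj_onI)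
      fix a b assume "a \<in> t ` A" "b \<in> t ` A" "c a = c b"
      then show "a = b" using ct(1)[OF t(1)] assms by (auto dest: inj_onD)
    qed
    moreover have "c ` (t ` A) = \<rho> ` A" using ct(1)[OF t(1)] by (auto simp: image_image)
    moreover have "t ` A \<subseteq> U" using ct(2)[OF t(1)] by auto
    ultimately show "e \<in> rsets c U (\<rho> ` A)" by (simp add: rsets_def t(2))
  next
    fix e assume e: "e \<in> rsets c U (\<rho> ` A)"
    then have e: "e \<subseteq> U" "inj_on c e" "c ` e = \<rho> ` A" by (auto simp: rsets_def)
    define t where "t = (\<lambda>j\<in>A. inv_into e c (\<rho> j))"
    have t: "t j \<in> e" "c (t j) = \<rho> j" if "j \<in> A" for j
    proof -
      have "\<rho> j \<in> c ` e" using e(3) that by simp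
      then show "t j \<in> e" "c (t j) = \<rho> j" using that by (auto simp: t_def inv_into_into f_inv_into_f)
    qed
    have "t \<in> PiE A (\<lambda>j. cls c U (\<rho> j))" using t e(1) by (auto simp: cls_def t_def)
    moreover have "t ` A = e"
    proof
      show "t ` A \<subseteq> e" using t by auto
      show "e \<subseteq> t ` A"
      proof
        fix v assume v: "v \<in> e"
        then obtain j where j: "j \<in> A" "c v = \<rho> j" using e(3) by (metis imageE imageI)
        have "t j = v" using inj_onD[OF e(2), of "t j" v] t[OF j(1)] j(2) v by simp
        then show "v \<in> t ` A" using j by auto
      qed
    qed
    ultimately show "e \<in> (\<lambda>t. t ` A) ` (PiE A (\<lambda>j. cls c U (\<rho> j)))" by auto
  qed
qed

lemma sum_PiE_rsets:
  fixes x :: "'v \<Rightarrow> real"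
  assumes "inj_on \<rho> A"
  shows "(\<Sum>t\<in>{t\<in>PiE A (\<lambda>j. cls c U (\<rho> j)). t ` A \<in> Q}. \<Prod>j\<in>A. x (t j)) = (\<Sum>e\<in>rsets c U (\<rho> ` A) \<inter> Q. prod x e)"
proof -
  let ?P = "PiE A (\<lambda>j. cls c U (\<rho> j))"
  have b: "bij_betw (\<lambda>t. t ` A) ?P (rsets c U (\<rho> ` A))" by (rule PiE_cls_bij[OF assms])
  have im: "(\<lambda>t. t ` A) ` {t\<in>?P. t ` A \<in> Q} = rsets c U (\<rho> ` A) \<inter> Q"
  proof (intro equalityI subsetI)
    fix e assume "e \<in> (\<lambda>t. t ` A) ` {t\<in>?P. t ` A \<in> Q}"
    then show "e \<in> rsets c U (\<rho> ` A) \<inter> Q" using bij_betwE[OF b] by auto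
  next
    fix e assume e: "e \<in> rsets c U (\<rho> ` A) \<inter> Q"
    then have "e \<in> (\<lambda>t. t ` A) ` ?P" using b by (simp add: bij_betw_def)
    then obtain t where "t \<in> ?P" "e = t ` A" by (rule imageE)
    then show "e \<in> (\<lambda>t. t ` A) ` {t\<in>?P. t ` A \<in> Q}" using e by blast
  qed
  have "bij_betw (\<lambda>t. t ` A) {t\<in>?P. t ` A \<in> Q} (rsets c U (\<rho> ` A) \<inter> Q)"
    by (rule bij_betw_subset[OF b _ im]) auto
  then have "(\<Sum>e\<in>rsets c U (\<rho> ` A) \<inter> Q. prod x e) = (\<Sum>t\<in>{t\<in>?P. t ` A \<in> Q}. prod x (t ` A))"
    by (rule sum.reindex_bij_betw[symmetric])
  also have "\<dots> = (\<Sum>t\<in>{t\<in>?P. t ` A \<in> Q}. \<Prod>j\<in>A. x (t j))"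
  proof (rule sum.cong)
    fix t assume "t \<in> {t\<in>?P. t ` A \<in> Q}"
    then have t: "c (t j) = \<rho> j" if "j \<in> A" for j using that by (auto simp: cls_def PiE_iff)
    have "inj_on t A"
      by (rule inj_onI) (metis assms inj_onD t)
    then show "prod x (t ` A) = (\<Prod>j\<in>A. x (t j))" by (simp add: prod.reindex)
  qed simp
  finally show ?thesis by simp
qed

lemma sum_rsets:
  fixes x :: "'v \<Rightarrow> real"
  assumes "finite I" and U: "finite U"
  shows "(\<Sum>e\<in>rsets c U I. prod x e) = (\<Prod>i\<in>I. \<Sum>v\<in>cls c U i. x v)"
proof -
  have "(\<Prod>i\<in>I. \<Sum>v\<in>cls c U i. x v) = (\<Sum>t\<in>PiE I (cls c U). \<Prod>i\<in>I. x (t i))"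
    by (rule prod_sum_PiE) (use assms finite_cls in auto)
  also have "\<dots> = (\<Sum>e\<in>rsets c U I. prod x e)"
    using sum_PiE_rsets[where \<rho>="\<lambda>i. i" and A=I and c=c and U=U and Q=UNIV and x=x] by simp
  finally show ?thesis by simp
qed

section \<open>Independence and union bounds for product weights\<close>

lemma sum_PiE_Un:
  fixes f g :: "('j \<Rightarrow> 'v) \<Rightarrow> real"
  assumes "A \<inter> B = {}"
  shows "(\<Sum>s\<in>PiE (A \<union> B) V. f (restrict s A) * g (restrict s B)) = (\<Sum>t\<in>PiE A V. f t) * (\<Sum>t\<in>PiE B V. g t)"
proof -
  have "(\<Sum>t\<in>PiE A V. f t) * (\<Sum>t\<in>PiE B V. g t) = (\<Sum>(s, t)\<in>PiE A V \<times> PiE B V. f s * g t)"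
    by (simp add: sum_product sum.cartesian_product)
  also have "\<dots> = (\<Sum>s\<in>PiE (A \<union> B) V. f (restrict s A) * g (restrict s B))"
  proof (rule sum.reindex_bij_witness[of _ "\<lambda>s. (restrict s A, restrict s B)" "merge A B"], goal_cases)
    case (1 a)
    then show ?case using assms
      by (auto simp: PiE_iff split: prod.splits)
  next
    case (2 a)
    then show ?case using assms by (auto simp: PiE_iff merge_def extensional_def split: prod.splits)
  next
    case (3 b)
    then show ?case using assms by (auto simp: PiE_iff)
  next
    case (4 b)
    then show ?case by auto
  next
    case (5 a)
    then show ?case using assms by (auto simp: PiE_iff)
  qed
  finally show ?thesis by simp
qed

lemma sum_PiE_blocks:
  fixes \<phi> :: "'j set \<Rightarrow> ('j \<Rightarrow> 'v) \<Rightarrow> real"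
  assumes "finite BB" "pairwise disjnt BB"
  shows "(\<Sum>s\<in>PiE (\<Union>BB) V. \<Prod>B\<in>BB. \<phi> B (restrict s B)) = (\<Prod>B\<in>BB. \<Sum>t\<in>PiE B V. \<phi> B t)"
  using assms
proof (induction BB rule: finite_induct)
  case empty
  then show ?case by simp
next
  case (insert B BB)
  have disj: "B \<inter> \<Union>BB = {}" using insert by (auto simp: pairwise_insert disjnt_def)
  have "(\<Sum>s\<in>PiE (\<Union>(insert B BB)) V. \<Prod>C\<in>insert B BB. \<phi> C (restrict s C))
      = (\<Sum>s\<in>PiE (B \<union> \<Union>BB) V. \<phi> B (restrict s B) * (\<Prod>C\<in>BB. \<phi> C (restrict (restrict s (\<Union>BB)) C)))"
  proof (rule sum.cong)
    fix s :: "'j \<Rightarrow> 'v"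
    have "restrict (restrict s (\<Union>BB)) C = restrict s C" if "C \<in> BB" for C
      using that by (auto simp: restrict_def fun_eq_iff)
    then show "(\<Prod>C\<in>insert B BB. \<phi> C (restrict s C)) =
      \<phi> B (restrict s B) * (\<Prod>C\<in>BB. \<phi> C (restrict (restrict s (\<Union>BB)) C))"
      using insert by (simp cong: prod.cong)
  qed simp
  also have "\<dots> = (\<Sum>t\<in>PiE B V. \<phi> B t) * (\<Sum>t\<in>PiE (\<Union>BB) V. \<Prod>C\<in>BB. \<phi> C (restrict t C))"
    by (rule sum_PiE_Un[OF disj])
  also have "(\<Sum>t\<in>PiE (\<Union>BB) V. \<Prod>C\<in>BB. \<phi> C (restrict t C)) = (\<Prod>C\<in>BB. \<Sum>t\<in>PiE C V. \<phi> C t)"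
    by (rule insert.IH) (use insert.prems in \<open>simp add: pairwise_insert\<close>)
  finally show ?case using insert by simp
qed

text \<open>The coordinates outside \<open>A\<close> are summed out. Each carries total weight at
  most 1, not exactly 1, hence an inequality.\<close>

lemma sum_PiE_event:
  fixes x :: "'v \<Rightarrow> real"
  assumes J: "finite J" and V: "\<And>j. j \<in> J \<Longrightarrow> finite (V j)" "\<And>j v. j \<in> J \<Longrightarrow> v \<in> V j \<Longrightarrow> 0 \<le> x v"
    "\<And>j. j \<in> J \<Longrightarrow> (\<Sum>v\<in>V j. x v) \<le> 1" and A: "A \<subseteq> J"
  shows "(\<Sum>s\<in>{s\<in>PiE J V. Q (restrict s A)}. \<Prod>j\<in>J. x (s j)) \<le> (\<Sum>t\<in>{t\<in>PiE A V. Q t}. \<Prod>j\<in>A. x (t j))"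
proof -
  have fin: "finite A" "finite (J - A)" "finite (PiE J V)" "finite (PiE A V)"
    using J A finite_subset V(1) by (auto intro!: finite_PiE)
  let ?f = "\<lambda>t. if Q t then \<Prod>j\<in>A. x (t j) else 0" and ?g = "\<lambda>t. \<Prod>j\<in>J - A. x (t j)"
  have "(\<Sum>s\<in>{s\<in>PiE J V. Q (restrict s A)}. \<Prod>j\<in>J. x (s j))
     = (\<Sum>s\<in>PiE J V. if Q (restrict s A) then \<Prod>j\<in>J. x (s j) else 0)"
    using fin(3) by (simp add: sum.If_cases Int_def)
  also have "\<dots> = (\<Sum>s\<in>PiE (A \<union> (J - A)) V. ?f (restrict s A) * ?g (restrict s (J - A)))"
  proof (rule sum.cong)
    show "PiE J V = PiE (A \<union> (J - A)) V" using A by (simp add: Un_absorb1)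
    fix s
    have "(\<Prod>j\<in>J. x (s j)) = (\<Prod>j\<in>A. x (s j)) * (\<Prod>j\<in>J - A. x (s j))"
      using J A by (metis prod.subset_diff mult.commute)
    then show "(if Q (restrict s A) then \<Prod>j\<in>J. x (s j) else 0) = ?f (restrict s A) * ?g (restrict s (J - A))"
      by (auto intro!: arg_cong2[where f="(*)"] prod.cong)
  qed
  also have "\<dots> = (\<Sum>t\<in>PiE A V. ?f t) * (\<Sum>t\<in>PiE (J - A) V. ?g t)"
    by (rule sum_PiE_Un) auto
  also have "(\<Sum>t\<in>PiE (J - A) V. ?g t) = (\<Prod>j\<in>J - A. \<Sum>v\<in>V j. x v)"
    by (rule prod_sum_PiE[symmetric]) (use fin V in auto)
  also have "(\<Sum>t\<in>PiE A V. ?f t) * (\<Prod>j\<in>J - A. \<Sum>v\<in>V j. x v) \<le> (\<Sum>t\<in>PiE A V. ?f t) * 1"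
  proof (rule mult_left_mono)
    show "(\<Prod>j\<in>J - A. \<Sum>v\<in>V j. x v) \<le> 1"
      by (rule prod_le_1) (use V in \<open>auto intro!: sum_nonneg\<close>)
    show "0 \<le> (\<Sum>t\<in>PiE A V. ?f t)"
    proof (rule sum_nonneg)
      fix t assume t: "t \<in> PiE A V"
      show "0 \<le> ?f t"
        using t A V(2) by (auto intro!: prod_nonneg simp: PiE_iff)
    qed
  qed
  also have "(\<Sum>t\<in>PiE A V. ?f t) * 1 = (\<Sum>t\<in>{t\<in>PiE A V. Q t}. \<Prod>j\<in>A. x (t j))"
    using fin(4) by (simp add: sum.If_cases Int_def)
  finally show ?thesis .
qed

text \<open>Union bound for a random choice of representatives: each block succeeds with probability at least
  \<open>\<eta>\<close>, independently of the others, and the exceptional events have small total probability.\<close>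

lemma sampling:
  fixes x :: "'v \<Rightarrow> real"
  assumes J: "finite J" and V: "\<And>j. j \<in> J \<Longrightarrow> finite (V j)" "\<And>j v. j \<in> J \<Longrightarrow> v \<in> V j \<Longrightarrow> 0 \<le> x v"
    "\<And>j. j \<in> J \<Longrightarrow> (\<Sum>v\<in>V j. x v) \<le> 1"
    and BB: "finite BB" "pairwise disjnt BB" "\<Union>BB = J"
    and pos: "0 \<le> \<eta>" "\<And>B. B \<in> BB \<Longrightarrow> \<eta> \<le> (\<Sum>t\<in>{t\<in>PiE B V. P B t}. \<Prod>j\<in>B. x (t j))"
    and N: "finite N" "\<And>n. n \<in> N \<Longrightarrow> A n \<subseteq> J"
      "\<And>n. n \<in> N \<Longrightarrow> (\<Sum>t\<in>{t\<in>PiE (A n) V. Q n t}. \<Prod>j\<in>A n. x (t j)) \<le> \<tau> n"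
    and less: "sum \<tau> N < \<eta> ^ card BB"
  obtains s where "s \<in> PiE J V" "\<And>B. B \<in> BB \<Longrightarrow> P B (restrict s B)" "\<And>n. n \<in> N \<Longrightarrow> \<not> Q n (restrict s (A n))"
proof (rule ccontr)
  assume no: "\<not> thesis"
  have finB: "finite B" "finite (PiE B V)" if "B \<in> BB" for B
  proof -
    have "B \<subseteq> J" using that BB by auto
    then show "finite B" "finite (PiE B V)" using J V(1) finite_subset by (auto intro!: finite_PiE)
  qed
  have finJ: "finite (PiE J V)" using J V(1) by (auto intro!: finite_PiE)
  let ?\<phi> = "\<lambda>B t. if P B t then \<Prod>j\<in>B. x (t j) else 0"
  have nn: "0 \<le> (\<Prod>j\<in>J. x (s j))" if "s \<in> PiE J V" for s
    using that V(2) by (auto intro!: prod_nonneg simp: PiE_iff)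
  have "\<eta> ^ card BB = (\<Prod>B\<in>BB. \<eta>)" by simp
  also have "\<dots> \<le> (\<Prod>B\<in>BB. \<Sum>t\<in>PiE B V. ?\<phi> B t)"
    by (rule prod_mono) (use pos finB in \<open>simp add: sum.If_cases Int_def\<close>)
  also have "\<dots> = (\<Sum>s\<in>PiE J V. \<Prod>B\<in>BB. ?\<phi> B (restrict s B))"
    using sum_PiE_blocks[OF BB(1,2), of ?\<phi> V] BB(3) by simp
  \<comment> \<open>If the claim failed, every choice that succeeds on all blocks would trigger some
    exceptional event and be counted on the right.\<close>
  also have "\<dots> \<le> (\<Sum>s\<in>PiE J V. \<Sum>n\<in>N. if Q n (restrict s (A n)) then \<Prod>j\<in>J. x (s j) else 0)"
  proof (rule sum_mono)
    fix s assume s: "s \<in> PiE J V"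
    show "(\<Prod>B\<in>BB. ?\<phi> B (restrict s B)) \<le> (\<Sum>n\<in>N. if Q n (restrict s (A n)) then \<Prod>j\<in>J. x (s j) else 0)"
    proof (cases "\<forall>B\<in>BB. P B (restrict s B)")
      case False
      then have "(\<Prod>B\<in>BB. ?\<phi> B (restrict s B)) = 0" using BB(1) by (auto intro!: prod_zero)
      then show ?thesis using nn[OF s] by (auto intro!: sum_nonneg)
    next
      case True
      then have "\<exists>n\<in>N. Q n (restrict s (A n))" using no that s by blast
      then obtain n where n: "n \<in> N" "Q n (restrict s (A n))" by blast
      have "(\<Prod>B\<in>BB. ?\<phi> B (restrict s B)) = (\<Prod>B\<in>BB. \<Prod>j\<in>B. x (s j))"
        using True by (auto intro!: prod.cong)
      also have "\<dots> = (\<Prod>j\<in>J. x (s j))"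
        using prod.Union_disjoint[of BB "\<lambda>j. x (s j)"] finB BB(2,3) by (auto simp: pairwise_def disjnt_def)
      also have "\<dots> = (\<Sum>n\<in>{n}. if Q n (restrict s (A n)) then \<Prod>j\<in>J. x (s j) else 0)"
        using n by simp
      also have "\<dots> \<le> (\<Sum>n\<in>N. if Q n (restrict s (A n)) then \<Prod>j\<in>J. x (s j) else 0)"
        by (rule sum_mono2) (use N n nn[OF s] in auto)
      finally show ?thesis .
    qed
  qed
  also have "\<dots> = (\<Sum>n\<in>N. \<Sum>s\<in>{s\<in>PiE J V. Q n (restrict s (A n))}. \<Prod>j\<in>J. x (s j))"
    by (subst sum.swap) (use finJ in \<open>simp add: sum.If_cases Int_def\<close>)
  also have "\<dots> \<le> sum \<tau> N"
  proof (rule sum_mono)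
    fix n assume n: "n \<in> N"
    have "(\<Sum>s\<in>{s\<in>PiE J V. Q n (restrict s (A n))}. \<Prod>j\<in>J. x (s j)) \<le> (\<Sum>t\<in>{t\<in>PiE (A n) V. Q n t}. \<Prod>j\<in>A n. x (t j))"
      by (rule sum_PiE_event[OF J V N(2)[OF n]]) auto
    then show "(\<Sum>s\<in>{s\<in>PiE J V. Q n (restrict s (A n))}. \<Prod>j\<in>J. x (s j)) \<le> \<tau> n"
      using N(3)[OF n] by linarith
  qed
  finally show False using less by simp
qed

text \<open>Once one representative is fixed, the other must be the same vertex, which has weight at
  most \<kappa>.\<close>

lemma collision_sum:
  fixes x :: "'v \<Rightarrow> real"
  assumes ij: "i \<noteq> j" and V: "finite (V i)" "finite (V j)" "\<And>v. v \<in> V i \<Longrightarrow> 0 \<le> x v" "\<And>v. v \<in> V j \<Longrightarrow> 0 \<le> x v \<and> x v \<le> \<kappa>"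
    "(\<Sum>v\<in>V i. x v) \<le> 1" and "0 \<le> \<kappa>"
  shows "(\<Sum>t\<in>{t\<in>PiE {i, j} V. t i = t j}. \<Prod>l\<in>{i, j}. x (t l)) \<le> \<kappa>"
proof -
  let ?T = "{t\<in>PiE {i, j} V. t i = t j}"
  have tV: "t i \<in> V i" "t j \<in> V j" if "t \<in> ?T" for t using that by (auto simp: PiE_iff)
  have fin: "finite ?T" using V by (auto intro!: finite_subset[OF _ finite_PiE[of "{i, j}" V]])
  have "(\<Sum>t\<in>?T. \<Prod>l\<in>{i, j}. x (t l)) \<le> (\<Sum>t\<in>?T. \<kappa> * x (t i))"
  proof (rule sum_mono)
    fix t assume "t \<in> ?T"
    then have "x (t i) * x (t j) \<le> x (t i) * \<kappa>" using tV V by (intro mult_left_mono) auto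
    then show "(\<Prod>l\<in>{i, j}. x (t l)) \<le> \<kappa> * x (t i)" using ij by (simp add: mult.commute)
  qed
  also have "\<dots> = (\<Sum>v\<in>(\<lambda>t. t i) ` ?T. \<kappa> * x v)"
  proof (rule sum.reindex[symmetric, unfolded comp_def])
    show "inj_on (\<lambda>t. t i) ?T"
    proof (rule inj_onI)
      fix s t assume s: "s \<in> ?T" and t: "t \<in> ?T" and eq: "s i = t i"
      show "s = t"
        by (rule PiE_ext[of s "{i, j}" V]) (use s t eq in auto)
    qed
  qed
  also have "\<dots> \<le> (\<Sum>v\<in>V i. \<kappa> * x v)"
    by (rule sum_mono2) (use V tV assms in auto)
  also have "\<dots> = \<kappa> * (\<Sum>v\<in>V i. x v)" by (simp add: sum_distrib_left)
  also have "\<dots> \<le> \<kappa> * 1" by (intro mult_left_mono) (use assms in auto)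
  finally show ?thesis by simp
qed

lemma hit_sum:
  fixes x :: "'v \<Rightarrow> real"
  assumes "0 \<le> \<kappa>" "\<And>v. v \<in> V j \<Longrightarrow> x v \<le> \<kappa>"
  shows "(\<Sum>t\<in>{t\<in>PiE {j} V. t j = w}. \<Prod>l\<in>{j}. x (t l)) \<le> \<kappa>"
proof -
  let ?T = "{t\<in>PiE {j} V. t j = w}"
  have "?T \<subseteq> {\<lambda>l\<in>{j}. w}" by (auto simp: PiE_iff extensional_def restrict_def)
  then have "?T = {} \<or> ?T = {\<lambda>l\<in>{j}. w}" by (rule subset_singletonD)
  then show ?thesis
  proof
    assume "?T = {}"
    then show ?thesis using assms by (simp only: sum.empty)
  next
    assume T: "?T = {\<lambda>l\<in>{j}. w}"
    then have "(\<lambda>l\<in>{j}. w) \<in> ?T" by blast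
    then have "w \<in> V j" by (auto simp: PiE_iff)
    then show ?thesis unfolding T using assms by simp
  qed
qed

text \<open>Collisions between representatives, and hits of \<open>W\<close>, join the exceptional
  events. Bounding them needs all weights to be at most \<kappa>, so injectivity is promised only
  under that proviso; otherwise plain \<open>sampling\<close> suffices.\<close>

lemma sampling_inj:
  fixes x :: "'v \<Rightarrow> real" and J :: "'j set" and N :: "'n set"
  assumes J: "finite J" and V: "\<And>j. j \<in> J \<Longrightarrow> finite (V j)" "\<And>j v. j \<in> J \<Longrightarrow> v \<in> V j \<Longrightarrow> 0 \<le> x v"
    "\<And>j. j \<in> J \<Longrightarrow> (\<Sum>v\<in>V j. x v) \<le> 1"
    and BB: "finite BB" "pairwise disjnt BB" "\<Union>BB = J"
    and pos: "0 \<le> \<eta>" "\<And>B. B \<in> BB \<Longrightarrow> \<eta> \<le> (\<Sum>t\<in>{t\<in>PiE B V. P B t}. \<Prod>j\<in>B. x (t j))"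
    and N: "finite N" "\<And>n. n \<in> N \<Longrightarrow> A n \<subseteq> J"
      "\<And>n. n \<in> N \<Longrightarrow> (\<Sum>t\<in>{t\<in>PiE (A n) V. Q n t}. \<Prod>j\<in>A n. x (t j)) \<le> \<tau>"
    and \<kappa>: "0 \<le> \<kappa>" and W: "finite W"
    and less: "real (card N) * \<tau> + real (card J * card J + card J * card W) * \<kappa> < \<eta> ^ card BB"
  obtains s where "s \<in> PiE J V" "\<And>B. B \<in> BB \<Longrightarrow> P B (restrict s B)" "\<And>n. n \<in> N \<Longrightarrow> \<not> Q n (restrict s (A n))"
    "(\<And>j v. j \<in> J \<Longrightarrow> v \<in> V j \<Longrightarrow> x v \<le> \<kappa>) \<Longrightarrow> inj_on s J \<and> s ` J \<inter> W = {}"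
proof (cases "\<forall>j\<in>J. \<forall>v\<in>V j. x v \<le> \<kappa>")
  case False
  have "0 \<le> real (card J * card J + card J * card W) * \<kappa>" using \<kappa> by simp
  then have l: "(\<Sum>n\<in>N. \<tau>) < \<eta> ^ card BB" using less by simp
  show thesis
    by (rule sampling[OF J V BB pos N l]) (use that False in blast)+
next
  case True
  define PJ where "PJ = {(i, j). i \<in> J \<and> j \<in> J \<and> i \<noteq> j}"
  have PJ: "PJ \<subseteq> J \<times> J" by (auto simp: PJ_def)
  then have finPJ: "finite PJ" using J finite_subset by blast
  have cPJ: "card PJ \<le> card J * card J" using card_mono[OF _ PJ] J by (simp add: card_cartesian_product)
  define N' where "N' = Inl ` N \<union> Inr ` (Inl ` PJ \<union> Inr ` (J \<times> W))"
  define A' where "A' n = (case n of Inl n \<Rightarrow> A n | Inr (Inl (i, j)) \<Rightarrow> {i, j} | Inr (Inr (j, w)) \<Rightarrow> {j})"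
    for n :: "'n + ('j \<times> 'j + 'j \<times> 'v)"
  define Q' where "Q' n t = (case n of Inl n \<Rightarrow> Q n t | Inr (Inl (i, j)) \<Rightarrow> t i = t j | Inr (Inr (j, w)) \<Rightarrow> t j = w)"
    for n :: "'n + ('j \<times> 'j + 'j \<times> 'v)" and t
  define \<tau>' where "\<tau>' n = (case n of Inl n \<Rightarrow> \<tau> | Inr _ \<Rightarrow> \<kappa>)" for n :: "'n + ('j \<times> 'j + 'j \<times> 'v)"
  have "sum \<tau>' N' = (\<Sum>n\<in>Inl ` N. \<tau>' n) + (\<Sum>n\<in>Inr ` (Inl ` PJ \<union> Inr ` (J \<times> W)). \<tau>' n)"
    unfolding N'_def by (rule sum.union_disjoint) (use N finPJ J W in auto)
  also have "(\<Sum>n\<in>Inl ` N. \<tau>' n) = real (card N) * \<tau>" by (simp add: sum.reindex \<tau>'_def)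
  also have "(\<Sum>n\<in>Inr ` (Inl ` PJ \<union> Inr ` (J \<times> W)). \<tau>' n) = real (card (Inl ` PJ \<union> Inr ` (J \<times> W))) * \<kappa>"
    by (simp add: sum.reindex \<tau>'_def)
  also have "\<dots> \<le> real (card J * card J + card J * card W) * \<kappa>"
  proof (intro mult_right_mono \<kappa>)
    have "card (Inl ` PJ \<union> Inr ` (J \<times> W)) \<le> card (Inl ` PJ :: ('j \<times> 'j + 'j \<times> 'v) set) + card (Inr ` (J \<times> W) :: ('j \<times> 'j + 'j \<times> 'v) set)"
      by (rule card_Un_le)
    also have "\<dots> \<le> card J * card J + card J * card W"
      using cPJ by (simp add: card_image card_cartesian_product)
    finally show "real (card (Inl ` PJ \<union> Inr ` (J \<times> W))) \<le> real (card J * card J + card J * card W)" by linarith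
  qed
  finally have l: "sum \<tau>' N' < \<eta> ^ card BB" using less by linarith
  have finN': "finite N'" unfolding N'_def using N finPJ J W by auto
  have A': "A' n \<subseteq> J" if "n \<in> N'" for n
    using that unfolding N'_def A'_def PJ_def by (auto intro: subsetD[OF N(2)])
  have Q': "(\<Sum>t\<in>{t\<in>PiE (A' n) V. Q' n t}. \<Prod>j\<in>A' n. x (t j)) \<le> \<tau>' n" if n: "n \<in> N'" for n
  proof -
    from n consider n' where "n' \<in> N" "n = Inl n'" | i j where "i \<in> J" "j \<in> J" "i \<noteq> j" "n = Inr (Inl (i, j))"
      | j w where "j \<in> J" "n = Inr (Inr (j, w))"
      unfolding N'_def PJ_def by auto
    then show ?thesis
    proof cases
      case 1
      then show ?thesis using N(3) by (simp add: A'_def Q'_def \<tau>'_def)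
    next
      case 2
      have "(\<Sum>t\<in>{t\<in>PiE {i, j} V. t i = t j}. \<Prod>l\<in>{i, j}. x (t l)) \<le> \<kappa>"
        by (rule collision_sum[OF 2(3)]) (use V 2 True \<kappa> in auto)
      then show ?thesis unfolding 2 A'_def Q'_def \<tau>'_def by simp
    next
      case 3
      have "(\<Sum>t\<in>{t\<in>PiE {j} V. t j = w}. \<Prod>l\<in>{j}. x (t l)) \<le> \<kappa>"
        by (rule hit_sum) (use 3 True \<kappa> in auto)
      then show ?thesis unfolding 3 A'_def Q'_def \<tau>'_def by simp
    qed
  qed
  obtain s where s: "s \<in> PiE J V" "\<And>B. B \<in> BB \<Longrightarrow> P B (restrict s B)" "\<And>n. n \<in> N' \<Longrightarrow> \<not> Q' n (restrict s (A' n))"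
  proof (rule sampling[OF J V BB pos finN' A' Q' l])
    fix s assume "s \<in> PiE J V" "\<And>B. B \<in> BB \<Longrightarrow> P B (restrict s B)" "\<And>n. n \<in> N' \<Longrightarrow> \<not> Q' n (restrict s (A' n))"
    then show thesis by (rule that)
  qed
  show thesis
  proof (rule that[OF s(1,2)])
    show "\<not> Q n (restrict s (A n))" if "n \<in> N" for n
      using s(3)[of "Inl n"] that by (auto simp: N'_def A'_def Q'_def)
    have "s i \<noteq> s j" if "i \<in> J" "j \<in> J" "i \<noteq> j" for i j
      using s(3)[of "Inr (Inl (i, j))"] that by (auto simp: N'_def A'_def Q'_def PJ_def)
    moreover have "s j \<noteq> w" if "j \<in> J" "w \<in> W" for j w
      using s(3)[of "Inr (Inr (j, w))"] that by (auto simp: N'_def A'_def Q'_def)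
    ultimately show "inj_on s J \<and> s ` J \<inter> W = {}" by (auto simp: inj_on_def)
  qed
qed

section \<open>Extending nearly complete multipartite hypergraphs\<close>

context pendant_core
begin

text \<open>The two settings in which embeddings are refuted: homomorphism-free with arbitrary
  weights, as met during symmetrisation, and copy-free with weights so small that random
  representatives can be made distinct, as met for the original hypergraph under uniform
  weights.\<close>

definition avoids :: "real \<Rightarrow> nat set \<Rightarrow> nat set set \<Rightarrow> (nat \<Rightarrow> real) \<Rightarrow> bool" where
  "avoids \<kappa> V E x \<longleftrightarrow> hom_free H E \<or>
     (\<not> contains_copy \<lparr>verts = V, edges = E\<rparr> H \<and> (\<forall>v\<in>V. x v \<le> \<kappa>))"

lemma finite_uncovered: "finite (uncovered_pairs K)"
proof (rule finite_subset)
  show "uncovered_pairs K \<subseteq> Pow (verts K)" by (auto simp: uncovered_pairs_def)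
qed (use fin_K in simp)

lemma finite_verts_H: "finite (verts H)"
  using fin_K finite_uncovered by (simp add: ext_graph_def)

lemma finite_edges_K: "finite (edges K)"
proof (rule finite_subset)
  show "edges K \<subseteq> Pow (verts K)" using K_edge by auto
qed (use fin_K in simp)

lemma finite_edges_H: "finite (edges H)"
proof -
  have "edges H = (\<lambda>e. Core ` e) ` edges K \<union> (\<lambda>P. Core ` P \<union> Aux P ` {..<r-2}) ` uncovered_pairs K"
    by (auto simp: ext_graph_def)
  then show ?thesis using finite_edges_K finite_uncovered by simp
qed

lemma H_edge_cases:
  assumes "e \<in> edges H"
  obtains (core) e' where "e' \<in> edges K" "e = Core ` e'"
  | (aux) P where "P \<in> uncovered_pairs K" "e = Core ` P \<union> Aux P ` {..<r-2}"
  using assms by (auto simp: ext_graph_def)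

lemma aux_edge_in_H: "P \<in> uncovered_pairs K \<Longrightarrow> Core ` P \<union> Aux P ` {..<r-2} \<in> edges H"
  by (auto simp: ext_graph_def)

lemma core_edge_in_H: "e \<in> edges K \<Longrightarrow> Core ` e \<in> edges H"
  by (auto simp: ext_graph_def)

lemma Union_edges_H: "\<Union> (edges H) = verts H"
proof
  show "\<Union> (edges H) \<subseteq> verts H"
  proof
    fix h assume "h \<in> \<Union> (edges H)"
    then obtain e where e: "e \<in> edges H" "h \<in> e" by blast
    from e(1) show "h \<in> verts H"
    proof (cases rule: H_edge_cases)
      case (core e')
      have "e \<subseteq> Core ` verts K" unfolding core(2) using K_edge[OF core(1)] by blast
      then show ?thesis using e by (auto simp: ext_graph_def)
    next
      case (aux P)
      then show ?thesis using e by (auto simp: ext_graph_def uncovered_pairs_def)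
    qed
  qed
  show "verts H \<subseteq> \<Union> (edges H)"
  proof
    fix h assume "h \<in> verts H"
    then consider c where "h = Core c" "c \<in> verts K" | P j where "P \<in> uncovered_pairs K" "j < r - 2" "h = Aux P j"
      by (auto simp: ext_graph_def)
    then show "h \<in> \<Union> (edges H)"
    proof cases
      case 1
      then obtain e where "e \<in> edges K" "c \<in> e" using Union_K by blast
      then show ?thesis using core_edge_in_H 1 by blast
    next
      case 2
      then show ?thesis using aux_edge_in_H by blast
    qed
  qed
qed

lemma in_H_edge:
  assumes "h \<in> verts H"
  obtains e where "e \<in> edges H" "h \<in> e"
  using assms unfolding Union_edges_H[symmetric] by blast

lemma card_H_edge:
  assumes "e \<in> edges H"
  shows "card e = r" "finite e" "e \<subseteq> verts H"
proof -
  show sub: "e \<subseteq> verts H" using assms Union_edges_H by blast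
  then show fin: "finite e" using finite_verts_H finite_subset by blast
  from assms show "card e = r"
  proof (cases rule: H_edge_cases)
    case (core e')
    then show ?thesis using K_edge by (simp add: card_image inj_on_def)
  next
    case (aux P)
    then obtain u v where "P = {u, v}" "u \<noteq> v" by (auto simp: uncovered_pairs_def)
    moreover have "card (Core ` P \<union> Aux P ` {..<r-2}) = card P + (r - 2)"
    proof (subst card_Un_disjoint)
      show "card (Core ` P) + card (Aux P ` {..<r-2}) = card P + (r - 2)"
        by (simp add: card_image inj_on_def)
    qed (use \<open>P = {u, v}\<close> in auto)
    ultimately show ?thesis using aux r2 by simp
  qed
qed

lemma not_avoids:
  assumes E: "unif r V E" and \<psi>: "\<And>e. e \<in> edges H \<Longrightarrow> \<psi> ` e \<in> E"
    and inj: "(\<And>v. v \<in> V \<Longrightarrow> x v \<le> \<kappa>) \<Longrightarrow> inj_on \<psi> (verts H)"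
  shows "\<not> avoids \<kappa> V E x"
proof -
  have "\<psi> ` verts H \<subseteq> V"
    using \<psi> unif_edge[OF E] unfolding Union_edges_H[symmetric] by blast
  then have "(\<And>v. v \<in> V \<Longrightarrow> x v \<le> \<kappa>) \<Longrightarrow> contains_copy \<lparr>verts = V, edges = E\<rparr> H"
    unfolding contains_copy_def using inj \<psi> by auto
  then show ?thesis using \<psi> unfolding avoids_def hom_free_def by auto
qed

lemma aux_colouring:
  assumes "\<And>P. P \<in> uncovered_pairs K \<Longrightarrow> finite (S P) \<and> card (S P) = r - 2"
  obtains \<rho> :: "'a ext_vertex \<Rightarrow> nat" where "\<And>c. \<rho> (Core c) = \<rho>0 c"
    "\<And>P. P \<in> uncovered_pairs K \<Longrightarrow> bij_betw (\<lambda>j. \<rho> (Aux P j)) {..<r-2} (S P)"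
proof -
  have "\<exists>b. bij_betw b {..<r-2} (S P)" if "P \<in> uncovered_pairs K" for P
    using assms[OF that] by (metis bij_betw_iff_card card_lessThan finite_lessThan)
  then obtain b where b: "\<And>P. P \<in> uncovered_pairs K \<Longrightarrow> bij_betw (b P) {..<r-2} (S P)" by metis
  show thesis
    by (rule that[of "\<lambda>h. case h of Core c \<Rightarrow> \<rho>0 c | Aux P j \<Rightarrow> b P j"]) (use b in auto)
qed

text \<open>A pair uses up at most two colours, and \<open>r \<le> m\<close> leaves
  \<open>r - 2\<close> others.\<close>

lemma ex_aux_colours:
  assumes "P \<in> uncovered_pairs K"
  shows "\<exists>S \<subseteq> {..<m}. finite S \<and> card S = r - 2 \<and> S \<inter> \<rho>0 ` P = {}"
proof -
  have P: "finite P" "card P \<le> 2" using assms by (auto simp: uncovered_pairs_def card_insert_if)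
  then have "card (\<rho>0 ` P) \<le> 2" using card_image_le le_trans by blast
  then have "r - 2 \<le> card ({..<m} - \<rho>0 ` P)"
    using diff_card_le_card_Diff[of "\<rho>0 ` P" "{..<m}"] P(1) m_ge by simp
  then obtain S where "S \<subseteq> {..<m} - \<rho>0 ` P" "card S = r - 2" "finite S"
    using obtain_subset_with_card_n by metis
  then show ?thesis by blast
qed

lemma aux_edge_rainbow:
  fixes \<rho> :: "'a ext_vertex \<Rightarrow> nat"
  assumes \<rho>: "\<And>c. \<rho> (Core c) = \<rho>0 c" and b: "bij_betw (\<lambda>j. \<rho> (Aux P j)) {..<r-2} S"
    and P: "inj_on \<rho>0 P" "\<rho>0 ` P \<subseteq> {..<m}" and S: "S \<subseteq> {..<m}" "S \<inter> \<rho>0 ` P = {}"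
  shows "inj_on \<rho> (Core ` P \<union> Aux P ` {..<r-2})" "\<rho> ` (Core ` P \<union> Aux P ` {..<r-2}) \<subseteq> {..<m}"
proof -
  have b2: "inj_on (\<lambda>j. \<rho> (Aux P j)) {..<r-2}" "(\<lambda>j. \<rho> (Aux P j)) ` {..<r-2} = S"
    using b by (auto simp: bij_betw_def)
  have im: "\<rho> ` Core ` P = \<rho>0 ` P" "\<rho> ` Aux P ` {..<r-2} = S"
    using \<rho> b2(2) by (simp_all add: image_image)
  show "inj_on \<rho> (Core ` P \<union> Aux P ` {..<r-2})"
    unfolding inj_on_Un
  proof (intro conjI)
    show "inj_on \<rho> (Core ` P)" using P(1) \<rho> by (auto simp: inj_on_def)
    show "inj_on \<rho> (Aux P ` {..<r-2})" using b2(1) by (auto simp: inj_on_def)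
    show "\<rho> ` (Core ` P - Aux P ` {..<r-2}) \<inter> \<rho> ` (Aux P ` {..<r-2} - Core ` P) = {}"
      using im S(2) by blast
  qed
  show "\<rho> ` (Core ` P \<union> Aux P ` {..<r-2}) \<subseteq> {..<m}"
    unfolding image_Un im using P(2) S(1) by simp
qed

section \<open>Embedding \<open>H\<close> by random representatives\<close>

text \<open>The numerator bounds from below the chance that all blocks succeed. The denominator is
  four times a count of exceptional events: non-edges, collisions, and hits of a set of at most
  \<open>r\<close> vertices; the summand 1 keeps it positive.\<close>

definition thr :: "real \<Rightarrow> real" where
  "thr \<eta> = \<eta> ^ card (verts H) / (4 * real (card (edges H) + 1 + card (verts H) * card (verts H) + card (verts H) * r))"

lemma thr_pos: "0 < \<eta> \<Longrightarrow> 0 < thr \<eta>"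
  unfolding thr_def by (intro divide_pos_pos) (auto intro!: add_pos_nonneg)

lemma thr_less:
  assumes "0 < \<eta>" "\<eta> \<le> 1" "n1 \<le> card (edges H)" "n2 \<le> card (verts H)" "w \<le> r" "n3 \<le> card (verts H)"
  shows "real n1 * thr \<eta> + real (n2 * n2 + n2 * w) * thr \<eta> < \<eta> ^ n3"
proof -
  let ?D = "card (edges H) + 1 + card (verts H) * card (verts H) + card (verts H) * r"
  have "n1 + (n2 * n2 + n2 * w) \<le> ?D"
    using assms mult_le_mono[OF assms(4,4)] mult_le_mono[OF assms(4,5)] by linarith
  then have "real (n1 + (n2 * n2 + n2 * w)) * thr \<eta> \<le> real ?D * thr \<eta>"
    using thr_pos[OF assms(1)] by (meson less_imp_le mult_right_mono of_nat_le_iff)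
  moreover have "real ?D * thr \<eta> = \<eta> ^ card (verts H) / 4"
  proof -
    have "real ?D > 0" by linarith
    moreover have "D * (e / (4 * D)) = e / 4" if "D > 0" for D e :: real using that by simp
    ultimately show ?thesis unfolding thr_def by blast
  qed
  moreover have "\<eta> ^ card (verts H) \<le> \<eta> ^ n3" by (rule power_decreasing) (use assms in auto)
  moreover have "0 < \<eta> ^ n3" using assms by simp
  ultimately have "real (n1 + (n2 * n2 + n2 * w)) * thr \<eta> < \<eta> ^ n3" by linarith
  then show ?thesis by (simp only: of_nat_add distrib_right)
qed

lemma thr_mono: "0 < \<eta> \<Longrightarrow> \<eta> \<le> \<eta>' \<Longrightarrow> thr \<eta> \<le> thr \<eta>'"
  unfolding thr_def by (intro divide_right_mono power_mono) auto

definition frame :: "nat set \<Rightarrow> nat set set \<Rightarrow> (nat \<Rightarrow> real) \<Rightarrow> nat set \<Rightarrow> (nat \<Rightarrow> nat) \<Rightarrow> bool" where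
  "frame V E x U c \<longleftrightarrow> unif r V E \<and> (\<forall>v\<in>V. 0 \<le> x v) \<and> (\<Sum>v\<in>V. x v) \<le> 1 \<and> U \<subseteq> V \<and> (\<forall>v\<in>U. c v < m)"

lemma frame_cls:
  assumes "frame V E x U c"
  shows "finite (cls c U j)" "v \<in> cls c U j \<Longrightarrow> 0 \<le> x v" "(\<Sum>v\<in>cls c U j. x v) \<le> 1"
proof -
  have fin: "finite V" and U: "U \<subseteq> V" and x: "\<forall>v\<in>V. 0 \<le> x v" "(\<Sum>v\<in>V. x v) \<le> 1"
    using assms by (auto simp: frame_def unif_def)
  then show "finite (cls c U j)" using finite_subset finite_cls by blast
  show "0 \<le> x v" if "v \<in> cls c U j" using that U x by (auto simp: cls_def)
  have "(\<Sum>v\<in>cls c U j. x v) \<le> (\<Sum>v\<in>V. x v)"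
    by (rule sum_mono2) (use fin U x in \<open>auto simp: cls_def\<close>)
  then show "(\<Sum>v\<in>cls c U j. x v) \<le> 1" using x by simp
qed

lemma singleton_PiE_sum:
  fixes x :: "nat \<Rightarrow> real"
  assumes "finite (F j)"
  shows "(\<Sum>t\<in>{t\<in>PiE {j} F. True}. \<Prod>l\<in>{j}. x (t l)) = (\<Sum>v\<in>F j. x v)"
  using prod_sum_PiE[of "{j}" F "\<lambda>_. x"] assms by simp

text \<open>Refutes an edge with two vertices that both look like members of class \<open>i\<close>.
  The leaf \<open>l\<close> and a core vertex \<alpha> outside \<open>el\<close> form an uncovered
  pair. They share the colour \<open>i\<close>, their auxiliary edge is laid on \<open>e0\<close>
  itself, and the other \<open>m - 1\<close> core vertices take the other colours.\<close>

lemma pair_embed: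
  assumes fr: "frame V E x U c" and av: "avoids (thr \<eta>) V E x" and \<eta>: "0 < \<eta>" "\<eta> \<le> 1"
    and cl: "\<And>j. j < m \<Longrightarrow> \<eta> \<le> (\<Sum>v\<in>cls c U j. x v)"
    and full: "\<And>I. I \<subseteq> {..<m} \<Longrightarrow> card I = r \<Longrightarrow> (\<Sum>e\<in>rsets c U I - E. prod x e) \<le> thr \<eta>"
    and i: "i < m"
    and full_a: "\<And>I. I \<subseteq> {..<m} - {i} \<Longrightarrow> card I = r - 1 \<Longrightarrow> (\<Sum>e\<in>rsets c U I - link E a. prod x e) \<le> thr \<eta>"
    and full_a': "\<And>I. I \<subseteq> {..<m} - {i} \<Longrightarrow> card I = r - 1 \<Longrightarrow> (\<Sum>e\<in>rsets c U I - link E a'. prod x e) \<le> thr \<eta>"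
    and e0: "e0 \<in> E" "a \<in> e0" "a' \<in> e0" "a \<noteq> a'"
  shows False
proof -
  have E: "unif r V E" and UV: "U \<subseteq> V" using fr by (auto simp: frame_def)
  have ecard: "card e0 = r" "finite e0" using unif_edge[OF E e0(1)] by auto
  have "card el < card (verts K)" using K_edge[OF el(1)] card_K m_ge by simp
  then obtain \<alpha> where \<alpha>: "\<alpha> \<in> verts K" "\<alpha> \<notin> el"
    by (metis K_edge card_mono el(1) leD subsetI)
  have \<alpha>l: "\<alpha> \<noteq> l" using \<alpha> el by auto
  define P0 where "P0 = {\<alpha>, l}"
  have P0: "P0 \<in> uncovered_pairs K"
    unfolding uncovered_pairs_def P0_def covered_def using \<alpha> l_in \<alpha>l leaf by blast
  obtain g where g: "bij_betw g (verts K - {l, \<alpha>}) ({..<m} - {i})"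
  proof -
    have "card (verts K - {l, \<alpha>}) = card ({..<m} - {i})"
      using fin_K card_K l_in \<alpha> \<alpha>l i by (simp add: card_Diff_subset)
    then show thesis using that fin_K by (metis bij_betw_iff_card finite_Diff finite_lessThan)
  qed
  define \<rho>0 where "\<rho>0 c = (if c \<in> {l, \<alpha>} then i else g c)" for c
  have \<rho>0_lt: "\<rho>0 c < m" if "c \<in> verts K" for c
    using g i that bij_betwE[OF g, rule_format, of c] unfolding \<rho>0_def by auto
  have \<rho>0_ne: "\<rho>0 c \<noteq> i" if "c \<in> verts K" "c \<notin> {l, \<alpha>}" for c
    using that bij_betwE[OF g, rule_format, of c] unfolding \<rho>0_def by auto
  have \<rho>0_inj: "inj_on \<rho>0 B" if B: "B \<subseteq> verts K" "\<not> {l, \<alpha>} \<subseteq> B" for B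
  proof (rule inj_onI)
    fix u v assume uv: "u \<in> B" "v \<in> B" "\<rho>0 u = \<rho>0 v"
    show "u = v"
    proof (cases "u \<in> {l, \<alpha>} \<or> v \<in> {l, \<alpha>}")
      case True
      then have "u \<in> {l, \<alpha>} \<and> v \<in> {l, \<alpha>}" using \<rho>0_ne uv B unfolding \<rho>0_def by (metis subsetD)
      then show ?thesis using B uv by auto
    next
      case False
      then have "g u = g v" "u \<in> verts K - {l, \<alpha>}" "v \<in> verts K - {l, \<alpha>}"
        using uv B(1) unfolding \<rho>0_def by auto
      then show ?thesis using bij_betw_imp_inj_on[OF g] by (rule inj_onD[rotated])
    qed
  qed
  obtain S where S: "\<And>P. P \<in> uncovered_pairs K \<Longrightarrow> S P \<subseteq> {..<m} \<and> finite (S P) \<and> card (S P) = r - 2 \<and> S P \<inter> \<rho>0 ` P = {}"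
    using ex_aux_colours[of _ \<rho>0] by metis
  obtain \<rho> :: "'a ext_vertex \<Rightarrow> nat" where \<rho>: "\<And>c. \<rho> (Core c) = \<rho>0 c"
    "\<And>P. P \<in> uncovered_pairs K \<Longrightarrow> bij_betw (\<lambda>j. \<rho> (Aux P j)) {..<r-2} (S P)"
    using aux_colouring[of S \<rho>0] S by metis
  define E0 where "E0 = Core ` P0 \<union> Aux P0 ` {..<r-2}"
  define J where "J = verts H - E0"
  have E0sub: "E0 \<subseteq> verts H" unfolding E0_def using aux_edge_in_H[OF P0] Union_edges_H by blast
  have edge: "inj_on \<rho> e \<and> \<rho> ` e \<subseteq> {..<m} \<and> e \<inter> J = e - {Core l, Core \<alpha>} \<and> \<not> {Core l, Core \<alpha>} \<subseteq> e"
    if e: "e \<in> edges H" "e \<noteq> E0" for e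
    using e(1)
  proof (cases rule: H_edge_cases)
    case (core e')
    have ns: "\<not> {l, \<alpha>} \<subseteq> e'" using leaf[OF core(1)] \<alpha> by auto
    have "inj_on \<rho>0 e'" by (rule \<rho>0_inj) (use K_edge[OF core(1)] ns in auto)
    then have "inj_on \<rho> e" unfolding core(2) inj_on_def using \<rho>(1) by auto
    moreover have "\<rho> ` e \<subseteq> {..<m}" unfolding core(2) using \<rho>(1) \<rho>0_lt K_edge[OF core(1)] by auto
    moreover have "e \<inter> J = e - {Core l, Core \<alpha>}"
      using card_H_edge(3)[OF e(1)] unfolding J_def E0_def P0_def core(2) by auto
    moreover have "\<not> {Core l, Core \<alpha>} \<subseteq> e" unfolding core(2) using ns by auto
    ultimately show ?thesis by blast
  next
    case (aux P)
    have PP0: "P \<noteq> P0" using aux(2) e(2) by (auto simp: E0_def)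
    have Psub: "P \<subseteq> verts K" using aux(1) by (auto simp: uncovered_pairs_def)
    have ns: "\<not> {l, \<alpha>} \<subseteq> P"
      using aux(1) PP0 \<alpha>l unfolding P0_def uncovered_pairs_def by auto
    have "\<rho>0 ` P \<subseteq> {..<m}" using \<rho>0_lt Psub by auto
    then have "inj_on \<rho> e" "\<rho> ` e \<subseteq> {..<m}"
      unfolding aux(2) using aux_edge_rainbow[OF \<rho>(1) \<rho>(2)[OF aux(1)] \<rho>0_inj[OF Psub ns]] S[OF aux(1)] by blast+
    moreover have "e \<inter> J = e - {Core l, Core \<alpha>}"
      using card_H_edge(3)[OF e(1)] PP0 unfolding J_def E0_def aux(2) P0_def by auto
    moreover have "\<not> {Core l, Core \<alpha>} \<subseteq> e" unfolding aux(2) using ns by auto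
    ultimately show ?thesis by blast
  qed
  \<comment> \<open>What the sampled part of \<open>e\<close> has to hit when \<alpha> goes to
    \<open>a\<close> and \<open>l\<close> goes to \<open>a'\<close>: the matching link if
    \<open>e\<close> contains one of them, and \<open>E\<close> otherwise. Only \<open>E0\<close>
    contains both.\<close>
  define T where "T e = (if Core \<alpha> \<in> e then link E a else if Core l \<in> e then link E a' else E)" for e
  let ?V = "\<lambda>j. cls c U (\<rho> j)"
  define N where "N = edges H - {E0}"
  have finJ: "finite J" using finite_verts_H by (simp add: J_def)
  have \<rho>J: "\<rho> h < m" if "h \<in> J" for h
  proof -
    have "h \<in> verts H" using that by (simp only: J_def DiffD1)
    then obtain e where e: "e \<in> edges H" "h \<in> e" by (rule in_H_edge)
    then have ne: "e \<noteq> E0" using that by (auto simp only: J_def)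
    have "\<rho> h \<in> \<rho> ` e" using e(2) by (rule imageI)
    then show ?thesis using edge[OF e(1) ne] by blast
  qed
  have meas: "(\<Sum>t\<in>{t\<in>PiE (e \<inter> J) ?V. t ` (e \<inter> J) \<in> - T e}. \<Prod>j\<in>e \<inter> J. x (t j)) \<le> thr \<eta>" if e: "e \<in> N" for e
  proof -
    have eH: "e \<in> edges H" and ed: "inj_on \<rho> e" "\<rho> ` e \<subseteq> {..<m}" "e \<inter> J = e - {Core l, Core \<alpha>}" "\<not> {Core l, Core \<alpha>} \<subseteq> e"
      using edge e by (auto simp: N_def)
    have fe: "finite e" "card e = r" using card_H_edge[OF eH] by auto
    have inj: "inj_on \<rho> (e \<inter> J)" using ed(1) by (rule inj_on_subset) auto
    have cc: "card (\<rho> ` (e \<inter> J)) = card (e \<inter> J)" by (rule card_image[OF inj])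
    have sub: "\<rho> ` (e \<inter> J) \<subseteq> {..<m}" using ed by auto
    have one: "\<rho> ` (e \<inter> J) \<subseteq> {..<m} - {i} \<and> card (\<rho> ` (e \<inter> J)) = r - 1"
      if b: "b \<in> e" "b = Core \<alpha> \<or> b = Core l" for b
    proof -
      have "e \<inter> J = e - {b}" using ed(3,4) b by auto
      moreover have "\<rho> b = i" using b \<rho>(1) by (auto simp: \<rho>0_def)
      ultimately show ?thesis using cc sub fe b ed(1) by (auto simp: inj_on_def)
    qed
    have "(\<Sum>t\<in>{t\<in>PiE (e \<inter> J) ?V. t ` (e \<inter> J) \<in> - T e}. \<Prod>j\<in>e \<inter> J. x (t j))
        = (\<Sum>f\<in>rsets c U (\<rho> ` (e \<inter> J)) - T e. prod x f)"
      unfolding Diff_eq by (rule sum_PiE_rsets[OF inj])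
    also have "\<dots> \<le> thr \<eta>"
    proof -
      consider "Core \<alpha> \<in> e" | "Core \<alpha> \<notin> e" "Core l \<in> e" | "Core \<alpha> \<notin> e" "Core l \<notin> e" by blast
      then show ?thesis
      proof cases
        case 1
        then show ?thesis using full_a one[of "Core \<alpha>"] by (simp add: T_def)
      next
        case 2
        then show ?thesis using full_a' one[of "Core l"] by (simp add: T_def)
      next
        case 3
        then have "e \<inter> J = e" using ed(3) by auto
        then show ?thesis using 3 full sub cc fe by (simp add: T_def)
      qed
    qed
    finally show ?thesis .
  qed
  have cardBB: "card ((\<lambda>h. {h}) ` J) = card J" by (rule card_image) auto
  have cJ: "card J \<le> card (verts H)" unfolding J_def by (rule card_mono) (use finite_verts_H in auto)
  have cN: "card N \<le> card (edges H)" unfolding N_def by (rule card_mono) (use finite_edges_H in auto)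
  obtain s where s: "s \<in> PiE J ?V" "\<And>e. e \<in> N \<Longrightarrow> \<not> restrict s (e \<inter> J) ` (e \<inter> J) \<in> - T e"
    "(\<And>j v. j \<in> J \<Longrightarrow> v \<in> ?V j \<Longrightarrow> x v \<le> thr \<eta>) \<Longrightarrow> inj_on s J \<and> s ` J \<inter> e0 = {}"
  proof (rule sampling_inj[where J=J and V="?V" and BB="(\<lambda>h. {h}) ` J" and P="\<lambda>B t. True" and x=x and \<eta>=\<eta> and N=N
        and A="\<lambda>e. e \<inter> J" and Q="\<lambda>e t. t ` (e \<inter> J) \<in> - T e" and \<tau>="thr \<eta>" and \<kappa>="thr \<eta>" and W=e0])
    show "real (card N) * thr \<eta> + real (card J * card J + card J * card e0) * thr \<eta> < \<eta> ^ card ((\<lambda>h. {h}) ` J)"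
      unfolding cardBB by (rule thr_less) (use \<eta> cN cJ ecard in auto)
    show "\<eta> \<le> (\<Sum>t\<in>{t\<in>PiE B ?V. True}. \<Prod>j\<in>B. x (t j))" if "B \<in> (\<lambda>h. {h}) ` J" for B
    proof -
      obtain h where h: "h \<in> J" "B = {h}" using \<open>B \<in> _\<close> by auto
      show ?thesis unfolding h(2) using singleton_PiE_sum[of ?V h x] frame_cls(1)[OF fr] cl[OF \<rho>J[OF h(1)]] by simp
    qed
    show "finite N" using finite_edges_H by (simp add: N_def)
  next
    fix s assume s: "s \<in> PiE J ?V" "\<And>n. n \<in> N \<Longrightarrow> \<not> restrict s (n \<inter> J) ` (n \<inter> J) \<in> - T n"
     "(\<And>j v. j \<in> J \<Longrightarrow> v \<in> ?V j \<Longrightarrow> x v \<le> thr \<eta>) \<Longrightarrow> inj_on s J \<and> s ` J \<inter> e0 = {}"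
    show thesis by (rule that[OF s])
  qed (use frame_cls[OF fr] meas finJ ecard(2) less_imp_le[OF thr_pos[OF \<eta>(1)]] less_imp_le[OF \<eta>(1)] in \<open>auto simp: pairwise_def disjnt_def\<close>)
  have sT: "s ` (e \<inter> J) \<in> T e" if "e \<in> N" for e using s(2)[OF that] by simp
  obtain \<beta> where \<beta>: "bij_betw \<beta> {..<r-2} (e0 - {a, a'})"
  proof -
    have "card (e0 - {a, a'}) = r - 2" using e0 ecard by (simp add: card_Diff_subset)
    then show thesis using that ecard by (metis bij_betw_iff_card card_lessThan finite_Diff finite_lessThan)
  qed
  define \<sigma> where "\<sigma> h = (case h of Core c \<Rightarrow> if c = \<alpha> then a else a' | Aux P j \<Rightarrow> \<beta> j)" for h :: "'a ext_vertex"
  have \<sigma>1: "\<sigma> (Core \<alpha>) = a" "\<sigma> (Core l) = a'" "\<And>P j. \<sigma> (Aux P j) = \<beta> j" using \<alpha>l by (auto simp: \<sigma>_def)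
  have \<sigma>E0: "\<sigma> ` E0 = e0"
  proof -
    have "\<sigma> ` E0 = {a, a'} \<union> \<beta> ` {..<r-2}" unfolding E0_def P0_def using \<sigma>1 by (simp add: image_Un image_image)
    then show ?thesis using \<beta> e0 by (auto simp: bij_betw_def)
  qed
  have \<sigma>inj: "inj_on \<sigma> E0"
    by (rule eq_card_imp_inj_on)
      (use \<sigma>E0 ecard card_H_edge[OF aux_edge_in_H[OF P0]] in \<open>auto simp: E0_def[symmetric]\<close>)
  define \<psi> where "\<psi> h = (if h \<in> J then s h else \<sigma> h)" for h
  have "\<not> avoids (thr \<eta>) V E x"
  proof (rule not_avoids[OF E])
    fix e assume e: "e \<in> edges H"
    show "\<psi> ` e \<in> E"
    proof (cases "e = E0")
      case True
      have "\<psi> ` E0 = \<sigma> ` E0" by (rule image_cong) (auto simp: \<psi>_def J_def)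
      then show ?thesis using True \<sigma>E0 e0 by simp
    next
      case False
      then have eN: "e \<in> N" using e by (simp add: N_def)
      have ed: "e \<inter> J = e - {Core l, Core \<alpha>}" "\<not> {Core l, Core \<alpha>} \<subseteq> e" using edge[OF e False] by auto
      have nJ: "Core l \<notin> J" "Core \<alpha> \<notin> J" unfolding J_def E0_def P0_def by auto
      have im: "\<psi> ` (e \<inter> J) = s ` (e \<inter> J)" by (rule image_cong) (auto simp: \<psi>_def)
      consider "Core \<alpha> \<in> e" | "Core \<alpha> \<notin> e" "Core l \<in> e" | "Core \<alpha> \<notin> e" "Core l \<notin> e" by blast
      then show ?thesis
      proof cases
        case 1
        then have "e = insert (Core \<alpha>) (e \<inter> J)" using ed by auto
        then have "\<psi> ` e = insert (\<psi> (Core \<alpha>)) (s ` (e \<inter> J))" using im by (metis image_insert)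
        also have "\<psi> (Core \<alpha>) = a" using nJ \<sigma>1 by (simp add: \<psi>_def)
        finally show ?thesis using sT[OF eN] 1 by (simp add: T_def link_iff)
      next
        case 2
        then have "e = insert (Core l) (e \<inter> J)" using ed by auto
        then have "\<psi> ` e = insert (\<psi> (Core l)) (s ` (e \<inter> J))" using im by (metis image_insert)
        also have "\<psi> (Core l) = a'" using nJ \<sigma>1 by (simp add: \<psi>_def)
        finally show ?thesis using sT[OF eN] 2 by (simp add: T_def link_iff)
      next
        case 3
        then have "e = e \<inter> J" using ed by auto
        then have "\<psi> ` e = s ` (e \<inter> J)" using im by metis
        then show ?thesis using sT[OF eN] 3 by (simp add: T_def)
      qed
    qed
  next
    assume tiny: "\<And>v. v \<in> V \<Longrightarrow> x v \<le> thr \<eta>"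
    have si: "inj_on s J \<and> s ` J \<inter> e0 = {}"
      by (rule s(3)) (use tiny UV in \<open>auto simp: cls_def\<close>)
    have VH: "verts H = J \<union> E0" using E0sub by (auto simp: J_def)
    have i1: "inj_on \<psi> J" using si by (auto simp: \<psi>_def inj_on_def)
    have i2: "inj_on \<psi> E0" using \<sigma>inj by (auto simp: \<psi>_def inj_on_def J_def)
    have "\<psi> ` J = s ` J" "\<psi> ` E0 = e0" using \<sigma>E0 by (auto simp: \<psi>_def J_def)
    then have "\<psi> ` (J - E0) \<inter> \<psi> ` (E0 - J) = {}" using si by blast
    then show "inj_on \<psi> (verts H)" unfolding VH inj_on_Un using i1 i2 by blast
  qed
  then show False using av by simp
qed

text \<open>Refutes a vertex \<open>a\<close> whose link has substantial weight at every colour. The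
  leaf \<open>l\<close> goes to \<open>a\<close>. A pair \<open>{l, u}\<close> needs an edge through
  \<open>a\<close> and the image of \<open>u\<close>, and the type given by \<open>T\<close> for the
  colour of \<open>u\<close> supplies one with probability at least \<eta>.\<close>

lemma extend_embed:
  assumes fr: "frame V E x U c" and av: "avoids (thr \<eta>) V E x" and \<eta>: "0 < \<eta>" "\<eta> \<le> 1"
    and cl: "\<And>j. j < m \<Longrightarrow> \<eta> \<le> (\<Sum>v\<in>cls c U j. x v)"
    and full: "\<And>I. I \<subseteq> {..<m} \<Longrightarrow> card I = r \<Longrightarrow> (\<Sum>e\<in>rsets c U I - E. prod x e) \<le> thr \<eta>"
    and T: "\<And>i. i < m \<Longrightarrow> T i \<subseteq> {..<m} \<and> card (T i) = r - 1 \<and> i \<in> T i \<and>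
         \<eta> \<le> (\<Sum>f\<in>rsets c U (T i) \<inter> link E a. prod x f)"
  shows False
proof -
  have E: "unif r V E" and UV: "U \<subseteq> V" using fr by (auto simp: frame_def)
  have elc: "card (el - {l}) = r - 1" "el - {l} \<subseteq> verts K - {l}"
    using K_edge[OF el(1)] el(2) by auto
  \<comment> \<open>The edge \<open>el\<close> must also land on an edge through \<open>a\<close>,
    so its other vertices are coloured by a type known to occur in the link.\<close>
  obtain g where g: "bij_betw g (verts K - {l}) {..<m}" "g ` (el - {l}) = T 0"
    using ex_bij_betw_subset[of "verts K - {l}" "{..<m}" "el - {l}" "T 0"] fin_K card_K l_in elc T[of 0] m_ge by auto
  have g_lt: "g u < m" if "u \<in> verts K" "u \<noteq> l" for u using bij_betwE[OF g(1)] that by auto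
  have ginj: "inj_on g (verts K - {l})" using g(1) by (simp add: bij_betw_def)
  have un_l: "\<exists>u. P = {l, u} \<and> u \<in> verts K \<and> u \<notin> el \<and> u \<noteq> l" if "P \<in> uncovered_pairs K" "l \<in> P" for P
  proof -
    have "\<exists>u. P = {l, u} \<and> u \<in> verts K \<and> u \<noteq> l \<and> \<not> covered K l u"
    proof (rule uncovered_pair[OF that(1)])
      fix u v assume uv: "P = {u, v}" "u \<noteq> v" "u \<in> verts K" "v \<in> verts K" "\<not> covered K u v"
      have "\<not> covered K v u" "P = {v, u}" using uv by (auto simp: covered_def)
      then show "\<exists>u. P = {l, u} \<and> u \<in> verts K \<and> u \<noteq> l \<and> \<not> covered K l u"
        using uv \<open>l \<in> P\<close> by blast
    qed
    then obtain u where "P = {l, u}" "u \<in> verts K" "u \<noteq> l" "\<not> covered K l u" by blast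
    moreover from this have "u \<notin> el" using el unfolding covered_def by blast
    ultimately show ?thesis by blast
  qed
  have l_un: "{l, u} \<in> uncovered_pairs K" if "u \<in> verts K" "u \<notin> el" for u
    unfolding uncovered_pairs_def covered_def using that l_in leaf el by blast
  \<comment> \<open>For a pair \<open>{l, u}\<close> the auxiliary vertices complete the colour of
    \<open>u\<close> to the type \<open>T (g u)\<close>, since \<open>l\<close> receives no
    colour.\<close>
  have "\<exists>S \<subseteq> {..<m}. finite S \<and> card S = r - 2 \<and> (l \<notin> P \<longrightarrow> S \<inter> g ` P = {}) \<and>
       (\<forall>u. P = {l, u} \<longrightarrow> u \<noteq> l \<longrightarrow> S = T (g u) - {g u})"
    if P: "P \<in> uncovered_pairs K" for P
  proof (cases "l \<in> P")
    case True
    then obtain u where u: "P = {l, u}" "u \<in> verts K" "u \<notin> el" "u \<noteq> l" using un_l[OF P] by blast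
    have "\<And>u'. P = {l, u'} \<Longrightarrow> u' \<noteq> l \<Longrightarrow> u' = u" using u by auto
    moreover have "finite (T (g u))" using T[OF g_lt[OF u(2,4)]] finite_subset by blast
    ultimately show ?thesis using True T[OF g_lt[OF u(2,4)]]
      by (intro exI[of _ "T (g u) - {g u}"]) auto
  next
    case False
    then show ?thesis using ex_aux_colours[OF P, of g] by blast
  qed
  then obtain S where S: "\<And>P. P \<in> uncovered_pairs K \<Longrightarrow> S P \<subseteq> {..<m} \<and> finite (S P) \<and> card (S P) = r - 2 \<and> (l \<notin> P \<longrightarrow> S P \<inter> g ` P = {}) \<and>
       (\<forall>u. P = {l, u} \<longrightarrow> u \<noteq> l \<longrightarrow> S P = T (g u) - {g u})"
    by metis
  obtain \<rho> :: "'a ext_vertex \<Rightarrow> nat" where \<rho>: "\<And>c. \<rho> (Core c) = g c"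
    "\<And>P. P \<in> uncovered_pairs K \<Longrightarrow> bij_betw (\<lambda>j. \<rho> (Aux P j)) {..<r-2} (S P)"
    using aux_colouring[of S g] S by metis
  define J where "J = verts H - {Core l}"
  have finJ: "finite J" using finite_verts_H by (simp add: J_def)
  have lH: "Core l \<in> verts H" using l_in by (simp add: ext_graph_def)
  have edge: "inj_on \<rho> e \<and> \<rho> ` e \<subseteq> {..<m}" if e: "e \<in> edges H" "Core l \<notin> e" for e
    using e(1)
  proof (cases rule: H_edge_cases)
    case (core e')
    then have sub: "e' \<subseteq> verts K - {l}" using K_edge[OF core(1)] e(2) by auto
    then have "inj_on g e'" using ginj inj_on_subset by blast
    then have "inj_on \<rho> e" unfolding core(2) inj_on_def using \<rho>(1) by auto
    moreover have "g u < m" if "u \<in> e'" for u using g_lt sub that by blast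
    then have "\<rho> ` e \<subseteq> {..<m}" unfolding core(2) using \<rho>(1) by auto
    ultimately show ?thesis by blast
  next
    case (aux P)
    have lP: "l \<notin> P" using aux(2) e(2) by auto
    have Psub: "P \<subseteq> verts K - {l}" using aux(1) lP by (auto simp: uncovered_pairs_def)
    have i1: "inj_on g P" using ginj inj_on_subset Psub by blast
    have "g ` P \<subseteq> {..<m}" using g_lt Psub by blast
    then show ?thesis
      unfolding aux(2) using aux_edge_rainbow[OF \<rho>(1) \<rho>(2)[OF aux(1)] i1] S[OF aux(1)] lP by blast
  qed
  define L where "L = {e \<in> edges H. Core l \<in> e}"
  have Lcases: "e = Core ` el \<or> (\<exists>u. u \<in> verts K \<and> u \<notin> el \<and> e = Core ` {l, u} \<union> Aux {l, u} ` {..<r-2})"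
    if "e \<in> L" for e
  proof -
    have e: "e \<in> edges H" "Core l \<in> e" using that by (auto simp: L_def)
    from e(1) show ?thesis
    proof (cases rule: H_edge_cases)
      case (core e')
      then show ?thesis using leaf e(2) by auto
    next
      case (aux P)
      then have "l \<in> P" using e(2) by auto
      then show ?thesis using un_l[OF aux(1)] aux(2) by blast
    qed
  qed
  text \<open>The links of \<open>Core l\<close> in \<open>H\<close> are pairwise disjoint; each of them is mapped to a link of \<open>a\<close>.\<close>
  have blk: "inj_on \<rho> (e - {Core l}) \<and> (\<exists>i<m. \<rho> ` (e - {Core l}) = T i)" if e: "e \<in> L" for e
    using Lcases[OF e]
  proof (elim disjE exE conjE)
    assume e: "e = Core ` el"
    have "e - {Core l} = Core ` (el - {l})" unfolding e by auto
    moreover have "inj_on \<rho> (Core ` (el - {l}))"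
      using inj_on_subset[OF ginj elc(2)] \<rho>(1) by (auto simp: inj_on_def)
    moreover have "\<rho> ` (Core ` (el - {l})) = T 0" using g(2) \<rho>(1) by (simp add: image_image)
    ultimately show ?thesis using m_ge by (metis gr0I not_numeral_le_zero)
  next
    fix u assume u: "u \<in> verts K" "u \<notin> el" and e: "e = Core ` {l, u} \<union> Aux {l, u} ` {..<r-2}"
    have ul: "u \<noteq> l" using u el by auto
    have P: "{l, u} \<in> uncovered_pairs K" by (rule l_un[OF u])
    have gu: "g u < m" using g_lt u ul by blast
    have e': "e - {Core l} = insert (Core u) (Aux {l, u} ` {..<r-2})" unfolding e using ul by auto
    have i2: "inj_on (\<lambda>j. \<rho> (Aux {l, u} j)) {..<r-2}" "(\<lambda>j. \<rho> (Aux {l, u} j)) ` {..<r-2} = T (g u) - {g u}"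
      using \<rho>(2)[OF P] S[OF P] ul by (auto simp: bij_betw_def)
    have "inj_on \<rho> (e - {Core l})"
      unfolding e' inj_on_insert
    proof
      show "inj_on \<rho> (Aux {l, u} ` {..<r-2})" using i2(1) by (auto simp: inj_on_def)
      have "\<rho> ` (Aux {l, u} ` {..<r-2} - {Core u}) \<subseteq> T (g u) - {g u}" unfolding i2(2)[symmetric] by auto
      then show "\<rho> (Core u) \<notin> \<rho> ` (Aux {l, u} ` {..<r-2} - {Core u})" using \<rho>(1) by auto
    qed
    moreover have "\<rho> ` (e - {Core l}) = T (g u)"
      unfolding e' using i2(2) \<rho>(1) T[OF gu] by (auto simp: image_image)
    ultimately show ?thesis using gu by blast
  qed
  define BL where "BL = (\<lambda>e. e - {Core l}) ` L"
  \<comment> \<open>Coordinates outside all links at \<open>l\<close> become singleton blocks, for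
    which only the weight of their class matters.\<close>
  define BB where "BB = BL \<union> (\<lambda>h. {h}) ` (J - \<Union>BL)"
  have finL: "finite L" using finite_edges_H by (simp add: L_def)
  have finBB: "finite BB" using finL finJ by (simp add: BB_def BL_def)
  have BLJ: "B \<subseteq> J" if "B \<in> BL" for B
    using that card_H_edge(3) unfolding BL_def L_def J_def by blast
  have UBB: "\<Union>BB = J" unfolding BB_def using BLJ by auto
  have disjL: "(e - {Core l}) \<inter> (e' - {Core l}) = {}" if "e \<in> L" "e' \<in> L" "e \<noteq> e'" for e e'
  proof -
    have d1: "(Core ` el - {Core l}) \<inter> (Core ` {l, u} \<union> Aux {l, u} ` {..<r-2} - {Core l}) = {}" if "u \<notin> el" for u
      using that by auto
    have d2: "(Core ` {l, u} \<union> Aux {l, u} ` {..<r-2} - {Core l}) \<inter> (Core ` {l, v} \<union> Aux {l, v} ` {..<r-2} - {Core l}) = {}"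
      if "u \<noteq> v" "u \<notin> el" "v \<notin> el" for u v
    proof -
      have "{l, u} \<noteq> {l, v}" using that el by (auto simp: doubleton_eq_iff)
      then show ?thesis using that by auto
    qed
    show ?thesis using Lcases[OF that(1)] Lcases[OF that(2)] that(3) d1 d2 by (metis Int_commute)
  qed
  have disjBB: "pairwise disjnt BB"
    unfolding pairwise_def disjnt_def
  proof (intro ballI impI)
    fix B B' assume BB': "B \<in> BB" "B' \<in> BB" "B \<noteq> B'"
    show "B \<inter> B' = {}"
    proof (cases "B \<in> BL \<and> B' \<in> BL")
      case True
      then obtain e e' where "e \<in> L" "e' \<in> L" "B = e - {Core l}" "B' = e' - {Core l}" unfolding BL_def by blast
      then show ?thesis using disjL BB'(3) by metis
    next
      case False
      then show ?thesis using BB' unfolding BB_def by auto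
    qed
  qed
  have BBne: "{} \<notin> BB"
  proof
    assume "{} \<in> BB"
    then have "{} \<in> BL" by (auto simp: BB_def)
    then obtain e where "e \<in> L" "e \<subseteq> {Core l}" unfolding BL_def by auto
    then have "card e \<le> 1" using card_mono[of "{Core l}" e] by simp
    then show False using card_H_edge(1)[of e] \<open>e \<in> L\<close> r2 by (simp add: L_def)
  qed
  have cJ: "card J \<le> card (verts H)" unfolding J_def by (rule card_mono) (use finite_verts_H in auto)
  have cBB: "card BB \<le> card (verts H)"
  proof -
    have "card BB \<le> card J"
    proof (rule card_inj_on_le[of "\<lambda>B. SOME h. h \<in> B"])
      have some: "(SOME h. h \<in> B) \<in> B" if "B \<in> BB" for B
        using that BBne by (metis all_not_in_conv someI_ex)
      show "inj_on (\<lambda>B. SOME h. h \<in> B) BB"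
      proof (rule inj_onI)
        fix B B' assume "B \<in> BB" "B' \<in> BB" "(SOME h. h \<in> B) = (SOME h. h \<in> B')"
        then show "B = B'" using some disjBB unfolding pairwise_def disjnt_def by (metis disjoint_iff)
      qed
      show "(\<lambda>B. SOME h. h \<in> B) ` BB \<subseteq> J" using some UBB by blast
    qed (rule finJ)
    then show ?thesis using cJ by simp
  qed
  let ?V = "\<lambda>j. cls c U (\<rho> j)"
  define N where "N = {e \<in> edges H. Core l \<notin> e}"
  have NJ: "e \<subseteq> J" if "e \<in> N" for e using that card_H_edge(3) by (auto simp: N_def J_def)
  have \<rho>J: "\<rho> h < m" if "h \<in> J" for h
  proof -
    have "h \<in> verts H" using that by (simp only: J_def DiffD1)
    then obtain e where e: "e \<in> edges H" "h \<in> e" by (rule in_H_edge)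
    show ?thesis
    proof (cases "Core l \<in> e")
      case True
      then have "e \<in> L" using e by (simp add: L_def)
      then obtain i where i: "i < m" "\<rho> ` (e - {Core l}) = T i" using blk by blast
      have "h \<in> e - {Core l}" using e that by (auto simp: J_def)
      then have "\<rho> h \<in> T i" using i by blast
      then show ?thesis using T[OF i(1)] by auto
    next
      case False
      then show ?thesis using edge[OF e(1)] e by auto
    qed
  qed
  have meas: "(\<Sum>t\<in>{t\<in>PiE e ?V. t ` e \<in> - E}. \<Prod>j\<in>e. x (t j)) \<le> thr \<eta>" if e: "e \<in> N" for e
  proof -
    have ed: "inj_on \<rho> e" "\<rho> ` e \<subseteq> {..<m}" "card e = r" using edge[of e] e card_H_edge(1)[of e] by (auto simp: N_def)
    have "(\<Sum>t\<in>{t\<in>PiE e ?V. t ` e \<in> - E}. \<Prod>j\<in>e. x (t j)) = (\<Sum>f\<in>rsets c U (\<rho> ` e) - E. prod x f)"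
      unfolding Diff_eq by (rule sum_PiE_rsets[OF ed(1)])
    also have "\<dots> \<le> thr \<eta>" by (rule full) (use ed card_image in auto)
    finally show ?thesis .
  qed
  have cN: "card N \<le> card (edges H)" unfolding N_def by (rule card_mono) (use finite_edges_H in auto)
  define P where "P B t \<longleftrightarrow> (B \<in> BL \<longrightarrow> t ` B \<in> link E a)" for B and t :: "'a ext_vertex \<Rightarrow> nat"
  have pos: "\<eta> \<le> (\<Sum>t\<in>{t\<in>PiE B ?V. P B t}. \<Prod>j\<in>B. x (t j))" if B: "B \<in> BB" for B
  proof (cases "B \<in> BL")
    case True
    then obtain e where "e \<in> L" "B = e - {Core l}" unfolding BL_def by blast
    then obtain i where i: "inj_on \<rho> B" "i < m" "\<rho> ` B = T i" using blk by blast
    have "(\<Sum>t\<in>{t\<in>PiE B ?V. t ` B \<in> link E a}. \<Prod>j\<in>B. x (t j)) = (\<Sum>f\<in>rsets c U (\<rho> ` B) \<inter> link E a. prod x f)"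
      by (rule sum_PiE_rsets[OF i(1)])
    then show ?thesis using T[OF i(2)] i(3) True by (simp add: P_def)
  next
    case False
    then obtain h where h: "h \<in> J" "B = {h}" using B by (auto simp: BB_def)
    have "{t\<in>PiE B ?V. P B t} = {t\<in>PiE {h} ?V. True}" using False h by (simp add: P_def)
    then show ?thesis
      using singleton_PiE_sum[of ?V h x] frame_cls(1)[OF fr] cl[OF \<rho>J[OF h(1)]] h(2) by simp
  qed
  obtain s where s: "s \<in> PiE J ?V" "\<And>B. B \<in> BB \<Longrightarrow> P B (restrict s B)"
    "\<And>e. e \<in> N \<Longrightarrow> \<not> restrict s e ` e \<in> - E"
    "(\<And>j v. j \<in> J \<Longrightarrow> v \<in> ?V j \<Longrightarrow> x v \<le> thr \<eta>) \<Longrightarrow> inj_on s J \<and> s ` J \<inter> {a} = {}"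
  proof (rule sampling_inj[where J=J and V="?V" and BB=BB and P=P and x=x and \<eta>=\<eta> and N=N
        and A="\<lambda>e. e" and Q="\<lambda>e t. t ` e \<in> - E" and \<tau>="thr \<eta>" and \<kappa>="thr \<eta>" and W="{a}"])
    show "real (card N) * thr \<eta> + real (card J * card J + card J * card {a}) * thr \<eta> < \<eta> ^ card BB"
      by (rule thr_less) (use \<eta> cN cJ cBB r2 in auto)
    show "finite N" using finite_edges_H by (simp add: N_def)
  next
    fix s assume s: "s \<in> PiE J ?V" "\<And>B. B \<in> BB \<Longrightarrow> P B (restrict s B)" "\<And>n. n \<in> N \<Longrightarrow> \<not> restrict s n ` n \<in> - E"
     "(\<And>j v. j \<in> J \<Longrightarrow> v \<in> ?V j \<Longrightarrow> x v \<le> thr \<eta>) \<Longrightarrow> inj_on s J \<and> s ` J \<inter> {a} = {}"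
    show thesis by (rule that[OF s])
  qed (use frame_cls[OF fr] meas NJ finJ finBB disjBB UBB pos less_imp_le[OF thr_pos[OF \<eta>(1)]] less_imp_le[OF \<eta>(1)] in auto)
  define \<psi> where "\<psi> = s(Core l := a)"
  have "\<not> avoids (thr \<eta>) V E x"
  proof (rule not_avoids[OF E])
    fix e assume e: "e \<in> edges H"
    show "\<psi> ` e \<in> E"
    proof (cases "Core l \<in> e")
      case True
      then have "e - {Core l} \<in> BL" using e by (auto simp: BL_def L_def)
      then have "s ` (e - {Core l}) \<in> link E a" using s(2)[of "e - {Core l}"] by (simp add: BB_def P_def)
      then have "insert a (s ` (e - {Core l})) \<in> E" by (simp add: link_iff)
      moreover have "\<psi> ` (e - {Core l}) = s ` (e - {Core l})" by (rule image_cong) (auto simp: \<psi>_def)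
      moreover have "\<psi> ` e = insert (\<psi> (Core l)) (\<psi> ` (e - {Core l}))" using True by blast
      ultimately show ?thesis by (simp add: \<psi>_def)
    next
      case False
      then have "s ` e \<in> E" using s(3)[of e] e by (simp add: N_def)
      moreover have "\<psi> ` e = s ` e" by (rule image_cong) (use False in \<open>auto simp: \<psi>_def\<close>)
      ultimately show ?thesis by simp
    qed
  next
    assume tiny: "\<And>v. v \<in> V \<Longrightarrow> x v \<le> thr \<eta>"
    have si: "inj_on s J \<and> s ` J \<inter> {a} = {}"
      by (rule s(4)) (use tiny UV in \<open>auto simp: cls_def\<close>)
    have VH: "verts H = insert (Core l) J" using lH by (auto simp: J_def)
    have "inj_on \<psi> J" using si by (auto simp: \<psi>_def inj_on_def J_def)
    moreover have "\<psi> (Core l) \<notin> \<psi> ` (J - {Core l})" using si by (auto simp: \<psi>_def)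
    ultimately show "inj_on \<psi> (verts H)" unfolding VH inj_on_insert by blast
  qed
  then show False using av by simp
qed

end

section \<open>The clique on the colours and the types of edges\<close>

definition complete_edges :: "nat \<Rightarrow> 'v set \<Rightarrow> 'v set set" where
  "complete_edges q A = {I. I \<subseteq> A \<and> card I = q}"

lemma unif_complete: "finite A \<Longrightarrow> unif q A (complete_edges q A)"
  by (simp add: unif_def complete_edges_def)

lemma finite_complete: "finite A \<Longrightarrow> finite (complete_edges q A)"
  using unif_complete unif_finite by blast

lemma link_complete:
  assumes "finite A" "i \<in> A" "q \<ge> 1"
  shows "link (complete_edges q A) i = complete_edges (q - 1) (A - {i})"
proof (intro equalityI subsetI)
  fix f assume "f \<in> link (complete_edges q A) i"
  then have f: "i \<notin> f" "insert i f \<subseteq> A" "card (insert i f) = q"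
    unfolding link_iff complete_edges_def by blast+
  have "f \<subseteq> A" using f(2) by simp
  then have "finite f" by (rule finite_subset[OF _ assms(1)])
  then have "card f = q - 1" using f by simp
  moreover have "f \<subseteq> A - {i}" using f by blast
  ultimately show "f \<in> complete_edges (q - 1) (A - {i})" by (simp add: complete_edges_def)
next
  fix f assume "f \<in> complete_edges (q - 1) (A - {i})"
  then have f: "f \<subseteq> A - {i}" "card f = q - 1" unfolding complete_edges_def by blast+
  have "finite f" by (rule finite_subset[OF _ assms(1)]) (use f in auto)
  then have "card (insert i f) = q" using f assms by (subst card_insert_disjoint) auto
  moreover have "insert i f \<subseteq> A" "i \<notin> f" using f assms by auto
  ultimately show "f \<in> link (complete_edges q A) i" by (simp add: link_iff complete_edges_def)
qed

text \<open>An \<open>(r - 2)\<close>-set inside \<open>A\<close> leaves \<open>k - 1\<close>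
  vertices, and the complete graph on these meets the Erdos--Sos bound with equality. Thus the
  sparse bounds apply to the clique on the colours, weighted by the classes.\<close>

lemma complete_sparse:
  assumes "finite A" "card A = k + r - 3" "k \<ge> 3" "r \<ge> 2"
  shows "es_sparse k r (complete_edges r A)"
  unfolding es_sparse_def
proof (intro allI impI, elim conjE)
  fix D S :: "'a set" assume D: "finite D" "card D + 2 = r" "finite S" "D \<inter> S = {}"
  let ?X = "{e\<in>complete_edges r A. D \<subseteq> e \<and> e \<subseteq> D \<union> S}"
  show "2 * card ?X \<le> (k - 2) * card S"
  proof (cases "D \<subseteq> A")
    case False
    then have "\<not> D \<subseteq> e" if "e \<in> complete_edges r A" for e using that by (auto simp: complete_edges_def)
    then have "?X = {}" by blast
    then have "card ?X = 0" by (metis card.empty)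
    then show ?thesis by simp
  next
    case True
    let ?S = "S \<inter> A"
    have fin: "finite ?S" using D by simp
    have "card ?X \<le> card {f. f \<subseteq> ?S \<and> card f = 2}"
    proof (rule card_inj_on_le[of "\<lambda>e. e - D"])
      show "inj_on (\<lambda>e. e - D) ?X" by (rule inj_onI) blast
      show "(\<lambda>e. e - D) ` ?X \<subseteq> {f. f \<subseteq> ?S \<and> card f = 2}"
        using D by (auto simp: complete_edges_def card_Diff_subset)
      show "finite {f. f \<subseteq> ?S \<and> card f = 2}" by (rule finite_subset[OF _ finite_Pow_iff[THEN iffD2, OF fin]]) blast
    qed
    also have "\<dots> = card ?S choose 2" by (rule n_subsets[OF fin])
    finally have 1: "card ?X \<le> card ?S choose 2" .
    have "2 * (card ?S choose 2) = card ?S * (card ?S - 1)"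
    proof -
      have "even (n * (n - 1))" for n :: nat by (cases n) auto
      then show ?thesis unfolding choose_two by (rule dvd_mult_div_cancel)
    qed
    then have "2 * card ?X \<le> card ?S * (card ?S - 1)" using 1 by linarith
    also have "\<dots> \<le> card S * (k - 2)"
    proof (rule mult_le_mono)
      show "card ?S \<le> card S" using D by (intro card_mono) auto
      have "card D + card ?S = card (D \<union> ?S)" using D by (intro card_Un_disjoint[symmetric]) auto
      also have "\<dots> \<le> card A" using assms(1) True by (intro card_mono) auto
      finally show "card ?S - 1 \<le> k - 2" using assms D by linarith
    qed
    finally show ?thesis by (simp add: mult.commute)
  qed
qed

text \<open>Sorting rainbow edges by type; with \<open>lag_complete_cls\<close> this compares a
  multipartite family with the weighted clique on the colours.\<close>

lemma lag_types:
  fixes x :: "'v \<Rightarrow> real"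
  assumes U: "finite U" and A: "finite A"
    and E: "\<And>e. e \<in> E \<Longrightarrow> e \<subseteq> U \<and> card e = q \<and> inj_on c e \<and> c ` e \<subseteq> A"
  shows "lag E x = (\<Sum>I\<in>complete_edges q A. \<Sum>e\<in>rsets c U I \<inter> E. prod x e)"
proof -
  have "E \<subseteq> Pow U" using E by blast
  then have finE: "finite E" using U finite_subset by blast
  have im: "(\<lambda>e. c ` e) ` E \<subseteq> complete_edges q A"
    using E by (fastforce simp: complete_edges_def card_image)
  have eq: "{e\<in>E. c ` e = I} = rsets c U I \<inter> E" for I
    using E unfolding rsets_def by blast
  have "lag E x = (\<Sum>I\<in>complete_edges q A. \<Sum>e\<in>{e\<in>E. c ` e = I}. prod x e)"
    unfolding lag_def by (rule sum.group[OF finE finite_complete[OF A] im, symmetric])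
  then show ?thesis unfolding eq .
qed

lemma lag_complete_cls:
  fixes x :: "'v \<Rightarrow> real"
  assumes U: "finite U" and A: "finite A"
  shows "lag (complete_edges q A) (\<lambda>i. \<Sum>v\<in>cls c U i. x v) = (\<Sum>I\<in>complete_edges q A. \<Sum>e\<in>rsets c U I. prod x e)"
  unfolding lag_def
proof (rule sum.cong)
  fix I assume "I \<in> complete_edges q A"
  then have "finite I" using A finite_subset by (auto simp: complete_edges_def)
  then show "(\<Prod>i\<in>I. \<Sum>v\<in>cls c U i. x v) = (\<Sum>e\<in>rsets c U I. prod x e)" using sum_rsets U by metis
qed simp

lemma sum_cls:
  fixes x :: "'v \<Rightarrow> real"
  assumes "finite U" "\<And>v. v \<in> U \<Longrightarrow> c v < m"
  shows "(\<Sum>i<m. \<Sum>v\<in>cls c U i. x v) = sum x U"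
  unfolding cls_def by (rule sum.group) (use assms in auto)

text \<open>The deficits of the types are nonnegative and add up to at most
  \<open>2 * \<tau>\<close>, so each of them is that small.\<close>

lemma miss_bound:
  fixes x :: "'v \<Rightarrow> real"
  assumes U: "finite U" and A: "finite A" and x: "\<And>v. v \<in> U \<Longrightarrow> 0 \<le> x v"
    and up: "lag (complete_edges q A) (\<lambda>i. \<Sum>v\<in>cls c U i. x v) \<le> B + \<tau>"
    and lo: "B - \<tau> \<le> (\<Sum>I\<in>complete_edges q A. \<Sum>e\<in>rsets c U I \<inter> L. prod x e)"
    and I: "I \<in> complete_edges q A"
  shows "(\<Sum>e\<in>rsets c U I - L. prod x e) \<le> 2 * \<tau>"
proof -
  have fin: "finite (rsets c U J)" for J by (rule finite_rsets[OF U])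
  have nn: "0 \<le> (\<Sum>e\<in>rsets c U J - L. prod x e)" for J
    by (intro sum_nonneg prod_nonneg) (use x in \<open>auto simp: rsets_def\<close>)
  have "(\<Sum>e\<in>rsets c U I - L. prod x e) = (\<Sum>J\<in>{I}. \<Sum>e\<in>rsets c U J - L. prod x e)" by simp
  also have "\<dots> \<le> (\<Sum>J\<in>complete_edges q A. \<Sum>e\<in>rsets c U J - L. prod x e)"
    by (rule sum_mono2) (use finite_complete[OF A] I nn in auto)
  also have "\<dots> = (\<Sum>J\<in>complete_edges q A. (\<Sum>e\<in>rsets c U J. prod x e) - (\<Sum>e\<in>rsets c U J \<inter> L. prod x e))"
  proof (rule sum.cong)
    fix J
    have "(\<Sum>e\<in>rsets c U J. prod x e) = (\<Sum>e\<in>rsets c U J \<inter> L. prod x e) + (\<Sum>e\<in>rsets c U J - L. prod x e)"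
      by (rule sum.Int_Diff[OF fin])
    then show "(\<Sum>e\<in>rsets c U J - L. prod x e) = (\<Sum>e\<in>rsets c U J. prod x e) - (\<Sum>e\<in>rsets c U J \<inter> L. prod x e)" by simp
  qed simp
  also have "\<dots> = lag (complete_edges q A) (\<lambda>i. \<Sum>v\<in>cls c U i. x v) - (\<Sum>J\<in>complete_edges q A. \<Sum>e\<in>rsets c U J \<inter> L. prod x e)"
    by (simp add: sum_subtractf lag_complete_cls[OF U A])
  also have "\<dots> \<le> 2 * \<tau>" using up lo by simp
  finally show ?thesis .
qed

context pendant_core
begin

abbreviation d :: real where "d \<equiv> dens m r"

lemma complete_m_sparse: "finite A \<Longrightarrow> card A = m \<Longrightarrow> es_sparse k r (complete_edges r A)"
  using complete_sparse k3 r2 m_def by blast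

lemma d_pos: "0 < d" "d \<le> 1"
  using dens_pos dens_le_1 m_ge by auto

lemma rd_eq: "real r * d = dens (m - 1) (r - 1) * (1 - 1 / real m) ^ (r - 1)"
  using dens_step m_ge by blast

lemma rd_le_1: "real r * d \<le> 1"
proof -
  have "(1 - 1 / real m) ^ (r - 1) \<le> 1" by (rule power_le_one) (use m_ge in auto)
  moreover have "0 \<le> (1 - 1 / real m) ^ (r - 1)" by (rule zero_le_power) (use m_ge in auto)
  ultimately show ?thesis unfolding rd_eq using mult_mono[OF dens_le_1[of "m - 1" "r - 1"]] by force
qed

section \<open>Nearly complete multipartite structure\<close>

text \<open>The colouring and the degrees refer to the subfamily \<open>E'\<close>, whereas
  \<open>E\<close> is the family to be coloured in the end: in the last application
  \<open>E'\<close> is what cleaning leaves of \<open>E\<close>.\<close>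

definition near_turan ::
  "real \<Rightarrow> nat set \<Rightarrow> nat set set \<Rightarrow> nat set set \<Rightarrow> (nat \<Rightarrow> real) \<Rightarrow> nat set \<Rightarrow> (nat \<Rightarrow> nat) \<Rightarrow> bool" where
  "near_turan \<zeta> V E E' x U c \<longleftrightarrow> frame V E x U c \<and> E' \<subseteq> E \<and> (\<forall>e\<in>E'. e \<subseteq> U \<longrightarrow> inj_on c e) \<and>
     1 - \<zeta> \<le> sum x U \<and> (\<forall>u\<in>U. real r * d - \<zeta> \<le> lag (link E' u) x)"

text \<open>The class weights are a near-optimal weighting of the clique on \<open>m\<close>
  colours. Stability finds \<open>m\<close> coordinates of weight about \<open>1 / m\<close>, and
  these are all the coordinates.\<close>

lemma cls_weights:
  assumes "\<delta> > 0"
  shows "\<exists>\<epsilon>>0. \<forall>V E E' x U c. frame V E x U c \<longrightarrow> E' \<subseteq> E \<longrightarrow> (\<forall>e\<in>E'. e \<subseteq> U \<longrightarrow> inj_on c e) \<longrightarrow>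
     d - \<epsilon> \<le> lag {e\<in>E'. e \<subseteq> U} x \<longrightarrow> (\<forall>j<m. 1 / real m - \<delta> \<le> (\<Sum>v\<in>cls c U j. x v))"
proof -
  obtain \<epsilon> where \<epsilon>: "\<epsilon> > 0" and S: "\<forall>(V :: nat set) E x. unif r V E \<longrightarrow> es_sparse k r E \<longrightarrow> (\<forall>v\<in>V. 0 \<le> x v) \<longrightarrow>
     (\<Sum>v\<in>V. x v) \<le> 1 \<longrightarrow> dens (k + r - 3) r - \<epsilon> \<le> lag E x \<longrightarrow>
     (\<exists>S\<subseteq>V. card S = k + r - 3 \<and> (\<forall>v\<in>S. 1 / real (k + r - 3) - \<delta> \<le> x v))"
    using sparse_stability[OF k3 r2 tame assms, where 'v=nat] by (elim exE conjE) (rule that)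
  show ?thesis
  proof (intro exI[of _ \<epsilon>] conjI allI impI \<epsilon>)
    fix V E E' x U c j
    assume fr: "frame V E x U c" and E': "E' \<subseteq> E" and rb: "\<forall>e\<in>E'. e \<subseteq> U \<longrightarrow> inj_on c e"
      and big: "d - \<epsilon> \<le> lag {e\<in>E'. e \<subseteq> U} x" and j: "j < m"
    have E: "unif r V E" and V: "finite V" and x: "\<And>v. v \<in> V \<Longrightarrow> 0 \<le> x v" "sum x V \<le> 1" and UV: "U \<subseteq> V"
      and cm: "\<And>v. v \<in> U \<Longrightarrow> c v < m"
      using fr by (auto simp: frame_def unif_def)
    have finU: "finite U" using V UV finite_subset by blast
    let ?w = "\<lambda>i. \<Sum>v\<in>cls c U i. x v"
    have nn: "0 \<le> prod x e" if "e \<in> rsets c U I" for e I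
      using that x UV by (auto simp: rsets_def intro!: prod_nonneg)
    have "lag {e\<in>E'. e \<subseteq> U} x = (\<Sum>I\<in>complete_edges r {..<m}. \<Sum>e\<in>rsets c U I \<inter> {e\<in>E'. e \<subseteq> U}. prod x e)"
      by (rule lag_types) (use finU rb cm E' unif_edge[OF E] in auto)
    also have "\<dots> \<le> (\<Sum>I\<in>complete_edges r {..<m}. \<Sum>e\<in>rsets c U I. prod x e)"
      by (intro sum_mono sum_mono2 finite_rsets finU) (use nn in auto)
    also have "\<dots> = lag (complete_edges r {..<m}) ?w" using lag_complete_cls[OF finU, of "{..<m}"] by simp
    finally have "d - \<epsilon> \<le> lag (complete_edges r {..<m}) ?w" using big by simp
    moreover have "sum ?w {..<m} \<le> 1"
    proof -
      have "sum ?w {..<m} = sum x U" by (rule sum_cls[OF finU cm])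
      also have "\<dots> \<le> sum x V" by (rule sum_mono2) (use V UV x in auto)
      finally show ?thesis using x by simp
    qed
    moreover have "\<forall>v\<in>{..<m}. 0 \<le> ?w v" using x UV by (auto intro!: sum_nonneg simp: cls_def)
    moreover have "unif r {..<m} (complete_edges r {..<m})" by (rule unif_complete) simp
    moreover have "es_sparse k r (complete_edges r {..<m})" by (rule complete_m_sparse) auto
    ultimately obtain S where S: "S \<subseteq> {..<m}" "card S = m" "\<forall>v\<in>S. 1 / real m - \<delta> \<le> ?w v"
      using S[rule_format, of "{..<m}" "complete_edges r {..<m}" ?w] unfolding m_def[symmetric] by blast
    have "S = {..<m}" using S by (intro card_subset_eq) auto
    then show "1 / real m - \<delta> \<le> ?w j" using S j by auto
  qed
qed

text \<open>The last clause is meant for vertices not yet in \<open>U\<close>: a link that is nearly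
  as heavy as possible on the types missing \<open>i\<close> is nearly complete on them.\<close>

definition full_frame :: "real \<Rightarrow> nat set set \<Rightarrow> (nat \<Rightarrow> real) \<Rightarrow> nat set \<Rightarrow> (nat \<Rightarrow> nat) \<Rightarrow> bool" where
  "full_frame \<tau> E x U c \<longleftrightarrow>
     (\<forall>j<m. 1 / (2 * real m) \<le> (\<Sum>v\<in>cls c U j. x v)) \<and>
     (\<forall>I. I \<subseteq> {..<m} \<longrightarrow> card I = r \<longrightarrow> (\<Sum>e\<in>rsets c U I - E. prod x e) \<le> \<tau>) \<and>
     (\<forall>u\<in>U. \<forall>I. I \<subseteq> {..<m} - {c u} \<longrightarrow> card I = r - 1 \<longrightarrow> (\<Sum>f\<in>rsets c U I - link E u. prod x f) \<le> \<tau>) \<and>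
     (\<forall>i<m. \<forall>L. real r * d - \<tau> / 2 \<le> (\<Sum>I\<in>complete_edges (r - 1) ({..<m} - {i}). \<Sum>f\<in>rsets c U I \<inter> L. prod x f) \<longrightarrow>
        (\<forall>I. I \<subseteq> {..<m} - {i} \<longrightarrow> card I = r - 1 \<longrightarrow> (\<Sum>f\<in>rsets c U I - L. prod x f) \<le> \<tau>))"

text \<open>Large degrees give near-maximal density inside \<open>U\<close> by Euler's identity. The
  sparse bounds for the clique at the class weights give matching upper bounds, so hardly any
  transversal is missing.\<close>

lemma near_turan_full:
  assumes "\<tau> > 0"
  shows "\<exists>\<zeta>>0. \<forall>V E E' x U c. near_turan \<zeta> V E E' x U c \<longrightarrow>
     full_frame \<tau> E x U c"
proof -
  let ?d' = "dens (m - 1) (r - 1)"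
  have "((\<lambda>t. ?d' * (1 - 1 / real m + t) ^ (r - 1)) \<longlongrightarrow> ?d' * (1 - 1 / real m + 0) ^ (r - 1)) (at_right 0)"
    by (intro tendsto_intros)
  then have "((\<lambda>t. ?d' * (1 - 1 / real m + t) ^ (r - 1)) \<longlongrightarrow> real r * d) (at_right 0)"
    by (simp only: rd_eq add_0_right)
  then have e1: "\<forall>\<^sub>F t in at_right 0. ?d' * (1 - 1 / real m + t) ^ (r - 1) < real r * d + \<tau> / 2"
    using assms by (intro order_tendstoD) auto
  have m2: "0 < 1 / (2 * real m)" using m_ge by simp
  have e2: "\<forall>\<^sub>F t in at_right (0::real). t < 1 / (2 * real m)"
    by (rule order_tendstoD(2)[OF tendsto_ident_at m2])
  have "\<forall>\<^sub>F t in at_right (0::real). t > 0 \<and> ?d' * (1 - 1 / real m + t) ^ (r - 1) < real r * d + \<tau> / 2 \<and> t < 1 / (2 * real m)"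
    using e1 e2 eventually_at_right_less[of "0::real"] by eventually_elim auto
  from eventually_happens'[OF trivial_limit_at_right_real this] obtain \<delta> where
    \<delta>: "\<delta> > 0" "?d' * (1 - 1 / real m + \<delta>) ^ (r - 1) < real r * d + \<tau> / 2" "\<delta> < 1 / (2 * real m)" by auto
  obtain \<epsilon> where \<epsilon>: "\<epsilon> > 0" and CW: "\<forall>V E E' x U c. frame V E x U c \<longrightarrow> E' \<subseteq> E \<longrightarrow> (\<forall>e\<in>E'. e \<subseteq> U \<longrightarrow> inj_on c e) \<longrightarrow>
     d - \<epsilon> \<le> lag {e\<in>E'. e \<subseteq> U} x \<longrightarrow> (\<forall>j<m. 1 / real m - \<delta> \<le> (\<Sum>v\<in>cls c U j. x v))"
    using cls_weights[OF \<delta>(1)] by (elim exE conjE) (rule that)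
  define \<zeta> where "\<zeta> = Min {\<tau> / 8, \<epsilon> / 4, real r * d / 4, 1 / 2}"
  have rd0: "0 < real r * d" using d_pos m_ge by simp
  have \<zeta>: "0 < \<zeta>" "\<zeta> \<le> \<tau> / 8" "\<zeta> \<le> \<epsilon> / 4" "\<zeta> \<le> real r * d / 4" "\<zeta> \<le> 1 / 2"
    unfolding \<zeta>_def using assms \<epsilon> rd0 by auto
  show ?thesis
  proof (intro exI[of _ \<zeta>] conjI[OF \<zeta>(1)] allI impI)
    fix V E E' x U c assume nt: "near_turan \<zeta> V E E' x U c"
    have fr: "frame V E x U c" and E': "E' \<subseteq> E" and rb: "\<forall>e\<in>E'. e \<subseteq> U \<longrightarrow> inj_on c e"
      and xU: "1 - \<zeta> \<le> sum x U" and deg: "\<And>u. u \<in> U \<Longrightarrow> real r * d - \<zeta> \<le> lag (link E' u) x"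
      using nt by (auto simp: near_turan_def)
    have E: "unif r V E" and V: "finite V" and x: "\<And>v. v \<in> V \<Longrightarrow> 0 \<le> x v" "sum x V \<le> 1" and UV: "U \<subseteq> V"
      and cm: "\<And>v. v \<in> U \<Longrightarrow> c v < m"
      using fr by (auto simp: frame_def unif_def)
    have uE': "unif r V E'" by (rule unif_subset[OF E E'])
    have finU: "finite U" using V UV finite_subset by blast
    have xVU: "sum x (V - U) \<le> \<zeta>"
      using x(2) xU by (simp add: sum_diff[OF V UV])
    let ?EU = "{e\<in>E'. e \<subseteq> U}"
    have uEU: "unif r U ?EU" using uE' finU by (auto simp: unif_def)
    have degU: "real r * d - 2 * \<zeta> \<le> lag {f\<in>link E' u. f \<subseteq> U - {u}} x" if u: "u \<in> U" for u
    proof -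
      have V1: "sum x (V - {u}) \<le> 1" using x sum_mono2[OF V, of "V - {u}" x] by force
      have "lag (link E' u) x - sum x ((V - {u}) - (U - {u})) \<le> lag {f\<in>link E' u. f \<subseteq> U - {u}} x"
        by (rule lag_loss[OF unif_link[OF uE'] _ V1]) (use x in auto)
      moreover have "(V - {u}) - (U - {u}) = V - U" using u by auto
      ultimately show ?thesis using deg[OF u] xVU by simp
    qed
    have linkEU: "link ?EU u = {f\<in>link E' u. f \<subseteq> U - {u}}" if "u \<in> U" for u
      using that by (auto simp: link_iff)
    have "real r * lag ?EU x = (\<Sum>u\<in>U. x u * lag (link ?EU u) x)" by (rule lag_euler[OF uEU, symmetric])
    also have "\<dots> \<ge> (\<Sum>u\<in>U. x u * (real r * d - 2 * \<zeta>))"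
      by (intro sum_mono mult_left_mono) (use degU linkEU x UV in auto)
    also have "(\<Sum>u\<in>U. x u * (real r * d - 2 * \<zeta>)) = sum x U * (real r * d - 2 * \<zeta>)" by (simp add: sum_distrib_right)
    finally have "sum x U * (real r * d - 2 * \<zeta>) \<le> real r * lag ?EU x" .
    moreover have "(1 - \<zeta>) * (real r * d - 2 * \<zeta>) \<le> sum x U * (real r * d - 2 * \<zeta>)"
      by (intro mult_right_mono xU) (use \<zeta> in auto)
    moreover have "real r * d - 3 * \<zeta> \<le> (1 - \<zeta>) * (real r * d - 2 * \<zeta>)"
    proof -
      have "\<zeta> * (real r * d) \<le> \<zeta> * 1" by (intro mult_left_mono rd_le_1) (use \<zeta> in auto)
      moreover have "0 \<le> \<zeta> * \<zeta>" by simp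
      moreover have "(1 - \<zeta>) * (real r * d - 2 * \<zeta>) = real r * d - 2 * \<zeta> - \<zeta> * (real r * d) + 2 * (\<zeta> * \<zeta>)"
        by (simp add: algebra_simps)
      ultimately show ?thesis by linarith
    qed
    ultimately have r_lag: "real r * d - 3 * \<zeta> \<le> real r * lag ?EU x" by linarith
    have lagEU: "d - 3 * \<zeta> \<le> lag ?EU x"
    proof -
      have "real r * (d - 3 * \<zeta>) \<le> real r * d - 3 * \<zeta>"
        using \<zeta> m_ge mult_right_mono[of 1 "real r" "3 * \<zeta>"] by (simp add: algebra_simps)
      then have "real r * (d - 3 * \<zeta>) \<le> real r * lag ?EU x" using r_lag by linarith
      then show ?thesis using m_ge by (simp add: mult_le_cancel_left_pos)
    qed
    let ?w = "\<lambda>i. \<Sum>v\<in>cls c U i. x v"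
    have "d - \<epsilon> \<le> lag ?EU x" using lagEU \<zeta> by linarith
    then have w: "1 / real m - \<delta> \<le> ?w j" if "j < m" for j
      using CW[rule_format, OF fr E' _ _ that] rb by blast
    have w0: "0 \<le> ?w j" for j using x UV by (auto intro!: sum_nonneg simp: cls_def)
    have ws: "sum ?w {..<m} \<le> 1"
    proof -
      have "sum ?w {..<m} = sum x U" by (rule sum_cls[OF finU cm])
      also have "\<dots> \<le> sum x V" by (rule sum_mono2) (use V UV x in auto)
      finally show ?thesis using x by simp
    qed
    have c1: "\<forall>j<m. 1 / (2 * real m) \<le> ?w j"
    proof (intro allI impI)
      fix j assume "j < m"
      have "1 / (2 * real m) = 1 / real m - 1 / (2 * real m)" by (simp add: field_simps)
      then show "1 / (2 * real m) \<le> ?w j" using w[OF \<open>j < m\<close>] \<delta>(3) by linarith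
    qed
    let ?C = "complete_edges r {..<m}"
    have uC: "unif r {..<m} ?C" "es_sparse k r ?C" by (rule unif_complete, simp) (rule complete_m_sparse, auto)
    have upC: "lag ?C ?w \<le> d"
    proof -
      have "lag ?C ?w \<le> d * sum ?w {..<m} ^ r"
        using sparse_bound[OF k3 r2 tame uC, of ?w] w0 by (simp add: m_def)
      also have "\<dots> \<le> d * 1"
        by (intro mult_left_mono power_le_one ws sum_nonneg[OF w0]) (use d_pos in auto)
      finally show ?thesis by simp
    qed
    \<comment> \<open>Class \<open>i\<close> weighs at least \<open>1 / m - \<delta>\<close>, which
      limits what is left for its link; \<delta> was chosen by continuity so that the bound exceeds
      \<open>r * d\<close> by at most \<open>\<tau> / 2\<close>.\<close>
    have upL: "lag (complete_edges (r - 1) ({..<m} - {i})) ?w \<le> real r * d + \<tau> / 2" if i: "i < m" for i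
    proof -
      have "lag (link ?C i) ?w \<le> dens (k + r - 4) (r - 1) * (\<Sum>j\<in>{..<m} - {i}. ?w j) ^ (r - 1)"
        by (rule link_bound[OF k3 r2 tame uC]) (use w0 in auto)
      also have "k + r - 4 = m - 1" by (simp add: m_def)
      also have "?d' * (\<Sum>j\<in>{..<m} - {i}. ?w j) ^ (r - 1) \<le> ?d' * (1 - 1 / real m + \<delta>) ^ (r - 1)"
      proof (intro mult_left_mono power_mono)
        have "(\<Sum>j\<in>{..<m} - {i}. ?w j) = sum ?w {..<m} - ?w i" using i by (simp add: sum_diff1)
        then show "(\<Sum>j\<in>{..<m} - {i}. ?w j) \<le> 1 - 1 / real m + \<delta>" using ws w[OF i] by linarith
        show "0 \<le> (\<Sum>j\<in>{..<m} - {i}. ?w j)" by (rule sum_nonneg[OF w0])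
        show "0 \<le> ?d'" by (simp add: dens_def)
      qed
      also have "link ?C i = complete_edges (r - 1) ({..<m} - {i})"
        by (rule link_complete) (use i m_ge in auto)
      finally show ?thesis using \<delta>(2) by linarith
    qed
    have c2: "\<forall>I. I \<subseteq> {..<m} \<longrightarrow> card I = r \<longrightarrow> (\<Sum>e\<in>rsets c U I - E. prod x e) \<le> \<tau>"
    proof (intro allI impI)
      fix I assume I: "I \<subseteq> {..<m}" "card I = r"
      have "lag ?EU x = (\<Sum>I\<in>?C. \<Sum>e\<in>rsets c U I \<inter> ?EU. prod x e)"
        by (rule lag_types) (use finU rb cm unif_edge[OF uE'] in auto)
      then have "(\<Sum>e\<in>rsets c U I - ?EU. prod x e) \<le> 2 * (3 * \<zeta>)"
        by (intro miss_bound[OF finU, of "{..<m}" x r c d]) (use x UV upC \<zeta> lagEU I in \<open>auto simp: complete_edges_def\<close>)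
      moreover have "(\<Sum>e\<in>rsets c U I - E. prod x e) \<le> (\<Sum>e\<in>rsets c U I - ?EU. prod x e)"
        by (rule sum_mono2) (use finite_rsets[OF finU] E' x UV in \<open>auto intro!: prod_nonneg simp: rsets_def\<close>)
      ultimately show "(\<Sum>e\<in>rsets c U I - E. prod x e) \<le> \<tau>" using \<zeta> by linarith
    qed
    have missL: "(\<Sum>f\<in>rsets c U I - L. prod x f) \<le> \<tau>"
      if "i < m" "real r * d - \<tau> / 2 \<le> (\<Sum>I\<in>complete_edges (r - 1) ({..<m} - {i}). \<Sum>f\<in>rsets c U I \<inter> L. prod x f)"
        "I \<subseteq> {..<m} - {i}" "card I = r - 1" for i I L
    proof -
      have "(\<Sum>f\<in>rsets c U I - L. prod x f) \<le> 2 * (\<tau> / 2)"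
        by (rule miss_bound[OF finU _ _ upL[OF that(1)] that(2)]) (use x UV that in \<open>auto simp: complete_edges_def\<close>)
      then show ?thesis by simp
    qed
    then have c4: "\<forall>i<m. \<forall>L. real r * d - \<tau> / 2 \<le> (\<Sum>I\<in>complete_edges (r - 1) ({..<m} - {i}). \<Sum>f\<in>rsets c U I \<inter> L. prod x f) \<longrightarrow>
        (\<forall>I. I \<subseteq> {..<m} - {i} \<longrightarrow> card I = r - 1 \<longrightarrow> (\<Sum>f\<in>rsets c U I - L. prod x f) \<le> \<tau>)" by blast
    have c3: "\<forall>u\<in>U. \<forall>I. I \<subseteq> {..<m} - {c u} \<longrightarrow> card I = r - 1 \<longrightarrow> (\<Sum>f\<in>rsets c U I - link E u. prod x f) \<le> \<tau>"
    proof (intro ballI allI impI)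
      fix u I assume u: "u \<in> U" and I: "I \<subseteq> {..<m} - {c u}" "card I = r - 1"
      let ?L = "{f\<in>link E' u. f \<subseteq> U - {u}}"
      have L: "f \<subseteq> U \<and> card f = r - 1 \<and> inj_on c f \<and> c ` f \<subseteq> {..<m} - {c u}" if "f \<in> ?L" for f
      proof -
        have f: "u \<notin> f" "insert u f \<in> E'" "f \<subseteq> U - {u}" using that by (auto simp: link_iff)
        then have "insert u f \<subseteq> U" using u by auto
        then have inj: "inj_on c (insert u f)" using rb f by blast
        have "card f = r - 1" using unif_edge[OF unif_link[OF uE'], of f u] that by auto
        moreover have "inj_on c f" using inj by (rule inj_on_subset) blast
        moreover have fU: "f \<subseteq> U" using f(3) by (rule subset_trans) simp
        moreover have "c ` f \<subseteq> {..<m} - {c u}"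
        proof (rule image_subsetI)
          fix w assume w: "w \<in> f"
          have "c w \<noteq> c u" using inj_onD[OF inj, of w u] w f(1) by blast
          moreover have "c w < m" by (rule cm[OF subsetD[OF fU w]])
          ultimately show "c w \<in> {..<m} - {c u}" by simp
        qed
        ultimately show ?thesis by simp
      qed
      have "lag ?L x = (\<Sum>I\<in>complete_edges (r - 1) ({..<m} - {c u}). \<Sum>f\<in>rsets c U I \<inter> ?L. prod x f)"
        by (rule lag_types[OF finU _ L]) auto
      then have "(\<Sum>f\<in>rsets c U I - ?L. prod x f) \<le> \<tau>"
        by (intro missL[OF cm[OF u] _ I]) (use degU[OF u] \<zeta> in linarith)
      moreover have "(\<Sum>f\<in>rsets c U I - link E u. prod x f) \<le> (\<Sum>f\<in>rsets c U I - ?L. prod x f)"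
        by (rule sum_mono2) (use finite_rsets[OF finU] link_mono[OF E', of u] x UV in \<open>auto intro!: prod_nonneg simp: rsets_def\<close>)
      ultimately show "(\<Sum>f\<in>rsets c U I - link E u. prod x f) \<le> \<tau>" by linarith
    qed
    show "full_frame \<tau> E x U c"
      unfolding full_frame_def using c1 c2 c3 c4 by (intro conjI)
  qed
qed

section \<open>Symmetrisation\<close>

lemma avoids_mono: "avoids \<kappa> V E x \<Longrightarrow> \<kappa> \<le> \<kappa>' \<Longrightarrow> avoids \<kappa>' V E x"
  unfolding avoids_def by (meson order_trans)

lemma near_turan_mono: "near_turan \<zeta> V E E' x U c \<Longrightarrow> \<zeta> \<le> \<zeta>' \<Longrightarrow> near_turan \<zeta>' V E E' x U c"
  unfolding near_turan_def by (meson diff_left_mono order_trans)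

lemma half_inverse: "0 < 1 / (2 * real m)" "1 / (2 * real m) \<le> 1"
  using m_ge by auto

section \<open>Extending colourings\<close>

text \<open>The transversals found in \<open>E'\<close> belong to \<open>E\<close>, so an edge of
  \<open>E\<close> with two vertices in one class falls to \<open>pair_embed\<close>.\<close>

lemma rainbow_upgrade:
  "\<exists>\<zeta>>0. \<forall>V E E' x U c. near_turan \<zeta> V E E' x U c \<longrightarrow> avoids (thr (1 / (2 * real m))) V E x \<longrightarrow>
     (\<forall>e\<in>E. e \<subseteq> U \<longrightarrow> inj_on c e)"
proof -
  let ?\<eta> = "1 / (2 * real m)"
  have t0: "0 < thr ?\<eta>" by (rule thr_pos[OF half_inverse(1)])
  obtain \<zeta> where \<zeta>: "\<zeta> > 0" and full: "\<And>V E E' x U c. near_turan \<zeta> V E E' x U c \<Longrightarrow> full_frame (thr ?\<eta>) E x U c"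
    using near_turan_full[OF t0] by blast
  show ?thesis
  proof (intro exI[of _ \<zeta>] conjI \<zeta> allI impI ballI)
    fix V E E' x U c e
    assume nt: "near_turan \<zeta> V E E' x U c" and av: "avoids (thr ?\<eta>) V E x" and e: "e \<in> E" "e \<subseteq> U"
    have fr: "frame V E x U c" using nt by (simp add: near_turan_def)
    note F = full[OF nt, unfolded full_frame_def]
    show "inj_on c e"
    proof (rule inj_onI, rule ccontr)
      fix a a' assume a: "a \<in> e" "a' \<in> e" "c a = c a'" "a \<noteq> a'"
      have aU: "a \<in> U" "a' \<in> U" using a e by auto
      have ca: "c a < m" using fr aU by (simp add: frame_def)
      show False
        by (rule pair_embed[OF fr av half_inverse _ _ ca _ _ e(1) a(1,2,4)])
          (use F aU a(3) in \<open>simp_all\<close>)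
    qed
  qed
qed

text \<open>If the link of \<open>v\<close> has weight at every colour, \<open>extend_embed\<close>
  applies. Otherwise it nearly misses a colour \<open>i\<close>, is nearly complete on the others
  because of its degree, and \<open>v\<close> behaves like a member of class \<open>i\<close>; then
  \<open>pair_embed\<close> excludes edges joining \<open>v\<close> to that class.\<close>

lemma extend_one:
  "\<exists>\<zeta>>0. \<exists>\<kappa>>0. \<forall>V E x U c v. near_turan \<zeta> V E E x U c \<longrightarrow> avoids \<kappa> V E x \<longrightarrow> v \<in> V - U \<longrightarrow>
     real r * d - \<zeta> \<le> lag (link E v) x \<longrightarrow>
     (\<exists>i<m. \<forall>e\<in>E. e \<subseteq> insert v U \<longrightarrow> inj_on (c(v := i)) e)"
proof -
  let ?\<eta> = "1 / (2 * real m)"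
  define \<tau> where "\<tau> = thr ?\<eta>"
  have \<tau>0: "0 < \<tau>" unfolding \<tau>_def by (rule thr_pos[OF half_inverse(1)])
  \<comment> \<open>At most \<open>2 ^ m\<close> types contain the missed colour, and each has
    weight below \<open>\<eta>2\<close>, so together they carry at most
    \<open>\<tau> / 4\<close>.\<close>
  define \<eta>2 where "\<eta>2 = min ?\<eta> (\<tau> / (4 * 2 ^ m))"
  have \<eta>2: "0 < \<eta>2" "\<eta>2 \<le> ?\<eta>" "\<eta>2 \<le> 1" "\<eta>2 \<le> \<tau> / (4 * 2 ^ m)"
    unfolding \<eta>2_def using \<tau>0 half_inverse by (auto simp: min_le_iff_disj simp del: divide_le_eq_1_pos)
  define \<kappa> where "\<kappa> = thr \<eta>2"
  have \<kappa>0: "0 < \<kappa>" unfolding \<kappa>_def by (rule thr_pos[OF \<eta>2(1)])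
  have \<kappa>\<tau>: "\<kappa> \<le> \<tau>" unfolding \<kappa>_def \<tau>_def by (rule thr_mono[OF \<eta>2(1,2)])
  obtain \<zeta>1 where \<zeta>1: "\<zeta>1 > 0" and full1: "\<And>V E E' x U c. near_turan \<zeta>1 V E E' x U c \<Longrightarrow> full_frame \<tau> E x U c"
    using near_turan_full[OF \<tau>0] by blast
  obtain \<zeta>2 where \<zeta>2: "\<zeta>2 > 0" and full2: "\<And>V E E' x U c. near_turan \<zeta>2 V E E' x U c \<Longrightarrow> full_frame \<kappa> E x U c"
    using near_turan_full[OF \<kappa>0] by blast
  define \<zeta> where "\<zeta> = Min {\<zeta>1, \<zeta>2, \<tau> / 8}"
  have \<zeta>: "0 < \<zeta>" "\<zeta> \<le> \<zeta>1" "\<zeta> \<le> \<zeta>2" "\<zeta> \<le> \<tau> / 8" unfolding \<zeta>_def using \<zeta>1 \<zeta>2 \<tau>0 by auto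
  show ?thesis
  proof (rule exI[of _ \<zeta>], rule conjI[OF \<zeta>(1)], rule exI[of _ \<kappa>], rule conjI[OF \<kappa>0], intro allI impI)
    fix V E x U c v
    assume nt: "near_turan \<zeta> V E E x U c" and av: "avoids \<kappa> V E x" and v: "v \<in> V - U"
      and deg: "real r * d - \<zeta> \<le> lag (link E v) x"
    have fr: "frame V E x U c" and rb: "\<forall>e\<in>E. e \<subseteq> U \<longrightarrow> inj_on c e" and xU: "1 - \<zeta> \<le> sum x U"
      using nt by (auto simp: near_turan_def)
    have E: "unif r V E" and V: "finite V" and x: "\<And>v. v \<in> V \<Longrightarrow> 0 \<le> x v" "sum x V \<le> 1" and UV: "U \<subseteq> V"
      and cm: "\<And>v. v \<in> U \<Longrightarrow> c v < m"
      using fr by (auto simp: frame_def unif_def)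
    have finU: "finite U" using V UV finite_subset by blast
    note F1 = full1[OF near_turan_mono[OF nt \<zeta>(2)], unfolded full_frame_def]
    have F1a: "\<And>j. j < m \<Longrightarrow> ?\<eta> \<le> (\<Sum>v\<in>cls c U j. x v)"
      and F1b: "\<And>I. I \<subseteq> {..<m} \<Longrightarrow> card I = r \<Longrightarrow> (\<Sum>e\<in>rsets c U I - E. prod x e) \<le> \<tau>"
      and F1c: "\<And>u I. u \<in> U \<Longrightarrow> I \<subseteq> {..<m} - {c u} \<Longrightarrow> card I = r - 1 \<Longrightarrow> (\<Sum>f\<in>rsets c U I - link E u. prod x f) \<le> \<tau>"
      and F1d: "\<And>i L I. i < m \<Longrightarrow> real r * d - \<tau> / 2 \<le> (\<Sum>I\<in>complete_edges (r - 1) ({..<m} - {i}). \<Sum>f\<in>rsets c U I \<inter> L. prod x f) \<Longrightarrow>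
         I \<subseteq> {..<m} - {i} \<Longrightarrow> card I = r - 1 \<Longrightarrow> (\<Sum>f\<in>rsets c U I - L. prod x f) \<le> \<tau>"
      using F1 by blast+
    have F2: "\<And>I. I \<subseteq> {..<m} \<Longrightarrow> card I = r \<Longrightarrow> (\<Sum>e\<in>rsets c U I - E. prod x e) \<le> \<kappa>"
      using full2[OF near_turan_mono[OF nt \<zeta>(3)], unfolded full_frame_def] by blast
    have av\<tau>: "avoids (thr ?\<eta>) V E x" using avoids_mono[OF av \<kappa>\<tau>] by (simp only: \<tau>_def)
    have F1b': "\<And>I. I \<subseteq> {..<m} \<Longrightarrow> card I = r \<Longrightarrow> (\<Sum>e\<in>rsets c U I - E. prod x e) \<le> thr ?\<eta>"
      using F1b by (simp only: \<tau>_def)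
    have F1c': "\<And>u I. u \<in> U \<Longrightarrow> I \<subseteq> {..<m} - {c u} \<Longrightarrow> card I = r - 1 \<Longrightarrow> (\<Sum>f\<in>rsets c U I - link E u. prod x f) \<le> thr ?\<eta>"
      using F1c by (simp only: \<tau>_def)
    have step1: "inj_on c (e - {v})" if e: "e \<in> E" "e \<subseteq> insert v U" for e
    proof (rule inj_onI, rule ccontr)
      fix a a' assume a: "a \<in> e - {v}" "a' \<in> e - {v}" "c a = c a'" "a \<noteq> a'"
      have aU: "a \<in> U" "a' \<in> U" using a e by auto
      have ae: "a \<in> e" "a' \<in> e" using a by auto
      show False
        by (rule pair_embed[OF fr av\<tau> half_inverse F1a F1b' cm[OF aU(1)] F1c'[OF aU(1)] _ e(1) ae a(4)])
          (use F1c'[OF aU(2)] a(3) in simp_all)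
    qed
    let ?L = "{f\<in>link E v. f \<subseteq> U}"
    let ?h = "\<lambda>I. \<Sum>f\<in>rsets c U I \<inter> link E v. prod x f"
    have V1: "sum x (V - {v}) \<le> 1" using x sum_mono2[OF V, of "V - {v}" x] by force
    have lagL: "real r * d - 2 * \<zeta> \<le> lag ?L x"
    proof -
      have "lag (link E v) x - sum x ((V - {v}) - U) \<le> lag ?L x"
        by (rule lag_loss[OF unif_link[OF E] _ V1]) (use x in auto)
      moreover have "sum x ((V - {v}) - U) \<le> sum x (V - U)"
        by (rule sum_mono2) (use V x in auto)
      moreover have "sum x (V - U) = sum x V - sum x U" by (rule sum_diff[OF V UV])
      ultimately show ?thesis using deg xU x(2) by linarith
    qed
    have Lt: "f \<subseteq> U \<and> card f = r - 1 \<and> inj_on c f \<and> c ` f \<subseteq> {..<m}" if "f \<in> ?L" for f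
    proof -
      have f: "v \<notin> f" "insert v f \<in> E" "f \<subseteq> U" "f \<in> link E v" using that by (simp_all add: link_iff)
      have "insert v f - {v} = f" using f(1) by simp
      moreover have "insert v f \<subseteq> insert v U" using f(3) by (rule insert_mono)
      ultimately have "inj_on c f" using step1[OF f(2)] by simp
      moreover have "card f = r - 1" using unif_edge[OF unif_link[OF E] f(4)] by simp
      moreover have "c ` f \<subseteq> {..<m}"
      proof (rule image_subsetI)
        fix w assume "w \<in> f"
        then show "c w \<in> {..<m}" using cm[of w] f(3) by (simp add: subset_iff)
      qed
      ultimately show ?thesis using f(3) by simp
    qed
    have "lag ?L x = (\<Sum>I\<in>complete_edges (r - 1) {..<m}. \<Sum>f\<in>rsets c U I \<inter> ?L. prod x f)"
      by (rule lag_types[OF finU _ Lt]) auto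
    also have "\<dots> = (\<Sum>I\<in>complete_edges (r - 1) {..<m}. ?h I)"
    proof (rule sum.cong[OF refl])
      fix I
      have "rsets c U I \<inter> ?L = rsets c U I \<inter> link E v" by (auto simp: rsets_def)
      then show "(\<Sum>f\<in>rsets c U I \<inter> ?L. prod x f) = ?h I" by simp
    qed
    finally have lagL': "lag ?L x = (\<Sum>I\<in>complete_edges (r - 1) {..<m}. ?h I)" .
    show "\<exists>i<m. \<forall>e\<in>E. e \<subseteq> insert v U \<longrightarrow> inj_on (c(v := i)) e"
    proof (cases "\<forall>i<m. \<exists>T. T \<subseteq> {..<m} \<and> card T = r - 1 \<and> i \<in> T \<and> \<eta>2 \<le> ?h T")
      case True
      then obtain T where T: "\<And>i. i < m \<Longrightarrow> T i \<subseteq> {..<m} \<and> card (T i) = r - 1 \<and> i \<in> T i \<and> \<eta>2 \<le> ?h (T i)"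
        by metis
      have False
        by (rule extend_embed[OF fr av[unfolded \<kappa>_def] \<eta>2(1,3) order_trans[OF \<eta>2(2) F1a] F2[unfolded \<kappa>_def] T])
      then show ?thesis by simp
    next
      case False
      then obtain i where i: "i < m" "\<And>T. T \<subseteq> {..<m} \<Longrightarrow> card T = r - 1 \<Longrightarrow> i \<in> T \<Longrightarrow> ?h T < \<eta>2"
        by (meson not_less)
      let ?A = "complete_edges (r - 1) {..<m}" and ?B = "complete_edges (r - 1) ({..<m} - {i})"
      have finA: "finite ?A" by (rule finite_complete) simp
      have BA: "?B \<subseteq> ?A" by (auto simp: complete_edges_def)
      have "(\<Sum>I\<in>?A. ?h I) = (\<Sum>I\<in>?A - ?B. ?h I) + (\<Sum>I\<in>?B. ?h I)"
        by (rule sum.subset_diff[OF BA finA])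
      moreover have "(\<Sum>I\<in>?A - ?B. ?h I) \<le> (\<Sum>I\<in>?A - ?B. \<eta>2)"
      proof (rule sum_mono)
        fix I assume "I \<in> ?A - ?B"
        then have "I \<subseteq> {..<m}" "card I = r - 1" "i \<in> I" by (auto simp: complete_edges_def)
        then show "?h I \<le> \<eta>2" using i(2) by (simp add: less_imp_le)
      qed
      moreover have "(\<Sum>I\<in>?A - ?B. \<eta>2) \<le> 2 ^ m * (\<tau> / (4 * 2 ^ m))"
      proof -
        have "card (?A - ?B) \<le> card (Pow {..<m})"
          by (rule card_mono) (auto simp: complete_edges_def)
        then have "real (card (?A - ?B)) \<le> real (2 ^ m)" unfolding card_Pow[OF finite_lessThan] card_lessThan by linarith
        then have "real (card (?A - ?B)) * \<eta>2 \<le> 2 ^ m * (\<tau> / (4 * 2 ^ m))"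
          by (intro mult_mono \<eta>2(4)) (use \<eta>2(1) in auto)
        then show ?thesis by simp
      qed
      ultimately have "real r * d - \<tau> / 2 \<le> (\<Sum>I\<in>?B. ?h I)" using lagL lagL' \<zeta>(4) \<tau>0 by simp
      then have missv: "(\<Sum>f\<in>rsets c U I - link E v. prod x f) \<le> thr ?\<eta>" if "I \<subseteq> {..<m} - {i}" "card I = r - 1" for I
        using F1d[OF i(1) _ that, of "link E v"] by (simp only: \<tau>_def)
      show ?thesis
      proof (intro exI[of _ i] conjI i(1) ballI impI)
        fix e assume e: "e \<in> E" "e \<subseteq> insert v U"
        show "inj_on (c(v := i)) e"
        proof (cases "v \<in> e")
          case False
          then have "e - {v} = e" by simp
          then have "inj_on c e" using step1[OF e] by simp
          then show ?thesis using False by (simp add: inj_on_def)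
        next
          case True
          have ne: "c u \<noteq> i" if u: "u \<in> e" "u \<noteq> v" for u
          proof
            assume cu: "c u = i"
            have uU: "u \<in> U" using u e(2) by blast
            show False
              by (rule pair_embed[OF fr av\<tau> half_inverse F1a F1b' i(1) missv _ e(1) True u(1)])
                (use F1c'[OF uU] cu u(2) in simp_all)
          qed
          show ?thesis
          proof (rule inj_onI)
            fix a b assume ab: "a \<in> e" "b \<in> e" "(c(v := i)) a = (c(v := i)) b"
            show "a = b"
            proof (cases "a = v \<or> b = v")
              case True
              then show ?thesis using ab ne by (auto split: if_splits)
            next
              case False
              then show ?thesis using ab inj_onD[OF step1[OF e], of a b] by simp
            qed
          qed
        qed
      qed
    qed
  qed
qed

definition colourable :: "nat set set \<Rightarrow> nat set \<Rightarrow> bool" where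
  "colourable E Y \<longleftrightarrow> (\<exists>c. (\<forall>v\<in>Y. c v < m) \<and> (\<forall>e\<in>E. e \<subseteq> Y \<longrightarrow> inj_on c e))"

definition extends :: "real \<Rightarrow> real \<Rightarrow> bool" where
  "extends \<zeta> \<kappa> \<longleftrightarrow> (\<forall>V E E' x U c Y. near_turan \<zeta> V E E' x U c \<longrightarrow> avoids \<kappa> V E x \<longrightarrow> U \<subseteq> Y \<longrightarrow> Y \<subseteq> V \<longrightarrow>
     (\<forall>v\<in>Y. real r * d - \<zeta> \<le> lag (link E v) x) \<longrightarrow> colourable E Y)"

text \<open>Adding vertices never lowers the weight of \<open>U\<close>, and the degree condition is
  assumed on all of \<open>Y\<close> from the start, so one \<zeta> serves for any number of
  additions. The passage from \<open>E'\<close> to \<open>E\<close> is made before the first of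
  them.\<close>

lemma extend_all: "\<exists>\<zeta>>0. \<exists>\<kappa>>0. extends \<zeta> \<kappa>"
proof -
  obtain \<zeta>1 where \<zeta>1: "\<zeta>1 > 0" and up: "\<forall>V E E' x U c. near_turan \<zeta>1 V E E' x U c \<longrightarrow> avoids (thr (1 / (2 * real m))) V E x \<longrightarrow>
     (\<forall>e\<in>E. e \<subseteq> U \<longrightarrow> inj_on c e)"
    using rainbow_upgrade by (elim exE conjE) (rule that)
  obtain \<zeta>2 \<kappa>2 where \<zeta>2: "\<zeta>2 > 0" "\<kappa>2 > 0" and ext: "\<forall>V E x U c v. near_turan \<zeta>2 V E E x U c \<longrightarrow> avoids \<kappa>2 V E x \<longrightarrow> v \<in> V - U \<longrightarrow>
     real r * d - \<zeta>2 \<le> lag (link E v) x \<longrightarrow>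
     (\<exists>i<m. \<forall>e\<in>E. e \<subseteq> insert v U \<longrightarrow> inj_on (c(v := i)) e)"
    using extend_one by (elim exE conjE) (rule that)
  define \<zeta> where "\<zeta> = min \<zeta>1 \<zeta>2"
  define \<kappa> where "\<kappa> = min \<kappa>2 (thr (1 / (2 * real m)))"
  have \<zeta>: "0 < \<zeta>" "\<zeta> \<le> \<zeta>1" "\<zeta> \<le> \<zeta>2" unfolding \<zeta>_def using \<zeta>1 \<zeta>2 by auto
  have \<kappa>: "0 < \<kappa>" "\<kappa> \<le> \<kappa>2" "\<kappa> \<le> thr (1 / (2 * real m))"
    unfolding \<kappa>_def using \<zeta>2 thr_pos[OF half_inverse(1)] by auto
  show ?thesis
  proof (rule exI[of _ \<zeta>], rule conjI[OF \<zeta>(1)], rule exI[of _ \<kappa>], rule conjI[OF \<kappa>(1)], unfold extends_def, intro allI impI)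
    fix V E E' x U c Y
    assume nt: "near_turan \<zeta> V E E' x U c" and av: "avoids \<kappa> V E x" and UY: "U \<subseteq> Y" and YV: "Y \<subseteq> V"
      and deg: "\<forall>v\<in>Y. real r * d - \<zeta> \<le> lag (link E v) x"
    have fr: "frame V E x U c" and xU: "1 - \<zeta> \<le> sum x U" using nt by (auto simp: near_turan_def)
    have E: "unif r V E" and V: "finite V" and x: "\<And>v. v \<in> V \<Longrightarrow> 0 \<le> x v" "sum x V \<le> 1"
      using fr by (auto simp: frame_def unif_def)
    have main: "\<exists>c'. near_turan \<zeta> V E E x (U \<union> Z) c'" if "finite Z" "Z \<subseteq> Y - U" for Z
      using that
    proof (induction Z rule: finite_induct)
      case empty
      have "\<forall>e\<in>E. e \<subseteq> U \<longrightarrow> inj_on c e"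
        using up near_turan_mono[OF nt \<zeta>(2)] avoids_mono[OF av \<kappa>(3)] by blast
      then have "near_turan \<zeta> V E E x U c"
        using fr xU deg UY unfolding near_turan_def by blast
      then show ?case by auto
    next
      case (insert v Z)
      then obtain c' where c': "near_turan \<zeta> V E E x (U \<union> Z) c'" by blast
      have v: "v \<in> V - (U \<union> Z)" "v \<in> Y" using insert YV by auto
      have "real r * d - \<zeta>2 \<le> lag (link E v) x" using deg v(2) \<zeta>(3) by force
      then obtain i where i: "i < m" "\<forall>e\<in>E. e \<subseteq> insert v (U \<union> Z) \<longrightarrow> inj_on (c'(v := i)) e"
        using ext near_turan_mono[OF c' \<zeta>(3)] avoids_mono[OF av \<kappa>(2)] v(1) by blast
      have sub: "insert v (U \<union> Z) \<subseteq> V" using v YV UY insert by auto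
      have "frame V E x (insert v (U \<union> Z)) (c'(v := i))"
        using c' i(1) sub by (simp add: near_turan_def frame_def)
      moreover have "sum x U \<le> sum x (insert v (U \<union> Z))"
        by (rule sum_mono2) (use sub V finite_subset x in \<open>auto\<close>)
      moreover have "\<forall>u\<in>insert v (U \<union> Z). real r * d - \<zeta> \<le> lag (link E u) x"
        using deg v insert UY by auto
      ultimately have "near_turan \<zeta> V E E x (insert v (U \<union> Z)) (c'(v := i))"
        using i(2) xU unfolding near_turan_def by force
      then show ?case by auto
    qed
    have "finite (Y - U)" using V YV finite_subset by blast
    then obtain c' where "near_turan \<zeta> V E E x (U \<union> (Y - U)) c'" using main[of "Y - U"] by blast
    moreover have "U \<union> (Y - U) = Y" using UY by auto
    ultimately have "near_turan \<zeta> V E E x Y c'" by simp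
    then show "colourable E Y"
      unfolding near_turan_def frame_def colourable_def by blast
  qed
qed

lemma hom_free_subset: "hom_free H E \<Longrightarrow> E' \<subseteq> E \<Longrightarrow> hom_free H E'"
  unfolding hom_free_def by blast

text \<open>Every edge through both vertices leaves the support and so has a factor 0.\<close>

lemma uncovered_shift:
  assumes E: "unif r V E" and x: "\<And>v. v \<in> V \<Longrightarrow> 0 \<le> x v"
    and uv: "u \<in> V" "v \<in> V" "u \<noteq> v" "x u > 0" "x v > 0"
    and un: "\<not> (\<exists>e\<in>E. e \<subseteq> {v\<in>V. x v > 0} \<and> u \<in> e \<and> v \<in> e)"
  shows "lag (link (link E u) v) x = 0"
  unfolding lag_def
proof (rule sum.neutral, rule ballI)
  fix f assume "f \<in> link (link E u) v"
  then have f: "insert u (insert v f) \<in> E" by (simp add: link_iff)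
  then have "\<not> insert u (insert v f) \<subseteq> {v\<in>V. x v > 0}" using un by blast
  then obtain w where w: "w \<in> f" "\<not> x w > 0" using uv unif_edge[OF E f] by auto
  moreover have "w \<in> V" "finite f" using unif_edge[OF E f] w by auto
  ultimately have "x w = 0" using x[of w] by simp
  then show "prod x f = 0" using w \<open>finite f\<close> by auto
qed

lemma sum_shift:
  fixes x :: "'v \<Rightarrow> real"
  assumes "finite V" "u \<in> V" "v \<in> V" "u \<noteq> v"
  shows "sum (x(u := x u + t, v := x v - t)) V = sum x V"
proof -
  have V: "V = insert u (insert v (V - {u, v}))" using assms by auto
  have eq: "sum y V = y u + (y v + sum y (V - {u, v}))" for y :: "'v \<Rightarrow> real"
    using assms by (subst V) simp
  have "sum (x(u := x u + t, v := x v - t)) (V - {u, v}) = sum x (V - {u, v})" by (rule sum.cong) auto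
  then show ?thesis unfolding eq using assms by simp
qed

text \<open>Motzkin--Straus symmetrisation: weight is moved between the vertices of an uncovered pair
  until the support is covered.\<close>

lemma hom_free_bound:
  assumes "unif r V E" "hom_free H E" "\<And>v. v \<in> V \<Longrightarrow> 0 \<le> x v"
  shows "lag E x \<le> d * sum x V ^ r"
  using assms(3)
proof (induction "card {v\<in>V. x v > 0}" arbitrary: x rule: less_induct)
  case less
  have finV: "finite V" using unif_finite_verts[OF assms(1)] .
  let ?P = "{v\<in>V. x v > 0}"
  let ?E = "{e\<in>E. e \<subseteq> ?P}"
  show ?case
  proof (cases "\<forall>u\<in>?P. \<forall>v\<in>?P. u \<noteq> v \<longrightarrow> (\<exists>e\<in>E. e \<subseteq> ?P \<and> u \<in> e \<and> v \<in> e)")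
    case True
    have uP: "unif r ?P ?E" using assms(1) finV by (auto simp: unif_def)
    have "es_sparse k r ?E"
    proof (rule covering_sparse[OF uP hom_free_subset[OF assms(2)]])
      fix u v assume uv: "u \<in> ?P" "v \<in> ?P" "u \<noteq> v"
      have "\<exists>e\<in>E. e \<subseteq> ?P \<and> u \<in> e \<and> v \<in> e"
        by (rule bspec[OF bspec[OF True uv(1)] uv(2), THEN mp, OF uv(3)])
      then show "\<exists>e\<in>?E. u \<in> e \<and> v \<in> e" by auto
    qed auto
    then have "lag ?E x \<le> dens (k + r - 3) r * sum x ?P ^ r"
      by (rule sparse_bound[OF k3 r2 tame uP]) auto
    moreover have "sum x ?P = sum x V"
    proof (rule sum.mono_neutral_left)
      show "\<forall>i\<in>V - ?P. x i = 0"
      proof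
        fix i assume "i \<in> V - ?P"
        then show "x i = 0" using less.prems[of i] by auto
      qed
    qed (use finV in auto)
    moreover have "lag ?E x = lag E x"
    proof (rule lag_restrict[OF assms(1)])
      fix i assume "i \<in> V" "i \<notin> ?P"
      then show "x i = 0" using less.prems[of i] by auto
    qed
    ultimately show ?thesis by (simp add: m_def)
  next
    case False
    then obtain u v where uv: "u \<in> ?P" "v \<in> ?P" "u \<noteq> v" "\<not> (\<exists>e\<in>E. e \<subseteq> ?P \<and> u \<in> e \<and> v \<in> e)" by blast
    have key: "lag E x \<le> d * sum x V ^ r"
      if uv: "u \<in> ?P" "v \<in> ?P" "u \<noteq> v" "\<not> (\<exists>e\<in>E. e \<subseteq> ?P \<and> u \<in> e \<and> v \<in> e)"
        and deg: "lag (link E v) x \<le> lag (link E u) x" for u v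
    proof -
      \<comment> \<open>All weight of \<open>v\<close> moves to \<open>u\<close>, the end of at
        least equal degree. With codegree 0 the change is linear, hence no loss, and
        \<open>v\<close> leaves the support.\<close>
      let ?y = "x(u := x u + x v, v := x v - x v)"
      have z: "lag (link (link E u) v) x = 0"
        by (rule uncovered_shift[OF assms(1) less.prems _ _ uv(3) _ _ uv(4)]) (use uv in auto)
      have "lag E ?y = lag E x + x v * (lag (link E u) x - lag (link E v) x)"
        using lag_shift(1)[OF assms(1) uv(3), of x "x v"] z by simp
      moreover have "0 \<le> x v * (lag (link E u) x - lag (link E v) x)"
        using uv(2) deg by (intro mult_nonneg_nonneg) auto
      ultimately have "lag E x \<le> lag E ?y" by linarith
      also have "lag E ?y \<le> d * sum ?y V ^ r"
      proof (rule less.hyps)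
        have yw: "?y w = (if w = v then 0 else if w = u then x u + x v else x w)" for w by simp
        have "{w\<in>V. ?y w > 0} \<subseteq> ?P"
        proof
          fix w assume "w \<in> {w\<in>V. ?y w > 0}"
          then have w: "w \<in> V" "?y w > 0" by blast+
          show "w \<in> ?P"
          proof (cases "w = u")
            case False
            then show ?thesis using w unfolding yw by (simp split: if_splits)
          qed (use uv(1) in simp)
        qed
        moreover have "v \<notin> {w\<in>V. ?y w > 0}" by simp
        ultimately have "{w\<in>V. ?y w > 0} \<subset> ?P" using uv(2) by blast
        then show "card {w\<in>V. ?y w > 0} < card ?P" using finV by (intro psubset_card_mono) auto
        show "0 \<le> ?y w" if "w \<in> V" for w
          unfolding yw using less.prems[OF that] less.prems[of u] less.prems[of v] uv(1,2) by simp
      qed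
      also have "sum ?y V = sum x V" by (rule sum_shift) (use finV uv in auto)
      finally show ?thesis .
    qed
    show ?thesis
    proof (cases "lag (link E v) x \<le> lag (link E u) x")
      case True
      then show ?thesis using key[OF uv] by blast
    next
      case False
      have uv': "\<not> (\<exists>e\<in>E. e \<subseteq> ?P \<and> v \<in> e \<and> u \<in> e)" using uv(4) by blast
      show ?thesis by (rule key[OF uv(2,1) uv(3)[symmetric] uv']) (use False in simp)
    qed
  qed
qed

section \<open>Stability for homomorphism-free hypergraphs\<close>

text \<open>Positive weight is demanded because at the end of symmetrisation only the structure on
  the support is under control.\<close>

definition heavy :: "real \<Rightarrow> nat set \<Rightarrow> nat set set \<Rightarrow> (nat \<Rightarrow> real) \<Rightarrow> nat set" where
  "heavy \<zeta> V E x = {v\<in>V. x v > 0 \<and> real r * d - \<zeta> \<le> lag (link E v) x}"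

lemma heavy_sub: "heavy \<zeta> V E x \<subseteq> V"
  by (auto simp: heavy_def)

lemma low_weight:
  assumes E: "unif r V E" "hom_free H E" and x: "\<And>v. v \<in> V \<Longrightarrow> 0 \<le> x v" "sum x V = 1" "d - \<epsilon> \<le> lag E x"
    and \<zeta>: "0 < \<zeta>" "\<zeta> \<le> 1" "\<epsilon> < \<zeta>\<^sup>2 / (4 * real r ^ 2)"
  shows "sum x {v\<in>V. lag (link E v) x < real r * d - \<zeta>} \<le> \<zeta>"
proof (rule low_degree_small[OF E(1) x(1) _ _ _ d_pos(2) x(3) m_ge(3) \<zeta>])
  show "lag E z \<le> d * sum z V ^ r" if "\<And>v. v \<in> V \<Longrightarrow> 0 \<le> z v" for z
    by (rule hom_free_bound[OF E that])
qed (use x(2) d_pos in auto)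

text \<open>The end of symmetrisation. Almost all weight lies on an \<open>m\<close>-set
  \<open>S\<close>, and a missing \<open>r\<close>-subset of \<open>S\<close> would cost too much
  density, so \<open>S\<close> spans a clique. By \<open>clique_pendant\<close> no edge joins
  another vertex of the support to \<open>r - 1\<close> vertices of \<open>S\<close>. Its degree is
  therefore tiny, \<open>heavy\<close> lies in \<open>S\<close>, and a bijection onto the colours
  suffices.\<close>

lemma covering_case:
  assumes \<zeta>: "\<zeta> < real r * d"
  shows "\<exists>\<epsilon>>0. \<forall>V E x. unif r V E \<longrightarrow> hom_free H E \<longrightarrow> (\<forall>v\<in>V. 0 \<le> x v) \<longrightarrow> sum x V = 1 \<longrightarrow> d - \<epsilon> \<le> lag E x \<longrightarrow>
     (\<forall>u\<in>{v\<in>V. x v > 0}. \<forall>v\<in>{v\<in>V. x v > 0}. u \<noteq> v \<longrightarrow> (\<exists>e\<in>E. e \<subseteq> {v\<in>V. x v > 0} \<and> u \<in> e \<and> v \<in> e)) \<longrightarrow>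
     colourable E (heavy \<zeta> V E x)"
proof -
  \<comment> \<open>A lower bound for the product over one \<open>r\<close>-subset of
    \<open>S\<close>, whose weights will be at least \<open>1 / (2 * m)\<close>.\<close>
  define q where "q = (1 / (2 * real m)) ^ r"
  have q0: "0 < q" unfolding q_def by (rule zero_less_power[OF half_inverse(1)])
  have rm: "real m > 0" using m_ge by simp
  define \<delta> where "\<delta> = Min {1 / (2 * real m), q / (4 * real m), (real r * d - \<zeta>) / (2 * real m)}"
  have \<delta>: "0 < \<delta>" "\<delta> \<le> 1 / (2 * real m)" "\<delta> \<le> q / (4 * real m)" "\<delta> \<le> (real r * d - \<zeta>) / (2 * real m)"
    unfolding \<delta>_def using q0 \<zeta> rm by auto
  have m\<delta>: "real m * \<delta> \<le> q / 4" "real m * \<delta> < real r * d - \<zeta>"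
  proof -
    have "real m * \<delta> \<le> real m * (q / (4 * real m))" by (intro mult_left_mono \<delta>(3)) simp
    then show "real m * \<delta> \<le> q / 4" using rm by simp
    have "real m * \<delta> \<le> real m * ((real r * d - \<zeta>) / (2 * real m))" by (intro mult_left_mono \<delta>(4)) simp
    also have "\<dots> = (real r * d - \<zeta>) / 2" using rm by simp
    also have "\<dots> < real r * d - \<zeta>" using \<zeta> by simp
    finally show "real m * \<delta> < real r * d - \<zeta>" .
  qed
  obtain \<epsilon>1 where \<epsilon>1: "\<epsilon>1 > 0" and S: "\<forall>(V :: nat set) E x. unif r V E \<longrightarrow> es_sparse k r E \<longrightarrow> (\<forall>v\<in>V. 0 \<le> x v) \<longrightarrow>
     (\<Sum>v\<in>V. x v) \<le> 1 \<longrightarrow> dens (k + r - 3) r - \<epsilon>1 \<le> lag E x \<longrightarrow>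
     (\<exists>S\<subseteq>V. card S = k + r - 3 \<and> (\<forall>v\<in>S. 1 / real (k + r - 3) - \<delta> \<le> x v))"
    using sparse_stability[OF k3 r2 tame \<delta>(1), where 'v=nat] by (elim exE conjE) (rule that)
  define \<epsilon> where "\<epsilon> = min \<epsilon>1 (q / 4)"
  have \<epsilon>: "0 < \<epsilon>" "\<epsilon> \<le> \<epsilon>1" "\<epsilon> \<le> q / 4" unfolding \<epsilon>_def using \<epsilon>1 q0 by auto
  show ?thesis
  proof (rule exI[of _ \<epsilon>], rule conjI[OF \<epsilon>(1)], intro allI impI)
    fix V :: "nat set" and E x
    assume E: "unif r V E" and hf: "hom_free H E" and x0: "\<forall>v\<in>V. 0 \<le> x v" and x1: "sum x V = 1" and big: "d - \<epsilon> \<le> lag E x"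
    define P where "P = {v\<in>V. x v > 0}"
    assume "\<forall>u\<in>{v\<in>V. x v > 0}. \<forall>v\<in>{v\<in>V. x v > 0}. u \<noteq> v \<longrightarrow> (\<exists>e\<in>E. e \<subseteq> {v\<in>V. x v > 0} \<and> u \<in> e \<and> v \<in> e)"
    then have cov: "\<And>u v. u \<in> P \<Longrightarrow> v \<in> P \<Longrightarrow> u \<noteq> v \<Longrightarrow> \<exists>e\<in>E. e \<subseteq> P \<and> u \<in> e \<and> v \<in> e"
      unfolding P_def[symmetric] by blast
    have finV: "finite V" using unif_finite_verts[OF E] .
    have PV: "P \<subseteq> V" by (auto simp: P_def)
    have finP: "finite P" using finV PV finite_subset by blast
    have xz: "x v = 0" if "v \<in> V" "v \<notin> P" for v using x0 that by (force simp: P_def)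
    have xP: "0 \<le> x v" if "v \<in> P" for v using that by (simp add: P_def)
    define EP where "EP = {e\<in>E. e \<subseteq> P}"
    have uP: "unif r P EP" using E finP by (auto simp: unif_def EP_def)
    have hfP: "hom_free H EP" by (rule hom_free_subset[OF hf]) (auto simp: EP_def)
    have covP: "\<exists>e\<in>EP. u \<in> e \<and> v \<in> e" if "u \<in> P" "v \<in> P" "u \<noteq> v" for u v
      using cov[OF that] unfolding EP_def by blast
    have sp: "es_sparse k r EP" by (rule covering_sparse[OF uP hfP covP])
    have sP: "sum x P = 1"
    proof -
      have "sum x P = sum x V" by (rule sum.mono_neutral_left[OF finV PV]) (use xz in blast)
      then show ?thesis using x1 by simp
    qed
    have lagP: "lag EP x = lag E x" unfolding EP_def by (rule lag_restrict[OF E xz])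
    obtain S where S: "S \<subseteq> P" "card S = m" "\<forall>v\<in>S. 1 / real m - \<delta> \<le> x v"
      using S[rule_format, of P EP x] uP sp xP sP lagP big \<epsilon>(2) unfolding m_def[symmetric] by auto
    have finS: "finite S" using S finP finite_subset by blast
    have xPS: "sum x (P - S) \<le> real m * \<delta>"
    proof -
      have "(\<Sum>v\<in>S. 1 / real m - \<delta>) \<le> sum x S" by (rule sum_mono) (use S in auto)
      then have "1 - real m * \<delta> \<le> sum x S" using S(2) rm by (simp add: right_diff_distrib)
      moreover have "sum x (P - S) = sum x P - sum x S" by (rule sum_diff[OF finP S(1)])
      ultimately show ?thesis using sP by linarith
    qed
    have complete: "e \<in> EP" if e: "e \<subseteq> S" "card e = r" for e
    proof (rule ccontr)
      assume ne: "e \<notin> EP"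
      let ?K = "complete_edges r S"
      have uK: "unif r S ?K" by (rule unif_complete[OF finS])
      have x0S: "0 \<le> x v" if "v \<in> S" for v using that S(1) xP by blast
      have "lag EP x - sum x (P - S) \<le> lag {e\<in>EP. e \<subseteq> S} x"
        by (rule lag_loss[OF uP xP]) (use sP in auto)
      also have "\<dots> \<le> lag (?K - {e}) x"
      proof (rule lag_mono_edges[OF unif_subset[OF uK]])
        show "{e\<in>EP. e \<subseteq> S} \<subseteq> ?K - {e}" using ne unif_edge[OF uP] by (auto simp: complete_edges_def)
      qed (use x0S in auto)
      also have "lag (?K - {e}) x = lag ?K x - prod x e"
        unfolding lag_def using finite_complete[OF finS] e by (subst sum_diff1) (auto simp: complete_edges_def)
      also have "lag ?K x \<le> d"
      proof -
        have "lag ?K x \<le> dens (k + r - 3) r * sum x S ^ r"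
          by (rule sparse_bound[OF k3 r2 tame uK complete_m_sparse[OF finS S(2)] x0S])
        also have "\<dots> \<le> d * 1"
          unfolding m_def[symmetric]
        proof (intro mult_left_mono power_le_one sum_nonneg)
          have "sum x S \<le> sum x P" by (rule sum_mono2[OF finP S(1)]) (use xP in auto)
          then show "sum x S \<le> 1" using sP by simp
        qed (use x0S d_pos in auto)
        finally show ?thesis by simp
      qed
      finally have "lag EP x - sum x (P - S) \<le> d - prod x e" by simp
      moreover have "q \<le> prod x e"
      proof -
        have "q = (\<Prod>v\<in>e. 1 / (2 * real m))" using e by (simp add: q_def)
        also have "\<dots> \<le> prod x e"
        proof (rule prod_mono)
          fix v assume "v \<in> e"
          then have "1 / real m - \<delta> \<le> x v" using S(3) e by blast
          moreover have "1 / real m = 1 / (2 * real m) + 1 / (2 * real m)" by (simp add: field_simps)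
          ultimately show "0 \<le> 1 / (2 * real m) \<and> 1 / (2 * real m) \<le> x v" using \<delta>(2) half_inverse by linarith
        qed
        finally show ?thesis .
      qed
      ultimately have "d - \<epsilon> \<le> d - q + q / 4" using xPS m\<delta>(1) lagP big by linarith
      then show False using \<epsilon>(3) q0 by linarith
    qed
    have light: "w \<notin> heavy \<zeta> V E x" if w: "w \<in> P" "w \<notin> S" for w
    proof
      assume "w \<in> heavy \<zeta> V E x"
      then have deg: "real r * d - \<zeta> \<le> lag (link E w) x" by (simp add: heavy_def)
      let ?L = "link EP w"
      have uL: "unif (r - 1) (P - {w}) ?L" by (rule unif_link[OF uP])
      have "{f\<in>link E w. f \<subseteq> P} = ?L" using w by (auto simp: link_iff EP_def)
      then have "lag (link E w) x = lag ?L x"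
        using lag_restrict[OF unif_link[OF E, of w], of P x] xz by auto
      moreover have "lag ?L x - sum x (P - {w} - S) \<le> lag {f\<in>?L. f \<subseteq> S} x"
      proof (rule lag_loss[OF uL])
        have "sum x (P - {w}) \<le> sum x P" by (rule sum_mono2[OF finP]) (use xP in auto)
        then show "sum x (P - {w}) \<le> 1" using sP by simp
      qed (use xP in auto)
      moreover have "{f\<in>?L. f \<subseteq> S} = {}"
      proof (rule ccontr)
        assume "\<not> ?thesis"
        then obtain f where f: "f \<in> ?L" "f \<subseteq> S" by blast
        have "card f = r - 1" using unif_edge[OF uL f(1)] by simp
        moreover have "insert w f \<in> EP" using f by (simp add: link_iff)
        moreover have "\<And>u. u \<in> S \<Longrightarrow> \<exists>e\<in>EP. u \<in> e \<and> w \<in> e" using covP w S(1) by blast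
        ultimately have "\<not> hom_free H EP"
          using clique_pendant[OF uP finS S(2) complete w(2) f(2)] by blast
        then show False using hfP by simp
      qed
      then have "lag {f\<in>?L. f \<subseteq> S} x = 0" by (simp only: lag_def sum.empty)
      moreover have "sum x (P - {w} - S) \<le> sum x (P - S)"
        by (rule sum_mono2) (use finP xP in auto)
      ultimately show False using deg xPS m\<delta>(2) by linarith
    qed
    have hS: "heavy \<zeta> V E x \<subseteq> S"
    proof
      fix w assume w: "w \<in> heavy \<zeta> V E x"
      then have "w \<in> P" by (simp add: heavy_def P_def)
      then show "w \<in> S" using light w by blast
    qed
    obtain c where c: "bij_betw c S {..<m}"
      using finS S(2) by (metis bij_betw_iff_card card_lessThan finite_lessThan)
    show "colourable E (heavy \<zeta> V E x)"
      unfolding colourable_def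
    proof (intro exI[of _ c] conjI ballI impI)
      show "c v < m" if "v \<in> heavy \<zeta> V E x" for v using bij_betwE[OF c] that hS by blast
      show "inj_on c e" if "e \<subseteq> heavy \<zeta> V E x" for e
        using bij_betw_imp_inj_on[OF c] by (rule inj_on_subset) (use that hS in blast)
    qed
  qed
qed

text \<open>The limit \<open>\<zeta>0\<close> allows the result to feed a later use of
  \<open>extends\<close>. The inner fact \<open>step\<close> carries a colouring back across one
  small move.\<close>

lemma heavy_colourable:
  assumes \<zeta>0: "0 < \<zeta>0"
  shows "\<exists>\<zeta>>0. \<zeta> \<le> \<zeta>0 \<and> (\<exists>\<epsilon>>0. \<forall>V E x. unif r V E \<longrightarrow> hom_free H E \<longrightarrow> (\<forall>v\<in>V. 0 \<le> x v) \<longrightarrow> sum x V = 1 \<longrightarrow>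
     d - \<epsilon> \<le> lag E x \<longrightarrow>
     sum x {v\<in>V. lag (link E v) x < real r * d - \<zeta>} \<le> \<zeta> \<and> colourable E (heavy \<zeta> V E x))"
proof -
  obtain \<zeta>1 \<kappa> where \<zeta>1: "\<zeta>1 > 0" "\<kappa> > 0" and ext: "extends \<zeta>1 \<kappa>"
    using extend_all by blast
  \<comment> \<open>In \<open>step\<close> the weight outside \<open>U\<close> is at most four times
    \<zeta>: the low-degree vertices of \<open>x\<close>, those of \<open>y\<close>, and the moved
    weight counted twice.\<close>
  define \<zeta> where "\<zeta> = Min {\<zeta>0, \<zeta>1 / 4, real r * d / 2, 1}"
  have rd0: "0 < real r * d" using d_pos m_ge by simp
  have \<zeta>: "0 < \<zeta>" "\<zeta> \<le> \<zeta>0" "\<zeta> \<le> \<zeta>1 / 4" "\<zeta> < real r * d" "\<zeta> \<le> 1"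
    unfolding \<zeta>_def using \<zeta>0 \<zeta>1 rd0 by auto
  obtain \<epsilon>1 where \<epsilon>1: "\<epsilon>1 > 0" and base: "\<forall>V E x. unif r V E \<longrightarrow> hom_free H E \<longrightarrow> (\<forall>v\<in>V. 0 \<le> x v) \<longrightarrow> sum x V = 1 \<longrightarrow> d - \<epsilon>1 \<le> lag E x \<longrightarrow>
     (\<forall>u\<in>{v\<in>V. x v > 0}. \<forall>v\<in>{v\<in>V. x v > 0}. u \<noteq> v \<longrightarrow> (\<exists>e\<in>E. e \<subseteq> {v\<in>V. x v > 0} \<and> u \<in> e \<and> v \<in> e)) \<longrightarrow>
     colourable E (heavy \<zeta> V E x)"
    using covering_case[OF \<zeta>(4)] by (elim exE conjE) (rule that)
  define \<epsilon> where "\<epsilon> = min \<epsilon>1 (\<zeta>\<^sup>2 / (8 * real r ^ 2))"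
  have r0: "0 < real r" using m_ge by simp
  have "\<zeta>\<^sup>2 / (8 * real r ^ 2) < \<zeta>\<^sup>2 / (4 * real r ^ 2)"
    using \<zeta>(1) r0 by (intro divide_strict_left_mono) auto
  then have \<epsilon>: "0 < \<epsilon>" "\<epsilon> \<le> \<epsilon>1" "\<epsilon> < \<zeta>\<^sup>2 / (4 * real r ^ 2)"
    unfolding \<epsilon>_def using \<epsilon>1 \<zeta>(1) r0 by auto
  show ?thesis
  proof (rule exI[of _ \<zeta>], rule conjI[OF \<zeta>(1)], rule conjI[OF \<zeta>(2)], rule exI[of _ \<epsilon>], rule conjI[OF \<epsilon>(1)], intro allI impI)
    fix V :: "nat set" and E x
    assume E: "unif r V E" and hf: "hom_free H E" and x: "\<forall>v\<in>V. 0 \<le> x v" "sum x V = 1" "d - \<epsilon> \<le> lag E x"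
    have finV: "finite V" using unif_finite_verts[OF E] .
    have low: "sum x {v\<in>V. lag (link E v) x < real r * d - \<zeta>} \<le> \<zeta>"
      if "\<forall>v\<in>V. 0 \<le> x v" "sum x V = 1" "d - \<epsilon> \<le> lag E x" for x
      by (rule low_weight[OF E hf _ that(2,3) \<zeta>(1,5) \<epsilon>(3)]) (use that in blast)
    have step: "colourable E (heavy \<zeta> V E x)"
      if x: "\<forall>v\<in>V. 0 \<le> x v" "sum x V = 1" "d - \<epsilon> \<le> lag E x"
        and y: "\<forall>v\<in>V. 0 \<le> y v" "sum y V = 1" "d - \<epsilon> \<le> lag E y" "colourable E (heavy \<zeta> V E y)"
        and uv: "u \<in> V" "v \<in> V" "u \<noteq> v" "x u > 0" "x v > 0"
        and yx: "y = x(u := x u + t, v := x v - t)" and t: "0 \<le> t" "t \<le> \<zeta>" for x y u v t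
    proof -
      obtain c where c: "\<forall>v\<in>heavy \<zeta> V E y. c v < m" "\<forall>e\<in>E. e \<subseteq> heavy \<zeta> V E y \<longrightarrow> inj_on c e"
        using y(4) unfolding colourable_def by blast
      \<comment> \<open>The colouring is known on the heavy vertices for \<open>y\<close>, while the
        degrees must be large at \<open>x\<close>; hence the intersection.\<close>
      define U where "U = heavy \<zeta> V E y \<inter> heavy \<zeta> V E x"
      let ?Lx = "{w\<in>V. lag (link E w) x < real r * d - \<zeta>}"
      let ?Ly = "{w\<in>V. lag (link E w) y < real r * d - \<zeta>}"
      define b where "b w = (if w = v then t else 0)" for w
      have sb: "sum b A \<le> \<zeta>" if "A \<subseteq> V" for A
      proof -
        have "finite A" using that finV finite_subset by blast
        then show ?thesis unfolding b_def using t by simp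
      qed
      have xy: "x w \<le> y w + b w" for w unfolding yx b_def using t uv(3) by simp
      have UV: "U \<subseteq> V" by (auto simp: U_def heavy_def)
      have "sum x (V - U) \<le> (\<Sum>w\<in>V - U. (if w \<in> ?Lx then x w else 0) + ((if w \<in> ?Ly then y w + b w else 0) + b w))"
      proof (rule sum_mono)
        fix w assume w: "w \<in> V - U"
        have nn: "0 \<le> x w" "0 \<le> y w" "0 \<le> b w" using w x(1) y(1) t by (auto simp: b_def)
        consider "w \<in> ?Lx" | "w \<in> ?Ly" | "x w = 0" | "y w = 0"
          using w nn unfolding U_def heavy_def by fastforce
        then show "x w \<le> (if w \<in> ?Lx then x w else 0) + ((if w \<in> ?Ly then y w + b w else 0) + b w)"
        proof cases
          case 1
          then show ?thesis using nn by simp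
        next
          case 2
          then show ?thesis using nn xy[of w] by simp
        next
          case 3
          then show ?thesis using nn by simp
        next
          case 4
          then show ?thesis using nn xy[of w] by simp
        qed
      qed
      also have "\<dots> = (\<Sum>w\<in>V - U. if w \<in> ?Lx then x w else 0) + ((\<Sum>w\<in>V - U. if w \<in> ?Ly then y w + b w else 0) + sum b (V - U))"
        by (simp only: sum.distrib)
      also have "(\<Sum>w\<in>V - U. if w \<in> ?Lx then x w else 0) \<le> sum x ?Lx"
      proof -
        have "(\<Sum>w\<in>V - U. if w \<in> ?Lx then x w else 0) = sum x ((V - U) \<inter> ?Lx)"
          by (rule sum.inter_restrict[symmetric]) (use finV in simp)
        also have "\<dots> \<le> sum x ?Lx" by (rule sum_mono2) (use finV x(1) in auto)
        finally show ?thesis .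
      qed
      also have "(\<Sum>w\<in>V - U. if w \<in> ?Ly then y w + b w else 0) \<le> sum y ?Ly + \<zeta>"
      proof -
        have "(\<Sum>w\<in>V - U. if w \<in> ?Ly then y w + b w else 0) = sum (\<lambda>w. y w + b w) ((V - U) \<inter> ?Ly)"
          by (rule sum.inter_restrict[symmetric]) (use finV in simp)
        also have "\<dots> \<le> sum (\<lambda>w. y w + b w) ?Ly" by (rule sum_mono2) (use finV y(1) t in \<open>auto simp: b_def\<close>)
        also have "\<dots> = sum y ?Ly + sum b ?Ly" by (rule sum.distrib)
        also have "sum b ?Ly \<le> \<zeta>" by (rule sb) auto
        finally show ?thesis by simp
      qed
      finally have "sum x (V - U) \<le> sum x ?Lx + (sum y ?Ly + \<zeta> + sum b (V - U))" by simp
      moreover have "sum b (V - U) \<le> \<zeta>" by (rule sb) auto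
      ultimately have "sum x (V - U) \<le> \<zeta>1" using low[OF x] low[OF y(1-3)] \<zeta>(3) by linarith
      moreover have "sum x (V - U) = sum x V - sum x U" by (rule sum_diff[OF finV UV])
      ultimately have xU: "1 - \<zeta>1 \<le> sum x U" using x(2) by linarith
      have deg: "real r * d - \<zeta>1 \<le> lag (link E w) x" if "w \<in> heavy \<zeta> V E x" for w
        using that \<zeta> \<zeta>1 unfolding heavy_def by auto
      have "frame V E x U c" using E x UV c(1) by (auto simp: frame_def U_def)
      then have "near_turan \<zeta>1 V E E x U c"
        unfolding near_turan_def using c(2) xU deg by (auto simp: U_def)
      moreover have "avoids \<kappa> V E x" using hf by (simp add: avoids_def)
      moreover have "U \<subseteq> heavy \<zeta> V E x" by (auto simp: U_def)
      ultimately show ?thesis using ext[unfolded extends_def] heavy_sub deg by blast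
    qed
    have main: "colourable E (heavy \<zeta> V E x)" if "\<forall>v\<in>V. 0 \<le> x v" "sum x V = 1" "d - \<epsilon> \<le> lag E x" for x
      using that
    proof (induction "card {v\<in>V. x v > 0}" arbitrary: x rule: less_induct)
      case less
      let ?P = "{v\<in>V. x v > 0}"
      show ?case
      proof (cases "\<forall>u\<in>?P. \<forall>v\<in>?P. u \<noteq> v \<longrightarrow> (\<exists>e\<in>E. e \<subseteq> ?P \<and> u \<in> e \<and> v \<in> e)")
        case True
        have "d - \<epsilon>1 \<le> lag E x" using less.prems(3) \<epsilon>(2) by linarith
        then show ?thesis using base E hf less.prems(1,2) True by blast
      next
        case False
        then obtain u v where uv: "u \<in> ?P" "v \<in> ?P" "u \<noteq> v" "\<not> (\<exists>e\<in>E. e \<subseteq> ?P \<and> u \<in> e \<and> v \<in> e)" by blast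
        have key: "colourable E (heavy \<zeta> V E x)"
          if uv: "u \<in> ?P" "v \<in> ?P" "u \<noteq> v" "\<not> (\<exists>e\<in>E. e \<subseteq> ?P \<and> u \<in> e \<and> v \<in> e)"
            and deg: "lag (link E v) x \<le> lag (link E u) x" for u v
        proof -
          have uV: "u \<in> V" "v \<in> V" "x u > 0" "x v > 0" using uv by auto
          have z: "lag (link (link E u) v) x = 0"
            by (rule uncovered_shift[OF E _ uV(1,2) uv(3) uV(3,4) uv(4)]) (use less.prems in blast)
          \<comment> \<open>Enough steps for each of them to move at most \<zeta>.\<close>
          obtain N :: nat where N: "x v / \<zeta> < real N" using reals_Archimedean2 by blast
          have "0 < x v / \<zeta>" using uV \<zeta> by simp
          then have N0: "0 < N" using N by (cases N) auto
          define \<tau> where "\<tau> = x v / real N"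
          have \<tau>: "0 < \<tau>" "\<tau> \<le> \<zeta>" "real N * \<tau> = x v"
            unfolding \<tau>_def using N N0 uV \<zeta> by (auto simp: field_simps)
          define y where "y j = x(u := x u + real j * \<tau>, v := x v - real j * \<tau>)" for j
          have yw: "y j w = (if w = v then x v - real j * \<tau> else if w = u then x u + real j * \<tau> else x w)" for j w
            by (simp add: y_def)
          have j\<tau>: "real j * \<tau> \<le> x v" if "j \<le> N" for j
          proof -
            have "real j * \<tau> \<le> real N * \<tau>" by (rule mult_right_mono) (use that \<tau> in auto)
            then show ?thesis using \<tau>(3) by simp
          qed
          have yprops: "\<forall>w\<in>V. 0 \<le> y j w" "sum (y j) V = 1" "d - \<epsilon> \<le> lag E (y j)" if j: "j \<le> N" for j
          proof -
            have j0: "0 \<le> real j * \<tau>" using \<tau>(1) by simp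
            show "\<forall>w\<in>V. 0 \<le> y j w"
            proof
              fix w assume "w \<in> V"
              then show "0 \<le> y j w" unfolding yw using j\<tau>[OF j] j0 uV less.prems(1) by simp
            qed
            show "sum (y j) V = 1" unfolding y_def using sum_shift[OF finV uV(1,2) uv(3)] less.prems(2) by simp
            have "lag E (y j) = lag E x + real j * \<tau> * (lag (link E u) x - lag (link E v) x)"
              unfolding y_def using lag_shift(1)[OF E uv(3), of x "real j * \<tau>"] z by simp
            moreover have "0 \<le> real j * \<tau> * (lag (link E u) x - lag (link E v) x)"
              by (rule mult_nonneg_nonneg[OF j0]) (use deg in simp)
            ultimately show "d - \<epsilon> \<le> lag E (y j)" using less.prems(3) by linarith
          qed
          \<comment> \<open>Downward induction from \<open>y N\<close>, whose support is smaller
            because it lacks \<open>v\<close>, to \<open>y 0\<close>, which is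
            \<open>x\<close>.\<close>
          have "colourable E (heavy \<zeta> V E (y 0))"
          proof (rule inc_induct[of 0 N])
            show "0 \<le> N" by simp
            have "{w\<in>V. y N w > 0} \<subseteq> ?P"
            proof
              fix w assume "w \<in> {w\<in>V. y N w > 0}"
              then have w: "w \<in> V" "y N w > 0" by blast+
              show "w \<in> ?P"
              proof (cases "w = u \<or> w = v")
                case False
                then show ?thesis using w unfolding yw by simp
              qed (use uv(1,2) in blast)
            qed
            moreover have "v \<notin> {w\<in>V. y N w > 0}" using \<tau>(3) by (simp add: yw)
            ultimately have "{w\<in>V. y N w > 0} \<subset> ?P" using uv(2) by blast
            then have "card {w\<in>V. y N w > 0} < card ?P" using finV by (intro psubset_card_mono) auto
            then show "colourable E (heavy \<zeta> V E (y N))"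
              by (rule less.hyps) (use yprops[of N] in auto)
            fix j assume j: "j < N" and IH: "colourable E (heavy \<zeta> V E (y (Suc j)))"
            have eq: "y (Suc j) = (y j)(u := y j u + \<tau>, v := y j v - \<tau>)"
              using uv(3) by (simp add: y_def fun_eq_iff algebra_simps)
            have "real j * \<tau> < real N * \<tau>" using j \<tau>(1) by simp
            then have pv: "y j v > 0" using \<tau>(3) by (simp add: yw)
            have "0 \<le> real j * \<tau>" using \<tau>(1) by simp
            then have pu: "y j u > 0" unfolding yw using uv(3) uV(3) by simp
            have jN: "j \<le> N" "Suc j \<le> N" using j by auto
            show "colourable E (heavy \<zeta> V E (y j))"
              by (rule step[OF yprops[OF jN(1)] yprops[OF jN(2)] IH uV(1,2) uv(3) pu pv eq less_imp_le[OF \<tau>(1)] \<tau>(2)])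
          qed
          moreover have "y 0 = x" by (simp add: y_def fun_eq_iff)
          ultimately show ?thesis by simp
        qed
        show ?thesis
        proof (cases "lag (link E v) x \<le> lag (link E u) x")
          case True
          then show ?thesis using key[OF uv] by blast
        next
          case False
          have uv': "\<not> (\<exists>e\<in>E. e \<subseteq> ?P \<and> v \<in> e \<and> u \<in> e)" using uv(4) by blast
          show ?thesis by (rule key[OF uv(2,1) uv(3)[symmetric] uv']) (use False in simp)
        qed
      qed
    qed
    show "sum x {v\<in>V. lag (link E v) x < real r * d - \<zeta>} \<le> \<zeta> \<and> colourable E (heavy \<zeta> V E x)"
      using low[OF x] main[OF x] by blast
  qed
qed

end

section \<open>Turan hypergraphs\<close>

lemma turan_edges:
  assumes "m > 0"
  shows "edges (turan r n m) = {e. e \<subseteq> {..<n} \<and> card e = r \<and> inj_on (\<lambda>x. x mod m) e}"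
proof -
  have "(\<forall>i<m. card {x\<in>e. x mod m = i} \<le> 1) \<longleftrightarrow> inj_on (\<lambda>x. x mod m) e" if "e \<subseteq> {..<n}" for e
  proof
    have fin: "finite e" using that finite_subset by blast
    assume l: "\<forall>i<m. card {x\<in>e. x mod m = i} \<le> 1"
    show "inj_on (\<lambda>x. x mod m) e"
    proof (rule inj_onI, rule ccontr)
      fix a b assume ab: "a \<in> e" "b \<in> e" "a mod m = b mod m" "a \<noteq> b"
      have "card {a, b} \<le> card {x\<in>e. x mod m = a mod m}"
        by (rule card_mono) (use fin ab in auto)
      moreover have "card {x\<in>e. x mod m = a mod m} \<le> 1" using l assms by simp
      ultimately show False using ab(4) by simp
    qed
  next
    assume inj: "inj_on (\<lambda>x. x mod m) e"
    show "\<forall>i<m. card {x\<in>e. x mod m = i} \<le> 1"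
    proof (intro allI impI)
      fix i
      have fin: "finite {x\<in>e. x mod m = i}" using that finite_subset[of e "{..<n}"] by simp
      show "card {x\<in>e. x mod m = i} \<le> 1"
        unfolding One_nat_def card_le_Suc0_iff_eq[OF fin] using inj by (auto dest: inj_onD)
    qed
  qed
  then show ?thesis unfolding turan_def by (simp only: hypergraph.select_convs) (rule Collect_cong, blast)
qed

lemma card_rainbow:
  assumes U: "finite U" and c: "\<And>v. v \<in> U \<Longrightarrow> c v < m"
  shows "real (card {e. e \<subseteq> U \<and> card e = r \<and> inj_on c e})
    = lag (complete_edges r {..<m}) (\<lambda>i. real (card (cls c U i)))"
proof -
  let ?E = "{e. e \<subseteq> U \<and> card e = r \<and> inj_on c e}"
  have "real (card ?E) = lag ?E (\<lambda>_. 1)" by (simp add: lag_def)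
  also have "\<dots> = (\<Sum>I\<in>complete_edges r {..<m}. \<Sum>e\<in>rsets c U I \<inter> ?E. \<Prod>v\<in>e. 1)"
    by (rule lag_types[OF U]) (use c in auto)
  also have "\<dots> = (\<Sum>I\<in>complete_edges r {..<m}. \<Sum>e\<in>rsets c U I. \<Prod>v\<in>e. (1::real))"
  proof (rule sum.cong[OF refl])
    fix I assume "I \<in> complete_edges r {..<m}"
    then have "card e = r" if "e \<in> rsets c U I" for e
      using card_rsets[OF that] by (simp add: complete_edges_def)
    then have "rsets c U I \<inter> ?E = rsets c U I" by (auto simp: rsets_def)
    then show "(\<Sum>e\<in>rsets c U I \<inter> ?E. \<Prod>v\<in>e. 1) = (\<Sum>e\<in>rsets c U I. \<Prod>v\<in>e. (1::real))" by simp
  qed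
  also have "\<dots> = lag (complete_edges r {..<m}) (\<lambda>i. \<Sum>v\<in>cls c U i. 1)"
    by (rule lag_complete_cls[OF U, symmetric]) simp
  finally show ?thesis by simp
qed

text \<open>By symmetry of the clique the two degrees differ by \<open>x v - x u\<close> times the
  codegree, so the exact expansion leaves the gain \<open>t * (x v - x u - t)\<close> times the
  codegree.\<close>

lemma complete_smooth:
  assumes A: "finite A" "u \<in> A" "v \<in> A" "u \<noteq> v" and x: "\<And>i. i \<in> A \<Longrightarrow> 0 \<le> x i"
    and t: "0 \<le> t" "t \<le> x v - x u" and q: "q \<ge> 1"
  shows "lag (complete_edges q A) x \<le> lag (complete_edges q A) (x(u := x u + t, v := x v - t))"
proof -
  let ?C = "complete_edges q A"
  have uC: "unif q A ?C" by (rule unif_complete[OF A(1)])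
  let ?D = "lag (link (link ?C u) v) x"
  have D: "0 \<le> ?D" by (rule lag_nonneg[OF unif_link[OF unif_link[OF uC]]]) (use x in auto)
  have "{e\<in>link ?C u. v \<notin> e} = {e\<in>link ?C v. u \<notin> e}"
    unfolding link_complete[OF A(1,2) q] link_complete[OF A(1,3) q]
    using A(2-4) by (auto simp: complete_edges_def)
  moreover have "lag (link ?C u) x = x v * ?D + lag {e\<in>link ?C u. v \<notin> e} x"
    by (rule lag_split[OF unif_link[OF uC]])
  moreover have "lag (link ?C v) x = x u * lag (link (link ?C v) u) x + lag {e\<in>link ?C v. u \<notin> e} x"
    by (rule lag_split[OF unif_link[OF uC]])
  ultimately have "lag (link ?C u) x - lag (link ?C v) x = (x v - x u) * ?D"
    using link_commute[of ?C u v] by (simp add: algebra_simps)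
  then have "lag ?C (x(u := x u + t, v := x v - t)) = lag ?C x + t * ((x v - x u) * ?D) - t\<^sup>2 * ?D"
    using lag_shift(1)[OF uC A(4), of x t] by simp
  also have "\<dots> = lag ?C x + t * (x v - x u - t) * ?D" by (simp add: algebra_simps power2_eq_square)
  also have "\<dots> \<ge> lag ?C x" using t D by simp
  finally show ?thesis .
qed

lemma lag_complete_reindex:
  assumes "finite A" "bij_betw h A A" "\<And>i. i \<in> A \<Longrightarrow> f i = g (h i)"
  shows "lag (complete_edges q A) f = lag (complete_edges q A) g"
proof -
  let ?C = "complete_edges q A"
  have inj: "inj_on h A" and im: "h ` A = A" using assms(2) by (auto simp: bij_betw_def)
  have "lag ?C f = (\<Sum>I\<in>?C. prod g (h ` I))"
    unfolding lag_def
  proof (rule sum.cong[OF refl])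
    fix I assume "I \<in> ?C"
    then have I: "I \<subseteq> A" by (simp add: complete_edges_def)
    have "prod g (h ` I) = (\<Prod>i\<in>I. g (h i))"
      using inj_on_subset[OF inj I] by (simp add: prod.reindex)
    also have "\<dots> = prod f I" by (rule prod.cong) (use assms(3) I in auto)
    finally show "prod f I = prod g (h ` I)" by simp
  qed
  also have "\<dots> = (\<Sum>J\<in>(\<lambda>I. h ` I) ` ?C. prod g J)"
  proof (rule sum.reindex[symmetric, unfolded comp_def])
    show "inj_on (\<lambda>I. h ` I) ?C"
      by (rule inj_on_subset[OF inj_on_image_Pow[OF inj]]) (auto simp: complete_edges_def)
  qed
  also have "(\<lambda>I. h ` I) ` ?C = ?C"
  proof (rule card_subset_eq[OF finite_complete[OF assms(1)]])
    show "(\<lambda>I. h ` I) ` ?C \<subseteq> ?C"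
    proof
      fix J assume "J \<in> (\<lambda>I. h ` I) ` ?C"
      then obtain I where I: "I \<subseteq> A" "card I = q" "J = h ` I" by (auto simp: complete_edges_def)
      have "card J = q" unfolding I(3) using card_image[OF inj_on_subset[OF inj I(1)]] I(2) by simp
      moreover have "J \<subseteq> A" unfolding I(3) using I(1) im by blast
      ultimately show "J \<in> ?C" by (simp add: complete_edges_def)
    qed
    show "card ((\<lambda>I. h ` I) ` ?C) = card ?C"
      by (rule card_image, rule inj_on_subset[OF inj_on_image_Pow[OF inj]]) (auto simp: complete_edges_def)
  qed
  finally show ?thesis by (simp add: lag_def)
qed

definition balanced :: "nat \<Rightarrow> (nat \<Rightarrow> nat) \<Rightarrow> bool" where
  "balanced m f \<longleftrightarrow> (\<forall>i<m. \<forall>j<m. f i \<le> f j + 1)"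

text \<open>One unit is moved from a part to one smaller by at least 2; the sum of squares drops
  each time.\<close>

lemma balanced_dominates:
  assumes "q \<ge> 1"
  shows "\<exists>g. balanced m g \<and> sum g {..<m} = sum f {..<m} \<and>
    lag (complete_edges q {..<m}) (\<lambda>i. real (f i)) \<le> lag (complete_edges q {..<m}) (\<lambda>i. real (g i))"
proof (induction "\<Sum>i<m. f i * f i" arbitrary: f rule: less_induct)
  case less
  show ?case
  proof (cases "balanced m f")
    case True
    then show ?thesis by blast
  next
    case False
    then obtain u v where uv: "u < m" "v < m" "f u + 2 \<le> f v"
      unfolding balanced_def by (metis add_2_eq_Suc' not_less_eq_eq Suc_eq_plus1)
    then have ne: "u \<noteq> v" by auto
    define h where "h = f(u := f u + 1, v := f v - 1)"
    have A: "{..<m} = insert u (insert v ({..<m} - {u, v}))" using uv by auto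
    have sA: "(\<Sum>i<m. w i) = w u + (w v + (\<Sum>i\<in>{..<m} - {u, v}. w i))" for w :: "nat \<Rightarrow> nat"
      using ne by (subst A) simp
    have hr: "(\<Sum>i\<in>{..<m} - {u, v}. h i) = (\<Sum>i\<in>{..<m} - {u, v}. f i)"
      "(\<Sum>i\<in>{..<m} - {u, v}. h i * h i) = (\<Sum>i\<in>{..<m} - {u, v}. f i * f i)"
      by (auto intro!: sum.cong simp: h_def)
    have huv: "h u = f u + 1" "h v = f v - 1" using ne by (simp_all add: h_def)
    have s: "sum h {..<m} = sum f {..<m}" unfolding sA[of h] sA[of f] hr huv using uv(3) by simp
    obtain a where a: "f v = f u + 2 + a" using uv(3) le_Suc_ex by blast
    have "(\<Sum>i<m. h i * h i) < (\<Sum>i<m. f i * f i)"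
      unfolding sA[of "\<lambda>i. h i * h i"] sA[of "\<lambda>i. f i * f i"] hr huv a by (simp add: algebra_simps)
    then obtain g where g: "balanced m g" "sum g {..<m} = sum h {..<m}"
      "lag (complete_edges q {..<m}) (\<lambda>i. real (h i)) \<le> lag (complete_edges q {..<m}) (\<lambda>i. real (g i))"
      using less.hyps by blast
    have "lag (complete_edges q {..<m}) (\<lambda>i. real (f i))
       \<le> lag (complete_edges q {..<m}) ((\<lambda>i. real (f i))(u := real (f u) + 1, v := real (f v) - 1))"
      by (rule complete_smooth) (use uv ne assms in auto)
    also have "(\<lambda>i. real (f i))(u := real (f u) + 1, v := real (f v) - 1) = (\<lambda>i. real (h i))"
      using a by (auto simp: h_def fun_eq_iff)
    finally show ?thesis using g s by (intro exI[of _ g]) auto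
  qed
qed

lemma balanced_shape:
  assumes "balanced m f" "m > 0"
  shows "\<forall>i<m. f i = sum f {..<m} div m \<or> f i = sum f {..<m} div m + 1"
    and "card {i\<in>{..<m}. f i = sum f {..<m} div m + 1} = sum f {..<m} mod m"
proof -
  define q where "q = Min (f ` {..<m})"
  have ne: "f ` {..<m} \<noteq> {}" using assms(2) by auto
  have "q \<in> f ` {..<m}" unfolding q_def by (rule Min_in) (use ne in auto)
  then obtain i0 where i0: "i0 < m" "f i0 = q" by auto
  have q: "q \<le> f i" if "i < m" for i unfolding q_def by (rule Min_le) (use that in auto)
  have two: "f i = q \<or> f i = q + 1" if "i < m" for i
    using q[OF that] assms(1) i0 that unfolding balanced_def by (metis Suc_eq_plus1 le_SucE le_antisym)
  let ?B = "{i\<in>{..<m}. f i = q + 1}"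
  have "sum f {..<m} = (\<Sum>i<m. q + (if i \<in> ?B then 1 else 0))"
    by (rule sum.cong) (use two in auto)
  also have "\<dots> = m * q + card ?B" by (simp add: sum.distrib sum.If_cases Int_def conj_commute)
  finally have s: "sum f {..<m} = m * q + card ?B" .
  have "card ?B \<le> card ({..<m} - {i0})" by (rule card_mono) (use i0 in auto)
  then have "card ?B < m" using i0(1) by simp
  then have d: "sum f {..<m} div m = q" "sum f {..<m} mod m = card ?B" unfolding s by simp_all
  show "\<forall>i<m. f i = sum f {..<m} div m \<or> f i = sum f {..<m} div m + 1" unfolding d using two by simp
  show "card {i\<in>{..<m}. f i = sum f {..<m} div m + 1} = sum f {..<m} mod m" unfolding d ..
qed

text \<open>Balanced size vectors with equal sums are permutations of each other, and the clique is
  symmetric.\<close>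

lemma balanced_lag_eq:
  assumes f: "balanced m f" and g: "balanced m g" and s: "sum f {..<m} = sum g {..<m}" and m: "m > 0"
  shows "lag (complete_edges q {..<m}) (\<lambda>i. real (f i)) = lag (complete_edges q {..<m}) (\<lambda>i. real (g i))"
proof -
  let ?p = "sum g {..<m} div m"
  let ?A = "{i\<in>{..<m}. f i = ?p + 1}" and ?B = "{i\<in>{..<m}. g i = ?p + 1}"
  have cA: "card ?A = card ?B" using balanced_shape(2)[OF f m] balanced_shape(2)[OF g m] s by simp
  obtain h where h: "bij_betw h {..<m} {..<m}" "h ` ?A = ?B"
    using ex_bij_betw_subset[of "{..<m}" "{..<m}" ?A ?B] cA by auto
  show ?thesis
  proof (rule lag_complete_reindex[OF _ h(1)])
    fix i assume i: "i \<in> {..<m}"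
    have hi: "h i \<in> {..<m}" using bij_betwE[OF h(1)] i by blast
    have "f i = ?p + 1 \<longleftrightarrow> g (h i) = ?p + 1"
    proof
      assume "f i = ?p + 1"
      then have "h i \<in> h ` ?A" using i by blast
      then show "g (h i) = ?p + 1" unfolding h(2) by blast
    next
      assume "g (h i) = ?p + 1"
      then have "h i \<in> h ` ?A" unfolding h(2) using hi by blast
      then obtain j where "j \<in> ?A" "h j = h i" by force
      then have "j = i" using bij_betw_imp_inj_on[OF h(1)] i by (auto dest: inj_onD)
      then show "f i = ?p + 1" using \<open>j \<in> ?A\<close> by simp
    qed
    moreover have "f i = ?p \<or> f i = ?p + 1" "g (h i) = ?p \<or> g (h i) = ?p + 1"
      using balanced_shape(1)[OF f m] balanced_shape(1)[OF g m] s i hi by auto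
    ultimately show "real (f i) = real (g (h i))" by auto
  qed simp
qed

lemma sum_card_cls:
  assumes "finite U" "\<And>v. v \<in> U \<Longrightarrow> c v < m"
  shows "(\<Sum>i<m. card (cls c U i)) = card U"
proof -
  have "(\<Sum>i<m. \<Sum>v\<in>cls c U i. 1) = (\<Sum>v\<in>U. 1::nat)"
    unfolding cls_def by (rule sum.group) (use assms in auto)
  then show ?thesis by simp
qed

lemma balanced_mod: "m > 0 \<Longrightarrow> balanced m (\<lambda>i. card (cls (\<lambda>x. x mod m) {..<n} i))"
  unfolding balanced_def cls_def using turan_parts_balanced by blast

lemma card_turan:
  assumes "m > 0"
  shows "real (card (edges (turan r n m))) = lag (complete_edges r {..<m}) (\<lambda>i. real (card (cls (\<lambda>x. x mod m) {..<n} i)))"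
  unfolding turan_edges[OF assms] by (rule card_rainbow) (use assms in auto)

lemma card_rainbow_le_turan:
  assumes m: "m > 0" and r: "r \<ge> 1" and c: "\<And>v. v < n \<Longrightarrow> c v < m"
    and E: "\<And>e. e \<in> E \<Longrightarrow> e \<subseteq> {..<n} \<and> card e = r \<and> inj_on c e"
  shows "card E \<le> card (edges (turan r n m))"
proof -
  let ?R = "{e. e \<subseteq> {..<n} \<and> card e = r \<and> inj_on c e}"
  have "finite ?R" by (rule finite_subset[of _ "Pow {..<n}"]) auto
  then have "card E \<le> card ?R" by (rule card_mono) (use E in blast)
  moreover have "real (card ?R) \<le> real (card (edges (turan r n m)))"
  proof -
    let ?f = "\<lambda>i. card (cls c {..<n} i)" and ?t = "\<lambda>i. card (cls (\<lambda>x. x mod m) {..<n} i)"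
    obtain g where g: "balanced m g" "sum g {..<m} = sum ?f {..<m}"
      "lag (complete_edges r {..<m}) (\<lambda>i. real (?f i)) \<le> lag (complete_edges r {..<m}) (\<lambda>i. real (g i))"
      using balanced_dominates[OF r] by blast
    have "sum ?f {..<m} = n" using sum_card_cls[of "{..<n}" c m] c by simp
    moreover have "sum ?t {..<m} = n" using sum_card_cls[of "{..<n}" "\<lambda>x. x mod m" m] m by simp
    ultimately have "lag (complete_edges r {..<m}) (\<lambda>i. real (g i)) = lag (complete_edges r {..<m}) (\<lambda>i. real (?t i))"
      using g(2) by (intro balanced_lag_eq[OF g(1) balanced_mod[OF m] _ m]) simp
    moreover have "real (card ?R) = lag (complete_edges r {..<m}) (\<lambda>i. real (?f i))"
      by (rule card_rainbow) (use c in auto)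
    ultimately show ?thesis using g(3) card_turan[OF m] by simp
  qed
  ultimately show ?thesis by linarith
qed

lemma lag_const: "unif r V E \<Longrightarrow> lag E (\<lambda>_. a) = real (card E) * a ^ r"
  unfolding lag_def using unif_edge by (simp add: unif_def)

text \<open>The new vertex \<open>n\<close> joins the class \<open>n mod m\<close>, and every class
  already has at least \<open>n div m\<close> vertices.\<close>

lemma turan_min_degree:
  assumes m: "m > 0" and r: "r \<ge> 1"
  shows "real ((m - 1) choose (r - 1)) * real (n div m) ^ (r - 1) + real (card (edges (turan r n m)))
    \<le> real (card (edges (turan r (Suc n) m)))"
proof -
  let ?s = "\<lambda>n i. card (cls (\<lambda>x. x mod m) {..<n} i)"
  let ?C = "complete_edges r {..<m}"
  let ?x = "\<lambda>i. real (?s n i)"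
  define j where "j = n mod m"
  have j: "j < m" using m by (simp add: j_def)
  have uC: "unif r {..<m} ?C" by (rule unif_complete) simp
  have size: "?s (Suc n) i = (if i = j then ?s n i + 1 else ?s n i)" for i
  proof (cases "i = j")
    case True
    then have "cls (\<lambda>x. x mod m) {..<Suc n} i = insert n (cls (\<lambda>x. x mod m) {..<n} i)"
      by (auto simp: cls_def j_def less_Suc_eq)
    moreover have "n \<notin> cls (\<lambda>x. x mod m) {..<n} i" "finite (cls (\<lambda>x. x mod m) {..<n} i)" by (auto simp: cls_def)
    ultimately show ?thesis using True by simp
  next
    case False
    then have "cls (\<lambda>x. x mod m) {..<Suc n} i = cls (\<lambda>x. x mod m) {..<n} i"
      by (auto simp: cls_def j_def less_Suc_eq)
    then show ?thesis using False by simp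
  qed
  have "(\<lambda>i. real (?s (Suc n) i)) = ?x(j := ?x j + 1)"
    unfolding size by (auto simp: fun_eq_iff)
  then have "real (card (edges (turan r (Suc n) m))) = lag ?C (?x(j := ?x j + 1))"
    using card_turan[OF m, of r "Suc n"] by simp
  also have "\<dots> = (?x j + 1) * lag (link ?C j) ?x + lag {e\<in>?C. j \<notin> e} ?x"
  proof -
    have "lag ?C (?x(j := ?x j + 1)) = (?x(j := ?x j + 1)) j * lag (link ?C j) (?x(j := ?x j + 1)) + lag {e\<in>?C. j \<notin> e} (?x(j := ?x j + 1))"
      by (rule lag_split[OF uC])
    also have "lag (link ?C j) (?x(j := ?x j + 1)) = lag (link ?C j) ?x" by (rule lag_link_upd)
    also have "lag {e\<in>?C. j \<notin> e} (?x(j := ?x j + 1)) = lag {e\<in>?C. j \<notin> e} ?x" by (rule lag_upd_notin) auto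
    finally show ?thesis by (simp only: fun_upd_same)
  qed
  also have "\<dots> = lag ?C ?x + lag (link ?C j) ?x"
    using lag_split[OF uC, of ?x j] by (simp add: algebra_simps)
  also have "lag ?C ?x = real (card (edges (turan r n m)))" using card_turan[OF m] by simp
  finally have 1: "real (card (edges (turan r (Suc n) m))) = real (card (edges (turan r n m))) + lag (link ?C j) ?x" .
  have big: "n div m \<le> ?s n i" if i: "i < m" for i
  proof -
    have "card ((\<lambda>q. m * q + i) ` {..<n div m}) \<le> ?s n i"
    proof (rule card_mono)
      show "finite (cls (\<lambda>x. x mod m) {..<n} i)" by (simp add: cls_def)
      show "(\<lambda>q. m * q + i) ` {..<n div m} \<subseteq> cls (\<lambda>x. x mod m) {..<n} i"
      proof
        fix y assume "y \<in> (\<lambda>q. m * q + i) ` {..<n div m}"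
        then obtain q where q: "q < n div m" "y = m * q + i" by auto
        have "m * q + i < m * Suc q" using i by simp
        also have "\<dots> \<le> m * (n div m)" by (rule mult_le_mono2) (use q in simp)
        also have "\<dots> \<le> n" by simp
        finally show "y \<in> cls (\<lambda>x. x mod m) {..<n} i" using q(2) i by (simp add: cls_def)
      qed
    qed
    moreover have "card ((\<lambda>q. m * q + i) ` {..<n div m}) = n div m"
      by (subst card_image) (use m in \<open>auto simp: inj_on_def\<close>)
    ultimately show ?thesis by simp
  qed
  have L: "link ?C j = complete_edges (r - 1) ({..<m} - {j})"
    by (rule link_complete) (use j r in auto)
  have uL: "unif (r - 1) ({..<m} - {j}) (link ?C j)" by (rule unif_link[OF uC])
  have "card (link ?C j) = (m - 1) choose (r - 1)"
    unfolding L unfolding complete_edges_def using n_subsets[of "{..<m} - {j}" "r - 1"] j by simp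
  then have "real ((m - 1) choose (r - 1)) * real (n div m) ^ (r - 1) = lag (link ?C j) (\<lambda>_. real (n div m))"
    using lag_const[OF uL] by simp
  also have "\<dots> \<le> lag (link ?C j) ?x"
    by (rule lag_mono[OF uL]) (use big in auto)
  finally show ?thesis using 1 by simp
qed

section \<open>From homomorphism-free to copy-free\<close>

lemma finite_pairs: "finite V \<Longrightarrow> finite {P. P \<subseteq> V \<and> card P = 2}"
  by (rule finite_subset[of _ "Pow V"]) auto

lemma card_pairs_le: "finite V \<Longrightarrow> card {P. P \<subseteq> V \<and> card P = 2} \<le> card V ^ 2"
proof -
  assume V: "finite V"
  have "card V choose 2 \<le> card V ^ 2"
    by (cases "2 \<le> card V") (auto intro: binomial_le_pow simp: binomial_eq_0)
  then show ?thesis using n_subsets[OF V, of 2] by simp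
qed

text \<open>Choosing a subgraph that maximises the number of edges plus \<open>L\<close> times the number of uncovered
  pairs makes every pair that remains covered have codegree at least \<open>L\<close>.\<close>

lemma codegree_cleaning:
  assumes E: "unif r V E"
  obtains E' where "E' \<subseteq> E" "card E \<le> card E' + L * card V ^ 2"
    "\<And>P. P \<subseteq> V \<Longrightarrow> card P = 2 \<Longrightarrow> \<exists>e\<in>E'. P \<subseteq> e \<Longrightarrow> L \<le> card {e\<in>E'. P \<subseteq> e}"
proof -
  have finV: "finite V" and finE: "finite E" using unif_finite_verts[OF E] unif_finite[OF E] by auto
  define un where "un F = {P. P \<subseteq> V \<and> card P = 2 \<and> \<not> (\<exists>e\<in>F. P \<subseteq> e)}" for F
  define val where "val F = card F + L * card (un F)" for F
  have finun: "finite (un F)" for F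
    by (rule finite_subset[OF _ finite_pairs[OF finV]]) (auto simp: un_def)
  have "Max (val ` Pow E) \<in> val ` Pow E" by (rule Max_in) (use finE in auto)
  then obtain E' where E': "E' \<subseteq> E" "val E' = Max (val ` Pow E)" by auto
  have max: "val F \<le> val E'" if "F \<subseteq> E" for F unfolding E'(2) by (rule Max_ge) (use finE that in auto)
  have finE': "finite E'" using E'(1) finE finite_subset by blast
  show thesis
  proof (rule that[OF E'(1)])
    have "card E \<le> val E" by (simp add: val_def)
    also have "\<dots> \<le> val E'" by (rule max) simp
    also have "\<dots> \<le> card E' + L * card V ^ 2"
    proof -
      have "card (un E') \<le> card {P. P \<subseteq> V \<and> card P = 2}"
        by (rule card_mono[OF finite_pairs[OF finV]]) (auto simp: un_def)
      also have "\<dots> \<le> card V ^ 2" by (rule card_pairs_le[OF finV])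
      finally show ?thesis unfolding val_def by (intro add_left_mono mult_le_mono2)
    qed
    finally show "card E \<le> card E' + L * card V ^ 2" .
  next
    fix P assume P: "P \<subseteq> V" "card P = 2" "\<exists>e\<in>E'. P \<subseteq> e"
    let ?c = "{e\<in>E'. P \<subseteq> e}"
    let ?F = "E' - ?c"
    have cF: "card ?F + card ?c = card E'"
      using card_Diff_subset[of ?c E'] card_mono[of E' ?c] finE' by simp
    have "P \<in> un ?F" "P \<notin> un E'" using P by (auto simp: un_def)
    moreover have "un E' \<subseteq> un ?F" by (auto simp: un_def)
    ultimately have "un E' \<subset> un ?F" by blast
    then have "card (un E') < card (un ?F)" by (rule psubset_card_mono[OF finun])
    then have "card (un E') + 1 \<le> card (un ?F)" by simp
    then have "L * (card (un E') + 1) \<le> L * card (un ?F)" by (rule mult_le_mono2)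
    moreover have "val ?F \<le> val E'" by (rule max) (use E'(1) in auto)
    ultimately show "L \<le> card ?c" using cF unfolding val_def by simp
  qed
qed

text \<open>Besides \<open>P\<close> and one vertex of \<open>W\<close>, only \<open>r - 3\<close>
  vertices remain to be chosen.\<close>

lemma few_edges_meet:
  assumes E: "unif r V E" and P: "finite P" "card P = 2" and W: "finite W" "W \<inter> P = {}" and r: "r \<ge> 3" and V: "card V \<ge> 1"
  shows "card {e\<in>E. P \<subseteq> e \<and> e \<inter> W \<noteq> {}} \<le> card W * card V ^ (r - 3)"
proof -
  have finV: "finite V" and finE: "finite E" using unif_finite_verts[OF E] unif_finite[OF E] by auto
  have one: "card {e\<in>E. P \<subseteq> e \<and> w \<in> e} \<le> card V ^ (r - 3)" if w: "w \<in> W" for w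
  proof -
    have wP: "w \<notin> P" using w W by auto
    have "card {e\<in>E. P \<subseteq> e \<and> w \<in> e} \<le> card {f. f \<subseteq> V \<and> card f = r - 3}"
    proof (rule card_inj_on_le[of "\<lambda>e. e - insert w P"])
      show "inj_on (\<lambda>e. e - insert w P) {e\<in>E. P \<subseteq> e \<and> w \<in> e}" by (rule inj_onI) blast
      show "(\<lambda>e. e - insert w P) ` {e\<in>E. P \<subseteq> e \<and> w \<in> e} \<subseteq> {f. f \<subseteq> V \<and> card f = r - 3}"
      proof (rule image_subsetI)
        fix e assume e: "e \<in> {e\<in>E. P \<subseteq> e \<and> w \<in> e}"
        then have e': "finite e" "e \<subseteq> V" "card e = r" "insert w P \<subseteq> e" using unif_edge[OF E] by auto
        have "card (e - insert w P) = card e - card (insert w P)"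
          by (rule card_Diff_subset) (use P e' in auto)
        also have "card (insert w P) = 3" using P wP by simp
        finally show "e - insert w P \<in> {f. f \<subseteq> V \<and> card f = r - 3}" using e' by auto
      qed
      show "finite {f. f \<subseteq> V \<and> card f = r - 3}" by (rule finite_subset[of _ "Pow V"]) (use finV in auto)
    qed
    also have "\<dots> = card V choose (r - 3)" by (rule n_subsets[OF finV])
    also have "\<dots> \<le> card V ^ (r - 3)"
      by (cases "r - 3 \<le> card V") (auto intro: binomial_le_pow simp: binomial_eq_0)
    finally show ?thesis .
  qed
  have "{e\<in>E. P \<subseteq> e \<and> e \<inter> W \<noteq> {}} = (\<Union>w\<in>W. {e\<in>E. P \<subseteq> e \<and> w \<in> e})" by auto
  then have "card {e\<in>E. P \<subseteq> e \<and> e \<inter> W \<noteq> {}} \<le> (\<Sum>w\<in>W. card {e\<in>E. P \<subseteq> e \<and> w \<in> e})"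
    using card_UN_le[OF W(1), of "\<lambda>w. {e\<in>E. P \<subseteq> e \<and> w \<in> e}"] by simp
  also have "\<dots> \<le> (\<Sum>w\<in>W. card V ^ (r - 3))" by (rule sum_mono) (rule one)
  finally show ?thesis by simp
qed

lemma contains_copy_mono:
  assumes "contains_copy G F" "verts G \<subseteq> verts G'" "edges G \<subseteq> edges G'"
  shows "contains_copy G' F"
  using assms unfolding contains_copy_def by (meson subset_eq)

context pendant_core
begin

text \<open>Any two core vertices share an edge of \<open>H\<close>, and edges keep their size
  \<open>r\<close>, so a homomorphism cannot identify them. Global injectivity can fail only through
  auxiliary vertices.\<close>

lemma hom_inj_on_core:
  assumes E: "unif r V E" and \<psi>: "\<And>e. e \<in> edges H \<Longrightarrow> \<psi> ` e \<in> E"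
  shows "inj_on (\<lambda>c. \<psi> (Core c)) (verts K)"
    and "\<And>u v. u \<in> verts K \<Longrightarrow> v \<in> verts K \<Longrightarrow> u \<noteq> v \<Longrightarrow> \<exists>e\<in>E. {\<psi> (Core u), \<psi> (Core v)} \<subseteq> e"
proof -
  have ex: "\<exists>e\<in>edges H. Core u \<in> e \<and> Core v \<in> e" if uv: "u \<in> verts K" "v \<in> verts K" "u \<noteq> v" for u v
  proof (cases "covered K u v")
    case True
    then obtain e where e: "e \<in> edges K" "u \<in> e" "v \<in> e" by (auto simp: covered_def)
    show ?thesis by (rule bexI[OF _ core_edge_in_H[OF e(1)]]) (use e in simp)
  next
    case False
    then have P: "{u, v} \<in> uncovered_pairs K" using uv by (auto simp: uncovered_pairs_def)
    show ?thesis by (rule bexI[OF _ aux_edge_in_H[OF P]]) simp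
  qed
  have inj: "inj_on \<psi> e" if e: "e \<in> edges H" for e
  proof (rule eq_card_imp_inj_on)
    show "finite e" using card_H_edge[OF e] by simp
    show "card (\<psi> ` e) = card e" using card_H_edge(1)[OF e] unif_edge[OF E \<psi>[OF e]] by simp
  qed
  show "inj_on (\<lambda>c. \<psi> (Core c)) (verts K)"
  proof (rule inj_onI, rule ccontr)
    fix u v assume uv: "u \<in> verts K" "v \<in> verts K" "\<psi> (Core u) = \<psi> (Core v)" "u \<noteq> v"
    obtain e where e: "e \<in> edges H" "Core u \<in> e" "Core v \<in> e" using ex[OF uv(1,2,4)] by blast
    then show False using inj_onD[OF inj[OF e(1)] uv(3)] uv(4) by simp
  qed
  show "\<exists>e\<in>E. {\<psi> (Core u), \<psi> (Core v)} \<subseteq> e" if uv: "u \<in> verts K" "v \<in> verts K" "u \<noteq> v" for u v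
  proof -
    obtain e where e: "e \<in> edges H" "Core u \<in> e" "Core v \<in> e" using ex[OF uv] by blast
    show ?thesis
      by (rule bexI[OF _ \<psi>[OF e(1)]]) (use imageI[OF e(2), of \<psi>] imageI[OF e(3), of \<psi>] in simp)
  qed
qed

text \<open>Bounds the number of vertices to be avoided by a new auxiliary edge: the images of the
  core and the edges chosen before.\<close>

definition reserve :: nat where
  "reserve = Suc m + r * card (uncovered_pairs K)"

text \<open>The core images are kept and the auxiliary edges are chosen anew, one after the other.
  The codegree of a covered pair exceeds the number of its edges that meet the forbidden
  vertices.\<close>

lemma copy_of_hom:
  assumes E: "unif r V E" and \<psi>: "\<And>e. e \<in> edges H \<Longrightarrow> \<psi> ` e \<in> E" and r3: "r \<ge> 3" and V: "card V \<ge> 1"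
    and cod: "\<And>P. P \<subseteq> V \<Longrightarrow> card P = 2 \<Longrightarrow> \<exists>e\<in>E. P \<subseteq> e \<Longrightarrow> Suc reserve * card V ^ (r - 3) \<le> card {e\<in>E. P \<subseteq> e}"
  shows "contains_copy \<lparr>verts = V, edges = E\<rparr> H"
proof -
  define \<phi> where "\<phi> c = \<psi> (Core c)" for c
  have inj: "inj_on \<phi> (verts K)" and cov: "\<And>u v. u \<in> verts K \<Longrightarrow> v \<in> verts K \<Longrightarrow> u \<noteq> v \<Longrightarrow> \<exists>e\<in>E. {\<phi> u, \<phi> v} \<subseteq> e"
    using hom_inj_on_core[OF E \<psi>] unfolding \<phi>_def by blast+
  have finE: "finite E" by (rule unif_finite[OF E])
  have psiV: "\<psi> ` verts H \<subseteq> V"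
    using \<psi> unif_edge[OF E] unfolding Union_edges_H[symmetric] by blast
  have \<phi>V: "\<phi> c \<in> V" if "c \<in> verts K" for c
    using psiV that unfolding \<phi>_def by (auto simp: ext_graph_def)
  have img: "finite (\<phi> ` P)" "card (\<phi> ` P) = 2" "\<phi> ` P \<subseteq> V" "\<exists>e\<in>E. \<phi> ` P \<subseteq> e" "P \<subseteq> verts K"
    if P: "P \<in> uncovered_pairs K" for P
  proof -
    obtain u v where uv: "P = {u, v}" "u \<noteq> v" "u \<in> verts K" "v \<in> verts K" using uncovered_pair[OF P] by metis
    have "\<phi> u \<noteq> \<phi> v" using inj uv by (auto dest: inj_onD)
    then show "finite (\<phi> ` P)" "card (\<phi> ` P) = 2" "\<phi> ` P \<subseteq> V" "\<exists>e\<in>E. \<phi> ` P \<subseteq> e" "P \<subseteq> verts K"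
      using uv \<phi>V cov[OF uv(3,4,2)] by auto
  qed
  have fam: "\<exists>g. (\<forall>P\<in>PP. g P \<in> E \<and> \<phi> ` P \<subseteq> g P \<and> (g P - \<phi> ` P) \<inter> \<phi> ` verts K = {}) \<and>
       (\<forall>P\<in>PP. \<forall>Q\<in>PP. P \<noteq> Q \<longrightarrow> (g P - \<phi> ` P) \<inter> (g Q - \<phi> ` Q) = {})"
    if "finite PP" "PP \<subseteq> uncovered_pairs K" for PP
    using that
  proof (induction PP rule: finite_induct)
    case empty
    then show ?case by simp
  next
    case (insert P PP)
    then obtain g where g: "\<And>P. P \<in> PP \<Longrightarrow> g P \<in> E \<and> \<phi> ` P \<subseteq> g P \<and> (g P - \<phi> ` P) \<inter> \<phi> ` verts K = {}"
       "\<And>P Q. P \<in> PP \<Longrightarrow> Q \<in> PP \<Longrightarrow> P \<noteq> Q \<Longrightarrow> (g P - \<phi> ` P) \<inter> (g Q - \<phi> ` Q) = {}"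
      by (metis insert_subset)
    have Pun: "P \<in> uncovered_pairs K" using insert by simp
    define W where "W = (\<phi> ` verts K \<union> (\<Union>Q\<in>PP. g Q)) - \<phi> ` P"
    have fing: "finite (g Q)" "card (g Q) = r" if "Q \<in> PP" for Q using g(1)[OF that] unif_edge[OF E] by auto
    have finW: "finite W" unfolding W_def using fin_K insert(1) fing by simp
    have "card W \<le> card (\<phi> ` verts K \<union> (\<Union>Q\<in>PP. g Q))"
      unfolding W_def by (rule card_mono) (use fin_K insert(1) fing in auto)
    also have "\<dots> \<le> card (\<phi> ` verts K) + card (\<Union>Q\<in>PP. g Q)" by (rule card_Un_le)
    also have "\<dots> \<le> Suc m + r * card (uncovered_pairs K)"
    proof (rule add_mono)
      show "card (\<phi> ` verts K) \<le> Suc m" using card_image_le[OF fin_K, of \<phi>] card_K by simp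
      have "card (\<Union>Q\<in>PP. g Q) \<le> (\<Sum>Q\<in>PP. card (g Q))" by (rule card_UN_le[OF insert(1)])
      also have "\<dots> = (\<Sum>Q\<in>PP. r)" by (rule sum.cong) (use fing in auto)
      also have "\<dots> = r * card PP" by simp
      also have "\<dots> \<le> r * card (uncovered_pairs K)"
        by (intro mult_le_mono2 card_mono finite_uncovered) (use insert in auto)
      finally show "card (\<Union>Q\<in>PP. g Q) \<le> r * card (uncovered_pairs K)" .
    qed
    finally have cW: "card W \<le> reserve" by (simp add: reserve_def)
    have "card {e\<in>E. \<phi> ` P \<subseteq> e \<and> e \<inter> W \<noteq> {}} \<le> card W * card V ^ (r - 3)"
      by (rule few_edges_meet[OF E img(1,2)[OF Pun] finW _ r3 V]) (auto simp: W_def)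
    also have "\<dots> \<le> reserve * card V ^ (r - 3)" by (rule mult_le_mono1[OF cW])
    also have "\<dots> < Suc reserve * card V ^ (r - 3)" using V by simp
    also have "\<dots> \<le> card {e\<in>E. \<phi> ` P \<subseteq> e}" by (rule cod[OF img(3,2,4)[OF Pun]])
    finally have lt: "card {e\<in>E. \<phi> ` P \<subseteq> e \<and> e \<inter> W \<noteq> {}} < card {e\<in>E. \<phi> ` P \<subseteq> e}" .
    have "\<not> {e\<in>E. \<phi> ` P \<subseteq> e} \<subseteq> {e\<in>E. \<phi> ` P \<subseteq> e \<and> e \<inter> W \<noteq> {}}"
    proof
      assume "{e\<in>E. \<phi> ` P \<subseteq> e} \<subseteq> {e\<in>E. \<phi> ` P \<subseteq> e \<and> e \<inter> W \<noteq> {}}"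
      then have "card {e\<in>E. \<phi> ` P \<subseteq> e} \<le> card {e\<in>E. \<phi> ` P \<subseteq> e \<and> e \<inter> W \<noteq> {}}"
        by (rule card_mono[rotated]) (use finE in simp)
      then show False using lt by simp
    qed
    then obtain e where e: "e \<in> E" "\<phi> ` P \<subseteq> e" "e \<inter> W = {}" by blast
    have eW: "(e - \<phi> ` P) \<inter> (\<phi> ` verts K \<union> (\<Union>Q\<in>PP. g Q)) = {}" using e(3) unfolding W_def by blast
    have PPP: "P \<notin> PP" by fact
    show ?case
    proof (intro exI[of _ "g(P := e)"] conjI ballI impI)
      fix Q assume Q: "Q \<in> insert P PP"
      show "(g(P := e)) Q \<in> E" using Q e g(1) by auto
      show "\<phi> ` Q \<subseteq> (g(P := e)) Q" using Q e g(1)[of Q] by (cases "Q = P") auto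
      show "((g(P := e)) Q - \<phi> ` Q) \<inter> \<phi> ` verts K = {}"
      proof (cases "Q = P")
        case True
        then show ?thesis using eW by auto
      next
        case False
        then show ?thesis using Q g(1)[of Q] by auto
      qed
    next
      fix Q R assume QR: "Q \<in> insert P PP" "R \<in> insert P PP" "Q \<noteq> R"
      have half: "(e - \<phi> ` P) \<inter> (g S - \<phi> ` S) = {}" if "S \<in> PP" for S using eW that by blast
      show "((g(P := e)) Q - \<phi> ` Q) \<inter> ((g(P := e)) R - \<phi> ` R) = {}"
      proof (cases "Q = P")
        case True
        then have "R \<in> PP" "R \<noteq> P" using QR by auto
        then show ?thesis using True half by simp
      next
        case Qn: False
        then have QPP: "Q \<in> PP" using QR by auto
        show ?thesis
        proof (cases "R = P")
          case True
          then show ?thesis using Qn half[OF QPP] by (simp add: Int_commute)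
        next
          case False
          then show ?thesis using Qn QR g(2)[of Q R] by simp
        qed
      qed
    qed
  qed
  obtain g where g: "\<And>P. P \<in> uncovered_pairs K \<Longrightarrow> g P \<in> E \<and> \<phi> ` P \<subseteq> g P \<and> (g P - \<phi> ` P) \<inter> \<phi> ` verts K = {}"
       "\<And>P Q. P \<in> uncovered_pairs K \<Longrightarrow> Q \<in> uncovered_pairs K \<Longrightarrow> P \<noteq> Q \<Longrightarrow> (g P - \<phi> ` P) \<inter> (g Q - \<phi> ` Q) = {}"
    using fam[OF finite_uncovered order_refl] by metis
  have "\<exists>b. bij_betw b {..<r-2} (g P - \<phi> ` P)" if P: "P \<in> uncovered_pairs K" for P
  proof -
    have "finite (g P)" "card (g P) = r" using g(1)[OF P] unif_edge[OF E] by auto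
    then have "card (g P - \<phi> ` P) = r - 2" using g(1)[OF P] img[OF P] by (simp add: card_Diff_subset)
    then show ?thesis using \<open>finite (g P)\<close> by (metis bij_betw_iff_card card_lessThan finite_Diff finite_lessThan)
  qed
  then obtain b where b: "\<And>P. P \<in> uncovered_pairs K \<Longrightarrow> bij_betw (b P) {..<r-2} (g P - \<phi> ` P)" by metis
  define \<omega> where "\<omega> h = (case h of Core c \<Rightarrow> \<phi> c | Aux P j \<Rightarrow> b P j)" for h
  have \<omega>: "\<omega> (Core c) = \<phi> c" "\<omega> (Aux P j) = b P j" for c P j by (simp_all add: \<omega>_def)
  have bin: "b P j \<in> g P - \<phi> ` P" if "P \<in> uncovered_pairs K" "j < r - 2" for P j
    using bij_betwE[OF b[OF that(1)]] that(2) by blast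
  have edge: "\<omega> ` e \<in> E" if e: "e \<in> edges H" for e
    using e
  proof (cases rule: H_edge_cases)
    case (core e')
    then have "\<omega> ` e = \<psi> ` e" using \<omega>(1) by (auto simp: \<phi>_def image_image)
    then show ?thesis using \<psi>[OF e] by simp
  next
    case (aux P)
    have "\<omega> ` e = \<phi> ` P \<union> b P ` {..<r-2}" unfolding aux(2) using \<omega> by (simp add: image_Un image_image)
    also have "b P ` {..<r-2} = g P - \<phi> ` P" using b[OF aux(1)] by (simp add: bij_betw_def)
    finally show ?thesis using g(1)[OF aux(1)] by (simp add: Un_absorb1)
  qed
  have "inj_on \<omega> (verts H)"
  proof (rule inj_onI)
    fix h h' assume h: "h \<in> verts H" "h' \<in> verts H" "\<omega> h = \<omega> h'"
    have cases: "(\<exists>c. h = Core c \<and> c \<in> verts K) \<or> (\<exists>P j. h = Aux P j \<and> P \<in> uncovered_pairs K \<and> j < r - 2)"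
      if "h \<in> verts H" for h
      using that by (auto simp: ext_graph_def)
    have mixed: "\<phi> c \<noteq> b P j" if "c \<in> verts K" "P \<in> uncovered_pairs K" "j < r - 2" for c P j
    proof
      assume "\<phi> c = b P j"
      then have "b P j \<in> \<phi> ` verts K" using that(1) by (metis imageI)
      then show False using bin[OF that(2,3)] g(1)[OF that(2)] by blast
    qed
    show "h = h'"
    proof (cases h)
      case (Core c)
      then have c: "c \<in> verts K" using cases[OF h(1)] by auto
      show ?thesis
      proof (cases h')
        case (Core c')
        then have "c' \<in> verts K" using cases[OF h(2)] by auto
        then show ?thesis using h(3) c \<open>h = Core c\<close> Core \<omega> inj by (auto dest: inj_onD)
      next
        case (Aux P j)
        then have "P \<in> uncovered_pairs K" "j < r - 2" using cases[OF h(2)] by auto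
        then show ?thesis using mixed[OF c] h(3) \<open>h = Core c\<close> Aux \<omega> by auto
      qed
    next
      case (Aux P j)
      then have Pj: "P \<in> uncovered_pairs K" "j < r - 2" using cases[OF h(1)] by auto
      show ?thesis
      proof (cases h')
        case (Core c')
        then have "c' \<in> verts K" using cases[OF h(2)] by auto
        then show ?thesis using mixed[OF _ Pj] h(3) \<open>h = Aux P j\<close> Core \<omega> by metis
      next
        case (Aux Q i)
        then have Qi: "Q \<in> uncovered_pairs K" "i < r - 2" using cases[OF h(2)] by auto
        have eq: "b P j = b Q i" using h(3) \<open>h = Aux P j\<close> Aux \<omega> by simp
        have PQ: "P = Q"
        proof (rule ccontr)
          assume "P \<noteq> Q"
          then show False using g(2)[OF Pj(1) Qi(1)] bin[OF Pj] bin[OF Qi] eq by auto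
        qed
        have "j = i" using inj_onD[OF bij_betw_imp_inj_on[OF b[OF Pj(1)]], of j i] eq PQ Pj(2) Qi(2) by simp
        then show ?thesis using PQ \<open>h = Aux P j\<close> Aux by simp
      qed
    qed
  qed
  moreover have "\<omega> ` verts H \<subseteq> V"
    using edge unif_edge[OF E] unfolding Union_edges_H[symmetric] by blast
  ultimately show ?thesis unfolding contains_copy_def using edge by auto
qed

text \<open>In rank two there are no auxiliary vertices, so a homomorphism is a copy. In higher rank
  a codegree threshold of order \<open>n ^ (r - 3)\<close> over at most \<open>n ^ 2\<close> pairs
  costs only order \<open>n ^ (r - 1)\<close> edges.\<close>

lemma cleaning:
  assumes E: "unif r V E" and free: "\<not> contains_copy \<lparr>verts = V, edges = E\<rparr> H" and V: "card V \<ge> 1"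
  obtains E' where "E' \<subseteq> E" "hom_free H E'" "card E \<le> card E' + Suc reserve * card V ^ (r - 1)"
proof (cases "r = 2")
  case True
  have "hom_free H E"
    unfolding hom_free_def
  proof
    assume "\<exists>\<psi>. \<forall>e\<in>edges H. \<psi> ` e \<in> E"
    then obtain \<psi> where \<psi>: "\<And>e. e \<in> edges H \<Longrightarrow> \<psi> ` e \<in> E" by blast
    have vH: "verts H = Core ` verts K" using True by (simp add: ext_graph_def)
    have "inj_on \<psi> (verts H)"
      unfolding vH using hom_inj_on_core(1)[OF E \<psi>] by (auto simp: inj_on_def)
    moreover have "\<psi> ` verts H \<subseteq> V"
      using \<psi> unif_edge[OF E] unfolding Union_edges_H[symmetric] by blast
    ultimately have "contains_copy \<lparr>verts = V, edges = E\<rparr> H" unfolding contains_copy_def using \<psi> by auto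
    then show False using free by simp
  qed
  then show thesis using that[of E] by simp
next
  case False
  then have r3: "r \<ge> 3" using r2 by simp
  obtain E' where E': "E' \<subseteq> E" "card E \<le> card E' + (Suc reserve * card V ^ (r - 3)) * card V ^ 2"
    "\<And>P. P \<subseteq> V \<Longrightarrow> card P = 2 \<Longrightarrow> \<exists>e\<in>E'. P \<subseteq> e \<Longrightarrow> Suc reserve * card V ^ (r - 3) \<le> card {e\<in>E'. P \<subseteq> e}"
  proof (rule codegree_cleaning[OF E, of "Suc reserve * card V ^ (r - 3)"])
    fix E' assume "E' \<subseteq> E" "card E \<le> card E' + (Suc reserve * card V ^ (r - 3)) * card V ^ 2"
      "\<And>P. P \<subseteq> V \<Longrightarrow> card P = 2 \<Longrightarrow> \<exists>e\<in>E'. P \<subseteq> e \<Longrightarrow> Suc reserve * card V ^ (r - 3) \<le> card {e\<in>E'. P \<subseteq> e}"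
    then show thesis by (rule that)
  qed
  have uE': "unif r V E'" by (rule unif_subset[OF E E'(1)])
  have "hom_free H E'"
    unfolding hom_free_def
  proof
    assume "\<exists>\<psi>. \<forall>e\<in>edges H. \<psi> ` e \<in> E'"
    then obtain \<psi> where \<psi>: "\<And>e. e \<in> edges H \<Longrightarrow> \<psi> ` e \<in> E'" by blast
    have "contains_copy \<lparr>verts = V, edges = E'\<rparr> H" by (rule copy_of_hom[OF uE' \<psi> r3 V E'(3)])
    then have "contains_copy \<lparr>verts = V, edges = E\<rparr> H" by (rule contains_copy_mono) (use E'(1) in simp_all)
    then show False using free by simp
  qed
  moreover have "(Suc reserve * card V ^ (r - 3)) * card V ^ 2 = Suc reserve * card V ^ (r - 1)"
  proof -
    have "r - 1 = (r - 3) + 2" using r3 by simp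
    then show ?thesis by (simp only: power_add mult.assoc)
  qed
  ultimately show thesis using that[OF E'(1)] E'(2) by simp
qed

section \<open>Large minimum degree and the exact extremal number\<close>

text \<open>Translates a comparison of degrees with increments of Turan numbers into the degree
  condition of \<open>extends\<close>.\<close>

lemma turan_degree_limit:
  assumes "\<zeta> > 0"
  shows "\<exists>n0. \<forall>n\<ge>n0. (real r * d - \<zeta>) * real n ^ (r - 1) \<le>
    real (card (edges (turan r n m))) - real (card (edges (turan r (n - 1) m)))"
proof -
  have m0: "real m > 0" using m_ge by simp
  let ?b = "real ((m - 1) choose (r - 1))"
  have rd: "real r * d = ?b * (1 / real m) ^ (r - 1)"
  proof -
    have "(1 - 1 / real m) = real (m - 1) / real m" using m_ge by (simp add: of_nat_diff field_simps)
    then have "real r * d = dens (m - 1) (r - 1) * (real (m - 1) / real m) ^ (r - 1)" by (simp only: rd_eq)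
    also have "\<dots> = ?b * (1 / real m) ^ (r - 1)" unfolding dens_def using m_ge by (simp add: power_divide)
    finally show ?thesis .
  qed
  have "(\<lambda>n. ?b * (1 / real m - 1 / real n) ^ (r - 1)) \<longlonglongrightarrow> ?b * (1 / real m - 0) ^ (r - 1)"
    by (intro tendsto_intros lim_1_over_n)
  then have "(\<lambda>n. ?b * (1 / real m - 1 / real n) ^ (r - 1)) \<longlonglongrightarrow> real r * d" by (simp add: rd)
  then have "\<forall>\<^sub>F n in sequentially. real r * d - \<zeta> < ?b * (1 / real m - 1 / real n) ^ (r - 1)"
    by (rule order_tendstoD(1)) (use assms in simp)
  then obtain n1 where n1: "\<And>n. n \<ge> n1 \<Longrightarrow> real r * d - \<zeta> < ?b * (1 / real m - 1 / real n) ^ (r - 1)"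
    unfolding eventually_sequentially by blast
  show ?thesis
  proof (intro exI[of _ "max n1 m"] allI impI)
    fix n assume n: "max n1 m \<le> n"
    then have nm: "n \<ge> m" "n \<ge> n1" "n > 0" using m_ge by auto
    let ?q = "(n - 1) div m"
    have "n - 1 < m * Suc ?q"
      using m_ge by (metis dividend_less_times_div less_le_trans mult.commute mult_Suc_right add.commute zero_less_numeral gr0I not_numeral_le_zero)
    then have "n \<le> m * ?q + m" by simp
    then have "real n \<le> real (m * ?q + m)" by (simp only: of_nat_le_iff)
    then have "real n - real m \<le> real m * real ?q" by simp
    then have q: "real n / real m - 1 \<le> real ?q" using m0 by (simp add: field_simps)
    have "(real r * d - \<zeta>) * real n ^ (r - 1) \<le> ?b * (1 / real m - 1 / real n) ^ (r - 1) * real n ^ (r - 1)"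
      by (rule mult_right_mono) (use n1[OF nm(2)] in auto)
    also have "\<dots> = ?b * ((1 / real m - 1 / real n) * real n) ^ (r - 1)" by (simp only: power_mult_distrib mult.assoc)
    also have "(1 / real m - 1 / real n) * real n = real n / real m - 1" using nm by (simp add: left_diff_distrib)
    also have "?b * (real n / real m - 1) ^ (r - 1) \<le> ?b * real ?q ^ (r - 1)"
    proof (intro mult_left_mono power_mono q)
      show "0 \<le> real n / real m - 1" using nm(1) m0 by simp
    qed simp
    also have "\<dots> \<le> real (card (edges (turan r n m))) - real (card (edges (turan r (n - 1) m)))"
      using turan_min_degree[of m r "n - 1"] m_ge nm(3) by simp
    finally show "(real r * d - \<zeta>) * real n ^ (r - 1) \<le>
      real (card (edges (turan r n m))) - real (card (edges (turan r (n - 1) m)))" .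
  qed
qed

text \<open>Any two core vertices share an edge, so the \<open>m + 1\<close> of them would need
  distinct residues modulo \<open>m\<close>.\<close>

lemma turan_free: "\<not> contains_copy (turan r n m) H"
proof
  assume "contains_copy (turan r n m) H"
  then obtain \<psi> where \<psi>: "inj_on \<psi> (verts H)" "\<And>e. e \<in> edges H \<Longrightarrow> \<psi> ` e \<in> edges (turan r n m)"
    by (auto simp: contains_copy_def)
  have m0: "m > 0" using m_ge by simp
  have E: "unif r {..<n} (edges (turan r n m))" by (auto simp: unif_def turan_def)
  let ?\<phi> = "\<lambda>c. \<psi> (Core c)"
  have "inj_on (\<lambda>c. ?\<phi> c mod m) (verts K)"
  proof (rule inj_onI, rule ccontr)
    fix u v assume uv: "u \<in> verts K" "v \<in> verts K" "?\<phi> u mod m = ?\<phi> v mod m" "u \<noteq> v"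
    obtain e where e: "e \<in> edges (turan r n m)" "{?\<phi> u, ?\<phi> v} \<subseteq> e"
      using hom_inj_on_core(2)[OF E \<psi>(2) uv(1,2,4)] by blast
    have "inj_on (\<lambda>x. x mod m) e" using e(1) unfolding turan_edges[OF m0] by simp
    then have "?\<phi> u = ?\<phi> v" using e(2) uv(3) by (auto dest: inj_onD)
    then show False using inj_onD[OF hom_inj_on_core(1)[OF E \<psi>(2)], of u v] uv by blast
  qed
  then have "card (verts K) \<le> card {..<m}" by (rule card_inj_on_le) (use m0 in auto)
  then show False using card_K by simp
qed

text \<open>Stability at weights \<open>1 / n\<close> is available only for the cleaned family,
  which is homomorphism-free. Its colouring is extended to all vertices and all edges of
  \<open>E\<close>, where the weights are small enough to produce genuine copies.\<close>

lemma large_min_degree_bound: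
  "\<exists>n0>0. \<forall>n\<ge>n0. \<forall>E. unif r {..<n} E \<longrightarrow> \<not> contains_copy \<lparr>verts = {..<n}, edges = E\<rparr> H \<longrightarrow>
     (\<forall>v<n. real (card (edges (turan r n m))) - real (card (edges (turan r (n - 1) m))) \<le> real (card (link E v))) \<longrightarrow>
     card E \<le> card (edges (turan r n m))"
proof -
  obtain \<zeta>1 \<kappa> where \<zeta>1: "\<zeta>1 > 0" "\<kappa> > 0" and ext: "extends \<zeta>1 \<kappa>"
    using extend_all by blast
  obtain \<zeta> \<epsilon> where \<zeta>: "\<zeta> > 0" "\<zeta> \<le> \<zeta>1" and \<epsilon>: "\<epsilon> > 0" and hc: "\<forall>V E x. unif r V E \<longrightarrow> hom_free H E \<longrightarrow> (\<forall>v\<in>V. 0 \<le> x v) \<longrightarrow> sum x V = 1 \<longrightarrow>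
     d - \<epsilon> \<le> lag E x \<longrightarrow>
     sum x {v\<in>V. lag (link E v) x < real r * d - \<zeta>} \<le> \<zeta> \<and> colourable E (heavy \<zeta> V E x)"
    using heavy_colourable[OF \<zeta>1(1)] by (elim exE conjE) (rule that)
  define \<zeta>' where "\<zeta>' = min \<zeta>1 (\<epsilon> / 2)"
  have \<zeta>': "0 < \<zeta>'" "\<zeta>' \<le> \<zeta>1" "\<zeta>' \<le> \<epsilon> / 2" unfolding \<zeta>'_def using \<zeta>1 \<epsilon> by auto
  obtain n1 where n1: "\<And>n. n \<ge> n1 \<Longrightarrow> (real r * d - \<zeta>') * real n ^ (r - 1) \<le>
    real (card (edges (turan r n m))) - real (card (edges (turan r (n - 1) m)))"
    using turan_degree_limit[OF \<zeta>'(1)] by blast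
  \<comment> \<open>\<open>n2\<close> brings the weight \<open>1 / n\<close> down to \<kappa>, and
    \<open>n3\<close> keeps the density lost in cleaning at most
    \<open>\<epsilon> / 2\<close>.\<close>
  obtain n2 :: nat where n2: "1 / \<kappa> < real n2" using reals_Archimedean2 by blast
  obtain n3 :: nat where n3: "2 * real (Suc reserve) / \<epsilon> < real n3" using reals_Archimedean2 by blast
  show ?thesis
  proof (rule exI[of _ "Suc (n1 + n2 + n3)"], rule conjI, simp, intro allI impI)
    fix n E assume n: "Suc (n1 + n2 + n3) \<le> n" and E: "unif r {..<n} E"
      and free: "\<not> contains_copy \<lparr>verts = {..<n}, edges = E\<rparr> H"
      and deg: "\<forall>v<n. real (card (edges (turan r n m))) - real (card (edges (turan r (n - 1) m))) \<le> real (card (link E v))"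
    let ?V = "{..<n}"
    have n0: "n > 0" "n \<ge> n1" using n by auto
    have rn: "real n > 0" using n0 by simp
    define a where "a = 1 / real n"
    have a: "0 < a" "real n * a = 1" using rn by (auto simp: a_def)
    let ?x = "\<lambda>v :: nat. a"
    have sx: "sum ?x ?V = 1" using a(2) by simp
    have degx: "real r * d - \<zeta>' \<le> lag (link E v) ?x" if v: "v \<in> ?V" for v
    proof -
      have "(real r * d - \<zeta>') * real n ^ (r - 1) \<le> real (card (link E v))"
        using n1[OF n0(2)] deg v by fastforce
      then have "(real r * d - \<zeta>') * real n ^ (r - 1) * a ^ (r - 1) \<le> real (card (link E v)) * a ^ (r - 1)"
        by (rule mult_right_mono) (use a in simp)
      also have "\<dots> = lag (link E v) ?x" by (rule lag_const[OF unif_link[OF E], symmetric])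
      also have "(real r * d - \<zeta>') * real n ^ (r - 1) * a ^ (r - 1) = (real r * d - \<zeta>') * (real n * a) ^ (r - 1)"
        by (simp only: power_mult_distrib mult.assoc)
      finally show ?thesis using a(2) by simp
    qed
    have "real r * (d - \<zeta>') \<le> real r * lag E ?x"
    proof -
      have "real r * d - \<zeta>' = (\<Sum>v\<in>?V. a * (real r * d - \<zeta>'))" using a(2) by simp
      also have "\<dots> \<le> (\<Sum>v\<in>?V. ?x v * lag (link E v) ?x)"
        by (rule sum_mono, rule mult_left_mono) (use degx a in auto)
      also have "\<dots> = real r * lag E ?x" by (rule lag_euler[OF E])
      finally have "real r * d - \<zeta>' \<le> real r * lag E ?x" .
      moreover have "1 * \<zeta>' \<le> real r * \<zeta>'" by (rule mult_right_mono) (use m_ge \<zeta>' in auto)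
      ultimately show ?thesis by (simp add: right_diff_distrib)
    qed
    then have lagE: "d - \<zeta>' \<le> lag E ?x" using m_ge by simp
    obtain E' where E': "E' \<subseteq> E" "hom_free H E'" "card E \<le> card E' + Suc reserve * card ?V ^ (r - 1)"
      using cleaning[OF E free] n0 by auto
    have uE': "unif r ?V E'" by (rule unif_subset[OF E E'(1)])
    have lagE': "d - \<epsilon> \<le> lag E' ?x"
    proof -
      have "real (card E) \<le> real (card E' + Suc reserve * n ^ (r - 1))"
        using E'(3) by (simp only: of_nat_le_iff card_lessThan)
      also have "\<dots> = real (card E') + real (Suc reserve) * real n ^ (r - 1)"
        by (simp only: of_nat_add of_nat_mult of_nat_power)
      finally have "real (card E) * a ^ r \<le> (real (card E') + real (Suc reserve) * real n ^ (r - 1)) * a ^ r"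
        by (intro mult_right_mono) (use a in auto)
      also have "\<dots> = real (card E') * a ^ r + real (Suc reserve) * (real n ^ (r - 1) * a ^ r)"
        by (simp only: distrib_right mult.assoc)
      also have "real n ^ (r - 1) * a ^ r = a"
      proof -
        have "a ^ r = a ^ (r - 1) * a" using m_ge by (metis power_minus_mult zero_less_one less_le_trans)
        then have "real n ^ (r - 1) * a ^ r = (real n * a) ^ (r - 1) * a" by (simp only: power_mult_distrib mult.assoc)
        then show ?thesis using a(2) by simp
      qed
      finally have "lag E ?x \<le> lag E' ?x + real (Suc reserve) * a"
        using lag_const[OF E, of a] lag_const[OF uE', of a] by simp
      moreover have "real (Suc reserve) * a \<le> \<epsilon> / 2"
      proof -
        have "2 * real (Suc reserve) / \<epsilon> < real n" using n3 n by linarith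
        then have "2 * real (Suc reserve) < \<epsilon> * real n" using \<epsilon> by (simp add: divide_less_eq mult.commute)
        then have "2 * real (Suc reserve) * a \<le> \<epsilon> * real n * a" by (intro mult_right_mono) (use a in auto)
        also have "\<epsilon> * real n * a = \<epsilon>" using a(2) by (simp add: mult.assoc)
        finally have "2 * real (Suc reserve) * a \<le> \<epsilon>" .
        moreover have "R * a \<le> \<epsilon> / 2" if "2 * R * a \<le> \<epsilon>" for R using that by simp
        ultimately show ?thesis by blast
      qed
      ultimately show ?thesis using lagE \<zeta>'(3) by linarith
    qed
    have x0: "\<forall>v\<in>?V. 0 \<le> ?x v" using a(1) by simp
    have lowc: "sum ?x {v\<in>?V. lag (link E' v) ?x < real r * d - \<zeta>} \<le> \<zeta>" "colourable E' (heavy \<zeta> ?V E' ?x)"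
      using hc[THEN spec, THEN spec, THEN spec, THEN mp, THEN mp, THEN mp, THEN mp, THEN mp, OF uE' E'(2) x0 sx lagE']
      by (rule conjunct1, rule conjunct2)
    let ?U = "heavy \<zeta> ?V E' ?x"
    have UV: "?U \<subseteq> ?V" by (rule heavy_sub)
    have "?V - ?U = {v\<in>?V. lag (link E' v) ?x < real r * d - \<zeta>}" using a(1) by (auto simp: heavy_def)
    moreover have "sum ?x (?V - ?U) = sum ?x ?V - sum ?x ?U" by (rule sum_diff[OF finite_lessThan UV])
    ultimately have xU: "1 - \<zeta>1 \<le> sum ?x ?U" using lowc(1) sx \<zeta>(2) by simp
    obtain c where c: "\<forall>v\<in>?U. c v < m" "\<forall>e\<in>E'. e \<subseteq> ?U \<longrightarrow> inj_on c e"
      using lowc(2) unfolding colourable_def by blast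
    have "frame ?V E ?x ?U c"
      unfolding frame_def using E a(1) sx UV c(1) by simp
    moreover have "\<forall>u\<in>?U. real r * d - \<zeta>1 \<le> lag (link E' u) ?x"
      using \<zeta>(2) by (auto simp: heavy_def)
    ultimately have nt: "near_turan \<zeta>1 ?V E E' ?x ?U c"
      unfolding near_turan_def using E'(1) c(2) xU by blast
    have "a \<le> \<kappa>"
    proof -
      have "1 / \<kappa> < real n" using n2 n by linarith
      then show ?thesis unfolding a_def using \<zeta>1(2) rn by (simp add: field_simps)
    qed
    then have av: "avoids \<kappa> ?V E ?x" unfolding avoids_def using free by simp
    have "\<forall>v\<in>?V. real r * d - \<zeta>1 \<le> lag (link E v) ?x" using degx \<zeta>'(2) by force
    then have "colourable E ?V" using ext[unfolded extends_def] nt av UV by blast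
    then obtain c' where c': "\<forall>v\<in>?V. c' v < m" "\<forall>e\<in>E. e \<subseteq> ?V \<longrightarrow> inj_on c' e"
      unfolding colourable_def by blast
    show "card E \<le> card (edges (turan r n m))"
      by (rule card_rainbow_le_turan[of m r n c']) (use m_ge c' unif_edge[OF E] in auto)
  qed
qed

lemma H_edge_sub: "e \<in> edges H \<Longrightarrow> e \<subseteq> verts H"
  by (rule card_H_edge(3))

lemma ex_number_ge:
  fixes G :: "nat hypergraph"
  assumes "rgraph r G" "verts G = {..<n}" "\<not> contains_copy G H"
  shows "card (edges G) \<le> ex_number r n H"
  using card_le_ex_number[OF assms(1,3) H_edge_sub] assms(2) by simp

lemma ex_number_attained:
  obtains G :: "nat hypergraph" where "rgraph r G" "verts G = {..<n}" "\<not> contains_copy G H" "card (edges G) = ex_number r n H"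
proof -
  let ?S = "{card (edges G) | G :: nat hypergraph. rgraph r G \<and> verts G = {..<n} \<and> \<not> contains_copy G H}"
  have "\<not> contains_copy \<lparr>verts = {..<n}, edges = {}\<rparr> H"
    using core_edge_in_H[OF el(1)] by (auto simp: contains_copy_def)
  moreover have "rgraph r \<lparr>verts = {..<n}, edges = {}\<rparr>" by (simp add: rgraph_def)
  ultimately have "card (edges \<lparr>verts = {..<n}, edges = {}\<rparr>) \<in> ?S"
    by (intro CollectI exI[of _ "\<lparr>verts = {..<n}, edges = {}\<rparr>"]) simp
  then have "?S \<noteq> {}" by blast
  then have "Max ?S \<in> ?S" by (rule Max_in[OF finite_ex_set])
  then obtain G :: "nat hypergraph" where "rgraph r G" "verts G = {..<n}" "\<not> contains_copy G H" "card (edges G) = Max ?S"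
    by auto
  then show thesis using that unfolding ex_number_def by metis
qed

lemma turan_le_ex_number: "card (edges (turan r n m)) \<le> ex_number r n H"
proof (rule ex_number_ge[OF _ _ turan_free])
  show "rgraph r (turan r n m)" by (auto simp: rgraph_def turan_def)
qed (simp add: turan_def)

lemma card_edges_delete:
  fixes E :: "nat set set"
  assumes "finite E"
  shows "card E = card (link E v) + card {e\<in>E. v \<notin> e}"
proof -
  have "card E = card {e\<in>E. v \<in> e} + card {e\<in>E. v \<notin> e}"
    using assms by (subst card_Un_disjoint[symmetric]) (auto intro!: arg_cong[of _ _ card])
  moreover have "card (link E v) = card {e\<in>E. v \<in> e}"
    unfolding link_def by (rule card_image) (auto simp: inj_on_def)
  ultimately show ?thesis by simp
qed

text \<open>The excess of the extremal number over the Turan number is never negative. If an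
  extremal example has a vertex of degree below the Turan increment, deleting it shows that the
  excess at \<open>n\<close> is smaller by at least 1 than at \<open>n - 1\<close>. Starting from
  \<open>n0\<close>, the excess is therefore used up after at most \<open>ex_number r n0 H\<close>
  steps.\<close>

lemma ex_number_eq_turan:
  "\<exists>n4>0. \<forall>n\<ge>n4. ex_number r n H = card (edges (turan r n m))"
proof -
  let ?e = "\<lambda>n. ex_number r n H" and ?t = "\<lambda>n. card (edges (turan r n m))"
  obtain n0 where n0: "n0 > 0" and big: "\<And>n E. n \<ge> n0 \<Longrightarrow> unif r {..<n} E \<Longrightarrow> \<not> contains_copy \<lparr>verts = {..<n}, edges = E\<rparr> H \<Longrightarrow>
     (\<forall>v<n. real (?t n) - real (?t (n - 1)) \<le> real (card (link E v))) \<Longrightarrow> card E \<le> ?t n"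
    using large_min_degree_bound by metis
  have step: "?e n = ?t n \<or> int (?e n) - int (?t n) \<le> int (?e (n - 1)) - int (?t (n - 1)) - 1" if n: "n \<ge> n0" for n
  proof -
    obtain G where G: "rgraph r G" "verts G = {..<n}" "\<not> contains_copy G H" "card (edges G) = ?e n"
      by (rule ex_number_attained)
    define E where "E = edges G"
    have Geq: "G = \<lparr>verts = {..<n}, edges = E\<rparr>" using G(2) by (simp add: E_def)
    have E: "unif r {..<n} E" using G(1,2) by (simp add: rgraph_def unif_def E_def)
    have finE: "finite E" by (rule unif_finite[OF E])
    show ?thesis
    proof (cases "\<forall>v<n. real (?t n) - real (?t (n - 1)) \<le> real (card (link E v))")
      case True
      have "card E \<le> ?t n" by (rule big[OF n E _ True]) (use G(3) Geq in simp)
      then show ?thesis using turan_le_ex_number[of n] G(4) by (simp add: E_def)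
    next
      case False
      then obtain v where v: "v < n" "real (card (link E v)) < real (?t n) - real (?t (n - 1))" by force
      let ?E = "{e\<in>E. v \<notin> e}"
      let ?G = "\<lparr>verts = {..<n} - {v}, edges = ?E\<rparr>"
      have "rgraph r ?G" using G(1,2) by (auto simp: rgraph_def E_def)
      moreover have "\<not> contains_copy ?G H"
        using contains_copy_mono[of ?G H G] G(2,3) by (auto simp: E_def)
      ultimately have "card (edges ?G) \<le> ex_number r (card (verts ?G)) H"
        by (rule card_le_ex_number[OF _ _ H_edge_sub])
      then have "card ?E \<le> ?e (n - 1)" using v(1) by simp
      moreover have "?e n = card (link E v) + card ?E" using card_edges_delete[OF finE] G(4) by (simp add: E_def)
      moreover have "card (link E v) + ?t (n - 1) < ?t n" using v(2) by linarith
      ultimately show ?thesis by linarith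
    qed
  qed
  have dec: "int (?e (n0 + j)) - int (?t (n0 + j)) \<le> max 0 (int (?e n0) - int (?t n0) - int j)" for j
  proof (induction j)
    case (Suc j)
    show ?case using step[of "n0 + Suc j"] Suc by auto
  qed simp
  show ?thesis
  proof (rule exI[of _ "n0 + ?e n0"], rule conjI)
    show "0 < n0 + ?e n0" using n0 by simp
    show "\<forall>n\<ge>n0 + ?e n0. ?e n = ?t n"
    proof (intro allI impI)
      fix n assume "n0 + ?e n0 \<le> n"
      then obtain j where j: "n = n0 + j" "j \<ge> ?e n0" by (metis add_leD1 le_Suc_ex nat_add_left_cancel_le)
      have "int (?e n) - int (?t n) \<le> max 0 (int (?e n0) - int (?t n0) - int j)" using dec[of j] j by simp
      also have "\<dots> = 0" using j(2) by simp
      finally show "?e n = ?t n" using turan_le_ex_number[of n] by linarith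
    qed
  qed
qed

end

section \<open>Enlargements of trees\<close>

text \<open>The Erdos--Sos bound for \<open>T\<close> applies to the link graph of every \<open>(r - 2)\<close>-set.\<close>

lemma enlargement_free_sparse:
  fixes T :: "'a hypergraph" and E :: "nat set set"
  assumes T: "is_tree T" "card (verts T) = k" "k \<ge> 3" "satisfies_erdos_sos T" and r: "r \<ge> 2"
    and E: "unif r V E"
    and free: "\<nexists>\<phi>. inj_on \<phi> (verts (core p (enlargement (r - 2) T))) \<and> (\<forall>e\<in>edges (core p (enlargement (r - 2) T)). \<phi> ` e \<in> E)"
    and p: "p \<le> card (verts (enlargement (r - 2) T))"
  shows "es_sparse k r E"
  unfolding es_sparse_def
proof (intro allI impI, elim conjE, rule ccontr)
  fix D S :: "nat set" assume D: "finite D" "card D + 2 = r" "finite S" "D \<inter> S = {}"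
  let ?X = "{e\<in>E. D \<subseteq> e \<and> e \<subseteq> D \<union> S}"
  assume big: "\<not> 2 * card ?X \<le> (k - 2) * card S"
  \<comment> \<open>The part inside \<open>S\<close> of the link graph of \<open>D\<close>; a copy
    of \<open>T\<close> in it together with \<open>D\<close> is a copy of the enlargement.\<close>
  let ?G = "\<lparr>verts = S, edges = (\<lambda>e. e - D) ` ?X\<rparr>"
  have G: "rgraph 2 ?G"
    unfolding rgraph_def
  proof (intro conjI ballI)
    fix f assume "f \<in> edges ?G"
    then obtain e where e: "e \<in> E" "D \<subseteq> e" "e \<subseteq> D \<union> S" "f = e - D" by auto
    show "f \<subseteq> verts ?G" using e by auto
    show "card f = 2" using e D unif_edge[OF E e(1)] by (simp add: card_Diff_subset)
  qed (use D in simp)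
  have cG: "card (edges ?G) = card ?X"
    by simp (rule card_image, rule inj_onI, blast)
  have Tsub: "e \<subseteq> verts T" if "e \<in> edges T" for e using T(1) that by (auto simp: is_tree_def rgraph_def)
  have "contains_copy ?G T"
  proof (rule ccontr)
    assume "\<not> contains_copy ?G T"
    then have "card (edges ?G) \<le> ex_number 2 (card (verts ?G)) T"
      by (rule card_le_ex_number[OF G _ Tsub])
    then have "real (card ?X) \<le> real (ex_number 2 (card S) T)" using cG by simp
    also have "\<dots> \<le> real (card S) * (real k - 2) / 2"
      using T(2,4) by (simp add: satisfies_erdos_sos_def)
    finally have "real (2 * card ?X) \<le> real (card S * (k - 2))" using T(3) by (simp add: of_nat_diff)
    then have "2 * card ?X \<le> card S * (k - 2)" by (simp only: of_nat_le_iff)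
    then show False using big by (simp add: mult.commute)
  qed
  then obtain \<phi> where \<phi>: "inj_on \<phi> (verts T)" "\<phi> ` verts T \<subseteq> S" "\<And>e. e \<in> edges T \<Longrightarrow> \<phi> ` e \<in> (\<lambda>e. e - D) ` ?X"
    by (auto simp: contains_copy_def)
  have "card D = r - 2" using D by simp
  then obtain b where b: "bij_betw b {..<r-2} D"
    using D(1) by (metis bij_betw_iff_card card_lessThan finite_lessThan)
  define \<psi> where "\<psi> c = (case c of Old (Inl v) \<Rightarrow> \<phi> v | Old (Inr i) \<Rightarrow> b i | New i \<Rightarrow> 0)" for c :: "('a + nat) core_vertex"
  have \<psi>: "\<psi> (Old (Inl v)) = \<phi> v" "\<psi> (Old (Inr i)) = b i" for v i by (simp_all add: \<psi>_def)
  have vK: "verts (core p (enlargement (r - 2) T)) = Old ` (Inl ` verts T \<union> Inr ` {..<r-2})"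
    using p by (simp add: core_def) (simp add: enlargement_def)
  have bD: "b i \<in> D" if "i < r - 2" for i using bij_betwE[OF b] that by blast
  have \<phi>S: "\<phi> v \<in> S" if "v \<in> verts T" for v using \<phi>(2) that by blast
  have "inj_on \<psi> (verts (core p (enlargement (r - 2) T)))"
  proof (rule inj_onI)
    fix x y assume xy: "x \<in> verts (core p (enlargement (r - 2) T))" "y \<in> verts (core p (enlargement (r - 2) T))" "\<psi> x = \<psi> y"
    have mixed: "\<phi> v \<noteq> b i" if "v \<in> verts T" "i < r - 2" for v i using bD[OF that(2)] \<phi>S[OF that(1)] D(4) by auto
    consider v where "x = Old (Inl v)" "v \<in> verts T" | i where "x = Old (Inr i)" "i < r - 2"
      using xy(1) unfolding vK by auto
    then show "x = y"
    proof cases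
      case 1
      consider w where "y = Old (Inl w)" "w \<in> verts T" | i where "y = Old (Inr i)" "i < r - 2"
        using xy(2) unfolding vK by auto
      then show ?thesis
      proof cases
        case 1
        then show ?thesis using xy(3) \<open>x = Old (Inl v)\<close> \<open>v \<in> verts T\<close> \<phi>(1) \<psi> by (auto dest: inj_onD)
      next
        case 2
        then show ?thesis using xy(3) \<open>x = Old (Inl v)\<close> \<open>v \<in> verts T\<close> mixed \<psi> by auto
      qed
    next
      case 2
      consider w where "y = Old (Inl w)" "w \<in> verts T" | j where "y = Old (Inr j)" "j < r - 2"
        using xy(2) unfolding vK by auto
      then show ?thesis
      proof cases
        case 1
        then show ?thesis using xy(3) \<open>x = Old (Inr i)\<close> \<open>i < r - 2\<close> mixed \<psi> by metis
      next
        case (2 j)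
        then show ?thesis using xy(3) \<open>x = Old (Inr i)\<close> \<open>i < r - 2\<close> inj_onD[OF bij_betw_imp_inj_on[OF b], of i j] \<psi> by simp
      qed
    qed
  qed
  moreover have "\<psi> ` e \<in> E" if e: "e \<in> edges (core p (enlargement (r - 2) T))" for e
  proof -
    obtain f where f: "f \<in> edges T" "e = Old ` (Inl ` f \<union> Inr ` {..<r-2})"
      using e by (auto simp: core_def enlargement_def)
    have "\<psi> ` e = \<phi> ` f \<union> b ` {..<r-2}" unfolding f(2) by (simp add: image_Un image_image \<psi>)
    also have "b ` {..<r-2} = D" using b by (simp add: bij_betw_def)
    also have "\<phi> ` f \<union> D \<in> E"
    proof -
      obtain e' where e': "e' \<in> E" "D \<subseteq> e'" "\<phi> ` f = e' - D" using \<phi>(3)[OF f(1)] by auto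
      then have "\<phi> ` f \<union> D = e'" by auto
      then show ?thesis using e'(1) by simp
    qed
    finally show ?thesis .
  qed
  ultimately show False using free by blast
qed

theorem theorem6p8:
  fixes k r :: nat and T :: "'a hypergraph"
  assumes "k \<ge> 3" and "r \<ge> 2" and "real k \<ge> M_last r"
    and "is_tree T" and "card (verts T) = k"
    and "satisfies_erdos_sos T"
  shows "\<exists>n4>0. \<forall>n\<ge>n4.
    ex_number r n (H_graph (enlargement (r - 2) T) r (r + k - 2))
      = card (edges (turan r n (r + k - 3)))"
proof -
  let ?F = "enlargement (r - 2) T"
  let ?K = "core (r + k - 2) ?F"
  have g2: "rgraph 2 T" using assms(4) by (simp add: is_tree_def)
  have finT: "finite (verts T)" using g2 by (simp add: rgraph_def)
  have r: "r - 2 + 2 = r" using assms(2) by simp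
  have cF: "card (verts ?F) = k + (r - 2)"
  proof -
    have "card (Inl ` verts T \<union> Inr ` {..<r-2} :: ('a + nat) set) = card (Inl ` verts T :: ('a + nat) set) + card (Inr ` {..<r-2} :: ('a + nat) set)"
      by (rule card_Un_disjoint) (use finT in auto)
    then show ?thesis using assms(5) by (simp add: enlargement_def card_image)
  qed
  \<comment> \<open>The enlargement already has \<open>r + k - 2\<close> vertices, so the core gets
    no \<open>New\<close> ones.\<close>
  have p: "r + k - 2 \<le> card (verts ?F)" using cF assms(2) by simp
  have vK: "verts ?K = Old ` verts ?F" using p by (simp add: core_def)
  then have vK2: "verts ?K = Old ` (Inl ` verts T \<union> Inr ` {..<r-2})" by (simp add: enlargement_def)
  have eK: "edges ?K = (\<lambda>e. Old ` (Inl ` e \<union> Inr ` {..<r-2})) ` edges T"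
    by (auto simp: core_def enlargement_def)
  obtain l t where lt: "{l, t} \<in> edges T" "l \<noteq> t" "\<And>e. e \<in> edges T \<Longrightarrow> l \<in> e \<Longrightarrow> e = {l, t}"
    using tree_leaf[OF assms(4)] assms(1,5) by metis
  let ?el = "Old ` (Inl ` {l, t} \<union> Inr ` {..<r-2}) :: ('a + nat) core_vertex set"
  have rK: "rgraph r ?K"
  proof -
    have F: "rgraph r ?F" using rgraph_enlargement[OF g2, of "r - 2"] unfolding r .
    have "card (Old ` e) = r" if "e \<in> edges ?F" for e
      using F that by (simp add: card_image inj_on_def rgraph_def)
    moreover have "finite (verts ?K)" using F by (simp add: vK rgraph_def)
    moreover have "Old ` e \<subseteq> verts ?K" if "e \<in> edges ?F" for e
      unfolding vK using F that by (intro image_mono) (simp add: rgraph_def)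
    ultimately show ?thesis by (auto simp: rgraph_def core_def)
  qed
  have "pendant_core ?K k r (r + k - 3) (Old (Inl l)) ?el"
  proof
    show "3 \<le> k" "2 \<le> r" "r + k - 3 = k + r - 3" using assms by simp_all
    show "tame k r" by (rule tame_of_M_last) (use assms in auto)
    show "rgraph r ?K" by (rule rK)
    show "card (verts ?K) = Suc (r + k - 3)"
      unfolding vK using cF assms(1,2) by (simp add: card_image inj_on_def)
    show "\<Union> (edges ?K) = verts ?K"
    proof
      show "\<Union> (edges ?K) \<subseteq> verts ?K" using rK by (auto simp: rgraph_def)
      show "verts ?K \<subseteq> \<Union> (edges ?K)"
      proof
        fix c assume "c \<in> verts ?K"
        then consider v where "c = Old (Inl v)" "v \<in> verts T" | i where "c = Old (Inr i)" "i < r - 2"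
          unfolding vK2 by blast
        then show "c \<in> \<Union> (edges ?K)"
        proof cases
          case 1
          then obtain e where "e \<in> edges T" "v \<in> e" using tree_vertex_in_edge[OF assms(4)] assms(1,5) by blast
          then show ?thesis unfolding eK using 1 by blast
        next
          case 2
          then show ?thesis unfolding eK using lt(1) by blast
        qed
      qed
    qed
    show "?el \<in> edges ?K" unfolding eK using lt(1) by blast
    show "Old (Inl l) \<in> ?el" by simp
    show "e = ?el" if "e \<in> edges ?K" "Old (Inl l) \<in> e" for e
    proof -
      obtain f where f: "f \<in> edges T" "e = Old ` (Inl ` f \<union> Inr ` {..<r-2})" using \<open>e \<in> edges ?K\<close> unfolding eK by blast
      have "l \<in> f" using \<open>Old (Inl l) \<in> e\<close> unfolding f(2) by auto
      then show ?thesis using lt(3)[OF f(1)] f(2) by simp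
    qed
    show "es_sparse k r E"
      if "unif r V E" "\<nexists>\<phi>. inj_on \<phi> (verts ?K) \<and> (\<forall>e\<in>edges ?K. \<phi> ` e \<in> E)" for V and E :: "nat set set"
      by (rule enlargement_free_sparse[OF assms(4,5,1,6,2) that p])
  qed
  then have "\<exists>n4>0. \<forall>n\<ge>n4. ex_number r n (ext_graph ?K r) = card (edges (turan r n (r + k - 3)))"
    by (rule pendant_core.ex_number_eq_turan)
  then show ?thesis unfolding H_graph_ext_graph .
qed

end
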